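(* There is an algorithm running in $O(N\log N)$ time that, given an $m\times n$ grid graph $M$ with $m,n\geq 3$, $N=mn$ nodes and positive integer node weights $w$, outputs a connected bipartition $(U,V\setminus U)$ of $M$ with $\mathrm{OPT}\leq \frac{5}{4}\min\{w(U),w(V\setminus U)\}$, where $\mathrm{OPT}$ is the maximum of $\min\{w(U'),w(V\setminus U')\}$ over all connected bipartitions $(U',V\setminus U')$ of $M$.
   Context: An $m\times n$ grid graph has node set $V=\{M_{ij}: 1\leq i\leq m,\ 1\leq j\leq n\}$, with an edge between two nodes consecutive in the same row or the same column. For $S\subseteq V$, $w(S)=\sum_{v\in S}w(v)$. A connected bipartition is a partition $(U,V\setminus U)$ of $V$ into two nonempty sets such that both induced subgraphs $M[U]$ and $M[V\setminus U]$ are connected. The problem GBCP$_2$ asks for a connected bipartition maximizing $\min\{w(U),w(V\setminus U)\}$. *)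

theory Defs
  imports
    "HOL-Library.Landau_Symbols"
    "Graph_Theory.Digraph_Component"
begin

section \<open>Grid graphs and connected bipartitions\<close>

text \<open>An undirected edge is represented by its two opposite arcs.\<close>

definition grid_adj :: "nat \<times> nat \<Rightarrow> nat \<times> nat \<Rightarrow> bool" where
  "grid_adj = (\<lambda>(i, j) (i', j').
     (i = i' \<and> (j' = Suc j \<or> j = Suc j')) \<or> (j = j' \<and> (i' = Suc i \<or> i = Suc i')))"

definition grid_graph :: "nat \<Rightarrow> nat \<Rightarrow> (nat \<times> nat) pair_pre_digraph" where
  "grid_graph m n =
     \<lparr> pverts = {1..m} \<times> {1..n},
       parcs = {(u, v). u \<in> {1..m} \<times> {1..n} \<and> v \<in> {1..m} \<times> {1..n} \<and> grid_adj u v} \<rparr>"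

lemma pair_graph_grid_graph: "pair_graph (grid_graph m n)"
proof
  show "symmetric (with_proj (grid_graph m n))"
    unfolding symmetric_def
    by (rule symI) (auto simp: grid_graph_def grid_adj_def arcs_ends_def arc_to_ends_def)
  have "parcs (grid_graph m n) \<subseteq> ({1..m} \<times> {1..n}) \<times> ({1..m} \<times> {1..n})"
    unfolding grid_graph_def by auto
  then show "finite (parcs (grid_graph m n))"
    by (rule finite_subset) simp
qed (auto simp: grid_graph_def grid_adj_def)

text \<open>
  The bipartition \<open>(U, V - U)\<close> is represented by its first part. The constant \<open>connected\<close> for graphs
  is qualified, since it competes with the topological notion of the same name.
\<close>

definition connected_bipartition :: "'a pair_pre_digraph \<Rightarrow> 'a set \<Rightarrow> bool" where
  "connected_bipartition G U \<longleftrightarrow>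
     U \<subseteq> pverts G \<and> U \<noteq> {} \<and> pverts G - U \<noteq> {} \<and>
     Digraph_Component.connected (with_proj G \<restriction> U) \<and>
     Digraph_Component.connected (with_proj G \<restriction> (pverts G - U))"

definition min_weight :: "'a pair_pre_digraph \<Rightarrow> ('a \<Rightarrow> nat) \<Rightarrow> 'a set \<Rightarrow> nat" where
  "min_weight G w U = min (\<Sum>v\<in>U. w v) (\<Sum>v\<in>pverts G - U. w v)"

definition opt_gbcp2 :: "'a pair_pre_digraph \<Rightarrow> ('a \<Rightarrow> nat) \<Rightarrow> nat" where
  "opt_gbcp2 G w = Max {min_weight G w U | U. connected_bipartition G U}"


section \<open>A unit-cost random access machine\<close>

text \<open>
  Algorithms are programs of a small imperative language over a finite number of integer registers
  and a finite number of integer arrays with indirect addressing. This is a structured form of the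
  unit-cost RAM: every operator, memory access, assignment, and branch costs one step. The only
  arithmetic operations are addition and subtraction. Multiplication is deliberately absent, because
  at unit cost it would allow numbers of exponential length to be built.
\<close>

datatype aexp =
    Const int
  | Reg string
  | Read string aexp
  | Add aexp aexp
  | Sub aexp aexp

datatype bexp =
    Less aexp aexp
  | Not bexp
  | And bexp bexp

datatype com =
    Skip
  | Assign string aexp
  | Write string aexp aexp
  | Seq com com
  | If bexp com com
  | While bexp com

record store =
  regs :: "string \<Rightarrow> int"
  arrays :: "string \<Rightarrow> int \<Rightarrow> int"

fun aval :: "aexp \<Rightarrow> store \<Rightarrow> int" where
  "aval (Const k) s = k"
| "aval (Reg x) s = regs s x"
| "aval (Read a e) s = arrays s a (aval e s)"
| "aval (Add e1 e2) s = aval e1 s + aval e2 s"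
| "aval (Sub e1 e2) s = aval e1 s - aval e2 s"

fun bval :: "bexp \<Rightarrow> store \<Rightarrow> bool" where
  "bval (Less e1 e2) s \<longleftrightarrow> aval e1 s < aval e2 s"
| "bval (Not b) s \<longleftrightarrow> \<not> bval b s"
| "bval (And b1 b2) s \<longleftrightarrow> bval b1 s \<and> bval b2 s"

fun acost :: "aexp \<Rightarrow> nat" where
  "acost (Const k) = 1"
| "acost (Reg x) = 1"
| "acost (Read a e) = 1 + acost e"
| "acost (Add e1 e2) = 1 + acost e1 + acost e2"
| "acost (Sub e1 e2) = 1 + acost e1 + acost e2"

fun bcost :: "bexp \<Rightarrow> nat" where
  "bcost (Less e1 e2) = 1 + acost e1 + acost e2"
| "bcost (Not b) = 1 + bcost b"
| "bcost (And b1 b2) = 1 + bcost b1 + bcost b2"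

text \<open>\<open>exec c s t s'\<close>: started in \<open>s\<close>, the program \<open>c\<close> halts in \<open>s'\<close> after exactly \<open>t\<close> steps.\<close>

inductive exec :: "com \<Rightarrow> store \<Rightarrow> nat \<Rightarrow> store \<Rightarrow> bool" where
  Skip: "exec Skip s 1 s"
| Assign: "exec (Assign x e) s (1 + acost e) (s\<lparr>regs := (regs s)(x := aval e s)\<rparr>)"
| Write: "exec (Write a e1 e2) s (1 + acost e1 + acost e2)
    (s\<lparr>arrays := (arrays s)(a := (arrays s a)(aval e1 s := aval e2 s))\<rparr>)"
| Seq: "exec c1 s t1 s1 \<Longrightarrow> exec c2 s1 t2 s2 \<Longrightarrow> exec (Seq c1 c2) s (t1 + t2) s2"
| IfTrue: "bval b s \<Longrightarrow> exec c1 s t s' \<Longrightarrow> exec (If b c1 c2) s (1 + bcost b + t) s'"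
| IfFalse: "\<not> bval b s \<Longrightarrow> exec c2 s t s' \<Longrightarrow> exec (If b c1 c2) s (1 + bcost b + t) s'"
| WhileFalse: "\<not> bval b s \<Longrightarrow> exec (While b c) s (1 + bcost b) s"
| WhileTrue: "bval b s \<Longrightarrow> exec c s t1 s1 \<Longrightarrow> exec (While b c) s1 t2 s2 \<Longrightarrow>
    exec (While b c) s (1 + bcost b + t1 + t2) s2"

inductive_cases exec_elims:
  "exec Skip s t s'"
  "exec (Assign x e) s t s'"
  "exec (Write a e1 e2) s t s'"
  "exec (Seq c1 c2) s t s'"
  "exec (If b c1 c2) s t s'"
  "exec (While b c) s t s'"

lemma exec_deterministic:
  "exec c s t s' \<Longrightarrow> exec c s u s'' \<Longrightarrow> t = u \<and> s' = s''"
proof (induction arbitrary: u s'' rule: exec.induct)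
  case Skip
  then show ?case by (rule exec_elims(1)) simp
next
  case Assign
  then show ?case by (rule exec_elims(2)) simp
next
  case Write
  then show ?case by (rule exec_elims(3)) simp
next
  case (Seq c1 s t1 s1 c2 t2 s2)
  from Seq.prems show ?case
  proof (rule exec_elims(4))
    fix u1 r u2
    assume u: "u = u1 + u2" and 1: "exec c1 s u1 r" and 2: "exec c2 r u2 s''"
    from Seq.IH(1)[OF 1] have "t1 = u1" "s1 = r" by simp_all
    with Seq.IH(2) 2 u show ?thesis by simp
  qed
next
  case (IfTrue b s c1 t s' c2)
  from IfTrue.prems show ?case
    by (rule exec_elims(5)) (simp_all add: IfTrue.hyps(1) IfTrue.IH)
next
  case (IfFalse b s c2 t s' c1)
  from IfFalse.prems show ?case
    by (rule exec_elims(5)) (simp_all add: IfFalse.hyps(1) IfFalse.IH)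
next
  case (WhileFalse b s c)
  from WhileFalse.prems show ?case
    by (rule exec_elims(6)) (simp_all add: WhileFalse.hyps)
next
  case (WhileTrue b s c t1 s1 t2 s2)
  from WhileTrue.prems show ?case
  proof (rule exec_elims(6))
    fix u1 r u2
    assume u: "u = Suc (bcost b + u1 + u2)"
      and 1: "exec c s u1 r" and 2: "exec (While b c) r u2 s''"
    from WhileTrue.IH(1)[OF 1] have "t1 = u1" "s1 = r" by simp_all
    with WhileTrue.IH(2) 2 u show ?thesis by simp
  qed (simp add: WhileTrue.hyps(1))
qed


section \<open>Encoding of instances and solutions\<close>

text \<open>
  The weights are given in row-major order in the array \<open>w\<close>, and the dimensions in the registers
  \<open>m\<close> and \<open>n\<close>; all other memory is initially zero. The result is the characteristic vector of \<open>U\<close>,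
  in the same order, in the array \<open>u\<close>.
\<close>

definition cell :: "nat \<Rightarrow> nat \<times> nat \<Rightarrow> int" where
  "cell n = (\<lambda>(i, j). (int i - 1) * int n + (int j - 1))"

definition grid_input :: "nat \<Rightarrow> nat \<Rightarrow> (nat \<times> nat \<Rightarrow> nat) \<Rightarrow> store" where
  "grid_input m n w =
     \<lparr> regs = (\<lambda>_. 0)(''m'' := int m, ''n'' := int n),
       arrays = (\<lambda>_ _. 0)(''w'' := \<lambda>k. if 0 \<le> k \<and> k < int m * int n
         then int (w (Suc (nat k div n), Suc (nat k mod n))) else 0) \<rparr>"

definition grid_output :: "nat \<Rightarrow> nat \<Rightarrow> store \<Rightarrow> (nat \<times> nat) set" where
  "grid_output m n s = {v \<in> pverts (grid_graph m n). arrays s ''u'' (cell n v) = 1}"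

lemma grid_input_cell:
  assumes "v \<in> pverts (grid_graph m n)"
  shows "arrays (grid_input m n w) ''w'' (cell n v) = int (w v)"
proof -
  obtain i j where v: "v = (Suc i, Suc j)" and ij: "i < m" "j < n"
  proof -
    obtain a b where "v = (a, b)" "1 \<le> a" "a \<le> m" "1 \<le> b" "b \<le> n"
      using assms by (auto simp: grid_graph_def)
    then show ?thesis using that[of "a - 1" "b - 1"] by simp
  qed
  have c: "cell n v = int (i * n + j)"
    by (simp add: v cell_def)
  have "Suc i * n \<le> m * n"
    using ij by (intro mult_le_mono1) simp
  then have "i * n + j < m * n"
    using ij by simp
  then have "int (i * n + j) < int m * int n"
    by (metis of_nat_less_iff of_nat_mult)
  moreover have "(i * n + j) div n = i" "(i * n + j) mod n = j"
    using ij by simp_all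
  ultimately show ?thesis
    unfolding c grid_input_def by (simp add: v del: of_nat_add of_nat_mult)
qed

end

theory Submission
  imports Defs
begin

text \<open>
  Call a cell heavy if it carries at least a fifth of the total weight \<open>W\<close>. The algorithm keeps the best of two
  kinds of connected bipartitions.

  The first kind consists of the arcs of a cyclic order of the cells that is a Hamiltonian cycle of the grid, or, if
  both dimensions are odd, nearly so (one arc is exceptional), and of the mirror images of that order. A window sliding
  along the order finds the best arc in linear time. If no cell has weight above \<open>2W/5\<close> and there are not exactly three
  heavy cells, then some arc has weight between \<open>2W/5\<close> and \<open>3W/5\<close>, which is enough because \<open>OPT \<le> W/2\<close>.
  With three heavy cells, the three arcs that each join two of them give \<open>3M \<ge> W + L\<close>, where \<open>L\<close> is the weight of
  the light cells and \<open>M\<close> the value found.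

  For the second kind, consecutive rows, and likewise columns, without heavy cells are merged. There are at most five
  heavy cells, so the result is a grid of bounded size, and all its connected bipartitions can be tried. If an optimal
  part contains the heavy cells \<open>b\<close> and \<open>c\<close> but not \<open>a\<close>, then there are two parts \<open>V1\<close>, \<open>V2\<close> of this kind that contain \<open>b\<close>
  and \<open>c\<close> but not \<open>a\<close> and whose intersection lies in the optimal part. Adding up their weights shows that one of them
  is good enough unless \<open>a\<close> is small compared with \<open>L\<close>, and then the arcs suffice.

  The first and last two rows and columns are not merged, so that disjoint connected sets joining the heavy cells
  can be found within merged cells.
\<close>

section \<open>Connected sets and bipartitions of the grid\<close>

text \<open>Behind \<open>V1\<close> and \<open>V2\<close> stands a rooted minor
  \<open>K_{2,3}\<close>: disjoint connected sets \<open>S\<close>, \<open>T\<close>, each touching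
  \<open>a\<close>, \<open>b\<close> and \<open>c\<close>. Cutting along \<open>S\<close>,
  \<open>b\<close>, \<open>c\<close> leaves \<open>a\<close> joined to \<open>T\<close>, and
  conversely. The obstacle is planarity. Three cells on one face, a 2 by 2 square or the outer
  boundary, admit no such minor, since a vertex placed in that face would complete a
  \<open>K_{3,3}\<close>. Nor does a triple in which a corner is adjacent to another of its cells,
  because a corner has only two neighbours. On a common face a parity argument forces the optimal
  part to contain a connected set joining \<open>b\<close> and \<open>c\<close> when these are not
  adjacent; that set then replaces the bridges. The constant: let \<open>u\<close> be the weight of
  the part holding \<open>a\<close> alone among the heavy cells. Then
  \<open>u \<le> w a + L\<close>, and \<open>V1\<close>, \<open>V2\<close> give
  \<open>w a + u \<le> 2 M\<close>. On the other side \<open>W + L \<le> 3 M\<close> and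
  \<open>5 M < 2 W\<close> give \<open>L < M / 2\<close>. The two routes balance at
  \<open>3 L = 2 w a\<close>, where each yields \<open>u \<le> 5 M / 4\<close>. The exceptional arc
  is unavoidable: with both sides odd the two colour classes of the grid differ in size, so no
  Hamiltonian cycle exists.\<close>

abbreviation grid :: "nat \<Rightarrow> nat \<Rightarrow> (nat \<times> nat) set" where
  "grid m n \<equiv> {1..m} \<times> {1..n}"

definition step_in :: "(nat \<times> nat) set \<Rightarrow> ((nat \<times> nat) \<times> (nat \<times> nat)) set" where
  "step_in S = {(u, v). u \<in> S \<and> v \<in> S \<and> grid_adj u v}"

text \<open>Nonemptiness is built in, so that \<open>bipart\<close> needs no separate condition on
  its two parts.\<close>

definition conn :: "(nat \<times> nat) set \<Rightarrow> bool" where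
  "conn S \<longleftrightarrow> S \<noteq> {} \<and> (\<forall>u\<in>S. \<forall>v\<in>S. (u, v) \<in> (step_in S)\<^sup>*)"

lemma grid_adj_sym: "grid_adj u v \<longleftrightarrow> grid_adj v u"
  by (cases u; cases v) (auto simp: grid_adj_def)

lemma sym_step_in: "sym (step_in S)"
  unfolding step_in_def sym_def using grid_adj_sym by blast

lemma step_in_rtrancl_sym: "(u, v) \<in> (step_in S)\<^sup>* \<Longrightarrow> (v, u) \<in> (step_in S)\<^sup>*"
  by (meson sym_step_in sym_rtrancl symD)

lemma step_in_mono: "A \<subseteq> B \<Longrightarrow> (step_in A)\<^sup>* \<subseteq> (step_in B)\<^sup>*"
  by (rule rtrancl_mono) (auto simp: step_in_def)

lemma connI:
  assumes "b \<in> S" "\<And>v. v \<in> S \<Longrightarrow> (b, v) \<in> (step_in S)\<^sup>*"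
  shows "conn S"
  unfolding conn_def
proof (intro conjI ballI)
  show "S \<noteq> {}" using assms(1) by blast
  fix u v assume "u \<in> S" "v \<in> S"
  then show "(u, v) \<in> (step_in S)\<^sup>*"
    using assms(2) step_in_rtrancl_sym by (meson rtrancl_trans)
qed

lemma conn_nonempty: "conn S \<Longrightarrow> S \<noteq> {}"
  by (simp add: conn_def)

lemma connD: "conn S \<Longrightarrow> u \<in> S \<Longrightarrow> v \<in> S \<Longrightarrow> (u, v) \<in> (step_in S)\<^sup>*"
  by (simp add: conn_def)

lemma conn_singleton: "conn {v}"
  by (rule connI[of v]) auto

lemma conn_Un:
  assumes A: "conn A" and B: "conn B" and uv: "u \<in> A" "v \<in> B" "u = v \<or> grid_adj u v"
  shows "conn (A \<union> B)"
proof (rule connI)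
  show "u \<in> A \<union> B" using uv by simp
  have uv': "(u, v) \<in> (step_in (A \<union> B))\<^sup>*"
    using uv by (auto simp: step_in_def)
  fix x assume "x \<in> A \<union> B"
  then show "(u, x) \<in> (step_in (A \<union> B))\<^sup>*"
  proof
    assume "x \<in> A"
    then show ?thesis using connD[OF A uv(1)] step_in_mono[of A "A \<union> B"] by blast
  next
    assume "x \<in> B"
    then have "(v, x) \<in> (step_in (A \<union> B))\<^sup>*"
      using connD[OF B uv(2)] step_in_mono[of B "A \<union> B"] by blast
    with uv' show ?thesis by (rule rtrancl_trans)
  qed
qed

lemma conn_insert:
  assumes "conn S" "u \<in> S" "grid_adj u v"
  shows "conn (insert v S)"
  using conn_Un[OF assms(1) conn_singleton[of v] assms(2), of v] assms(3) by simp

text \<open>Strictly decreasing ranks lead from any cell to \<open>b\<close>. For boxes the rank is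
  the coordinate sum, for pieces of the boundary the position along it.\<close>

lemma conn_rank:
  fixes r :: "nat \<times> nat \<Rightarrow> nat"
  assumes "b \<in> S" "\<And>v. v \<in> S \<Longrightarrow> v \<noteq> b \<Longrightarrow> \<exists>u\<in>S. grid_adj u v \<and> r u < r v"
  shows "conn S"
proof (rule connI[OF assms(1)])
  fix v assume "v \<in> S"
  then show "(b, v) \<in> (step_in S)\<^sup>*"
  proof (induction "r v" arbitrary: v rule: less_induct)
    case less
    show ?case
    proof (cases "v = b")
      case False
      then obtain u where u: "u \<in> S" "grid_adj u v" "r u < r v" using assms(2) less.prems by blast
      then have "(b, u) \<in> (step_in S)\<^sup>*" using less.hyps by blast
      moreover have "(u, v) \<in> step_in S" using u less.prems by (simp add: step_in_def)
      ultimately show ?thesis by (rule rtrancl_into_rtrancl)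
    qed simp
  qed
qed

lemma conn_box:
  assumes "a \<le> b" "c \<le> d"
  shows "conn ({a..b} \<times> {c..d})"
proof (rule conn_rank[of "(a, c)" _ "\<lambda>(i, j). i + j"])
  show "(a, c) \<in> {a..b} \<times> {c..d}" using assms by simp
  fix v assume v: "v \<in> {a..b} \<times> {c..d}" "v \<noteq> (a, c)"
  obtain i j where ij: "v = (i, j)" by (cases v)
  show "\<exists>u\<in>{a..b} \<times> {c..d}. grid_adj u v \<and> (case u of (i, j) \<Rightarrow> i + j) < (case v of (i, j) \<Rightarrow> i + j)"
  proof (cases "a < i")
    case True
    then show ?thesis using v ij
      by (intro bexI[of _ "(i - 1, j)"]) (auto simp: grid_adj_def)
  next
    case False
    then show ?thesis using v ij
      by (intro bexI[of _ "(i, j - 1)"]) (auto simp: grid_adj_def)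
  qed
qed

text \<open>Used to catch the step at which a walk inside \<open>S\<close> leaves a set, and to show
  that locally constant properties are constant.\<close>

lemma conn_crossing:
  assumes "conn S" "u \<in> S" "v \<in> S" "P u" "\<not> P v"
  obtains x y where "x \<in> S" "y \<in> S" "grid_adj x y" "P x" "\<not> P y"
proof -
  have "(u, v) \<in> (step_in S)\<^sup>*" using connD assms(1-3) .
  then have "\<not> P v \<longrightarrow> (\<exists>x y. x \<in> S \<and> y \<in> S \<and> grid_adj x y \<and> P x \<and> \<not> P y)"
    by (induction rule: rtrancl_induct) (use assms(4) in \<open>auto simp: step_in_def\<close>)
  with assms(5) that show ?thesis by blast
qed

text \<open>Connectivity of digraphs passes through the symmetric closure, which adds nothing here
  since arcs come in opposite pairs. Reachability there differs from the closure of
  \<open>step_in S\<close> only by asking the start to be a vertex.\<close>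

lemma connected_induced_grid:
  assumes "S \<subseteq> grid m n"
  shows "Digraph_Component.connected (with_proj (grid_graph m n) \<restriction> S) \<longleftrightarrow> conn S"
proof -
  define H where "H = with_proj (mk_symmetric (with_proj (grid_graph m n) \<restriction> S))"
  have v: "verts H = S" by (simp add: H_def mk_symmetric_def)
  have "arcs_ends H = parcs (mk_symmetric (with_proj (grid_graph m n) \<restriction> S))"
    unfolding H_def by (simp add: arcs_ends_def arc_to_ends_def)
  also have "\<dots> = (\<Union>e\<in>{e \<in> parcs (grid_graph m n). fst e \<in> S \<and> snd e \<in> S}. {(fst e, snd e), (snd e, fst e)})"
    by (simp add: mk_symmetric_def)
  also have "{e \<in> parcs (grid_graph m n). fst e \<in> S \<and> snd e \<in> S} = step_in S"
    using assms unfolding step_in_def grid_graph_def by fastforce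
  also have "(\<Union>e\<in>step_in S. {(fst e, snd e), (snd e, fst e)}) = step_in S"
    using symD[OF sym_step_in[of S]] by fastforce
  finally have e: "arcs_ends H = step_in S" .
  have r: "u \<rightarrow>\<^sup>*\<^bsub>H\<^esub> v \<longleftrightarrow> (u, v) \<in> (step_in S)\<^sup>*" if "u \<in> S" for u v
  proof
    assume "u \<rightarrow>\<^sup>*\<^bsub>H\<^esub> v"
    then show "(u, v) \<in> (step_in S)\<^sup>*" unfolding reachable_def e by (rule rtrancl_on_rtranclI)
  next
    assume "(u, v) \<in> (step_in S)\<^sup>*"
    then show "u \<rightarrow>\<^sup>*\<^bsub>H\<^esub> v"
      unfolding reachable_def e v
    proof (induction rule: rtrancl_induct)
      case base
      then show ?case using that by (rule rtrancl_on_refl)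
    next
      case (step y z)
      then show ?case
        by (intro rtrancl_on_into_rtrancl_on[OF step.IH]) (auto simp: step_in_def)
    qed
  qed
  show ?thesis
    unfolding connected_def strongly_connected_def H_def[symmetric] v conn_def
    using r by auto
qed

definition bipart :: "nat \<Rightarrow> nat \<Rightarrow> (nat \<times> nat) set \<Rightarrow> bool" where
  "bipart m n U \<longleftrightarrow> U \<subseteq> grid m n \<and> conn U \<and> conn (grid m n - U)"

lemma pverts_grid [simp]: "pverts (grid_graph m n) = grid m n"
  by (simp add: grid_graph_def)

lemma connected_bipartition_grid:
  "connected_bipartition (grid_graph m n) U \<longleftrightarrow> bipart m n U"
proof (cases "U \<subseteq> grid m n")
  case True
  then have "grid m n - U \<subseteq> grid m n" by blast
  with True show ?thesis
    unfolding connected_bipartition_def bipart_def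
    using connected_induced_grid[of U m n] connected_induced_grid[of "grid m n - U" m n]
    by (auto simp del: with_proj_simps dest: conn_nonempty)
next
  case False
  then show ?thesis
    unfolding connected_bipartition_def bipart_def by simp
qed

section \<open>Components, and the bipartition that a connected set cuts off\<close>

definition comp :: "(nat \<times> nat) set \<Rightarrow> nat \<times> nat \<Rightarrow> (nat \<times> nat) set" where
  "comp S a = {v. (a, v) \<in> (step_in S)\<^sup>*}"

lemma comp_self: "a \<in> comp S a"
  by (simp add: comp_def)

lemma comp_subset: "a \<in> S \<Longrightarrow> comp S a \<subseteq> S"
proof
  fix v assume a: "a \<in> S" "v \<in> comp S a"
  then have "(a, v) \<in> (step_in S)\<^sup>*" by (simp add: comp_def)
  then show "v \<in> S" by (induction rule: rtrancl_induct) (use a in \<open>auto simp: step_in_def\<close>)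
qed

lemma comp_step:
  assumes "u \<in> comp S a" "u \<in> S" "v \<in> S" "grid_adj u v"
  shows "v \<in> comp S a"
  using assms unfolding comp_def
  by (auto simp: step_in_def intro: rtrancl_into_rtrancl)

lemma comp_conn_subset:
  assumes "conn T" "T \<subseteq> S" "t \<in> T" "t \<in> comp S a"
  shows "T \<subseteq> comp S a"
proof
  fix v assume "v \<in> T"
  then have "(t, v) \<in> (step_in S)\<^sup>*"
    using connD[OF assms(1,3)] step_in_mono[OF assms(2)] by blast
  then show "v \<in> comp S a"
    using assms(4) unfolding comp_def by (auto intro: rtrancl_trans)
qed

lemma conn_comp:
  assumes "a \<in> S" shows "conn (comp S a)"
proof (rule connI[OF comp_self[of a S]])
  fix v assume "v \<in> comp S a"
  then have "(a, v) \<in> (step_in S)\<^sup>*" by (simp add: comp_def)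
  then show "(a, v) \<in> (step_in (comp S a))\<^sup>*"
  proof (induction rule: rtrancl_induct)
    case (step y z)
    then have "(y, z) \<in> step_in (comp S a)"
      by (auto simp: step_in_def comp_def intro: rtrancl_into_rtrancl)
    with step.IH show ?case by (rule rtrancl_into_rtrancl)
  qed simp
qed

text \<open>A walk in \<open>V\<close> towards \<open>a\<close> has to pass through \<open>Q\<close>
  before it enters the component of \<open>a\<close>: a cell outside \<open>Q\<close> with a
  neighbour in the component belongs to it. So every remaining cell is joined to the connected set
  \<open>Q\<close> without entering the component.\<close>

lemma conn_compl_comp:
  assumes V: "conn V" and Q: "conn Q" "Q \<subseteq> V" and a: "a \<in> V - Q"
  shows "conn (V - comp (V - Q) a)"
proof -
  define W where "W = V - comp (V - Q) a"
  have QW: "Q \<subseteq> W" using comp_subset[OF a] Q(2) by (auto simp: W_def)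
  have *: "v \<in> W \<longrightarrow> (\<exists>q\<in>Q. (v, q) \<in> (step_in W)\<^sup>*)" if "(v, a) \<in> (step_in V)\<^sup>*" for v
    using that
  proof (induction rule: converse_rtrancl_induct)
    case base
    then show ?case using comp_self by (auto simp: W_def)
  next
    case (step v v')
    show ?case
    proof
      assume vW: "v \<in> W"
      show "\<exists>q\<in>Q. (v, q) \<in> (step_in W)\<^sup>*"
      proof (cases "v \<in> Q")
        case True
        then show ?thesis by blast
      next
        case False
        have adj: "grid_adj v' v" and vV: "v \<in> V" "v' \<in> V"
          using step.hyps(1) grid_adj_sym by (auto simp: step_in_def)
        have "v' \<in> W"
        proof (rule ccontr)
          assume "v' \<notin> W"
          then have v': "v' \<in> comp (V - Q) a" using vV by (simp add: W_def)
          then have "v \<in> comp (V - Q) a"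
            using comp_step[OF v' _ _ adj] False vV comp_subset[OF a] by blast
          then show False using vW by (simp add: W_def)
        qed
        then obtain q where "q \<in> Q" "(v', q) \<in> (step_in W)\<^sup>*" using step.IH by blast
        moreover have "(v, v') \<in> step_in W"
          using \<open>v' \<in> W\<close> vW adj grid_adj_sym by (simp add: step_in_def)
        ultimately show ?thesis by (meson converse_rtrancl_into_rtrancl)
      qed
    qed
  qed
  obtain q where q: "q \<in> Q" using conn_nonempty[OF Q(1)] by blast
  have "conn W"
  proof (rule connI[of q])
    show "q \<in> W" using q QW by blast
    fix v assume v: "v \<in> W"
    then have "(v, a) \<in> (step_in V)\<^sup>*" using connD[OF V] a by (auto simp: W_def)
    then obtain q' where q': "q' \<in> Q" "(v, q') \<in> (step_in W)\<^sup>*" using * v by blast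
    have "(q, q') \<in> (step_in W)\<^sup>*" using connD[OF Q(1) q q'(1)] step_in_mono[OF QW] by blast
    then show "(q, v) \<in> (step_in W)\<^sup>*" using q'(2) step_in_rtrancl_sym by (meson rtrancl_trans)
  qed
  then show ?thesis by (simp add: W_def)
qed

lemma conn_grid: "m \<ge> 1 \<Longrightarrow> n \<ge> 1 \<Longrightarrow> conn (grid m n)"
  by (rule conn_box) auto

text \<open>The source of all parts of the second kind: any connected \<open>Q\<close> yields a
  bipartition whose one part contains \<open>Q\<close> and whose other part is the component of
  \<open>a\<close>.\<close>

lemma bipart_compl_comp:
  assumes "conn Q" "Q \<subseteq> grid m n" "a \<in> grid m n - Q"
  shows "bipart m n (grid m n - comp (grid m n - Q) a)"
proof -
  have "comp (grid m n - Q) a \<subseteq> grid m n"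
    using comp_subset[OF assms(3)] by blast
  then have "grid m n - (grid m n - comp (grid m n - Q) a) = comp (grid m n - Q) a" by blast
  moreover have "conn (grid m n)" using assms(3) by (intro conn_grid) auto
  ultimately show ?thesis
    unfolding bipart_def
    using conn_compl_comp[OF _ assms] conn_comp[OF assms(3)] by simp
qed

section \<open>Two disjoint connected sets touching three cells\<close>

text \<open>\<open>(a, b, c, d)\<close> stands for rows \<open>a..b\<close> and columns
  \<open>c..d\<close> and may be empty. Describing connected sets by lists of rectangles turns
  connectedness, disjointness and adjacency into linear arithmetic; empty rectangles let one picture
  cover its degenerate cases.\<close>

type_synonym rect = "nat \<times> nat \<times> nat \<times> nat"

fun rect_cells :: "rect \<Rightarrow> (nat \<times> nat) set" where
  "rect_cells (a, b, c, d) = {a..b} \<times> {c..d}"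

fun rect_empty :: "rect \<Rightarrow> bool" where
  "rect_empty (a, b, c, d) \<longleftrightarrow> b < a \<or> d < c"

text \<open>Each disjunct demands a common row or a common column, so rectangles that touch only at
  a corner do not count.\<close>

fun rect_meets :: "rect \<Rightarrow> rect \<Rightarrow> bool" where
  "rect_meets (a, b, c, d) (a', b', c', d') \<longleftrightarrow>
     a \<le> b \<and> c \<le> d \<and>
     (a \<le> b' \<and> a' \<le> b \<and> c \<le> Suc d' \<and> c' \<le> Suc d \<or>
      a \<le> Suc b' \<and> a' \<le> Suc b \<and> c \<le> d' \<and> c' \<le> d)"

fun rect_disjnt :: "rect \<Rightarrow> rect \<Rightarrow> bool" where
  "rect_disjnt (a, b, c, d) (a', b', c', d') \<longleftrightarrow>
     b < a \<or> d < c \<or> b' < a' \<or> d' < c' \<or> b < a' \<or> b' < a \<or> d < c' \<or> d' < c"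

fun rect_touches :: "nat \<times> nat \<Rightarrow> rect \<Rightarrow> bool" where
  "rect_touches (i, j) (a, b, c, d) \<longleftrightarrow>
     a \<le> b \<and> c \<le> d \<and>
     (a \<le> i \<and> i \<le> b \<and> (c \<le> Suc j \<and> Suc j \<le> d \<or> Suc c \<le> j \<and> j \<le> Suc d) \<or>
      c \<le> j \<and> j \<le> d \<and> (a \<le> Suc i \<and> Suc i \<le> b \<or> Suc a \<le> i \<and> i \<le> Suc b))"

fun rect_avoids :: "nat \<times> nat \<Rightarrow> rect \<Rightarrow> bool" where
  "rect_avoids (i, j) (a, b, c, d) \<longleftrightarrow> i < a \<or> b < i \<or> j < c \<or> d < j"

fun rect_within :: "nat \<Rightarrow> nat \<Rightarrow> rect \<Rightarrow> bool" where
  "rect_within m n (a, b, c, d) \<longleftrightarrow> b < a \<or> d < c \<or> 1 \<le> a \<and> b \<le> m \<and> 1 \<le> c \<and> d \<le> n"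

text \<open>An empty rectangle passes the test but never serves as a link, because
  \<open>rect_meets\<close> asks its first argument to be nonempty.\<close>

fun rects_linked :: "rect list \<Rightarrow> rect list \<Rightarrow> bool" where
  "rects_linked acc [] \<longleftrightarrow> True"
| "rects_linked acc (r # rs) \<longleftrightarrow>
     (rect_empty r \<or> (\<exists>q\<in>set acc. rect_meets q r)) \<and> rects_linked (acc @ [r]) rs"

definition rects_cells :: "rect list \<Rightarrow> (nat \<times> nat) set" where
  "rects_cells rs = (\<Union>r\<in>set rs. rect_cells r)"

lemma rect_meets_adj:
  assumes "rect_meets q r" "\<not> rect_empty r"
  obtains u v where "u \<in> rect_cells q" "v \<in> rect_cells r" "u = v \<or> grid_adj u v"
proof -
  obtain a b c d where q: "q = (a, b, c, d)" by (cases q)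
  obtain a' b' c' d' where r: "r = (a', b', c', d')" by (cases r)
  have ne: "a \<le> b" "c \<le> d" "a' \<le> b'" "c' \<le> d'" using assms by (auto simp: q r)
  from assms(1) consider
    (1) "a \<le> b'" "a' \<le> b" "c \<le> Suc d'" "c' \<le> Suc d"
  | (2) "a \<le> Suc b'" "a' \<le> Suc b" "c \<le> d'" "c' \<le> d" by (auto simp: q r)
  then show ?thesis
  proof cases
    case 1
    define i where "i = max a a'"
    have i: "a \<le> i" "i \<le> b" "a' \<le> i" "i \<le> b'" using 1 ne by (auto simp: i_def)
    show ?thesis
    proof (cases "c \<le> d' \<and> c' \<le> d")
      case True
      then show ?thesis using i ne
        by (intro that[of "(i, max c c')" "(i, max c c')"]) (auto simp: q r)
    next
      case False
      then consider "c = Suc d'" | "c' = Suc d" using 1 by linarith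
      then show ?thesis
      proof cases
        case 1
        then show ?thesis using i ne
          by (intro that[of "(i, c)" "(i, d')"]) (auto simp: q r grid_adj_def)
      next
        case 2
        then show ?thesis using i ne
          by (intro that[of "(i, d)" "(i, c')"]) (auto simp: q r grid_adj_def)
      qed
    qed
  next
    case 2
    define j where "j = max c c'"
    have j: "c \<le> j" "j \<le> d" "c' \<le> j" "j \<le> d'" using 2 ne by (auto simp: j_def)
    show ?thesis
    proof (cases "a \<le> b' \<and> a' \<le> b")
      case True
      then show ?thesis using j ne
        by (intro that[of "(max a a', j)" "(max a a', j)"]) (auto simp: q r)
    next
      case False
      then consider "a = Suc b'" | "a' = Suc b" using 2 by linarith
      then show ?thesis
      proof cases
        case 1
        then show ?thesis using j ne
          by (intro that[of "(a, j)" "(b', j)"]) (auto simp: q r grid_adj_def)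
      next
        case 2
        then show ?thesis using j ne
          by (intro that[of "(b, j)" "(a', j)"]) (auto simp: q r grid_adj_def)
      qed
    qed
  qed
qed

lemma conn_rects_linked:
  assumes "conn (rects_cells acc)" "rects_linked acc rs"
  shows "conn (rects_cells (acc @ rs))"
  using assms
proof (induction rs arbitrary: acc)
  case (Cons r rs)
  have "conn (rects_cells (acc @ [r]))"
  proof (cases "rect_empty r")
    case True
    then have "rect_cells r = {}" by (cases r) auto
    then have "rects_cells (acc @ [r]) = rects_cells acc" by (auto simp: rects_cells_def)
    then show ?thesis using Cons.prems(1) by simp
  next
    case False
    then obtain q where q: "q \<in> set acc" "rect_meets q r" using Cons.prems(2) by auto
    obtain u v where uv: "u \<in> rect_cells q" "v \<in> rect_cells r" "u = v \<or> grid_adj u v"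
      using rect_meets_adj[OF q(2) False] .
    have "conn (rect_cells r)" using False by (cases r) (auto intro: conn_box)
    moreover have "u \<in> rects_cells acc" using uv(1) q(1) by (auto simp: rects_cells_def)
    ultimately have "conn (rects_cells acc \<union> rect_cells r)"
      using conn_Un[OF Cons.prems(1)] uv by blast
    then show ?thesis by (simp add: rects_cells_def Un_commute)
  qed
  then show ?case using Cons.IH[of "acc @ [r]"] Cons.prems(2) by simp
qed simp

lemma conn_rects:
  assumes "\<not> rect_empty r" "rects_linked [r] rs"
  shows "conn (rects_cells (r # rs))"
proof -
  have "conn (rects_cells [r])"
    using assms(1) by (cases r) (auto simp: rects_cells_def intro: conn_box)
  then show ?thesis using conn_rects_linked[of "[r]" rs] assms(2) by simp
qed

text \<open>Two disjoint connected sets that both touch all roots: a \<open>K\<^sub>2\<^sub>,\<^sub>3\<close> minor rooted at \<open>R\<close>.\<close>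

definition rooted_K23 :: "nat \<Rightarrow> nat \<Rightarrow> (nat \<times> nat) set \<Rightarrow> (nat \<times> nat) set \<Rightarrow> bool" where
  "rooted_K23 m n F R \<longleftrightarrow> (\<exists>S T. S \<subseteq> grid m n - (R \<union> F) \<and> T \<subseteq> grid m n - (R \<union> F) \<and> S \<inter> T = {} \<and>
     conn S \<and> conn T \<and> (\<forall>r\<in>R. (\<exists>s\<in>S. grid_adj s r) \<and> (\<exists>t\<in>T. grid_adj t r)))"

text \<open>All premises are comparisons of rectangle bounds, so a configuration is settled by
  exhibiting two lists of rectangles.\<close>

lemma rooted_K23_rects:
  assumes "\<not> rect_empty p" "rects_linked [p] ps" "\<not> rect_empty q" "rects_linked [q] qs"
    and "\<forall>r\<in>set (p # ps). \<forall>s\<in>set (q # qs). rect_disjnt r s"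
    and "\<forall>r\<in>set (p # ps). rect_within m n r" "\<forall>r\<in>set (q # qs). rect_within m n r"
    and "\<forall>v\<in>R. (\<exists>r\<in>set (p # ps). rect_touches v r)" "\<forall>v\<in>R. (\<exists>r\<in>set (q # qs). rect_touches v r)"
    and "\<forall>v\<in>R \<union> F. (\<forall>r\<in>set (p # ps). rect_avoids v r)" "\<forall>v\<in>R \<union> F. (\<forall>r\<in>set (q # qs). rect_avoids v r)"
  shows "rooted_K23 m n F R"
  unfolding rooted_K23_def
proof (intro exI conjI)
  have within: "rect_cells r \<subseteq> grid m n" if "rect_within m n r" for r
    using that by (cases r) auto
  have disj: "rect_cells r \<inter> rect_cells s = {}" if "rect_disjnt r s" for r s
    using that by (cases r; cases s) auto
  have avoid: "v \<notin> rect_cells r" if "rect_avoids v r" for v r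
    using that by (cases v; cases r) auto
  have touch: "\<exists>s\<in>rect_cells r. grid_adj s v" if tr: "rect_touches v r" for v r
  proof -
    obtain i j where v: "v = (i, j)" by (cases v)
    obtain a b c d where r: "r = (a, b, c, d)" by (cases r)
    from tr consider "a \<le> i" "i \<le> b" "c \<le> Suc j" "Suc j \<le> d" | "a \<le> i" "i \<le> b" "Suc c \<le> j" "j \<le> Suc d"
      | "c \<le> j" "j \<le> d" "a \<le> Suc i" "Suc i \<le> b" | "c \<le> j" "j \<le> d" "Suc a \<le> i" "i \<le> Suc b"
      by (auto simp: v r)
    then show ?thesis
    proof cases
      case 1 then show ?thesis by (intro bexI[of _ "(i, Suc j)"]) (auto simp: v r grid_adj_def)
    next
      case 2 then show ?thesis by (intro bexI[of _ "(i, j - 1)"]) (auto simp: v r grid_adj_def)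
    next
      case 3 then show ?thesis by (intro bexI[of _ "(Suc i, j)"]) (auto simp: v r grid_adj_def)
    next
      case 4 then show ?thesis by (intro bexI[of _ "(i - 1, j)"]) (auto simp: v r grid_adj_def)
    qed
  qed
  let ?S = "rects_cells (p # ps)" and ?T = "rects_cells (q # qs)"
  show "?S \<subseteq> grid m n - (R \<union> F)" "?T \<subseteq> grid m n - (R \<union> F)"
    using assms(6,7,10,11) within avoid unfolding rects_cells_def by blast+
  show "?S \<inter> ?T = {}"
    using assms(5) disj unfolding rects_cells_def by blast
  show "conn ?S" "conn ?T" using assms(1-4) by (auto intro: conn_rects)
  show "\<forall>r\<in>R. (\<exists>s\<in>?S. grid_adj s r) \<and> (\<exists>t\<in>?T. grid_adj t r)"
    using assms(8,9) touch unfolding rects_cells_def by (meson UN_I)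
qed

section \<open>Explicit bridges for the normal forms of three cells\<close>

text \<open>One set hangs from the top row, the other stands on the bottom row. The first reaches
  the lower cell \<open>(p', q)\<close> from the side through column \<open>q + 1\<close>, the
  second reaches \<open>(p, q)\<close> from the side through column \<open>q - 1\<close>; room for
  column \<open>q + 1\<close> is the reason for \<open>Suc q < q'\<close>.\<close>

lemma K23_L:
  assumes "1 < p" "p < p'" "p' < m" "1 < q" "Suc q < q'" "q' < n"
  shows "rooted_K23 m n {} {(p, q), (p', q), (p, q')}"
proof -
  obtain P where p: "p = Suc P" using assms by (cases p) auto
  obtain Q where q: "q = Suc Q" using assms by (cases q) auto
  show ?thesis
    by (rule rooted_K23_rects[of "(1, 1, 1, n)" "[(1, P, q, q), (1, P, q', q'), (1, p', Suc q, Suc q)]"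
          "(m, m, 1, n)" "[(Suc p', m, q, q), (Suc p, m, q', q'), (p, m, Q, Q)]"])
      (use assms in \<open>simp_all add: p q\<close>)
qed

text \<open>One set is row 2 without its ends, with branches down to the two lower cells; the other
  is the outer frame, with branches up from the bottom row.\<close>

lemma K23_T1a:
  assumes "2 < p" "p < m" "1 < q" "q < q'" "q' < n" "1 < j" "j < n"
  shows "rooted_K23 m n {} {(1, j), (p, q), (p, q')}"
proof -
  obtain P where p: "p = Suc P" using assms by (cases p) auto
  obtain N where n: "n = Suc N" using assms by (cases n) auto
  obtain J where j: "j = Suc J" using assms by (cases j) auto
  show ?thesis
    by (rule rooted_K23_rects[of "(2, 2, 2, N)" "[(2, P, q, q), (2, P, q', q')]"
          "(m, m, 1, n)" "[(1, m, 1, 1), (1, m, n, n), (1, 1, 1, J), (1, 1, Suc j, n), (Suc p, m, q, q), (Suc p, m, q', q')]"])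
      (use assms in \<open>simp_all add: p n j\<close>)
qed

lemma K23_T1b:
  assumes "2 < m" "1 < q" "q < j" "j < q'" "q' < n"
  shows "rooted_K23 m n {} {(1, j), (2, q), (2, q')}"
proof -
  obtain Q' where q2: "q' = Suc Q'" using assms by (cases q') auto
  obtain J where j: "j = Suc J" using assms by (cases j) auto
  show ?thesis
    by (rule rooted_K23_rects[of "(2, 2, Suc q, Q')" "[]"
          "(m, m, 1, n)" "[(1, m, 1, 1), (1, m, n, n), (1, 1, 1, J), (1, 1, Suc j, n)]"])
      (use assms in \<open>simp_all add: q2 j\<close>)
qed

text \<open>With both cells in row 2 on the same side of \<open>j\<close>, a left comb and a right
  comb interlock. The excluded position is three cells of one 2 by 2 square.\<close>

lemma K23_T1c:
  assumes "2 < m" "1 < j" "j \<le> q" "q < q'" "q' < n" "q = j \<longrightarrow> q' \<noteq> Suc j"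
  shows "rooted_K23 m n {} {(1, j), (2, q), (2, q')}"
proof -
  obtain Q where q: "q = Suc Q" using assms by (cases q) auto
  obtain Q' where q2: "q' = Suc Q'" using assms by (cases q') auto
  obtain J where j: "j = Suc J" using assms by (cases j) auto
  obtain M where m: "m = Suc M" using assms by (cases m) auto
  obtain N where n: "n = Suc N" using assms by (cases n) auto
  \<comment> \<open>The last rectangle is the single cell \<open>(2, q + 1)\<close> if
    \<open>q + 1 < q'\<close>. If \<open>q' = q + 1\<close> the minimum makes it empty, and the
    right comb touches \<open>(2, q)\<close> from row 1 instead, which requires
    \<open>j < q\<close>.\<close>
  show ?thesis
    by (rule rooted_K23_rects[of "(1, m, 1, 1)" "[(1, 1, 1, J), (2, 2, 1, Q), (m, m, 1, N), (3, m, q', q')]"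
          "(1, M, n, n)" "[(1, 1, Suc j, n), (2, 2, Suc q', n), (2, 2, Suc q, min (Suc q) Q')]"])
      (use assms in \<open>simp_all add: q q2 j m n, (presburger | linarith | force)+\<close>)
qed

lemma K23_T2a:
  assumes "1 < p" "p < m" "1 \<le> j" "j < q" "q < j'" "j' \<le> n"
  shows "rooted_K23 m n {} {(1, j), (1, j'), (p, q)}"
proof -
  obtain P where p: "p = Suc P" using assms by (cases p) auto
  obtain J where j: "j = Suc J" using assms by (cases j) auto
  obtain J' where j2: "j' = Suc J'" using assms by (cases j') auto
  show ?thesis
    by (rule rooted_K23_rects[of "(1, 1, Suc j, J')" "[(1, P, q, q)]"
          "(m, m, 1, n)" "[(2, m, 1, 1), (2, m, n, n), (1, 1, 1, J), (1, 1, Suc j', n), (Suc p, m, q, q)]"])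
      (use assms in \<open>simp_all add: p j j2, (presburger | linarith | force)+\<close>)
qed

text \<open>The inner set runs along row 2 up to column \<open>j + 1\<close>. If
  \<open>j' = j + 1\<close> the cell below \<open>j'\<close> must not lie in the last column, which
  belongs to the other set; and if moreover \<open>p = 2\<close> and \<open>q = j\<close>, the cell
  below \<open>(1, j)\<close> would be a root.\<close>

lemma K23_T2b:
  assumes "1 < p" "p < m" "1 < q" "q \<le> j" "j < j'" "j' \<le> n"
    and "j' = Suc j \<longrightarrow> j' < n \<and> \<not> (p = 2 \<and> q = j)"
  shows "rooted_K23 m n {} {(1, j), (1, j'), (p, q)}"
proof -
  obtain P where p: "p = Suc P" using assms by (cases p) auto
  obtain J where j: "j = Suc J" using assms by (cases j) auto
  obtain J' where j2: "j' = Suc J'" using assms by (cases j') auto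
  show ?thesis
    by (rule rooted_K23_rects[of "(2, 2, if 2 < p then q else Suc q, Suc j)" "[(2, P, q, q), (1, 1, Suc j, J')]"
          "(m, m, 1, n)" "[(2, m, 1, 1), (2, m, n, n), (1, 1, 1, J), (1, 1, Suc j', n), (Suc p, m, q, q)]"])
      (use assms in \<open>simp_all add: p j j2, (presburger | linarith | force)+\<close>)
qed

lemma K23_T3a:
  assumes "1 < p" "p < m" "1 < q" "q < j" "j < n" "1 < i" "i < m"
  shows "rooted_K23 m n {} {(1, j), (i, 1), (p, q)}"
proof -
  obtain P where p: "p = Suc P" using assms by (cases p) auto
  obtain J where j: "j = Suc J" using assms by (cases j) auto
  obtain I where i: "i = Suc I" using assms by (cases i) auto
  show ?thesis
    by (rule rooted_K23_rects[of "(1, I, 1, 1)" "[(1, 1, 1, J), (1, P, q, q)]"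
          "(m, m, 1, n)" "[(1, m, n, n), (1, 1, Suc j, n), (Suc i, m, 1, 1), (Suc p, m, q, q)]"])
      (use assms in \<open>simp_all add: p j i\<close>)
qed

text \<open>The inner set is an angle along column 2 and row 2. Both sets avoid
  \<open>(1, 1)\<close>; this is recorded as a forbidden cell for triples that contain both
  neighbours of a corner.\<close>

lemma K23_T3b:
  assumes "2 < p" "p < m" "2 < q" "q < n" "1 < j" "j \<le> q" "1 < i" "i \<le> p"
  shows "rooted_K23 m n {(1, 1)} {(1, j), (i, 1), (p, q)}"
proof -
  obtain P where p: "p = Suc P" using assms by (cases p) auto
  obtain J where j: "j = Suc J" using assms by (cases j) auto
  obtain I where i: "i = Suc I" using assms by (cases i) auto
  show ?thesis
    by (rule rooted_K23_rects[of "(2, i, 2, 2)" "[(2, 2, 2, q), (2, P, q, q)]"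
          "(m, m, 1, n)" "[(1, m, n, n), (1, 1, Suc j, n), (Suc i, m, 1, 1), (Suc p, m, q, q)]"])
      (use assms in \<open>simp_all add: p j i\<close>)
qed

lemma K23_T3c:
  assumes "2 < m" "2 < q" "q < n" "1 < j" "j \<le> q"
  shows "rooted_K23 m n {(1, 1)} {(1, j), (2, 1), (2, q)}"
proof -
  obtain Q where q: "q = Suc Q" using assms by (cases q) auto
  obtain J where j: "j = Suc J" using assms by (cases j) auto
  \<comment> \<open>If \<open>j = q\<close>, the cell below \<open>(1, j)\<close> is a root, so the
    inner set touches \<open>(1, j)\<close> through \<open>(1, j - 1)\<close>. For
    \<open>j = 2\<close> that cell would be the forbidden corner, and the rectangle is made empty;
    then \<open>j < q\<close> and the cell below is available.\<close>
  show ?thesis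
    by (rule rooted_K23_rects[of "(2, 2, 2, Q)" "[(1, if 2 < j then 1 else 0, J, J)]"
          "(m, m, 1, n)" "[(1, m, n, n), (1, 1, Suc j, n), (3, m, 1, 1), (3, m, q, q)]"])
      (use assms in \<open>simp_all add: q j\<close>)
qed

text \<open>Each of the three rows is split by its root: the left piece joins the first column, the
  right piece the last column. Both columns omit the corners, which leaves corner roots possible in
  the top and bottom rows.\<close>

lemma K23_LR:
  assumes "3 \<le> m" "3 \<le> n" "1 \<le> i1" "i1 < i2" "i2 < i3" "i3 \<le> m"
    and "1 \<le> j1" "j1 \<le> n" "1 < j2" "j2 < n" "1 \<le> j3" "j3 \<le> n"
    and "i1 = 1 \<or> 1 < j1 \<and> j1 < n" "i3 = m \<or> 1 < j3 \<and> j3 < n"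
  shows "rooted_K23 m n {} {(i1, j1), (i2, j2), (i3, j3)}"
proof -
  obtain M where m: "m = Suc M" using assms by (cases m) auto
  obtain J1 where j1: "j1 = Suc J1" using assms by (cases j1) auto
  obtain J2 where j2: "j2 = Suc J2" using assms by (cases j2) auto
  obtain J3 where j3: "j3 = Suc J3" using assms by (cases j3) auto
  show ?thesis
    by (rule rooted_K23_rects[of "(2, M, 1, 1)" "[(i1, i1, 1, J1), (i2, i2, 1, J2), (i3, i3, 1, J3)]"
          "(2, M, n, n)" "[(i1, i1, Suc j1, n), (i2, i2, Suc j2, n), (i3, i3, Suc j3, n)]"])
      (use assms in \<open>simp_all add: m j1 j2 j3, (presburger | linarith | force)+\<close>)
qed

section \<open>Images of connected sets and symmetries of the grid\<close>

lemma conn_image: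
  assumes "conn S" "\<And>u v. u \<in> S \<Longrightarrow> v \<in> S \<Longrightarrow> grid_adj u v \<Longrightarrow> g u = g v \<or> grid_adj (g u) (g v)"
  shows "conn (g ` S)"
proof -
  obtain b where b: "b \<in> S" using conn_nonempty[OF assms(1)] by blast
  show ?thesis
  proof (rule connI[of "g b"])
    fix v assume "v \<in> g ` S"
    then obtain u where u: "u \<in> S" "v = g u" by blast
    have "(b, u) \<in> (step_in S)\<^sup>*" using connD[OF assms(1) b u(1)] .
    then have "(g b, g u) \<in> (step_in (g ` S))\<^sup>*"
    proof (induction rule: rtrancl_induct)
      case (step y z)
      then have "g y = g z \<or> (g y, g z) \<in> step_in (g ` S)"
        using assms(2)[of y z] by (auto simp: step_in_def)
      with step.IH show ?case by (auto intro: rtrancl_into_rtrancl)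
    qed simp
    then show "(g b, v) \<in> (step_in (g ` S))\<^sup>*" using u by simp
  qed (use b in blast)
qed

lemma rooted_K23_antimono:
  "rooted_K23 m n F R \<Longrightarrow> F' \<subseteq> F \<Longrightarrow> rooted_K23 m n F' R"
  unfolding rooted_K23_def
  by (elim exE, rule_tac x = S in exI, rule_tac x = T in exI) blast

text \<open>The minor is found in the image of the configuration and pulled back, hence only
  \<open>g\<close> is asked to preserve adjacency.\<close>

lemma rooted_K23_iso:
  assumes K: "rooted_K23 m' n' (f ` F) (f ` R)"
    and FR: "F \<subseteq> grid m n" "R \<subseteq> grid m n"
    and f: "\<And>v. v \<in> grid m n \<Longrightarrow> g (f v) = v"
    and g: "\<And>v. v \<in> grid m' n' \<Longrightarrow> g v \<in> grid m n"
    and fg: "\<And>v. v \<in> grid m' n' \<Longrightarrow> f (g v) = v"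
    and fR: "\<And>v. v \<in> grid m n \<Longrightarrow> f v \<in> grid m' n'"
    and adj: "\<And>u v. u \<in> grid m' n' \<Longrightarrow> v \<in> grid m' n' \<Longrightarrow> grid_adj u v \<Longrightarrow> grid_adj (g u) (g v)"
  shows "rooted_K23 m n F R"
proof -
  obtain S T where S: "S \<subseteq> grid m' n' - (f ` R \<union> f ` F)" and T: "T \<subseteq> grid m' n' - (f ` R \<union> f ` F)"
    and ST: "S \<inter> T = {}" "conn S" "conn T"
    and t: "\<And>r. r \<in> R \<Longrightarrow> \<exists>s\<in>S. grid_adj s (f r)" "\<And>r. r \<in> R \<Longrightarrow> \<exists>s\<in>T. grid_adj s (f r)"
    using K unfolding rooted_K23_def by (auto simp: ball_Un)
  have sub: "g ` X \<subseteq> grid m n - (R \<union> F)" if X: "X \<subseteq> grid m' n' - (f ` R \<union> f ` F)" for X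
  proof
    fix v assume "v \<in> g ` X"
    then obtain x where x: "x \<in> X" "v = g x" by blast
    then have xg: "x \<in> grid m' n'" using X by blast
    have "f v = x" using fg[OF xg] x by simp
    then have "v \<notin> R \<union> F" using x X by blast
    then show "v \<in> grid m n - (R \<union> F)" using g[OF xg] x by simp
  qed
  have cn: "conn (g ` X)" if X: "X \<subseteq> grid m' n' - (f ` R \<union> f ` F)" "conn X" for X
    using adj X(1) by (intro conn_image[OF X(2)]) blast
  have tch: "\<exists>s\<in>g ` X. grid_adj s r"
    if X: "X \<subseteq> grid m' n' - (f ` R \<union> f ` F)" "\<exists>s\<in>X. grid_adj s (f r)" "r \<in> R" for X r
  proof -
    obtain s where s: "s \<in> X" "grid_adj s (f r)" using X by blast
    have r: "r \<in> grid m n" using X(3) FR by blast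
    have "grid_adj (g s) (g (f r))" using adj[OF _ fR[OF r] s(2)] s(1) X(1) by blast
    then show ?thesis using f[OF r] s(1) by auto
  qed
  have inj: "g ` S \<inter> g ` T = {}"
  proof (rule ccontr)
    assume "g ` S \<inter> g ` T \<noteq> {}"
    then obtain x y where xy: "x \<in> S" "y \<in> T" "g x = g y" by blast
    then have "x = y" using fg S T by (metis Diff_iff subsetD)
    then show False using xy ST(1) by blast
  qed
  show ?thesis
    unfolding rooted_K23_def
  proof (intro exI conjI ballI)
    show "g ` S \<subseteq> grid m n - (R \<union> F)" "g ` T \<subseteq> grid m n - (R \<union> F)" by (fact sub[OF S] sub[OF T])+
    show "g ` S \<inter> g ` T = {}" by (fact inj)
    show "conn (g ` S)" "conn (g ` T)" by (fact cn[OF S ST(2)] cn[OF T ST(3)])+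
    fix r assume r: "r \<in> R"
    show "\<exists>s\<in>g ` S. grid_adj s r" by (rule tch[OF S t(1)[OF r] r])
    show "\<exists>t\<in>g ` T. grid_adj t r" by (rule tch[OF T t(2)[OF r] r])
  qed
qed

definition flip1 :: "nat \<Rightarrow> nat \<times> nat \<Rightarrow> nat \<times> nat" where
  "flip1 m = (\<lambda>(i, j). (Suc m - i, j))"
definition flip2 :: "nat \<Rightarrow> nat \<times> nat \<Rightarrow> nat \<times> nat" where
  "flip2 n = (\<lambda>(i, j). (i, Suc n - j))"

lemma flip1_simp [simp]: "flip1 m (i, j) = (Suc m - i, j)" by (simp add: flip1_def)
lemma flip2_simp [simp]: "flip2 n (i, j) = (i, Suc n - j)" by (simp add: flip2_def)

lemma rooted_K23_flip1:
  assumes "rooted_K23 m n (flip1 m ` F) (flip1 m ` R)" "F \<subseteq> grid m n" "R \<subseteq> grid m n"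
  shows "rooted_K23 m n F R"
  by (rule rooted_K23_iso[OF assms, of "flip1 m"]) (auto simp: flip1_def grid_adj_def)

lemma rooted_K23_flip2:
  assumes "rooted_K23 m n (flip2 n ` F) (flip2 n ` R)" "F \<subseteq> grid m n" "R \<subseteq> grid m n"
  shows "rooted_K23 m n F R"
  by (rule rooted_K23_iso[OF assms, of "flip2 n"]) (auto simp: flip2_def grid_adj_def)

lemma rooted_K23_transpose:
  assumes "rooted_K23 n m (prod.swap ` F) (prod.swap ` R)" "F \<subseteq> grid m n" "R \<subseteq> grid m n"
  shows "rooted_K23 m n F R"
  by (rule rooted_K23_iso[OF assms, of prod.swap]) (auto simp: grid_adj_def)

section \<open>Three cells, at least one of them interior\<close>

definition interior :: "nat \<Rightarrow> nat \<Rightarrow> nat \<times> nat \<Rightarrow> bool" where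
  "interior m n = (\<lambda>(i, j). 1 < i \<and> i < m \<and> 1 < j \<and> j < n)"
definition corner :: "nat \<Rightarrow> nat \<Rightarrow> nat \<times> nat \<Rightarrow> bool" where
  "corner m n = (\<lambda>(i, j). (i = 1 \<or> i = m) \<and> (j = 1 \<or> j = n))"
definition square :: "nat \<Rightarrow> nat \<Rightarrow> (nat \<times> nat) set" where
  "square a b = {a, Suc a} \<times> {b, Suc b}"

lemma interior_simp [simp]: "interior m n (i, j) \<longleftrightarrow> 1 < i \<and> i < m \<and> 1 < j \<and> j < n"
  by (simp add: interior_def)
lemma corner_simp [simp]: "corner m n (i, j) \<longleftrightarrow> (i = 1 \<or> i = m) \<and> (j = 1 \<or> j = n)"
  by (simp add: corner_def)

lemma K23_rows:
  assumes "3 \<le> m" "3 \<le> n" "(i1, j1) \<in> grid m n" "(i2, j2) \<in> grid m n" "(i3, j3) \<in> grid m n"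
    and "i1 \<noteq> i2" "i1 \<noteq> i3" "i2 \<noteq> i3"
    and "i1 = 1 \<or> i1 = m \<or> 1 < j1 \<and> j1 < n" "i2 = 1 \<or> i2 = m \<or> 1 < j2 \<and> j2 < n"
      "i3 = 1 \<or> i3 = m \<or> 1 < j3 \<and> j3 < n"
  shows "rooted_K23 m n {} {(i1, j1), (i2, j2), (i3, j3)}"
proof -
  have *: "rooted_K23 m n {} {(i1, j1), (i2, j2), (i3, j3)}"
    if "(i1, j1) \<in> grid m n" "(i2, j2) \<in> grid m n" "(i3, j3) \<in> grid m n" "i1 < i2" "i2 < i3"
     "i1 = 1 \<or> i1 = m \<or> 1 < j1 \<and> j1 < n" "i2 = 1 \<or> i2 = m \<or> 1 < j2 \<and> j2 < n"
      "i3 = 1 \<or> i3 = m \<or> 1 < j3 \<and> j3 < n" for i1 i2 i3 j1 j2 j3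
    by (rule K23_LR) (use that assms(1,2) in auto)
  consider "i1 < i2" "i2 < i3" | "i1 < i3" "i3 < i2" | "i2 < i1" "i1 < i3" | "i2 < i3" "i3 < i1"
    | "i3 < i1" "i1 < i2" | "i3 < i2" "i2 < i1"
    using assms(6-8) by linarith
  then show ?thesis
    by cases (use *[of i1 j1 i2 j2 i3 j3] *[of i1 j1 i3 j3 i2 j2] *[of i2 j2 i1 j1 i3 j3]
        *[of i2 j2 i3 j3 i1 j1] *[of i3 j3 i1 j1 i2 j2] *[of i3 j3 i2 j2 i1 j1] assms
        in \<open>simp_all add: insert_commute\<close>)
qed

lemma K23_columns:
  assumes "3 \<le> m" "3 \<le> n" "(i1, j1) \<in> grid m n" "(i2, j2) \<in> grid m n" "(i3, j3) \<in> grid m n"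
    and "j1 \<noteq> j2" "j1 \<noteq> j3" "j2 \<noteq> j3"
    and "j1 = 1 \<or> j1 = n \<or> 1 < i1 \<and> i1 < m" "j2 = 1 \<or> j2 = n \<or> 1 < i2 \<and> i2 < m"
      "j3 = 1 \<or> j3 = n \<or> 1 < i3 \<and> i3 < m"
  shows "rooted_K23 m n {} {(i1, j1), (i2, j2), (i3, j3)}"
  using K23_rows[of n m j1 i1 j2 i2 j3 i3] assms
  by - (rule rooted_K23_transpose, simp_all)

text \<open>Reflections bring the angle into the position of \<open>K23_L\<close>. If the horizontal
  arm has length 1 and leaves no free column, the vertical arm is longer, and transposing exchanges
  the arms.\<close>

lemma K23_right_angle:
  assumes "1 < p" "p < m" "1 < p'" "p' < m" "1 < q" "q < n" "1 < q'" "q' < n" "p \<noteq> p'" "q \<noteq> q'"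
    and "\<not> ((p' = Suc p \<or> p = Suc p') \<and> (q' = Suc q \<or> q = Suc q'))"
  shows "rooted_K23 m n {} {(p, q), (p', q), (p, q')}"
proof -
  have 1: "rooted_K23 m n {} {(p, q), (p', q), (p, q')}"
    if "1 < p" "p < p'" "p' < m" "1 < q" "q < q'" "q' < n" "\<not> (p' = Suc p \<and> q' = Suc q)"
    for p p' q q'
  proof (cases "q' = Suc q")
    case False
    then show ?thesis using that by (intro K23_L) auto
  next
    case True
    then have "rooted_K23 n m {} {(q, p), (q', p), (q, p')}" using that by (intro K23_L) auto
    then show ?thesis using that
      by - (rule rooted_K23_transpose, simp_all add: insert_commute)
  qed
  have 2: "rooted_K23 m n {} {(p, q), (p', q), (p, q')}"
    if a: "1 < p" "p < p'" "p' < m" "1 < q" "q < n" "1 < q'" "q' < n" "q \<noteq> q'"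
      "\<not> (p' = Suc p \<and> (q' = Suc q \<or> q = Suc q'))" for p p' q q'
  proof (cases "q < q'")
    case True
    then show ?thesis using that by (intro 1) auto
  next
    case False
    then have "rooted_K23 m n {} {(p, Suc n - q), (p', Suc n - q), (p, Suc n - q')}"
      using that by (intro 1) auto
    then show ?thesis using that
      by - (rule rooted_K23_flip2, simp_all)
  qed
  show ?thesis
  proof (cases "p < p'")
    case True
    then show ?thesis using assms by (intro 2) auto
  next
    case False
    then have "rooted_K23 m n {} {(Suc m - p, q), (Suc m - p', q), (Suc m - p, q')}"
      using assms by (intro 2) auto
    then show ?thesis using assms
      by - (rule rooted_K23_flip1, simp_all)
  qed
qed

text \<open>Either all rows differ, or all columns differ, or one pair shares a row and another pair
  a column; the last case is a right angle.\<close>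

lemma K23_interior:
  assumes mn: "3 \<le> m" "3 \<le> n" and "interior m n x" "interior m n y" "interior m n z"
    and d: "x \<noteq> y" "x \<noteq> z" "y \<noteq> z" and sq: "\<And>a b. \<not> {x, y, z} \<subseteq> square a b"
  shows "rooted_K23 m n {} {x, y, z}"
proof -
  obtain x1 x2 y1 y2 z1 z2 where xyz: "x = (x1, x2)" "y = (y1, y2)" "z = (z1, z2)"
    by (cases x; cases y; cases z)
  have i: "1 < x1" "x1 < m" "1 < x2" "x2 < n" "1 < y1" "y1 < m" "1 < y2" "y2 < n" "1 < z1" "z1 < m" "1 < z2" "z2 < n"
    using assms by (auto simp: xyz)
  have L: "rooted_K23 m n {} {x, y, z}"
    if "{x, y, z} = {(p, q), (p', q), (p, q')}" "p \<noteq> p'" "q \<noteq> q'" for p p' q q'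
  unfolding that(1)
  proof (rule K23_right_angle)
    show "\<not> ((p' = Suc p \<or> p = Suc p') \<and> (q' = Suc q \<or> q = Suc q'))"
      using sq[of p q] sq[of p' q] sq[of p q'] sq[of p' q'] unfolding that(1) by (auto simp: square_def)
    have "\<forall>v\<in>{x, y, z}. interior m n v" using assms(3-5) by simp
    then have "interior m n (p, q)" "interior m n (p', q)" "interior m n (p, q')"
      unfolding that(1) by simp_all
    then show "1 < p" "p < m" "1 < p'" "p' < m" "1 < q" "q < n" "1 < q'" "q' < n" by auto
  qed (use that(2,3) in simp_all)
  consider (r) "x1 \<noteq> y1" "x1 \<noteq> z1" "y1 \<noteq> z1" | (c) "x2 \<noteq> y2" "x2 \<noteq> z2" "y2 \<noteq> z2"
    | "x1 = y1" "x2 = z2" | "x1 = y1" "y2 = z2" | "x1 = z1" "x2 = y2" | "x1 = z1" "z2 = y2"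
    | "y1 = z1" "y2 = x2" | "y1 = z1" "z2 = x2"
    using d unfolding xyz prod.inject by argo
  then show ?thesis
  proof cases
    case r
    then show ?thesis unfolding xyz using i mn by (intro K23_rows) auto
  next
    case c
    then show ?thesis unfolding xyz using i mn by (intro K23_columns) auto
  next
    case 3 show ?thesis by (rule L[of x1 x2 z1 y2]) (use d 3 in \<open>simp_all add: xyz insert_commute\<close>)
  next
    case 4 show ?thesis by (rule L[of y1 y2 z1 x2]) (use d 4 in \<open>simp_all add: xyz insert_commute\<close>)
  next
    case 5 show ?thesis by (rule L[of x1 x2 y1 z2]) (use d 5 in \<open>simp_all add: xyz insert_commute\<close>)
  next
    case 6 show ?thesis by (rule L[of z1 z2 y1 x2]) (use d 6 in \<open>simp_all add: xyz insert_commute\<close>)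
  next
    case 7 show ?thesis by (rule L[of y1 y2 x1 z2]) (use d 7 in \<open>simp_all add: xyz insert_commute\<close>)
  next
    case 8 show ?thesis by (rule L[of z1 z2 x1 y2]) (use d 8 in \<open>simp_all add: xyz insert_commute\<close>)
  qed
qed

lemma K23_same_row:
  assumes "1 < p" "p < m" "1 < q" "q < n" "1 < q'" "q' < n" "q \<noteq> q'" "1 < j" "j < n"
    and "p = 2 \<Longrightarrow> \<not> ({j, q, q'} = {j, Suc j} \<or> {j, q, q'} = {j, j - 1})"
  shows "rooted_K23 m n {} {(1, j), (p, q), (p, q')}"
proof -
  have 1: "rooted_K23 m n {} {(1, j), (p, q), (p, q')}"
    if a: "1 < p" "p < m" "1 < q" "q < q'" "q' < n" "1 < j" "j < n" and
     b: "p = 2 \<Longrightarrow> \<not> ({j, q, q'} = {j, Suc j} \<or> {j, q, q'} = {j, j - 1})" for p q q' j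
  proof -
    consider "2 < p" | "p = 2" "q < j" "j < q'" | "p = 2" "j \<le> q" | "p = 2" "q' \<le> j"
      using a by linarith
    then show ?thesis
    proof cases
      case 1
      then show ?thesis using a by (intro K23_T1a) auto
    next
      case 2
      then show ?thesis using a by (simp add: K23_T1b del: One_nat_def)
    next
      case 3
      moreover have "q = j \<longrightarrow> q' \<noteq> Suc j" using b 3 by auto
      ultimately show ?thesis using a by (simp add: K23_T1c del: One_nat_def)
    next
      case 4
      have "q' = j \<longrightarrow> q \<noteq> j - 1" using b 4 by auto
      then have "rooted_K23 m n {} {(1, Suc n - j), (2, Suc n - q'), (2, Suc n - q)}"
        using a 4 by (intro K23_T1c) auto
      then show ?thesis using a 4
        by - (rule rooted_K23_flip2, simp_all add: insert_commute)
    qed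
  qed
  show ?thesis
  proof (cases "q < q'")
    case True
    then show ?thesis using assms by (intro 1) auto
  next
    case False
    then have "rooted_K23 m n {} {(1, j), (p, q'), (p, q)}" using assms
      by (intro 1) (auto simp: insert_commute)
    then show ?thesis by (simp add: insert_commute)
  qed
qed

lemma K23_top:
  assumes mn: "3 \<le> m" "3 \<le> n" and "interior m n x" "interior m n z" "1 \<le> j" "j \<le> n"
    and d: "x \<noteq> z" and sq: "\<And>a b. \<not> {(1, j), x, z} \<subseteq> square a b"
  shows "rooted_K23 m n {} {(1, j), x, z}"
proof -
  obtain x1 x2 z1 z2 where xz: "x = (x1, x2)" "z = (z1, z2)"
    by (cases x; cases z)
  have i: "1 < x1" "x1 < m" "1 < x2" "x2 < n" "1 < z1" "z1 < m" "1 < z2" "z2 < n"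
    using assms by (auto simp: xz)
  show ?thesis
  proof (cases "x1 = z1")
    case False
    then show ?thesis unfolding xz using i mn assms by (intro K23_rows) auto
  next
    case True
    then have ne: "x2 \<noteq> z2" using d by (auto simp: xz)
    show ?thesis
    proof (cases "j = 1 \<or> j = n")
      case True
      then show ?thesis unfolding xz using i mn assms ne by (intro K23_columns) auto
    next
      case False
      have "\<not> ({j, x2, z2} = {j, Suc j} \<or> {j, x2, z2} = {j, j - 1})" if "x1 = 2"
      proof
        assume "{j, x2, z2} = {j, Suc j} \<or> {j, x2, z2} = {j, j - 1}"
        then have "{x2, z2} \<subseteq> {j, Suc j} \<or> {x2, z2} \<subseteq> {j - 1, j}" by blast
        then show False
          using sq[of 1 j] sq[of 1 "j - 1"] that \<open>x1 = z1\<close> False assms(5,6) by (auto simp: xz square_def)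
      qed
      then have "rooted_K23 m n {} {(1, j), (x1, x2), (x1, z2)}"
        using i ne False assms(5,6) by (intro K23_same_row) auto
      then show ?thesis using \<open>x1 = z1\<close> by (simp add: xz)
    qed
  qed
qed

lemma K23_two_top:
  assumes mn: "3 \<le> m" "3 \<le> n" and "interior m n x" "1 \<le> j" "j \<le> n" "1 \<le> j'" "j' \<le> n"
    and d: "j \<noteq> j'" and sq: "\<And>a b. \<not> {(1, j), (1, j'), x} \<subseteq> square a b"
    and cn: "\<not> {j, j'} = {1, 2}" "\<not> {j, j'} = {n - 1, n}"
  shows "rooted_K23 m n {} {(1, j), (1, j'), x}"
proof -
  have 1: "rooted_K23 m n {} {(1, j), (1, j'), x}"
    if a: "interior m n x" "1 \<le> j" "j < j'" "j' \<le> n" and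
      sq: "\<And>a b. \<not> {(1, j), (1, j'), x} \<subseteq> square a b" and
      cn: "\<not> (j = 1 \<and> j' = 2)" "\<not> (j = n - 1 \<and> j' = n)" for x j j'
  proof -
    obtain p q where x: "x = (p, q)" by (cases x)
    have i: "1 < p" "p < m" "1 < q" "q < n" using a by (auto simp: x)
    consider "j < q" "q < j'" | "q \<le> j" | "j' \<le> q" by linarith
    then show ?thesis
    proof cases
      case 1
      then show ?thesis unfolding x using a i by (intro K23_T2a) auto
    next
      case 2
      show ?thesis unfolding x
      proof (rule K23_T2b)
        show "j' = Suc j \<longrightarrow> j' < n \<and> \<not> (p = 2 \<and> q = j)"
          using a cn sq[of 1 j] by (auto simp: x square_def)
      qed (use a i 2 in auto)
    next
      case 3
      have "rooted_K23 m n {} {(1, Suc n - j'), (1, Suc n - j), (p, Suc n - q)}"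
      proof (rule K23_T2b)
        show "Suc n - j = Suc (Suc n - j') \<longrightarrow> Suc n - j < n \<and> \<not> (p = 2 \<and> Suc n - q = Suc n - j')"
          using a i cn sq[of 1 j] by (auto simp: x square_def)
      qed (use a i 3 in auto)
      then show ?thesis unfolding x using a i
        by - (rule rooted_K23_flip2, simp_all add: insert_commute)
    qed
  qed
  show ?thesis
  proof (cases "j < j'")
    case True
    then show ?thesis using assms by (intro 1) auto
  next
    case False
    then have "rooted_K23 m n {} {(1, j'), (1, j), x}" using assms
      by (intro 1) (auto simp: insert_commute)
    then show ?thesis by (simp add: insert_commute)
  qed
qed

text \<open>Cells left of column \<open>j\<close>, or by transposition above row \<open>i\<close>,
  are served by \<open>K23_T3a\<close>; the others lie below and to the right, where the inner angle
  fits. What remains is \<open>(2, 2)\<close> with \<open>(1, 2)\<close> and \<open>(2, 1)\<close>,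
  a square.\<close>

lemma K23_top_left:
  assumes "interior m n x" "1 < j" "j < n" "1 < i" "i < m"
    and sq: "\<And>a b. \<not> {(1, j), (i, 1), x} \<subseteq> square a b"
  shows "rooted_K23 m n {} {(1, j), (i, 1), x}"
proof -
  obtain p q where x: "x = (p, q)" by (cases x)
  have pq: "1 < p" "p < m" "1 < q" "q < n" using assms by (auto simp: x)
  have T: "rooted_K23 m n {} {(1, j), (i, 1), (p, q)}" if "rooted_K23 n m {} {(1, i), (j, 1), (q, p)}"
    using that assms pq by - (rule rooted_K23_transpose, simp_all add: insert_commute)
  consider "q < j" | "p < i" | "j \<le> q" "i \<le> p" "2 < p" "2 < q" | "j \<le> q" "i \<le> p" "p = 2" "2 < q"
    | "j \<le> q" "i \<le> p" "q = 2" "2 < p" | "j \<le> q" "i \<le> p" "q = 2" "p = 2"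
    using pq by linarith
  then show ?thesis unfolding x
  proof cases
    case 1
    then show "rooted_K23 m n {} {(1, j), (i, 1), (p, q)}" using assms pq by (intro K23_T3a) auto
  next
    case 2
    then show "rooted_K23 m n {} {(1, j), (i, 1), (p, q)}" using assms pq
      by (intro T K23_T3a) auto
  next
    case 3
    then show "rooted_K23 m n {} {(1, j), (i, 1), (p, q)}" using assms pq
      by (intro rooted_K23_antimono[OF K23_T3b]) auto
  next
    case 4
    then have "i = 2" using assms by simp
    then show "rooted_K23 m n {} {(1, j), (i, 1), (p, q)}" using assms pq 4 \<open>i = 2\<close>
      by (simp add: rooted_K23_antimono[OF K23_T3c] del: One_nat_def)
  next
    case 5
    then have "j = 2" using assms by simp
    then show "rooted_K23 m n {} {(1, j), (i, 1), (p, q)}" using assms pq 5 \<open>j = 2\<close>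
      by (intro T) (simp add: rooted_K23_antimono[OF K23_T3c] del: One_nat_def)
  next
    case 6
    then show "rooted_K23 m n {} {(1, j), (i, 1), (p, q)}"
      using sq[of 1 1] assms by (auto simp: x square_def)
  qed
qed

text \<open>For a corner that is itself one of the given cells or must stay free: its two neighbours
  and \<open>x\<close> are joined without it.\<close>

lemma K23_near_corner:
  assumes "interior m n x" "x \<noteq> (2, 2)"
  shows "rooted_K23 m n {(1, 1)} {(1, 2), (2, 1), x}"
proof -
  obtain p q where x: "x = (p, q)" by (cases x)
  have pq: "1 < p" "p < m" "1 < q" "q < n" using assms by (auto simp: x)
  consider "2 < p" "2 < q" | "p = 2" "2 < q" | "q = 2" "2 < p"
    using pq assms by (cases "p = 2"; cases "q = 2") (auto simp: x)
  then show ?thesis unfolding x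
  proof cases
    case 1
    then show "rooted_K23 m n {(1, 1)} {(1, 2), (2, 1), (p, q)}" using pq by (intro K23_T3b) auto
  next
    case 2
    then show "rooted_K23 m n {(1, 1)} {(1, 2), (2, 1), (p, q)}" using pq by (simp add: K23_T3c del: One_nat_def)
  next
    case 3
    then have "rooted_K23 n m {(1, 1)} {(1, 2), (2, 1), (q, p)}" using pq by (simp add: K23_T3c del: One_nat_def)
    then show "rooted_K23 m n {(1, 1)} {(1, 2), (2, 1), (p, q)}" using pq
      by - (rule rooted_K23_transpose, simp_all add: insert_commute)
  qed
qed

text \<open>The exclusions are obstructions, not conveniences. Cells of one square lie on a common
  face. A corner has two neighbours, one for each of the disjoint sets, so neither of them may be a
  root.\<close>

definition K23_triple :: "nat \<Rightarrow> nat \<Rightarrow> nat \<times> nat \<Rightarrow> nat \<times> nat \<Rightarrow> nat \<times> nat \<Rightarrow> bool" where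
  "K23_triple m n x y z \<longleftrightarrow> x \<in> grid m n \<and> y \<in> grid m n \<and> z \<in> grid m n \<and> x \<noteq> y \<and> x \<noteq> z \<and> y \<noteq> z \<and>
     (\<forall>a b. \<not> {x, y, z} \<subseteq> square a b) \<and>
     (\<forall>r\<in>{x, y, z}. \<forall>s\<in>{x, y, z}. corner m n r \<longrightarrow> \<not> grid_adj r s)"

lemma K23_triple_map:
  assumes "K23_triple m n x y z"
    and f: "\<And>v. v \<in> grid m n \<Longrightarrow> f v \<in> grid m' n'" "\<And>v. v \<in> grid m n \<Longrightarrow> g (f v) = v"
    and sq: "\<And>a b. \<exists>a' b'. \<forall>v\<in>grid m n. f v \<in> square a b \<longrightarrow> v \<in> square a' b'"
    and cn: "\<And>v. v \<in> grid m n \<Longrightarrow> corner m' n' (f v) \<Longrightarrow> corner m n v"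
    and ad: "\<And>u v. u \<in> grid m n \<Longrightarrow> v \<in> grid m n \<Longrightarrow> grid_adj (f u) (f v) \<Longrightarrow> grid_adj u v"
  shows "K23_triple m' n' (f x) (f y) (f z)"
proof -
  have t: "x \<in> grid m n" "y \<in> grid m n" "z \<in> grid m n" "x \<noteq> y" "x \<noteq> z" "y \<noteq> z"
    "\<And>a b. \<not> {x, y, z} \<subseteq> square a b"
    "\<And>r s. r \<in> {x, y, z} \<Longrightarrow> s \<in> {x, y, z} \<Longrightarrow> corner m n r \<Longrightarrow> \<not> grid_adj r s"
    using assms(1) unfolding K23_triple_def by blast+
  have n: "f x \<noteq> f y" "f x \<noteq> f z" "f y \<noteq> f z" using t(1-6) f(2) by metis+
  have s: "\<not> {f x, f y, f z} \<subseteq> square a b" for a b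
  proof
    assume "{f x, f y, f z} \<subseteq> square a b"
    moreover obtain a' b' where "\<forall>v\<in>grid m n. f v \<in> square a b \<longrightarrow> v \<in> square a' b'" using sq by blast
    ultimately have "{x, y, z} \<subseteq> square a' b'" using t(1-3) by blast
    then show False using t(7) by blast
  qed
  have c: "\<not> grid_adj r s" if rs: "r \<in> {f x, f y, f z}" "s \<in> {f x, f y, f z}" "corner m' n' r" for r s
  proof -
    obtain r' s' where r: "r' \<in> {x, y, z}" "r = f r'" "s' \<in> {x, y, z}" "s = f s'" using rs by blast
    have "r' \<in> grid m n" "s' \<in> grid m n" using r t(1-3) by blast+
    then show ?thesis using t(8)[OF r(1,3)] cn[of r'] ad[of r' s'] rs(3) r by blast
  qed
  show ?thesis unfolding K23_triple_def using f(1) t(1-3) n s c by blast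
qed

lemma square_flip1: "v \<in> grid m n \<Longrightarrow> flip1 m v \<in> square a b \<Longrightarrow> v \<in> square (m - a) b"
  by (cases v) (simp add: square_def, linarith)
lemma square_flip2: "v \<in> grid m n \<Longrightarrow> flip2 n v \<in> square a b \<Longrightarrow> v \<in> square a (n - b)"
  by (cases v) (simp add: square_def, linarith)
lemma flip1_grid: "v \<in> grid m n \<Longrightarrow> flip1 m v \<in> grid m n" by (cases v) auto
lemma flip2_grid: "v \<in> grid m n \<Longrightarrow> flip2 n v \<in> grid m n" by (cases v) auto
lemma flip1_flip1: "v \<in> grid m n \<Longrightarrow> flip1 m (flip1 m v) = v" by (cases v) auto
lemma flip2_flip2: "v \<in> grid m n \<Longrightarrow> flip2 n (flip2 n v) = v" by (cases v) auto
lemma corner_flip1: "v \<in> grid m n \<Longrightarrow> corner m n (flip1 m v) \<Longrightarrow> corner m n v" by (cases v) auto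
lemma corner_flip2: "v \<in> grid m n \<Longrightarrow> corner m n (flip2 n v) \<Longrightarrow> corner m n v" by (cases v) auto
lemma grid_adj_flip1:
  "u \<in> grid m n \<Longrightarrow> v \<in> grid m n \<Longrightarrow> grid_adj (flip1 m u) (flip1 m v) \<Longrightarrow> grid_adj u v"
  by (cases u; cases v) (auto simp: grid_adj_def)
lemma grid_adj_flip2:
  "u \<in> grid m n \<Longrightarrow> v \<in> grid m n \<Longrightarrow> grid_adj (flip2 n u) (flip2 n v) \<Longrightarrow> grid_adj u v"
  by (cases u; cases v) (auto simp: grid_adj_def)

lemma K23_triple_flip1: "K23_triple m n x y z \<Longrightarrow> K23_triple m n (flip1 m x) (flip1 m y) (flip1 m z)"
  by (rule K23_triple_map[where f = "flip1 m" and g = "flip1 m"])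
    (assumption | blast intro: square_flip1 flip1_grid flip1_flip1 corner_flip1 grid_adj_flip1)+

lemma K23_triple_flip2: "K23_triple m n x y z \<Longrightarrow> K23_triple m n (flip2 n x) (flip2 n y) (flip2 n z)"
  by (rule K23_triple_map[where f = "flip2 n" and g = "flip2 n"])
    (assumption | blast intro: square_flip2 flip2_grid flip2_flip2 corner_flip2 grid_adj_flip2)+

lemma K23_triple_swap: "K23_triple m n x y z \<Longrightarrow> K23_triple n m (prod.swap x) (prod.swap y) (prod.swap z)"
proof (rule K23_triple_map[where f = prod.swap and g = prod.swap])
  show "\<exists>a' b'. \<forall>v\<in>grid m n. prod.swap v \<in> square a b \<longrightarrow> v \<in> square a' b'" for a b
    by (intro exI[of _ b] exI[of _ a]) (auto simp: square_def)
  show "grid_adj (prod.swap u) (prod.swap v) \<Longrightarrow> grid_adj u v" for u v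
    by (cases u; cases v) (auto simp: grid_adj_def)
qed auto

lemma K23_triple_grid: "K23_triple m n x y z \<Longrightarrow> {x, y, z} \<subseteq> grid m n"
  by (simp add: K23_triple_def)

lemma K23_by_flip1:
  assumes "K23_triple m n x y z" "rooted_K23 m n {} {flip1 m x, flip1 m y, flip1 m z}"
  shows "rooted_K23 m n {} {x, y, z}"
  using assms K23_triple_grid[OF assms(1)] by - (rule rooted_K23_flip1, simp_all)

lemma K23_by_flip2:
  assumes "K23_triple m n x y z" "rooted_K23 m n {} {flip2 n x, flip2 n y, flip2 n z}"
  shows "rooted_K23 m n {} {x, y, z}"
  using assms K23_triple_grid[OF assms(1)] by - (rule rooted_K23_flip2, simp_all)

lemma K23_by_swap:
  assumes "K23_triple m n x y z" "rooted_K23 n m {} {prod.swap x, prod.swap y, prod.swap z}"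
  shows "rooted_K23 m n {} {x, y, z}"
  using assms K23_triple_grid[OF assms(1)] by - (rule rooted_K23_transpose, simp_all)

lemma interior_flip1: "v \<in> grid m n \<Longrightarrow> interior m n (flip1 m v) \<longleftrightarrow> interior m n v"
  by (cases v) auto
lemma interior_flip2: "v \<in> grid m n \<Longrightarrow> interior m n (flip2 n v) \<longleftrightarrow> interior m n v"
  by (cases v) auto
lemma interior_swap: "interior n m (prod.swap v) \<longleftrightarrow> interior m n v"
  by (cases v) auto

lemma not_interior_cases:
  assumes "v \<in> grid m n" "\<not> interior m n v"
  obtains "fst v = 1" | "fst v = m" | "snd v = 1" | "snd v = n"
  using assms by (cases v) fastforce

lemma K23_one_ring:
  assumes mn: "3 \<le> m" "3 \<le> n" and t: "K23_triple m n x y z" and i: "interior m n x" "interior m n z"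
    and y: "\<not> interior m n y"
  shows "rooted_K23 m n {} {x, y, z}"
proof -
  have top: "rooted_K23 m n {} {x, y, z}"
    if "3 \<le> m" "3 \<le> n" "K23_triple m n x y z" "interior m n x" "interior m n z" and y: "fst y = 1" for m n x y z
  proof -
    obtain j where "y = (1, j)" using y by (cases y) simp
    moreover have "{(1, j), x, z} = {x, (1, j), z}" by (rule insert_commute)
    ultimately show ?thesis
      using that(3) K23_top[OF that(1,2,4,5), of j] by (simp add: K23_triple_def del: insert_subset One_nat_def)
  qed
  have ver: "rooted_K23 m n {} {x, y, z}"
    if "3 \<le> m" "3 \<le> n" and t: "K23_triple m n x y z" and "interior m n x" "interior m n z" "fst y = 1 \<or> fst y = m" for m n x y z
  proof (cases "fst y = 1")
    case False
    have g: "x \<in> grid m n" "y \<in> grid m n" "z \<in> grid m n" using t by (auto simp: K23_triple_def)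
    have "fst (flip1 m y) = 1" using that(6) False by (cases y) simp
    then show ?thesis
      using that g by (intro K23_by_flip1[OF t] top K23_triple_flip1) (simp_all add: interior_flip1 del: flip1_simp)
  qed (use that top in blast)
  have g: "x \<in> grid m n" "y \<in> grid m n" "z \<in> grid m n" using t by (auto simp: K23_triple_def)
  consider "fst y = 1 \<or> fst y = m" | "snd y = 1 \<or> snd y = n"
    using not_interior_cases[OF g(2) y] by blast
  then show ?thesis
  proof cases
    case 1
    then show ?thesis using ver assms by blast
  next
    case 2
    then show ?thesis
      using mn i by (intro K23_by_swap[OF t] ver K23_triple_swap[OF t]) (simp_all add: interior_swap)
  qed
qed

text \<open>Symmetry brings one boundary cell to the top row. The other is then on the top row, on
  the bottom row (three distinct rows, if the third is interior) or on a side, where reflection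
  leaves only the left one.\<close>

lemma K23_two_ring:
  assumes mn: "3 \<le> m" "3 \<le> n" and t: "K23_triple m n x y z" and i: "interior m n x"
    and yz: "\<not> interior m n y" "\<not> interior m n z"
  shows "rooted_K23 m n {} {x, y, z}"
proof -
  have tt: "rooted_K23 m n {} {x, y, z}"
    if "3 \<le> m" "3 \<le> n" and t: "K23_triple m n x y z" and "interior m n x" and yz: "fst y = 1" "fst z = 1" for m n x y z
  proof -
    obtain j where y: "y = (1, j)" using yz by (cases y) simp
    obtain j' where z: "z = (1, j')" using yz by (cases z) simp
    have g: "y \<in> grid m n" "z \<in> grid m n" "y \<noteq> z" and sq: "\<And>a b. \<not> {x, y, z} \<subseteq> square a b"
      and cn: "\<And>r s. r \<in> {x, y, z} \<Longrightarrow> s \<in> {x, y, z} \<Longrightarrow> corner m n r \<Longrightarrow> \<not> grid_adj r s"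
      using t unfolding K23_triple_def by blast+
    have j: "1 \<le> j" "j \<le> n" "1 \<le> j'" "j' \<le> n" "j \<noteq> j'" using g by (simp_all add: y z)
    have eq: "{(1, j), (1, j'), x} = {x, y, z}" unfolding y z by blast
    have sq': "\<not> {(1, j), (1, j'), x} \<subseteq> square a b" for a b unfolding eq by (rule sq)
    have cn': "corner m n y \<Longrightarrow> \<not> grid_adj y z" "corner m n z \<Longrightarrow> \<not> grid_adj z y"
      using cn by blast+
    have c: "\<not> {j, j'} = {1, 2}" "\<not> {j, j'} = {n - 1, n}"
      using cn' that(1,2) unfolding y z by (auto simp: doubleton_eq_iff grid_adj_def)
    have "rooted_K23 m n {} {(1, j), (1, j'), x}"
      by (rule K23_two_top[OF that(1,2,4) j sq' c])
    then show ?thesis unfolding eq .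
  qed
  have ss: "rooted_K23 m n {} {x, y, z}"
    if "3 \<le> m" "3 \<le> n" and t: "K23_triple m n x y z" and "interior m n x" and yz: "snd y = 1" "snd z = 1" for m n x y z
    using that by (intro K23_by_swap[OF t] tt K23_triple_swap[OF t]) (simp_all add: interior_swap)
  have tl: "rooted_K23 m n {} {x, y, z}"
    if mn: "3 \<le> m" "3 \<le> n" and t: "K23_triple m n x y z" and i: "interior m n x" and yz: "fst y = 1" "snd z = 1" for m n x y z
  proof -
    obtain p q where x: "x = (p, q)" by (cases x)
    obtain j where y: "y = (1, j)" using yz by (cases y) simp
    obtain k where z: "z = (k, 1)" using yz by (cases z) simp
    have t': "1 < p" "p < m" "1 < q" "q < n" "1 \<le> j" "j \<le> n" "1 \<le> k" "k \<le> m"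
      using t i unfolding K23_triple_def x y z by auto
    consider "k = 1" | "k = m" | "j = 1" | "j = n" | "1 < j" "j < n" "1 < k" "k < m" using t' by linarith
    then show ?thesis
    proof cases
      case 1
      then show ?thesis using tt[OF mn t i] y z by simp
    next
      case 2
      have "rooted_K23 m n {} {(p, q), (1, j), (k, 1)}"
        by (rule K23_rows) (use mn t' 2 in auto)
      then show ?thesis unfolding x y z .
    next
      case 3
      then show ?thesis using ss[OF mn t i] y z by simp
    next
      case 4
      have "rooted_K23 m n {} {(p, q), (1, j), (k, 1)}"
        by (rule K23_columns) (use mn t' 4 in auto)
      then show ?thesis unfolding x y z .
    next
      case 5
      have "{x, y, z} = {(1, j), (k, 1), x}" unfolding y z by blast
      then have "\<not> {(1, j), (k, 1), x} \<subseteq> square a b" for a b using t unfolding K23_triple_def by metis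
      then have "rooted_K23 m n {} {(1, j), (k, 1), x}" using 5 i by (intro K23_top_left) auto
      then show ?thesis using \<open>{x, y, z} = _\<close> by simp
    qed
  qed
  have top: "rooted_K23 m n {} {x, y, z}"
    if mn: "3 \<le> m" "3 \<le> n" and t: "K23_triple m n x y z" and i: "interior m n x" and yz: "fst y = 1" "\<not> interior m n z" for m n x y z
  proof -
    have g: "x \<in> grid m n" "y \<in> grid m n" "z \<in> grid m n" using t by (auto simp: K23_triple_def)
    show ?thesis using not_interior_cases[OF g(3) yz(2)]
    proof cases
      case 1
      then show ?thesis using tt that by blast
    next
      case 2
      obtain p q where x: "x = (p, q)" by (cases x)
      obtain j where y: "y = (1, j)" using yz by (cases y) simp
      obtain k where z: "z = (m, k)" using 2 by (cases z) simp
      have "rooted_K23 m n {} {(p, q), (1, j), (m, k)}"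
        by (rule K23_rows) (use mn g i in \<open>auto simp: x y z\<close>)
      then show ?thesis unfolding x y z .
    next
      case 3
      then show ?thesis using tl that by blast
    next
      case 4
      have "snd (flip2 n z) = 1" using 4 by (cases z) simp
      moreover have "fst (flip2 n y) = 1" using yz by (cases y) simp
      ultimately show ?thesis using mn i g
        by (intro K23_by_flip2[OF t] tl K23_triple_flip2[OF t]) (simp_all add: interior_flip2 del: flip2_simp)
    qed
  qed
  have ver: "rooted_K23 m n {} {x, y, z}"
    if mn: "3 \<le> m" "3 \<le> n" and t: "K23_triple m n x y z" and i: "interior m n x"
      and yz: "fst y = 1 \<or> fst y = m" "\<not> interior m n z" for m n x y z
  proof (cases "fst y = 1")
    case False
    have g: "x \<in> grid m n" "y \<in> grid m n" "z \<in> grid m n" using t by (auto simp: K23_triple_def)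
    have "fst (flip1 m y) = 1" using yz(1) False by (cases y) simp
    then show ?thesis
      using mn i yz g by (intro K23_by_flip1[OF t] top K23_triple_flip1[OF t]) (simp_all add: interior_flip1 del: flip1_simp)
  qed (use that top in blast)
  have g: "x \<in> grid m n" "y \<in> grid m n" "z \<in> grid m n" using t by (auto simp: K23_triple_def)
  consider "fst y = 1 \<or> fst y = m" | "snd y = 1 \<or> snd y = n"
    using not_interior_cases[OF g(2) yz(1)] by blast
  then show ?thesis
  proof cases
    case 1
    then show ?thesis using ver assms by blast
  next
    case 2
    then show ?thesis
      using mn i yz by (intro K23_by_swap[OF t] ver K23_triple_swap[OF t]) (simp_all add: interior_swap)
  qed
qed

text \<open>The missing case, all three cells on the boundary, is impossible by planarity and is
  treated by \<open>bridged_ring\<close>.\<close>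

theorem K23_exists:
  assumes mn: "3 \<le> m" "3 \<le> n" and t: "K23_triple m n x y z"
    and i: "interior m n x \<or> interior m n y \<or> interior m n z"
  shows "rooted_K23 m n {} {x, y, z}"
proof -
  have "rooted_K23 m n {} {x, y, z}" if t: "K23_triple m n x y z" and i: "interior m n x" for x y z
  proof -
    have sw: "K23_triple m n x z y" using t unfolding K23_triple_def by (simp add: insert_commute) blast
    have t': "x \<noteq> y" "x \<noteq> z" "y \<noteq> z" "\<And>a b. \<not> {x, y, z} \<subseteq> square a b"
      using t unfolding K23_triple_def by blast+
    consider "interior m n y" "interior m n z" | "\<not> interior m n y" "interior m n z"
      | "interior m n y" "\<not> interior m n z" | "\<not> interior m n y" "\<not> interior m n z" by blast
    then show ?thesis
    proof cases
      case 1
      then show ?thesis using K23_interior[OF mn i] t' by blast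
    next
      case 2
      then show ?thesis using K23_one_ring[OF mn t i] by blast
    next
      case 3
      then show ?thesis using K23_one_ring[OF mn sw i] by (simp add: insert_commute)
    next
      case 4
      then show ?thesis using K23_two_ring[OF mn t i] by blast
    qed
  qed note * = this
  have p: "K23_triple m n y x z" "K23_triple m n z x y"
    using t unfolding K23_triple_def by (simp_all add: insert_commute) blast+
  show ?thesis
    using i *[OF t] *[OF p(1)] *[OF p(2)] by (auto simp: insert_commute)
qed

section \<open>Crossing paths\<close>

text \<open>Think of \<open>x = (i, j)\<close> as the point halfway between rows \<open>i\<close>
  and \<open>i + 1\<close> and just right of column \<open>j\<close>, with a ray going right. A step
  crosses the ray if it is vertical between these rows in a later column. \<open>parity\<close>
  counts crossings modulo 2, the discrete winding number behind the Jordan curve theorem.\<close>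

definition crosses :: "nat \<times> nat \<Rightarrow> nat \<times> nat \<Rightarrow> nat \<times> nat \<Rightarrow> bool" where
  "crosses x s t \<longleftrightarrow> snd s = snd t \<and> snd x < snd s \<and>
     (fst s = fst x \<and> fst t = Suc (fst x) \<or> fst t = fst x \<and> fst s = Suc (fst x))"

fun parity :: "(nat \<Rightarrow> nat \<times> nat) \<Rightarrow> nat \<Rightarrow> nat \<times> nat \<Rightarrow> bool" where
  "parity p 0 x = False"
| "parity p (Suc k) x = (parity p k x \<noteq> crosses x (p k) (p (Suc k)))"

definition row_ray :: "nat \<times> nat \<Rightarrow> (nat \<times> nat) set" where
  "row_ray x = {fst x} \<times> {snd x<..}"

text \<open>Between the two rays lies the strip \<open>row_ray (Suc i, j)\<close>. A walk avoiding
  \<open>(Suc i, j)\<close> enters or leaves it only by a vertical step, which crosses exactly one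
  of the rays; so the parities differ by the change of membership in the strip from start to
  end.\<close>

lemma parity_vertical:
  assumes "\<And>t. t < k \<Longrightarrow> grid_adj (p t) (p (Suc t))" "\<And>t. t \<le> k \<Longrightarrow> p t \<noteq> (Suc i, j)"
  shows "(parity p k (Suc i, j) \<noteq> parity p k (i, j)) = ((p 0 \<in> row_ray (Suc i, j)) \<noteq> (p k \<in> row_ray (Suc i, j)))"
  using assms
proof (induction k)
  case (Suc k)
  have "(crosses (Suc i, j) (p k) (p (Suc k)) \<noteq> crosses (i, j) (p k) (p (Suc k))) =
      ((p k \<in> row_ray (Suc i, j)) \<noteq> (p (Suc k) \<in> row_ray (Suc i, j)))"
    using Suc.prems(1)[of k] Suc.prems(2)[of k] Suc.prems(2)[of "Suc k"]
    by (cases "p k"; cases "p (Suc k)") (auto simp: crosses_def row_ray_def grid_adj_def)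
  then show ?case using Suc by auto
qed simp

text \<open>The rays differ only by the step between \<open>(i, Suc j)\<close> and
  \<open>(Suc i, Suc j)\<close>, which uses both cells.\<close>

lemma parity_horizontal:
  assumes "(\<forall>t\<le>k. p t \<noteq> (i, Suc j)) \<or> (\<forall>t\<le>k. p t \<noteq> (Suc i, Suc j))"
  shows "parity p k (i, Suc j) = parity p k (i, j)"
  using assms
proof (induction k)
  case (Suc k)
  have "crosses (i, Suc j) (p k) (p (Suc k)) = crosses (i, j) (p k) (p (Suc k))"
  proof -
    have "p k \<noteq> (i, Suc j) \<and> p (Suc k) \<noteq> (i, Suc j) \<or> p k \<noteq> (Suc i, Suc j) \<and> p (Suc k) \<noteq> (Suc i, Suc j)"
      using Suc.prems le_Suc_eq by blast
    then show ?thesis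
      by (cases "p k"; cases "p (Suc k)") (auto simp: crosses_def)
  qed
  moreover have "parity p k (i, Suc j) = parity p k (i, j)"
    using Suc.prems by (intro Suc.IH) auto
  ultimately show ?case by simp
qed simp

text \<open>From column 0 the ray spans the whole width, so it is crossed exactly when the walk
  changes sides.\<close>

lemma parity_column0:
  assumes "\<And>t. t < k \<Longrightarrow> grid_adj (p t) (p (Suc t))" "\<And>t. t \<le> k \<Longrightarrow> snd (p t) \<ge> 1"
  shows "parity p k (i, 0) = ((fst (p 0) \<le> i) \<noteq> (fst (p k) \<le> i))"
  using assms
proof (induction k)
  case (Suc k)
  have "crosses (i, 0) (p k) (p (Suc k)) = ((fst (p k) \<le> i) \<noteq> (fst (p (Suc k)) \<le> i))"
    using Suc.prems(1)[of k] Suc.prems(2)[of k] Suc.prems(2)[of "Suc k"]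
    by (cases "p k"; cases "p (Suc k)") (auto simp: crosses_def grid_adj_def)
  then show ?case using Suc by auto
qed simp

lemma parity_outside:
  assumes "\<And>t. t \<le> k \<Longrightarrow> p t \<in> grid m n" "i = 0 \<or> i = m \<or> j = n"
  shows "\<not> parity p k (i, j)"
  using assms
proof (induction k)
  case (Suc k)
  have "\<not> crosses (i, j) (p k) (p (Suc k))"
    using Suc.prems(1)[of k] Suc.prems(1)[of "Suc k"] Suc.prems(2)
    by (cases "p k"; cases "p (Suc k)") (auto simp: crosses_def)
  then show ?case using Suc by auto
qed simp

lemma conn_walk:
  assumes "conn U" "a \<in> U" "u \<in> U"
  obtains p k where "p 0 = a" "p k = u" "\<And>t. t < k \<Longrightarrow> grid_adj (p t) (p (Suc t))" "\<And>t. t \<le> k \<Longrightarrow> p t \<in> U"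
proof -
  obtain k where "(a, u) \<in> (step_in U) ^^ k"
    using rtrancl_imp_relpow[OF connD[OF assms]] by blast
  then obtain p where p: "p 0 = a" "p k = u" "\<And>t. t < k \<Longrightarrow> (p t, p (Suc t)) \<in> step_in U"
    unfolding relpow_fun_conv by blast
  have "p t \<in> U" if "t \<le> k" for t
  proof (cases "t = k")
    case False
    then show ?thesis using p(3)[of t] that by (simp add: step_in_def)
  qed (use p assms in simp)
  with p that show ?thesis by (auto simp: step_in_def)
qed

lemma conn_invariant:
  assumes V: "conn V" "b \<in> V" "c \<in> V"
    and v: "\<And>i j. (i, j) \<in> V \<Longrightarrow> (Suc i, j) \<in> V \<Longrightarrow> P (Suc i, j) = (P (i, j) :: bool)"
    and h: "\<And>i j. (i, j) \<in> V \<Longrightarrow> (i, Suc j) \<in> V \<Longrightarrow> P (i, Suc j) = P (i, j)"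
  shows "P b = P c"
proof (rule ccontr)
  assume ne: "P b \<noteq> P c"
  have "(P b) = (P b)" "\<not> P c = P b" using ne by simp_all
  from conn_crossing[OF V, of "\<lambda>x. P x = P b", OF this]
  obtain x y where xy: "x \<in> V" "y \<in> V" "grid_adj x y" "P x = P b" "\<not> P y = P b" .
  have "P x = P y"
    using xy(1-3) v h by (cases x; cases y) (auto simp: grid_adj_def)
  then show False using xy by simp
qed

text \<open>The walk from \<open>a\<close> to \<open>u\<close>, closed by the diagonal of the
  square, is a closed curve that separates \<open>b\<close> from \<open>c\<close>; a connected set
  containing both would have to cross it.\<close>

lemma square_crossing:
  assumes V: "conn V" "b \<in> V" "c \<in> V" and U: "conn U" "a \<in> U" "u \<in> U" and d: "U \<inter> V = {}"
    and sq: "a = (i, j) \<and> u = (Suc i, Suc j) \<and> b = (i, Suc j) \<and> c = (Suc i, j) \<or>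
      a = (i, Suc j) \<and> u = (Suc i, j) \<and> b = (i, j) \<and> c = (Suc i, Suc j)"
  shows False
proof -
  obtain p k where p: "p 0 = a" "p k = u" "\<And>t. t < k \<Longrightarrow> grid_adj (p t) (p (Suc t))" "\<And>t. t \<le> k \<Longrightarrow> p t \<in> U"
    using conn_walk[OF U] by blast
  have pV: "p t \<noteq> v" if "t \<le> k" "v \<in> V" for t v using p(4)[OF that(1)] that(2) d by blast
  \<comment> \<open>\<open>D\<close> is the crossing parity of the closing diagonal with the ray of
    \<open>x\<close>. Adding it makes \<open>P\<close> the parity of a closed curve, hence constant
    on the connected set \<open>V\<close>.\<close>
  define D where "D = (\<lambda>x::nat \<times> nat. fst x = i \<and> snd x \<le> j)"
  define P where "P = (\<lambda>x. parity p k x \<noteq> D x)"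
  have "P b = P c"
  proof (rule conn_invariant[OF V])
    fix r q assume 1: "(r, q) \<in> V" "(Suc r, q) \<in> V"
    have "(Suc r, q) \<noteq> a" "(Suc r, q) \<noteq> u" using 1 U d by blast+
    then have "(D (Suc r, q) \<noteq> D (r, q)) = ((a \<in> row_ray (Suc r, q)) \<noteq> (u \<in> row_ray (Suc r, q)))"
      using sq by (auto simp: D_def row_ray_def)
    moreover have "(parity p k (Suc r, q) \<noteq> parity p k (r, q)) = ((a \<in> row_ray (Suc r, q)) \<noteq> (u \<in> row_ray (Suc r, q)))"
      using parity_vertical[of k p r q] p(1-3) pV 1(2) by auto
    ultimately show "P (Suc r, q) = P (r, q)" unfolding P_def by blast
  next
    fix r q assume 1: "(r, q) \<in> V" "(r, Suc q) \<in> V"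
    have "(r, q) \<noteq> a" "(r, q) \<noteq> u" "(r, Suc q) \<noteq> a" "(r, Suc q) \<noteq> u" using 1 U d by blast+
    then have "D (r, Suc q) = D (r, q)" using sq by (auto simp: D_def)
    moreover have "parity p k (r, Suc q) = parity p k (r, q)"
      using parity_horizontal[of k p r q] pV 1(2) by blast
    ultimately show "P (r, Suc q) = P (r, q)" unfolding P_def by blast
  qed
  moreover have "P b \<noteq> P c" using sq
  proof
    assume s: "a = (i, j) \<and> u = (Suc i, Suc j) \<and> b = (i, Suc j) \<and> c = (Suc i, j)"
    have "(parity p k (Suc i, j) \<noteq> parity p k (i, j)) = True"
      using parity_vertical[of k p i j] p(1-3) pV s V by (auto simp: row_ray_def)
    moreover have "parity p k (i, Suc j) = parity p k (i, j)"
      using parity_horizontal[of k p i j] pV s V by blast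
    ultimately show ?thesis using s by (auto simp: P_def D_def)
  next
    assume s: "a = (i, Suc j) \<and> u = (Suc i, j) \<and> b = (i, j) \<and> c = (Suc i, Suc j)"
    have "(parity p k (Suc i, Suc j) \<noteq> parity p k (i, Suc j)) = False"
      using parity_vertical[of k p i "Suc j"] p(1-3) pV s V by (auto simp: row_ray_def)
    moreover have "parity p k (i, Suc j) = parity p k (i, j)"
      using parity_horizontal[of k p i j] pV s V by blast
    ultimately show ?thesis using s by (auto simp: P_def D_def)
  qed
  ultimately show False by blast
qed

definition ring :: "nat \<Rightarrow> nat \<Rightarrow> (nat \<times> nat) set" where
  "ring m n = {v \<in> grid m n. \<not> interior m n v}"

text \<open>Clockwise numbering from \<open>(1, 1)\<close>: top row, right column, bottom row, left
  column. Some numbers are skipped; only the order matters.\<close>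

definition ring_pos :: "nat \<Rightarrow> nat \<Rightarrow> nat \<times> nat \<Rightarrow> nat" where
  "ring_pos m n = (\<lambda>(i, j). if i = 1 then j else if j = n then n + i else
     if i = m then n + m + (n - j) else n + m + n + (m - i))"

text \<open>Disjoint connected sets cannot interleave on the outer boundary: \<open>b\<close>
  separates \<open>a\<close> from \<open>u\<close> in the boundary order if and only if
  \<open>c\<close> does. The walk from \<open>a\<close> to \<open>u\<close> is closed outside the
  grid, and the parity of the closed curve is constant on \<open>V\<close>.\<close>

lemma ring_crossing:
  assumes m: "2 \<le> m" "2 \<le> n"
    and V: "conn V" "b \<in> V" "c \<in> V" and U: "conn U" "a \<in> U" "u \<in> U" and d: "U \<inter> V = {}"
    and UV: "U \<subseteq> grid m n" "V \<subseteq> grid m n" and r: "a \<in> ring m n" "b \<in> ring m n" "c \<in> ring m n" "u \<in> ring m n"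
  defines "\<kappa> \<equiv> ring_pos m n"
  shows "((\<kappa> a < \<kappa> b) \<noteq> (\<kappa> u < \<kappa> b)) = ((\<kappa> a < \<kappa> c) \<noteq> (\<kappa> u < \<kappa> c))"
proof -
  obtain p k where p: "p 0 = a" "p k = u" "\<And>t. t < k \<Longrightarrow> grid_adj (p t) (p (Suc t))" "\<And>t. t \<le> k \<Longrightarrow> p t \<in> U"
    using conn_walk[OF U] by blast
  have pV: "p t \<noteq> v" if "t \<le> k" "v \<in> V" for t v using p(4)[OF that(1)] that(2) d by blast
  have pg: "p t \<in> grid m n" if "t \<le> k" for t using p(4)[OF that] UV by blast
  \<comment> \<open>Crossing parity of the ray of \<open>x\<close> with an arc that leaves the grid
    at the boundary cell \<open>q\<close>: upwards, to the right and then down, downwards, or to the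
    left.\<close>
  define \<phi> where "\<phi> = (\<lambda>q x::nat \<times> nat. if fst q = 1 then False else if snd q = n then fst q \<le> fst x
    else if fst q = m then fst x = m \<and> snd x < snd q else False)"
  define P where "P = (\<lambda>x. parity p k x \<noteq> (\<phi> a x \<noteq> \<phi> u x))"
  have au: "a \<in> grid m n" "u \<in> grid m n" using U UV by blast+
  have "P b = P c"
  proof (rule conn_invariant[OF V])
    fix s q assume 1: "(s, q) \<in> V" "(Suc s, q) \<in> V"
    have *: "(\<phi> x (Suc s, q) \<noteq> \<phi> x (s, q)) = (x \<in> row_ray (Suc s, q))" if x: "x \<in> ring m n" "x \<in> U" for x
    proof -
      have "(Suc s, q) \<noteq> x" "(s, q) \<noteq> x" using 1 x d by blast+
      moreover have "1 \<le> s" "Suc s \<le> m" "1 \<le> q" "q \<le> n" using 1 UV by auto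
      ultimately show ?thesis using x(1)
        by (cases x) (auto simp: \<phi>_def row_ray_def ring_def)
    qed
    have "(parity p k (Suc s, q) \<noteq> parity p k (s, q)) = ((a \<in> row_ray (Suc s, q)) \<noteq> (u \<in> row_ray (Suc s, q)))"
      using parity_vertical[of k p s q] p(1-3) pV 1(2) by auto
    then show "P (Suc s, q) = P (s, q)" unfolding P_def using *[OF r(1) U(2)] *[OF r(4) U(3)] by blast
  next
    fix s q assume 1: "(s, q) \<in> V" "(s, Suc q) \<in> V"
    have *: "\<phi> x (s, Suc q) = \<phi> x (s, q)" if x: "x \<in> ring m n" "x \<in> U" for x
    proof -
      have "(s, Suc q) \<noteq> x" "(s, q) \<noteq> x" using 1 x d by blast+
      moreover have "1 \<le> s" "s \<le> m" "1 \<le> q" "Suc q \<le> n" using 1 UV by auto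
      ultimately show ?thesis using x(1)
        by (cases x) (auto simp: \<phi>_def ring_def)
    qed
    have "parity p k (s, Suc q) = parity p k (s, q)"
      using parity_horizontal[of k p s q] pV 1(2) by blast
    then show "P (s, Suc q) = P (s, q)" unfolding P_def using *[OF r(1) U(2)] *[OF r(4) U(3)] by blast
  qed
  moreover have "P x = (((\<kappa> a < \<kappa> x) \<noteq> (\<kappa> u < \<kappa> x)) \<noteq> ((fst a = 1) \<noteq> (fst u = 1)))"
    if x: "x \<in> V" "x \<in> ring m n" for x
  proof -
    obtain i j where xij: "x = (i, j)" by (cases x)
    \<comment> \<open>On the boundary the parity of the walk alone is explicit: the top row is one
      vertical move away from row 0 outside, on the right column and the bottom row no crossing is
      possible, and on the left column it equals the value at column 0.\<close>
    define \<rho> where "\<rho> = (\<lambda>q::nat \<times> nat. if i = 1 then q \<in> row_ray (1, j) else if j = n \<or> i = m then False else fst q \<le> i)"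
    have ij: "1 \<le> i" "i \<le> m" "1 \<le> j" "j \<le> n" using x UV by (auto simp: xij)
    have "parity p k x = (\<rho> a \<noteq> \<rho> u)"
    proof (cases "i = 1")
      case True
      have "\<not> parity p k (0, j)" using pg by (intro parity_outside[where m = m and n = n]) auto
      then show ?thesis
        using parity_vertical[of k p 0 j] p(1-3) pV x(1) True by (auto simp: \<rho>_def xij)
    next
      case False
      show ?thesis
      proof (cases "j = n \<or> i = m")
        case True
        then have "\<not> parity p k (i, j)" using pg by (intro parity_outside[where m = m and n = n]) auto
        then show ?thesis using True False by (simp add: \<rho>_def xij)
      next
        case F: False
        then have j: "j = 1" using x(2) False ij by (auto simp: xij ring_def)
        have "parity p k (i, Suc 0) = parity p k (i, 0)"
          using pV x(1) j by (intro parity_horizontal) (auto simp: xij)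
        also have "\<dots> = ((fst (p 0) \<le> i) \<noteq> (fst (p k) \<le> i))"
        proof (rule parity_column0)
          show "1 \<le> snd (p t)" if "t \<le> k" for t using pg[OF that] by (cases "p t") simp
        qed (rule p(3))
        finally show ?thesis using F False p(1,2) j by (simp add: \<rho>_def xij)
      qed
    qed
    moreover have *: "(\<rho> q \<noteq> \<phi> q x) = ((\<kappa> q < \<kappa> x) \<noteq> ((i \<noteq> 1 \<and> i \<noteq> m \<and> j \<noteq> n) \<noteq> (fst q = 1)))"
      if q: "q \<in> ring m n" "q \<noteq> x" for q
    proof -
      obtain s t where q': "q = (s, t)" by (cases q)
      have st: "1 \<le> s" "s \<le> m" "1 \<le> t" "t \<le> n" "s = 1 \<or> s = m \<or> t = 1 \<or> t = n" using q by (auto simp: q' ring_def)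
      have ir: "i = 1 \<or> i = m \<or> j = 1 \<or> j = n" using x(2) ij by (auto simp: xij ring_def)
      consider "s = 1" | "s \<noteq> 1" "t = n" | "s = m" "s \<noteq> 1" "t \<noteq> n" | "t = 1" "s \<noteq> 1" "s \<noteq> m" "t \<noteq> n" using st by blast
      then show ?thesis
        by cases (use q ij ir st m in \<open>auto simp: \<rho>_def \<phi>_def \<kappa>_def ring_pos_def row_ray_def xij q'\<close>)
    qed
    moreover have ax: "a \<noteq> x" "u \<noteq> x" using x U d by blast+
    ultimately show ?thesis unfolding P_def using *[OF r(1) ax(1)] *[OF r(4) ax(2)] by argo
  qed
  ultimately show ?thesis using V r by blast
qed

section \<open>Merging equivalent rows and columns\<close>

text \<open>A row of \<open>R\<close> is a class by itself and a maximal run of other rows is one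
  class; \<open>f\<close> numbers the classes from 1.\<close>

definition classmap :: "nat \<Rightarrow> nat set \<Rightarrow> (nat \<Rightarrow> nat) \<Rightarrow> bool" where
  "classmap m R f \<longleftrightarrow> f 1 = 1 \<and>
     (\<forall>i. 1 \<le> i \<and> i < m \<longrightarrow> f (Suc i) = (if i \<in> R \<or> Suc i \<in> R then Suc (f i) else f i))"

lemma classmap_mono:
  assumes "classmap m R f" "1 \<le> i" "i \<le> j" "j \<le> m"
  shows "f i \<le> f j"
  using assms(3,4)
proof (induction j rule: dec_induct)
  case (step k)
  then have "f k \<le> f (Suc k)" using assms by (simp add: classmap_def)
  with step show ?case by simp
qed simp

lemma classmap_step: "classmap m R f \<Longrightarrow> 1 \<le> i \<Longrightarrow> i < m \<Longrightarrow> f (Suc i) = f i \<or> f (Suc i) = Suc (f i)"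
  by (simp add: classmap_def)

lemma classmap_special:
  assumes c: "classmap m R f" and r: "r \<in> R" "1 \<le> r" "r \<le> m" and i: "1 \<le> i" "i \<le> m" "f i = f r"
  shows "i = r"
proof (rule ccontr)
  assume "i \<noteq> r"
  then consider "i < r" | "r < i" by linarith
  then show False
  proof cases
    case 1
    then obtain q where q: "r = Suc q" using i by (cases r) auto
    then have "f r = Suc (f q)" using c r i 1 unfolding classmap_def by simp
    moreover have "f i \<le> f q" using 1 i r q by (intro classmap_mono[OF c]) auto
    ultimately show False using i by simp
  next
    case 2
    then have "f (Suc r) = Suc (f r)" using c r i unfolding classmap_def by simp
    moreover have "f (Suc r) \<le> f i" using 2 i r by (intro classmap_mono[OF c]) auto
    ultimately show False using i by simp
  qed
qed

lemma classmap_special_less: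
  assumes c: "classmap m R f" and r: "r \<in> R" "1 \<le> r" "r \<le> m" and i: "1 \<le> i" "i \<le> m"
  shows "f i < f r \<longleftrightarrow> i < r" "f r < f i \<longleftrightarrow> r < i"
  using classmap_special[OF c r i] classmap_mono[OF c, of i r] classmap_mono[OF c, of r i] r i
  by (metis le_less linorder_not_less)+

lemma classmap_special_Suc:
  assumes c: "classmap m R f" and r: "r \<in> R" "1 \<le> r" "r \<le> m" and s: "s \<in> R" "1 \<le> s" "s \<le> m"
  shows "f s = Suc (f r) \<longleftrightarrow> s = Suc r"
proof
  assume a: "f s = Suc (f r)"
  then have "r < s" using classmap_special_less(2)[OF c r s(2,3)] by simp
  then have "f (Suc r) = f s" using c r s a unfolding classmap_def by simp
  then show "s = Suc r" using classmap_special[OF c s, of "Suc r"] \<open>r < s\<close> s by simp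
next
  assume "s = Suc r"
  then show "f s = Suc (f r)" using c r s unfolding classmap_def by simp
qed

lemma classmap_jump:
  assumes c: "classmap m R f" and m: "1 \<le> m" and "1 \<le> k" "k < f m"
  obtains i where "1 \<le> i" "i < m" "f i = k" "f (Suc i) = Suc k"
proof -
  have "1 \<le> i \<Longrightarrow> i \<le> m \<Longrightarrow> k < f i \<Longrightarrow> \<exists>i'. 1 \<le> i' \<and> i' < i \<and> f i' = k \<and> f (Suc i') = Suc k" for i
  proof (induction i rule: dec_induct)
    case base
    then show ?case using c assms by (simp add: classmap_def)
  next
    case (step i)
    show ?case
    proof (cases "k < f i")
      case True
      then show ?thesis using step by force
    next
      case False
      then show ?thesis using classmap_step[OF c, of i] step by (intro exI[of _ i]) auto
    qed
  qed
  from this[of m] m assms(4) that show ?thesis by blast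
qed

lemma classmap_onto:
  assumes c: "classmap m R f" "1 \<le> m" and k: "1 \<le> k" "k \<le> f m"
  obtains i where "1 \<le> i" "i \<le> m" "f i = k"
proof (cases "k = f m")
  case True
  then show ?thesis using that[of m] assms by simp
next
  case False
  then show ?thesis using classmap_jump[OF c k(1)] k that
    by (metis less_imp_le nless_le)
qed

lemma classmap_range:
  assumes c: "classmap m R f" "1 \<le> i" "i \<le> m"
  shows "1 \<le> f i" "f i \<le> f m"
  using classmap_mono[OF c(1), of 1 i] classmap_mono[OF c(1), of i m] assms
  by (auto simp: classmap_def)

lemma classmap_interval:
  assumes c: "classmap m R f" "1 \<le> m" and k: "1 \<le> k" "k \<le> f m"
  obtains l u where "l \<le> u" "{i \<in> {1..m}. f i = k} = {l..u}"
proof -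
  let ?K = "{i \<in> {1..m}. f i = k}"
  obtain i where "1 \<le> i" "i \<le> m" "f i = k" using classmap_onto[OF assms] .
  then have ne: "?K \<noteq> {}" "finite ?K" by auto
  define l where "l = Min ?K"
  define u where "u = Max ?K"
  have "l \<in> ?K" "u \<in> ?K" unfolding l_def u_def using ne by (rule Min_in[rotated] Max_in[rotated])+
  then have lu: "1 \<le> l" "f l = k" "u \<le> m" "f u = k" by auto
  have "?K = {l..u}"
  proof
    show "?K \<subseteq> {l..u}" unfolding l_def u_def using ne by auto
    show "{l..u} \<subseteq> ?K"
    proof
      fix i assume "i \<in> {l..u}"
      then have "f l \<le> f i" "f i \<le> f u" "1 \<le> i" "i \<le> m"
        using lu classmap_mono[OF c(1), of l i] classmap_mono[OF c(1), of i u] by auto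
      then show "i \<in> ?K" using lu by auto
    qed
  qed
  moreover have "l \<le> u" unfolding l_def u_def using ne by (meson Max_ge Min_in)
  ultimately show ?thesis using that by metis
qed

text \<open>The sets \<open>S\<close> and \<open>T\<close> are two alternative bridges between \<open>b\<close> and \<open>c\<close>; each of them
  leaves the other one connected to \<open>a\<close>.\<close>

lemma two_bridges_comp:
  assumes U: "conn (G - V)" and bc: "b \<in> B" "c \<in> B" "B \<subseteq> V" and a: "a \<in> A" "a \<notin> V"
    and sub: "A \<subseteq> G" "B \<subseteq> G" "S \<subseteq> G - (A \<union> B)" "T \<subseteq> G - (A \<union> B)"
    and ST: "S \<inter> T = {}" "A \<inter> B = {}"
    and cn: "conn (S \<union> B)" "conn (T \<union> B)" "conn (S \<union> A)" "conn (T \<union> A)"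
  shows "S \<union> B \<subseteq> G" "T \<union> B \<subseteq> G" "a \<in> G - (S \<union> B)" "a \<in> G - (T \<union> B)"
    and "{b, c} \<subseteq> G - comp (G - (S \<union> B)) a" "{b, c} \<subseteq> G - comp (G - (T \<union> B)) a"
    and "a \<notin> G - comp (G - (S \<union> B)) a" "a \<notin> G - comp (G - (T \<union> B)) a"
    and "(G - comp (G - (S \<union> B)) a) \<inter> (G - comp (G - (T \<union> B)) a) \<subseteq> V"
proof -
  define D where "D = (\<lambda>X. comp (G - (X \<union> B)) a)"
  show SB: "S \<union> B \<subseteq> G" "T \<union> B \<subseteq> G" using sub by blast+
  show aX: "a \<in> G - (S \<union> B)" "a \<in> G - (T \<union> B)" using sub a ST by blast+
  have DX: "D S \<subseteq> G - (S \<union> B)" "D T \<subseteq> G - (T \<union> B)"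
    unfolding D_def using comp_subset[OF aX(1)] comp_subset[OF aX(2)] .
  have aD: "a \<in> D X" for X unfolding D_def by (rule comp_self)
  have bD: "{b, c} \<subseteq> G - D S" "{b, c} \<subseteq> G - D T" "a \<notin> G - D S" "a \<notin> G - D T"
    using DX bc sub aD by blast+
  then show "{b, c} \<subseteq> G - comp (G - (S \<union> B)) a" "{b, c} \<subseteq> G - comp (G - (T \<union> B)) a"
    "a \<notin> G - comp (G - (S \<union> B)) a" "a \<notin> G - comp (G - (T \<union> B)) a"
    unfolding D_def by blast+
  have inD: "Y \<subseteq> D X" if "Y \<union> A \<subseteq> G - (X \<union> B)" "conn (Y \<union> A)" for X Y
  proof -
    have "a \<in> Y \<union> A" using a by blast
    then have "Y \<union> A \<subseteq> D X" unfolding D_def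
      by (rule comp_conn_subset[OF that(2,1)]) (rule comp_self)
    then show ?thesis by blast
  qed
  have "T \<union> A \<subseteq> G - (S \<union> B)" "S \<union> A \<subseteq> G - (T \<union> B)" using sub ST by blast+
  then have TS: "T \<subseteq> D S" "S \<subseteq> D T" using inD cn by blast+
  \<comment> \<open>A cell \<open>x\<close> outside \<open>V\<close> is joined to \<open>a\<close>
    by a walk outside \<open>V\<close>. Where this walk leaves \<open>D S \<union> D T\<close>, the
    next cell avoids \<open>S\<close> and \<open>T\<close>, which lie in \<open>D T\<close> and
    \<open>D S\<close>, and avoids \<open>B\<close>, which lies in \<open>V\<close>; so it still
    belongs to the component just left.\<close>
  have "(G - D S) \<inter> (G - D T) \<subseteq> V"
  proof
    fix x assume x: "x \<in> (G - D S) \<inter> (G - D T)"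
    show "x \<in> V"
    proof (rule ccontr)
      assume "x \<notin> V"
      then have xU: "x \<in> G - V" using x by blast
      have aU: "a \<in> G - V" using a sub by blast
      have 1: "a \<in> D S \<union> D T" using aD by blast
      have 2: "\<not> x \<in> D S \<union> D T" using x by blast
      obtain u v where uv: "u \<in> G - V" "v \<in> G - V" "grid_adj u v"
        "u \<in> D S \<union> D T" "\<not> v \<in> D S \<union> D T"
        by (rule conn_crossing[of "G - V" a x "\<lambda>z. z \<in> D S \<union> D T", OF U aU xU 1 2])
      have v: "v \<in> G - (S \<union> B)" "v \<in> G - (T \<union> B)" using uv TS bc by blast+
      have "u \<in> D S \<Longrightarrow> v \<in> D S" "u \<in> D T \<Longrightarrow> v \<in> D T"
        unfolding D_def
        using comp_step[of u _ a v] v uv(3) DX[unfolded D_def] by blast+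
      then show False using uv(4,5) by blast
    qed
  qed
  then show "(G - comp (G - (S \<union> B)) a) \<inter> (G - comp (G - (T \<union> B)) a) \<subseteq> V"
    unfolding D_def .
qed

locale classes =
  fixes m n :: nat and R C :: "nat set" and f g :: "nat \<Rightarrow> nat"
  assumes m3: "3 \<le> m" and n3: "3 \<le> n"
    and f: "classmap m R f" and g: "classmap n C g"
    and R: "{1, 2, m - 1, m} \<subseteq> R" and C: "{1, 2, n - 1, n} \<subseteq> C"
begin

definition h :: "nat \<times> nat \<Rightarrow> nat \<times> nat" where
  "h = (\<lambda>(i, j). (f i, g j))"

definition lift :: "(nat \<times> nat) set \<Rightarrow> (nat \<times> nat) set" where
  "lift X = {v \<in> grid m n. h v \<in> X}"

text \<open>Saturated sets are unions of merged blocks, that is, the sets of the form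
  \<open>lift X\<close>.\<close>

definition sat :: "(nat \<times> nat) set \<Rightarrow> bool" where
  "sat S \<longleftrightarrow> S \<subseteq> grid m n \<and> (\<forall>u\<in>S. \<forall>v\<in>grid m n. h v = h u \<longrightarrow> v \<in> S)"

lemma h_simp [simp]: "h (i, j) = (f i, g j)"
  by (simp add: h_def)

lemma h_grid: "v \<in> grid m n \<Longrightarrow> h v \<in> grid (f m) (g n)"
  using classmap_range[OF f] classmap_range[OF g] by (cases v) auto

lemma h_onto:
  assumes "x \<in> grid (f m) (g n)" obtains v where "v \<in> grid m n" "h v = x"
proof -
  obtain k l where x: "x = (k, l)" by (cases x)
  obtain i where "1 \<le> i" "i \<le> m" "f i = k"
    by (rule classmap_onto[OF f, of k]) (use assms m3 x in auto)
  moreover obtain j where "1 \<le> j" "j \<le> n" "g j = l"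
    by (rule classmap_onto[OF g, of l]) (use assms n3 x in auto)
  ultimately show ?thesis using that[of "(i, j)"] x by simp
qed

lemma h_adj:
  assumes "u \<in> grid m n" "v \<in> grid m n" "grid_adj u v"
  shows "h u = h v \<or> grid_adj (h u) (h v)"
proof -
  obtain i j i' j' where uv: "u = (i, j)" "v = (i', j')" by (cases u; cases v)
  from assms(3) consider "i = i'" "j' = Suc j" | "i = i'" "j = Suc j'" | "j = j'" "i' = Suc i" | "j = j'" "i = Suc i'"
    by (auto simp: uv grid_adj_def)
  then show ?thesis
    by cases (use assms classmap_step[OF f, of i] classmap_step[OF f, of i'] classmap_step[OF g, of j]
        classmap_step[OF g, of j'] in \<open>auto simp: uv grid_adj_def\<close>)
qed

lemma conn_block:
  assumes "x \<in> grid (f m) (g n)" shows "conn (lift {x})"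
proof -
  obtain k l where x: "x = (k, l)" by (cases x)
  obtain a b where ab: "a \<le> b" "{i \<in> {1..m}. f i = k} = {a..b}"
    by (rule classmap_interval[OF f, of k]) (use assms m3 x in auto)
  obtain c d where cd: "c \<le> d" "{j \<in> {1..n}. g j = l} = {c..d}"
    by (rule classmap_interval[OF g, of l]) (use assms n3 x in auto)
  have "lift {x} = {i \<in> {1..m}. f i = k} \<times> {j \<in> {1..n}. g j = l}"
    by (auto simp: lift_def x)
  then show ?thesis unfolding ab cd using conn_box[OF ab(1) cd(1)] by simp
qed

lemma h_adj_lift:
  assumes "x \<in> grid (f m) (g n)" "y \<in> grid (f m) (g n)" "grid_adj x y"
  obtains u v where "u \<in> lift {x}" "v \<in> lift {y}" "grid_adj u v"
proof -
  have vert: "\<exists>u\<in>lift {(k, l)}. \<exists>v\<in>lift {(Suc k, l)}. grid_adj u v"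
    if kl: "(k, l) \<in> grid (f m) (g n)" "(Suc k, l) \<in> grid (f m) (g n)" for k l
  proof -
    obtain i where i: "1 \<le> i" "i < m" "f i = k" "f (Suc i) = Suc k"
      by (rule classmap_jump[OF f, of k]) (use kl m3 in auto)
    obtain j where j: "1 \<le> j" "j \<le> n" "g j = l"
      by (rule classmap_onto[OF g, of l]) (use kl n3 in auto)
    show ?thesis using i j
      by (intro bexI[of _ "(i, j)"] bexI[of _ "(Suc i, j)"]) (auto simp: lift_def grid_adj_def)
  qed
  have hor: "\<exists>u\<in>lift {(k, l)}. \<exists>v\<in>lift {(k, Suc l)}. grid_adj u v"
    if kl: "(k, l) \<in> grid (f m) (g n)" "(k, Suc l) \<in> grid (f m) (g n)" for k l
  proof -
    obtain i where i: "1 \<le> i" "i \<le> m" "f i = k"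
      by (rule classmap_onto[OF f, of k]) (use kl m3 in auto)
    obtain j where j: "1 \<le> j" "j < n" "g j = l" "g (Suc j) = Suc l"
      by (rule classmap_jump[OF g, of l]) (use kl n3 in auto)
    show ?thesis using i j
      by (intro bexI[of _ "(i, j)"] bexI[of _ "(i, Suc j)"]) (auto simp: lift_def grid_adj_def)
  qed
  obtain k l k' l' where xy: "x = (k, l)" "y = (k', l')" by (cases x; cases y)
  from assms(3) consider "k = k'" "l' = Suc l" | "k = k'" "l = Suc l'" | "l = l'" "k' = Suc k" | "l = l'" "k = Suc k'"
    by (auto simp: xy grid_adj_def)
  then have "\<exists>u\<in>lift {x}. \<exists>v\<in>lift {y}. grid_adj u v"
  proof cases
    case 1 then show ?thesis using hor[of k l] assms xy by simp
  next
    case 2 then show ?thesis using hor[of k l'] assms xy grid_adj_sym by blast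
  next
    case 3 then show ?thesis using vert[of k l] assms xy by simp
  next
    case 4 then show ?thesis using vert[of k' l] assms xy grid_adj_sym by blast
  qed
  then show ?thesis using that by blast
qed

text \<open>Blocks are boxes, and adjacent blocks contain adjacent cells, so a walk in the merged
  grid lifts block by block.\<close>

lemma conn_lift:
  assumes X: "X \<subseteq> grid (f m) (g n)" "conn X"
  shows "conn (lift X)"
proof -
  obtain x0 where x0: "x0 \<in> X" using conn_nonempty[OF X(2)] by blast
  then have "x0 \<in> grid (f m) (g n)" using X by blast
  then obtain u0 where u0: "u0 \<in> grid m n" "h u0 = x0" by (rule h_onto)
  have sub: "lift {y} \<subseteq> lift X" if "y \<in> X" for y using that by (auto simp: lift_def)
  have blk: "(u, v) \<in> (step_in (lift X))\<^sup>*" if "y \<in> X" "u \<in> lift {y}" "v \<in> lift {y}" for y u v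
    using connD[OF conn_block that(2,3)] X that(1) step_in_mono[OF sub[OF that(1)]] by blast
  have *: "\<forall>v\<in>lift {y}. (u0, v) \<in> (step_in (lift X))\<^sup>*" if "(x0, y) \<in> (step_in X)\<^sup>*" for y
    using that
  proof (induction rule: rtrancl_induct)
    case base
    then show ?case using blk[OF x0, of u0] u0 by (simp add: lift_def)
  next
    case (step y z)
    have yz: "y \<in> X" "z \<in> X" "grid_adj y z" using step.hyps by (auto simp: step_in_def)
    obtain u v where uv: "u \<in> lift {y}" "v \<in> lift {z}" "grid_adj u v"
      using h_adj_lift[of y z] yz X by blast
    have "(u0, u) \<in> (step_in (lift X))\<^sup>*" using step.IH uv by blast
    moreover have "(u, v) \<in> step_in (lift X)" using uv subsetD[OF sub[OF yz(1)]] subsetD[OF sub[OF yz(2)]] by (simp add: step_in_def)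
    ultimately have "(u0, v) \<in> (step_in (lift X))\<^sup>*" by (rule rtrancl_into_rtrancl)
    then show ?case using blk[OF yz(2) uv(2)] by (meson rtrancl_trans)
  qed
  show ?thesis
  proof (rule connI[of u0])
    show "u0 \<in> lift X" using u0 x0 by (simp add: lift_def)
    fix v assume v: "v \<in> lift X"
    then have "v \<in> lift {h v}" "h v \<in> X" by (auto simp: lift_def)
    then show "(u0, v) \<in> (step_in (lift X))\<^sup>*" using * connD[OF X(2) x0] by blast
  qed
qed

lemma sat_lift: "sat (lift X)"
  by (auto simp: sat_def lift_def)

lemma sat_lift_image:
  assumes "sat U" shows "U = lift (h ` U)"
  using assms unfolding sat_def lift_def by blast

lemma bipart_lift:
  assumes "bipart (f m) (g n) X" shows "bipart m n (lift X)"
proof -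
  have "grid m n - lift X = lift (grid (f m) (g n) - X)"
    using h_grid by (auto simp: lift_def simp del: mem_Sigma_iff)
  then show ?thesis
    using assms conn_lift[of X] conn_lift[of "grid (f m) (g n) - X"]
    unfolding bipart_def by (auto simp: lift_def)
qed

text \<open>Together with \<open>bipart_lift\<close> this identifies saturated bipartitions with the
  bipartitions of the merged grid, which is why trying the latter is exhaustive.\<close>

lemma bipart_image:
  assumes "sat U" "bipart m n U" shows "bipart (f m) (g n) (h ` U)"
proof -
  have U: "U \<subseteq> grid m n" "conn U" "conn (grid m n - U)" using assms(2) by (auto simp: bipart_def)
  have c: "conn (h ` S)" if "conn S" "S \<subseteq> grid m n" for S
    using that h_adj by (intro conn_image) blast+
  have "grid (f m) (g n) - h ` U = h ` (grid m n - U)"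
  proof
    show "grid (f m) (g n) - h ` U \<subseteq> h ` (grid m n - U)"
    proof
      fix x assume x: "x \<in> grid (f m) (g n) - h ` U"
      then obtain v where "v \<in> grid m n" "h v = x" using h_onto by blast
      then show "x \<in> h ` (grid m n - U)" using x by blast
    qed
    show "h ` (grid m n - U) \<subseteq> grid (f m) (g n) - h ` U"
    proof
      fix x assume "x \<in> h ` (grid m n - U)"
      then obtain v where v: "v \<in> grid m n" "v \<notin> U" "x = h v" by blast
      have "x \<notin> h ` U"
      proof
        assume "x \<in> h ` U"
        then obtain u where "u \<in> U" "h v = h u" using v(3) by (metis imageE)
        then show False using assms(1) v unfolding sat_def by blast
      qed
      then show "x \<in> grid (f m) (g n) - h ` U" using h_grid[OF v(1)] v(3) by simp
    qed
  qed
  moreover have "h ` U \<subseteq> grid (f m) (g n)" using U h_grid by blast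
  ultimately show ?thesis unfolding bipart_def using c[OF U(2,1)] c[OF U(3)] by simp
qed

text \<open>A block that misses the saturated set \<open>Q\<close> is connected, so a component of
  the complement of \<open>Q\<close> contains all of it or none of it.\<close>

lemma sat_compl_comp:
  assumes Q: "sat Q" and a: "a \<in> grid m n - Q"
  shows "sat (grid m n - comp (grid m n - Q) a)"
  unfolding sat_def
proof (intro conjI ballI impI)
  fix u v assume u: "u \<in> grid m n - comp (grid m n - Q) a" and v: "v \<in> grid m n" "h v = h u"
  have cs: "comp (grid m n - Q) a \<subseteq> grid m n - Q" using comp_subset[OF a] .
  have "v \<notin> comp (grid m n - Q) a"
  proof
    assume vc: "v \<in> comp (grid m n - Q) a"
    then have "v \<notin> Q" using cs by blast
    have "lift {h u} \<subseteq> grid m n - Q"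
    proof
      fix w assume "w \<in> lift {h u}"
      then have w: "w \<in> grid m n" "h w = h u" by (auto simp: lift_def)
      have "w \<notin> Q"
      proof
        assume "w \<in> Q"
        then have "v \<in> Q" using Q v w unfolding sat_def by metis
        then show False using \<open>v \<notin> Q\<close> by simp
      qed
      then show "w \<in> grid m n - Q" using w by simp
    qed
    moreover have "v \<in> lift {h u}" "u \<in> lift {h u}" using u v by (auto simp: lift_def simp del: mem_Sigma_iff)
    moreover have "conn (lift {h u})" using u h_grid by (intro conn_block) blast
    ultimately have "u \<in> comp (grid m n - Q) a" using comp_conn_subset vc by blast
    then show False using u by blast
  qed
  then show "v \<in> grid m n - comp (grid m n - Q) a" using v by blast
qed blast

lemma two_bridges:
  assumes V: "bipart m n V" and bc: "b \<in> B" "c \<in> B" "B \<subseteq> V" and a: "a \<in> A" "a \<notin> V"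
    and sub: "A \<subseteq> grid m n" "B \<subseteq> grid m n" "S \<subseteq> grid m n - (A \<union> B)" "T \<subseteq> grid m n - (A \<union> B)"
    and ST: "S \<inter> T = {}" "A \<inter> B = {}"
    and cn: "conn (S \<union> B)" "conn (T \<union> B)" "conn (S \<union> A)" "conn (T \<union> A)"
    and st: "sat S" "sat T" "sat B"
  obtains V1 V2 where "bipart m n V1" "sat V1" "bipart m n V2" "sat V2" "{b, c} \<subseteq> V1" "{b, c} \<subseteq> V2"
    "a \<notin> V1" "a \<notin> V2" "V1 \<inter> V2 \<subseteq> V"
proof -
  let ?D = "\<lambda>X. grid m n - comp (grid m n - (X \<union> B)) a"
  have U: "conn (grid m n - V)" using V by (simp add: bipart_def)
  note br = two_bridges_comp[OF U bc a sub ST cn]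
  have st': "sat (S \<union> B)" "sat (T \<union> B)" using st unfolding sat_def by blast+
  have "bipart m n (?D S)" "bipart m n (?D T)"
    by (rule bipart_compl_comp; fact cn br)+
  moreover have "sat (?D S)" "sat (?D T)"
    by (rule sat_compl_comp; fact st' br)+
  ultimately show ?thesis using that br(5-9) by meson
qed

end

section \<open>Replacing a bipartition by two saturated ones\<close>

lemma ring_pos_inj:
  assumes "u \<in> ring m n" "v \<in> ring m n" "ring_pos m n u = ring_pos m n v"
  shows "u = v"
proof -
  obtain i j i' j' where uv: "u = (i, j)" "v = (i', j')" by (cases u; cases v)
  have "1 \<le> i" "i \<le> m" "1 \<le> j" "j \<le> n" "i = 1 \<or> i = m \<or> j = 1 \<or> j = n"
    "1 \<le> i'" "i' \<le> m" "1 \<le> j'" "j' \<le> n" "i' = 1 \<or> i' = m \<or> j' = 1 \<or> j' = n"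
    using assms(1,2) by (auto simp: uv ring_def)
  then show ?thesis using assms(3) by (auto simp: uv ring_pos_def split: if_splits)
qed

lemma ring_pos_pos:
  assumes "v \<in> ring m n" shows "1 \<le> ring_pos m n v"
proof -
  obtain i j where v: "v = (i, j)" by (cases v)
  then have "1 \<le> i" "1 \<le> j" "j \<le> n" using assms by (auto simp: ring_def)
  then have "1 \<le> j" "1 \<le> n + i" "1 \<le> n + m + (n - j)" "1 \<le> n + m + n + (m - i)" by linarith+
  then show ?thesis unfolding v ring_pos_def prod.case by presburger
qed

lemma ring_pred:
  assumes m: "2 \<le> m" "2 \<le> n" and v: "v \<in> ring m n" "v \<noteq> (1, 1)"
  obtains u where "u \<in> ring m n" "grid_adj u v" "ring_pos m n u < ring_pos m n v"
    "\<And>w. w \<in> ring m n \<Longrightarrow> ring_pos m n w < ring_pos m n v \<Longrightarrow> ring_pos m n w \<le> ring_pos m n u"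
proof -
  obtain i j where vij: "v = (i, j)" by (cases v)
  have ij: "1 \<le> i" "i \<le> m" "1 \<le> j" "j \<le> n" "i = 1 \<or> i = m \<or> j = 1 \<or> j = n"
    using v(1) by (auto simp: vij ring_def)
  \<comment> \<open>The values of \<open>ring_pos\<close> side by side; \<open>n + 1\<close> and
    \<open>n + m + n\<close> do not occur. Without these gaps the neighbour \<open>u\<close> below
    could not be the immediate predecessor.\<close>
  have w: "ring_pos m n w \<le> n \<or> (\<exists>k. 2 \<le> k \<and> k \<le> m \<and> ring_pos m n w = n + k) \<or>
      (\<exists>k. 1 \<le> k \<and> k < n \<and> ring_pos m n w = n + m + k) \<or>
      (\<exists>k. 1 \<le> k \<and> k + 1 < m \<and> ring_pos m n w = n + m + n + k)" if w: "w \<in> ring m n" for w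
  proof -
    obtain s t where st: "w = (s, t)" by (cases w)
    have b: "1 \<le> s" "s \<le> m" "1 \<le> t" "t \<le> n" "s = 1 \<or> s = m \<or> t = 1 \<or> t = n"
      using w by (auto simp: st ring_def)
    consider "s = 1" | "s \<noteq> 1" "t = n" | "s \<noteq> 1" "t \<noteq> n" "s = m" | "s \<noteq> 1" "t \<noteq> n" "s \<noteq> m" by blast
    then show ?thesis
    proof cases
      case 3
      then have "1 \<le> n - t \<and> n - t < n \<and> ring_pos m n w = n + m + (n - t)"
        using b by (auto simp: st ring_pos_def)
      then show ?thesis by blast
    next
      case 4
      then have "1 \<le> m - s \<and> m - s + 1 < m \<and> ring_pos m n w = n + m + n + (m - s)"
        using b by (auto simp: st ring_pos_def)
      then show ?thesis by blast
    qed (use b in \<open>auto simp: st ring_pos_def\<close>)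
  qed
  define u where "u = (if i = 1 then (1, j - 1) else if j = n then (i - 1, n) else if i = m then (m, Suc j) else (Suc i, 1))"
  have ne: "i = 1 \<Longrightarrow> 2 \<le> j" using v(2) ij by (auto simp: vij)
  have 1: "u \<in> ring m n" "grid_adj u v" "ring_pos m n u < ring_pos m n v"
    using ij ne m by (auto simp: u_def vij ring_def grid_adj_def ring_pos_def)
  have 2: "ring_pos m n x \<le> ring_pos m n u" if x: "x \<in> ring m n" "ring_pos m n x < ring_pos m n v" for x
  proof -
    consider "i = 1" | "i \<noteq> 1" "j = n" | "i \<noteq> 1" "j \<noteq> n" "i = m" | "i \<noteq> 1" "j \<noteq> n" "i \<noteq> m" by blast
    then show ?thesis
    proof cases
      case 1
      then have "ring_pos m n u = j - 1" "ring_pos m n v = j" using ne by (auto simp: u_def vij ring_pos_def)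
      then show ?thesis using x(2) by simp
    next
      case 2
      then have "ring_pos m n u = (if i = 2 then n else n + (i - 1))" "ring_pos m n v = n + i"
        using ij m by (auto simp: u_def vij ring_pos_def)
      then show ?thesis using x(2) w[OF x(1)] 2 ij by (auto split: if_splits)
    next
      case 3
      then have "ring_pos m n u = n + m + (n - Suc j)" "ring_pos m n v = n + m + (n - j)"
        using ij m by (auto simp: u_def vij ring_pos_def)
      then show ?thesis using x(2) w[OF x(1)] 3 ij by auto
    next
      case 4
      then have "ring_pos m n u = (if Suc i = m then n + m + (n - 1) else n + m + n + (m - Suc i))"
         "ring_pos m n v = n + m + n + (m - i)"
        using ij m by (auto simp: u_def vij ring_pos_def)
      then show ?thesis using x(2) w[OF x(1)] 4 ij by (auto split: if_splits)
    qed
  qed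
  show ?thesis using that[OF 1] 2 by blast
qed

lemma conn_ring_segment:
  assumes m: "2 \<le> m" "2 \<le> n" and b: "b \<in> ring m n" "ring_pos m n b \<le> k"
  shows "conn {v \<in> ring m n. ring_pos m n b \<le> ring_pos m n v \<and> ring_pos m n v \<le> k}"
proof (rule conn_rank[of b _ "ring_pos m n"])
  fix v assume v: "v \<in> {v \<in> ring m n. ring_pos m n b \<le> ring_pos m n v \<and> ring_pos m n v \<le> k}" "v \<noteq> b"
  then have "v \<in> ring m n" "ring_pos m n b \<le> ring_pos m n v" by simp_all
  then have lt: "ring_pos m n b < ring_pos m n v"
    using ring_pos_inj[OF b(1), of v] v(2) by (metis le_neq_implies_less)
  have "v \<noteq> (1, 1)"
  proof
    assume "v = (1, 1)"
    then have "ring_pos m n b < 1" using lt by (simp add: ring_pos_def)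
    then show False using ring_pos_pos[OF b(1)] by simp
  qed
  then obtain u where u: "u \<in> ring m n" "grid_adj u v" "ring_pos m n u < ring_pos m n v"
    "ring_pos m n b \<le> ring_pos m n u"
    using ring_pred[OF m, of v] v lt b(1) by blast
  then show "\<exists>u\<in>{v \<in> ring m n. ring_pos m n b \<le> ring_pos m n v \<and> ring_pos m n v \<le> k}.
      grid_adj u v \<and> ring_pos m n u < ring_pos m n v"
    using v by (intro bexI[of _ u]) auto
qed (use b in auto)

context classes
begin

definition special :: "nat \<times> nat \<Rightarrow> bool" where
  "special v \<longleftrightarrow> v \<in> grid m n \<and> fst v \<in> R \<and> snd v \<in> C"

definition bridged :: "(nat \<times> nat) set \<Rightarrow> nat \<times> nat \<Rightarrow> nat \<times> nat \<Rightarrow> nat \<times> nat \<Rightarrow> bool" where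
  "bridged V a b c \<longleftrightarrow> (\<exists>V1 V2. bipart m n V1 \<and> sat V1 \<and> bipart m n V2 \<and> sat V2 \<and>
     {b, c} \<subseteq> V1 \<and> {b, c} \<subseteq> V2 \<and> a \<notin> V1 \<and> a \<notin> V2 \<and> V1 \<inter> V2 \<subseteq> V)"

lemma bridgedI:
  assumes "bipart m n V" "b \<in> B" "c \<in> B" "B \<subseteq> V" "a \<in> A" "a \<notin> V"
    "A \<subseteq> grid m n" "B \<subseteq> grid m n" "S \<subseteq> grid m n - (A \<union> B)" "T \<subseteq> grid m n - (A \<union> B)"
    "S \<inter> T = {}" "A \<inter> B = {}"
    "conn (S \<union> B)" "conn (T \<union> B)" "conn (S \<union> A)" "conn (T \<union> A)" "sat S" "sat T" "sat B"
  shows "bridged V a b c"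
  unfolding bridged_def using two_bridges[OF assms] by metis

lemma bridged_commute: "bridged V a b c \<longleftrightarrow> bridged V a c b"
  unfolding bridged_def by (simp add: insert_commute)

text \<open>If \<open>V\<close> already contains a connected saturated set joining \<open>b\<close>
  and \<open>c\<close>, empty bridges suffice and the two parts coincide.\<close>

lemma bridged_forced:
  assumes V: "bipart m n V" and B: "b \<in> B" "c \<in> B" "B \<subseteq> V" "conn B" "sat B" and a: "a \<in> grid m n" "a \<notin> V"
  shows "bridged V a b c"
proof (rule bridgedI[OF V B(1-3), of a "{a}" "{}" "{}"])
  show "B \<subseteq> grid m n" using B(5) by (simp add: sat_def)
  show "{a} \<inter> B = {}" using a B by blast
  show "conn ({} \<union> {a})" "conn ({} \<union> {a})" using conn_singleton by simp_all
  show "sat {}" "sat {}" by (simp_all add: sat_def)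
qed (use assms in simp_all)

lemma row_special:
  assumes "r \<in> R" "1 \<le> r" "r \<le> m" "1 \<le> i" "i \<le> m" "1 \<le> i'" "i' \<le> m" "f i = f i'"
  shows "i = r \<longleftrightarrow> i' = r" "i < r \<longleftrightarrow> i' < r"
  using classmap_special[OF f assms(1-3)] classmap_special_less[OF f assms(1-3)] assms(4-) by metis+

lemma column_special:
  assumes "r \<in> C" "1 \<le> r" "r \<le> n" "1 \<le> i" "i \<le> n" "1 \<le> i'" "i' \<le> n" "g i = g i'"
  shows "i = r \<longleftrightarrow> i' = r" "i < r \<longleftrightarrow> i' < r"
  using classmap_special[OF g assms(1-3)] classmap_special_less[OF g assms(1-3)] assms(4-) by metis+

lemma border_special: "1 \<in> R" "2 \<in> R" "m - 1 \<in> R" "m \<in> R" "1 \<in> C" "2 \<in> C" "n - 1 \<in> C" "n \<in> C"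
  using R C by blast+

lemma h_special:
  assumes "special u" "v \<in> grid m n" "h v = h u" shows "v = u"
  using assms classmap_special[OF f, of "fst u" "fst v"] classmap_special[OF g, of "snd u" "snd v"]
  by (cases u; cases v) (auto simp: special_def)

lemma lift_special: "special u \<Longrightarrow> lift {h u} = {u}"
  using h_special[of u] by (auto simp: lift_def special_def)

lemma sat_special: "special u \<Longrightarrow> sat {u}"
  using h_special[of u] by (auto simp: sat_def special_def)

lemma sat_Un: "sat A \<Longrightarrow> sat B \<Longrightarrow> sat (A \<union> B)"
  unfolding sat_def by blast

text \<open>Special rows and columns are classes of their own, so merging creates no new adjacency
  among special cells; \<open>square_special\<close> shows the same for squares. Hence the
  conditions of \<open>K23_triple\<close> survive merging.\<close>

lemma h_adj_special:
  assumes "special u" "special v" "grid_adj (h u) (h v)" shows "grid_adj u v"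
proof -
  obtain i j i' j' where uv: "u = (i, j)" "v = (i', j')" by (cases u; cases v)
  have s: "i \<in> R" "1 \<le> i" "i \<le> m" "i' \<in> R" "1 \<le> i'" "i' \<le> m"
     "j \<in> C" "1 \<le> j" "j \<le> n" "j' \<in> C" "1 \<le> j'" "j' \<le> n"
    using assms(1,2) by (auto simp: uv special_def)
  have "f i = f i' \<longleftrightarrow> i = i'" "g j = g j' \<longleftrightarrow> j = j'"
    using classmap_special[OF f s(1-3,5-6)] classmap_special[OF g s(7-9,11-12)] by auto
  then show ?thesis
    using assms(3) classmap_special_Suc[OF f s(1-6)] classmap_special_Suc[OF f s(4-6) s(1-3)]
      classmap_special_Suc[OF g s(7-12)] classmap_special_Suc[OF g s(10-12) s(7-9)]
    by (auto simp: uv grid_adj_def)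
qed

lemma special_near:
  assumes "special u" "special v" "fst (h v) \<le> Suc (fst (h u))" "snd (h v) \<le> Suc (snd (h u))"
  shows "fst v \<le> Suc (fst u)" "snd v \<le> Suc (snd u)"
proof -
  obtain i j i' j' where uv: "u = (i, j)" "v = (i', j')" by (cases u; cases v)
  have s: "i \<in> R" "1 \<le> i" "i \<le> m" "i' \<in> R" "1 \<le> i'" "i' \<le> m"
     "j \<in> C" "1 \<le> j" "j \<le> n" "j' \<in> C" "1 \<le> j'" "j' \<le> n"
    using assms(1,2) by (auto simp: uv special_def)
  show "fst v \<le> Suc (fst u)"
    using assms(3) classmap_special_Suc[OF f s(1-6)] classmap_special_less(2)[OF f s(1-3) s(5,6)]
    by (cases "i < i'") (auto simp: uv le_Suc_eq)
  show "snd v \<le> Suc (snd u)"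
    using assms(4) classmap_special_Suc[OF g s(7-12)] classmap_special_less(2)[OF g s(7-9) s(11,12)]
    by (cases "j < j'") (auto simp: uv le_Suc_eq)
qed

lemma square_special:
  assumes s: "special a" "special b" "special c" and sq: "{h a, h b, h c} \<subseteq> square k l"
  obtains i j where "{a, b, c} \<subseteq> square i j"
proof -
  define i where "i = Min (fst ` {a, b, c})"
  define j where "j = Min (snd ` {a, b, c})"
  have sp: "special u" "fst (h u) = k \<or> fst (h u) = Suc k" "snd (h u) = l \<or> snd (h u) = Suc l" if "u \<in> {a, b, c}" for u
    using that s sq by (auto simp: square_def mem_Times_iff)
  have near: "fst v \<le> Suc (fst u)" "snd v \<le> Suc (snd u)" if "u \<in> {a, b, c}" "v \<in> {a, b, c}" for u v
    using special_near[OF sp(1)[OF that(1)] sp(1)[OF that(2)]] sp(2,3)[OF that(1)] sp(2,3)[OF that(2)] by auto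
  have ij: "i \<in> fst ` {a, b, c}" "j \<in> snd ` {a, b, c}" unfolding i_def j_def by (rule Min_in; simp)+
  obtain x where x: "x \<in> {a, b, c}" "fst x = i" using ij(1) by (metis imageE)
  obtain y where y: "y \<in> {a, b, c}" "snd y = j" using ij(2) by (metis imageE)
  have "v \<in> square i j" if v: "v \<in> {a, b, c}" for v
  proof -
    have "i \<le> fst v" "j \<le> snd v" unfolding i_def j_def using v by auto
    then show ?thesis using near(1)[OF x(1) v] near(2)[OF y(1) v] x(2) y(2)
      by (cases v) (auto simp: square_def)
  qed
  then show ?thesis using that by blast
qed

lemma fm3: "3 \<le> f m" "3 \<le> g n"
proof -
  have "f 2 = Suc (f 1)" "g 2 = Suc (g 1)" "f 1 = 1" "g 1 = 1"
    using f g border_special m3 n3 by (simp_all add: classmap_def numeral_2_eq_2)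
  moreover have "f 2 < f m" "g 2 < g n"
    using classmap_special_less(1)[OF f, of m 2] classmap_special_less(1)[OF g, of n 2] border_special m3 n3 by auto
  ultimately show "3 \<le> f m" "3 \<le> g n" by auto
qed

lemma f1: "f 1 = 1" "g 1 = 1"
  using f g by (simp_all add: classmap_def)

lemma border_h:
  assumes "(i, j) \<in> grid m n"
  shows "f i = 1 \<longleftrightarrow> i = 1" "f i = f m \<longleftrightarrow> i = m" "g j = 1 \<longleftrightarrow> j = 1" "g j = g n \<longleftrightarrow> j = n"
  using assms classmap_special[OF f, of 1 i] classmap_special[OF f, of m i] classmap_special[OF g, of 1 j]
    classmap_special[OF g, of n j] border_special f1 m3 n3 by auto

lemma corner_h: "v \<in> grid m n \<Longrightarrow> corner (f m) (g n) (h v) \<longleftrightarrow> corner m n v"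
  using border_h[of "fst v" "snd v"] by (cases v) simp

lemma interior_h: "v \<in> grid m n \<Longrightarrow> interior (f m) (g n) (h v) \<longleftrightarrow> interior m n v"
proof -
  assume v: "v \<in> grid m n"
  obtain i j where ij: "v = (i, j)" by (cases v)
  have "1 \<le> f i" "f i \<le> f m" "1 \<le> g j" "g j \<le> g n"
    using v ij classmap_range[OF f, of i] classmap_range[OF g, of j] by auto
  then show ?thesis using border_h[of i j] v by (auto simp: ij)
qed

lemma lift_touch:
  assumes "S \<subseteq> grid (f m) (g n)" "special r" "\<exists>s\<in>S. grid_adj s (h r)"
  shows "\<exists>u\<in>lift S. grid_adj u r"
proof -
  obtain s where s: "s \<in> S" "grid_adj s (h r)" using assms(3) by blast
  have "h r \<in> grid (f m) (g n)" "s \<in> grid (f m) (g n)"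
    using assms(1,2) h_grid s by (auto simp: special_def simp del: mem_Sigma_iff)
  then obtain u v where uv: "u \<in> lift {s}" "v \<in> lift {h r}" "grid_adj u v"
    using h_adj_lift[OF _ _ s(2)] by metis
  then have "v = r" using lift_special[OF assms(2)] by blast
  moreover have "lift {s} \<subseteq> lift S" using s(1) by (auto simp: lift_def)
  ultimately show ?thesis using uv by blast
qed

text \<open>Roots and forbidden cells are special and so form blocks of size one: lifted sets avoid
  them and still touch the roots themselves.\<close>

lemma rooted_K23_lift:
  assumes K: "rooted_K23 (f m) (g n) (h ` F) {h x, h y, h z}" and s: "special x" "special y" "special z"
    and F: "\<And>t. t \<in> F \<Longrightarrow> special t"
  obtains S T where "S \<subseteq> grid m n - ({x, y, z} \<union> F)" "T \<subseteq> grid m n - ({x, y, z} \<union> F)" "S \<inter> T = {}"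
    "conn S" "conn T" "sat S" "sat T" "\<And>r. r \<in> {x, y, z} \<Longrightarrow> \<exists>s\<in>S. grid_adj s r"
    "\<And>r. r \<in> {x, y, z} \<Longrightarrow> \<exists>s\<in>T. grid_adj s r"
proof -
  obtain S T where S: "S \<subseteq> grid (f m) (g n) - ({h x, h y, h z} \<union> h ` F)"
    and T: "T \<subseteq> grid (f m) (g n) - ({h x, h y, h z} \<union> h ` F)"
    and ST: "S \<inter> T = {}" "conn S" "conn T"
    and tch: "\<forall>r\<in>{h x, h y, h z}. (\<exists>s\<in>S. grid_adj s r) \<and> (\<exists>t\<in>T. grid_adj t r)"
    using K unfolding rooted_K23_def by blast
  have sub: "lift X \<subseteq> grid m n - ({x, y, z} \<union> F)" if "X \<subseteq> grid (f m) (g n) - ({h x, h y, h z} \<union> h ` F)" for X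
  proof
    fix v assume "v \<in> lift X"
    then have "v \<in> grid m n" "h v \<in> X" by (simp_all add: lift_def)
    moreover then have "h v \<notin> {h x, h y, h z} \<union> h ` F" using that by blast
    ultimately show "v \<in> grid m n - ({x, y, z} \<union> F)" by blast
  qed
  have Sg: "S \<subseteq> grid (f m) (g n)" "T \<subseteq> grid (f m) (g n)" using S T by blast+
  show ?thesis
  proof (rule that[OF sub[OF S] sub[OF T]])
    show "lift S \<inter> lift T = {}" using ST(1) by (auto simp: lift_def)
    show "conn (lift S)" "conn (lift T)" using conn_lift Sg ST by blast+
    show "sat (lift S)" "sat (lift T)" by (rule sat_lift)+
    fix r assume r: "r \<in> {x, y, z}"
    then have sr: "special r" using s by (elim insertE) simp_all
    have "h r \<in> {h x, h y, h z}" using r by blast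
    then have "\<exists>s\<in>S. grid_adj s (h r)" "\<exists>s\<in>T. grid_adj s (h r)" using tch by blast+
    then show "\<exists>s\<in>lift S. grid_adj s r" "\<exists>s\<in>lift T. grid_adj s r"
      using lift_touch[OF Sg(1) sr] lift_touch[OF Sg(2) sr] by blast+
  qed
qed

text \<open>The minor is sought in the merged grid and lifted, which makes both bridges
  saturated.\<close>

lemma bridged_K23:
  assumes V: "bipart m n V" "b \<in> V" "c \<in> V" "a \<notin> V" and s: "special a" "special b" "special c"
    and t: "K23_triple m n a b c" and i: "interior m n a \<or> interior m n b \<or> interior m n c"
  shows "bridged V a b c"
proof -
  have gr: "a \<in> grid m n" "b \<in> grid m n" "c \<in> grid m n" "a \<noteq> b" "a \<noteq> c" "b \<noteq> c"
    and sq: "\<And>i j. \<not> {a, b, c} \<subseteq> square i j"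
    and cn: "\<And>r s. r \<in> {a, b, c} \<Longrightarrow> s \<in> {a, b, c} \<Longrightarrow> corner m n r \<Longrightarrow> \<not> grid_adj r s"
    using t unfolding K23_triple_def by blast+
  have "K23_triple (f m) (g n) (h a) (h b) (h c)"
    unfolding K23_triple_def
  proof (intro conjI allI ballI impI)
    show "h a \<in> grid (f m) (g n)" "h b \<in> grid (f m) (g n)" "h c \<in> grid (f m) (g n)" using gr h_grid by blast+
    show "h a \<noteq> h b" "h a \<noteq> h c" "h b \<noteq> h c" using gr s h_special by metis+
    show "\<not> {h a, h b, h c} \<subseteq> square k l" for k l
      using square_special[OF s] sq by metis
    fix r q assume rq: "r \<in> {h a, h b, h c}" "q \<in> {h a, h b, h c}" "corner (f m) (g n) r"
    obtain r' q' where r': "r' \<in> {a, b, c}" "r = h r'" "q' \<in> {a, b, c}" "q = h q'" using rq by blast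
    have "special r'" "special q'" using r' s by auto
    moreover have "corner m n r'" using rq(3) r' gr corner_h by auto
    ultimately show "\<not> grid_adj r q" using cn[OF r'(1,3)] h_adj_special r' by blast
  qed
  moreover have "interior (f m) (g n) (h a) \<or> interior (f m) (g n) (h b) \<or> interior (f m) (g n) (h c)"
    using i interior_h gr by simp
  ultimately have K: "rooted_K23 (f m) (g n) (h ` {}) {h a, h b, h c}"
    using K23_exists[OF fm3] by simp
  obtain S T where S: "S \<subseteq> grid m n - ({a, b, c} \<union> {})" and T: "T \<subseteq> grid m n - ({a, b, c} \<union> {})" and ST: "S \<inter> T = {}"
    "conn S" "conn T" "sat S" "sat T" and tc: "\<And>r. r \<in> {a, b, c} \<Longrightarrow> \<exists>s\<in>S. grid_adj s r"
    "\<And>r. r \<in> {a, b, c} \<Longrightarrow> \<exists>s\<in>T. grid_adj s r"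
    using rooted_K23_lift[OF K s] by blast
  have c1: "conn (insert r X)" if "conn X" "\<exists>s\<in>X. grid_adj s r" for X r
    using conn_insert that by blast
  have ex: "conn (X \<union> {a})" "conn (X \<union> {b, c})" if "conn X" "\<And>r. r \<in> {a, b, c} \<Longrightarrow> \<exists>s\<in>X. grid_adj s r" for X
  proof -
    show "conn (X \<union> {a})" using c1[OF that(1), of a] that(2)[of a] by simp
    have "conn (insert c X)" using c1[OF that(1), of c] that(2)[of c] by simp
    then show "conn (X \<union> {b, c})" using c1[of "insert c X" b] that(2)[of b] by (simp add: insert_commute)
  qed
  show ?thesis
  proof (rule bridgedI[OF V(1), of b "{b, c}" c a "{a}" S T])
    show "{a} \<subseteq> grid m n" "{b, c} \<subseteq> grid m n" using gr by blast+
    show "S \<subseteq> grid m n - ({a} \<union> {b, c})" "T \<subseteq> grid m n - ({a} \<union> {b, c})" using S T by blast+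
    show "sat {b, c}" using sat_Un[OF sat_special[OF s(2)] sat_special[OF s(3)]] by (simp add: insert_commute)
    show "{a} \<inter> {b, c} = {}" using gr by blast
  qed (use V gr ST ex[OF ST(2) tc(1)] ex[OF ST(3) tc(2)] in \<open>simp_all del: mem_Sigma_iff\<close>)
qed

end

definition next_in :: "nat \<Rightarrow> nat \<Rightarrow> nat" where
  "next_in m i = (if i = 1 then 2 else m - 1)"

text \<open>The corner is forbidden rather than a root. It stays free and can later be attached to
  one of its neighbours.\<close>

lemma K23_corner:
  assumes m: "3 \<le> m" "3 \<le> n" and i: "i = 1 \<or> i = m" and j: "j = 1 \<or> j = n"
    and x: "interior m n x" "x \<noteq> (next_in m i, next_in n j)"
  shows "rooted_K23 m n {(i, j)} {(i, next_in n j), (next_in m i, j), x}"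
proof -
  have 1: "rooted_K23 m n {(1, j)} {(1, next_in n j), (2, j), x}"
    if x: "interior m n x" "x \<noteq> (2, next_in n j)" for x
  proof (cases "j = 1")
    case True
    then show ?thesis using K23_near_corner[OF x(1)] x(2) by (simp add: next_in_def)
  next
    case False
    then have jn: "j = n" using j by simp
    obtain p q where pq: "x = (p, q)" by (cases x)
    have "rooted_K23 m n {(1, 1)} {(1, 2), (2, 1), flip2 n x}"
      by (rule K23_near_corner) (use x m jn in \<open>auto simp: pq next_in_def\<close>)
    moreover have "flip2 n ` {(1, j)} = {(1, 1)}" "flip2 n ` {(1, next_in n j), (2, j), x} = {(1, 2), (2, 1), flip2 n x}"
      using jn m by (auto simp: next_in_def)
    moreover have "{(1, j)} \<subseteq> grid m n" "{(1, next_in n j), (2, j), x} \<subseteq> grid m n"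
      using x m jn by (auto simp: pq next_in_def)
    ultimately show ?thesis using rooted_K23_flip2[of m n "{(1, j)}" "{(1, next_in n j), (2, j), x}"] by metis
  qed
  show ?thesis
  proof (cases "i = 1")
    case True
    then show ?thesis using 1 x by (simp add: next_in_def)
  next
    case False
    then have im: "i = m" using i by simp
    obtain p q where pq: "x = (p, q)" by (cases x)
    have "rooted_K23 m n {(1, j)} {(1, next_in n j), (2, j), flip1 m x}"
      by (rule 1) (use x m im in \<open>auto simp: pq next_in_def\<close>)
    moreover have "flip1 m ` {(i, j)} = {(1, j)}" "flip1 m ` {(i, next_in n j), (next_in m i, j), x} = {(1, next_in n j), (2, j), flip1 m x}"
      using im m by (auto simp: next_in_def)
    moreover have "{(i, j)} \<subseteq> grid m n" "{(i, next_in n j), (next_in m i, j), x} \<subseteq> grid m n"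
      using x m im j by (auto simp: pq next_in_def)
    ultimately show ?thesis using rooted_K23_flip1[of m n "{(i, j)}" "{(i, next_in n j), (next_in m i, j), x}"] by metis
  qed
qed

lemma corner_nbrs:
  assumes "i = 1 \<or> i = m" "j = 1 \<or> j = n" "3 \<le> m" "3 \<le> n" "v \<in> grid m n" "grid_adj (i, j) v"
  shows "v = (i, next_in n j) \<or> v = (next_in m i, j)"
  using assms by (cases v) (auto simp: grid_adj_def next_in_def)

context classes
begin

lemma f_next_in: "i = 1 \<or> i = m \<Longrightarrow> f (next_in m i) = next_in (f m) (f i)"
proof -
  assume i: "i = 1 \<or> i = m"
  have "f 2 = 2" using f border_special m3 by (simp add: classmap_def numeral_2_eq_2)
  moreover have "f m = Suc (f (m - 1))"
    using classmap_special_Suc[OF f, of "m - 1" m] border_special m3 by simp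
  ultimately show ?thesis using i f1 fm3 m3 by (auto simp: next_in_def)
qed

lemma g_next_in: "i = 1 \<or> i = n \<Longrightarrow> g (next_in n i) = next_in (g n) (g i)"
proof -
  assume i: "i = 1 \<or> i = n"
  have "g 2 = 2" using g border_special n3 by (simp add: classmap_def numeral_2_eq_2)
  moreover have "g n = Suc (g (n - 1))"
    using classmap_special_Suc[OF g, of "n - 1" n] border_special n3 by simp
  ultimately show ?thesis using i f1 fm3 n3 by (auto simp: next_in_def)
qed

lemma conn_insert_touch: "conn X \<Longrightarrow> \<exists>s\<in>X. grid_adj s r \<Longrightarrow> conn (insert r X)"
  using conn_insert by blast

text \<open>Let \<open>t\<close> be the corner among \<open>a\<close>, \<open>b\<close>, let
  \<open>n1\<close> be the other one and \<open>n2\<close> the second neighbour of \<open>t\<close>.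
  The minor is rooted at \<open>n1\<close>, \<open>n2\<close>, \<open>c\<close> and avoids
  \<open>t\<close>; then \<open>n2\<close> represents \<open>t\<close>, being merged with
  \<open>a\<close> into \<open>A\<close> or with \<open>b\<close> into \<open>B\<close>.\<close>

lemma bridged_corner:
  assumes V: "bipart m n V" "b \<in> V" "c \<in> V" "a \<notin> V" and s: "special a" "special b" "special c"
    and sq: "\<And>i j. \<not> {a, b, c} \<subseteq> square i j" and ab: "grid_adj a b"
    and cn: "corner m n a \<or> corner m n b" and c: "interior m n c"
  shows "bridged V a b c"
proof -
  obtain t n1 where t: "corner m n t" "grid_adj t n1" "(t = a \<and> n1 = b) \<or> (t = b \<and> n1 = a)"
    using cn ab grid_adj_sym by blast
  obtain i j where ij: "t = (i, j)" by (cases t)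
  have i: "i = 1 \<or> i = m" "j = 1 \<or> j = n" using t(1) by (auto simp: ij)
  let ?p = "(i, next_in n j)" and ?q = "(next_in m i, j)"
  have st: "special t" "special n1" using t(3) s by auto
  have gr: "a \<in> grid m n" "b \<in> grid m n" "c \<in> grid m n" "t \<in> grid m n" "n1 \<in> grid m n"
    using s st by (simp_all add: special_def)
  have sp: "special ?p" "special ?q"
    using i border_special m3 n3 by (auto simp: special_def next_in_def)
  have n1: "n1 = ?p \<or> n1 = ?q" using corner_nbrs[OF i m3 n3 gr(5)] t(2) by (simp add: ij)
  define n2 where "n2 = (if n1 = ?p then ?q else ?p)"
  have pq: "?p \<noteq> ?q" using i m3 n3 by (auto simp: next_in_def)
  have n2: "{?p, ?q} = {n1, n2}" "special n2" "n1 \<noteq> n2" "n2 = ?p \<or> n2 = ?q"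
    using n1 pq sp by (auto simp: n2_def)
  have n2g: "n2 \<in> grid m n" using n2(2) by (simp add: special_def)
  have n2i: "\<not> interior m n n2" "\<not> interior m n n1" "\<not> interior m n t" "n2 \<noteq> t" "grid_adj t n2"
    using n2(4) n1 i m3 n3 by (auto simp: ij next_in_def grid_adj_def)
  have "c \<noteq> (next_in m i, next_in n j)"
  proof
    assume "c = (next_in m i, next_in n j)"
    then have "{t, n1, c} \<subseteq> square (if i = 1 then 1 else m - 1) (if j = 1 then 1 else n - 1)"
      using n1 i m3 n3 by (auto simp: ij square_def next_in_def)
    moreover have "{t, n1, c} = {a, b, c}" using t(3) by blast
    ultimately show False using sq by metis
  qed
  have hc: "h c \<noteq> (next_in (f m) (f i), next_in (g n) (g j))"
  proof
    assume "h c = (next_in (f m) (f i), next_in (g n) (g j))"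
    then have "h c = h (next_in m i, next_in n j)" using f_next_in[OF i(1)] g_next_in[OF i(2)] by simp
    moreover have "(next_in m i, next_in n j) \<in> grid m n" using m3 n3 by (auto simp: next_in_def)
    ultimately have "(next_in m i, next_in n j) = c" using h_special[OF s(3)] by metis
    then show False using \<open>c \<noteq> _\<close> by simp
  qed
  have "f i = 1 \<or> f i = f m" "g j = 1 \<or> g j = g n" using i f1 by auto
  then have "rooted_K23 (f m) (g n) {(f i, g j)} {(f i, next_in (g n) (g j)), (next_in (f m) (f i), g j), h c}"
    using K23_corner[OF fm3 _ _ _ hc] interior_h[OF gr(3)] c by blast
  moreover have "{(f i, next_in (g n) (g j)), (next_in (f m) (f i), g j), h c} = {h n1, h n2, h c}"
    using arg_cong[OF n2(1), of "\<lambda>X. h ` X"] f_next_in[OF i(1)] g_next_in[OF i(2)] by (simp add: insert_commute)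
  ultimately have K: "rooted_K23 (f m) (g n) (h ` {t}) {h n1, h n2, h c}" by (simp add: ij)
  obtain S T where S: "S \<subseteq> grid m n - ({n1, n2, c} \<union> {t})" and T: "T \<subseteq> grid m n - ({n1, n2, c} \<union> {t})" and ST: "S \<inter> T = {}"
    "conn S" "conn T" "sat S" "sat T" and tc: "\<And>r. r \<in> {n1, n2, c} \<Longrightarrow> \<exists>s\<in>S. grid_adj s r"
    "\<And>r. r \<in> {n1, n2, c} \<Longrightarrow> \<exists>s\<in>T. grid_adj s r"
    using rooted_K23_lift[OF K st(2) n2(2) s(3)] st(1) by blast
  have n2t: "grid_adj n2 t" using n2i(5) grid_adj_sym by blast
  have co: "conn (X \<union> {n1})" "conn (X \<union> {n1, c})" "conn (X \<union> {t, n2})" "conn (X \<union> {t, n2, c})"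
    if X: "conn X" "\<And>r. r \<in> {n1, n2, c} \<Longrightarrow> \<exists>s\<in>X. grid_adj s r" for X
  proof -
    show 1: "conn (X \<union> {n1})" using conn_insert_touch[OF X(1), of n1] X(2)[of n1] by simp
    show "conn (X \<union> {n1, c})" using conn_insert_touch[OF 1, of c] X(2)[of c] by (simp add: insert_commute)
    have 2: "conn (insert n2 X)" using conn_insert_touch[OF X(1), of n2] X(2)[of n2] by simp
    then have 3: "conn (insert t (insert n2 X))" using conn_insert_touch[OF 2, of t] n2t by blast
    then show "conn (X \<union> {t, n2})" by simp
    show "conn (X \<union> {t, n2, c})" using conn_insert_touch[OF 3, of c] X(2)[of c] by (simp add: insert_commute)
  qed
  have cne: "c \<noteq> n1" "c \<noteq> n2" "c \<noteq> t" using c n2i by auto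
  have tn1: "t \<noteq> n1" using t(2) by (cases t) (auto simp: grid_adj_def)
  from t(3) show ?thesis
  proof
    assume ta: "t = a \<and> n1 = b"
    show ?thesis
    proof (rule bridgedI[OF V(1), of b "{b, c}" c a "{a, n2}" S T])
      show "{a, n2} \<subseteq> grid m n" "{b, c} \<subseteq> grid m n" using gr n2g by blast+
      show "S \<subseteq> grid m n - ({a, n2} \<union> {b, c})" "T \<subseteq> grid m n - ({a, n2} \<union> {b, c})" using S T ta by blast+
      show "sat {b, c}" using sat_Un[OF sat_special[OF s(2)] sat_special[OF s(3)]] by (simp add: insert_commute)
      show "{a, n2} \<inter> {b, c} = {}" using ta cne tn1 n2(3) by auto
    qed (use V ST ta co[OF ST(2) tc(1)] co[OF ST(3) tc(2)] in \<open>simp_all del: mem_Sigma_iff\<close>)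
  next
    assume tb: "t = b \<and> n1 = a"
    \<comment> \<open>The connected part \<open>V\<close> must leave its corner cell
      \<open>b\<close> in order to reach \<open>c\<close>; the neighbour \<open>a\<close> lies
      outside \<open>V\<close>, so the step goes to \<open>n2\<close>.\<close>
    have "n2 \<in> V"
    proof -
      have "conn V" using V(1) by (simp add: bipart_def)
      then obtain x y where xy: "x \<in> V" "y \<in> V" "grid_adj x y" "x = t" "y \<noteq> t"
        using conn_crossing[of V t c "\<lambda>x. x = t"] V tb cne by blast
      have "y \<in> grid m n" using V(1) xy by (auto simp: bipart_def)
      then have "y = ?p \<or> y = ?q" using corner_nbrs[OF i m3 n3] xy by (simp add: ij)
      then have "y \<in> {n1, n2}" using n2(1) by blast
      then show ?thesis using xy V(4) tb by auto
    qed
    show ?thesis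
    proof (rule bridgedI[OF V(1), of b "{b, n2, c}" c a "{a}" S T])
      show "{a} \<subseteq> grid m n" "{b, n2, c} \<subseteq> grid m n" using gr n2g by blast+
      show "S \<subseteq> grid m n - ({a} \<union> {b, n2, c})" "T \<subseteq> grid m n - ({a} \<union> {b, n2, c})" using S T tb by blast+
      show "sat {b, n2, c}"
        using sat_Un[OF sat_special[OF s(2)] sat_Un[OF sat_special[OF n2(2)] sat_special[OF s(3)]]] by (simp add: insert_commute)
      show "{a} \<inter> {b, n2, c} = {}" using tb cne tn1 n2(3) by auto
    qed (use V ST tb \<open>n2 \<in> V\<close> co[OF ST(2) tc(1)] co[OF ST(3) tc(2)] in \<open>simp_all del: mem_Sigma_iff\<close>)
  qed
qed

text \<open>Being nonadjacent, \<open>b\<close> and \<open>c\<close> are diagonal in the square.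
  Were the fourth cell \<open>u\<close> outside \<open>V\<close>, the two diagonals would be joined
  by disjoint connected sets, against \<open>square_crossing\<close>. So \<open>b\<close>,
  \<open>u\<close>, \<open>c\<close> is a path inside \<open>V\<close>.\<close>

lemma bridged_square:
  assumes V: "bipart m n V" "b \<in> V" "c \<in> V" "a \<notin> V" and s: "special a" "special b" "special c"
    and d: "a \<noteq> b" "a \<noteq> c" "b \<noteq> c" and sq: "{a, b, c} \<subseteq> square i j" and bc: "\<not> grid_adj b c"
  shows "bridged V a b c"
proof -
  have *: "bridged V a b c"
    if V: "b \<in> V" "c \<in> V" "a \<notin> V" and s: "special a" "special b" "special c"
      and q: "a = (i, j) \<and> u = (Suc i, Suc j) \<and> b = (i, Suc j) \<and> c = (Suc i, j) \<or>
        u = (i, j) \<and> a = (Suc i, Suc j) \<and> b = (i, Suc j) \<and> c = (Suc i, j) \<or>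
        a = (i, Suc j) \<and> u = (Suc i, j) \<and> b = (i, j) \<and> c = (Suc i, Suc j) \<or>
        u = (i, Suc j) \<and> a = (Suc i, j) \<and> b = (i, j) \<and> c = (Suc i, Suc j)" for a b c u
  proof -
    have V2: "conn V" "conn (grid m n - V)" "V \<subseteq> grid m n" using assms(1) by (auto simp: bipart_def)
    have su: "special u" using q s by (auto simp: special_def)
    have ug: "u \<in> grid m n" "a \<in> grid m n" using su s by (simp_all add: special_def)
    have "u \<in> V"
    proof (rule ccontr)
      assume "u \<notin> V"
      then have uU: "u \<in> grid m n - V" "a \<in> grid m n - V" using ug V by blast+
      have dj: "(grid m n - V) \<inter> V = {}" by blast
      from q show False
        using square_crossing[OF V2(1) V(1,2) V2(2) uU(2,1) dj, of i j]
          square_crossing[OF V2(1) V(1,2) V2(2) uU(1,2) dj, of i j] by blast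
    qed
    show ?thesis
    proof (rule bridged_forced[OF assms(1), of b "{b, u, c}" c a])
      have "conn (insert u {b})" using q by (intro conn_insert[OF conn_singleton]) (auto simp: grid_adj_def)
      then have "conn (insert c (insert u {b}))"
        using conn_insert[of "insert u {b}" u c] q by (auto simp: grid_adj_def)
      then show "conn {b, u, c}" by (simp add: insert_commute)
      show "sat {b, u, c}"
        using sat_Un[OF sat_special[OF s(2)] sat_Un[OF sat_special[OF su] sat_special[OF s(3)]]] by (simp add: insert_commute)
    qed (use V ug \<open>u \<in> V\<close> in simp_all)
  qed
  have "a \<in> {(i, j), (i, Suc j), (Suc i, j), (Suc i, Suc j)}" "b \<in> {(i, j), (i, Suc j), (Suc i, j), (Suc i, Suc j)}"
    "c \<in> {(i, j), (i, Suc j), (Suc i, j), (Suc i, Suc j)}"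
    using sq by (auto simp: square_def)
  then consider "a = (i, j)" "b = (i, Suc j)" "c = (Suc i, j)" | "a = (Suc i, Suc j)" "b = (i, Suc j)" "c = (Suc i, j)"
    | "a = (i, j)" "c = (i, Suc j)" "b = (Suc i, j)" | "a = (Suc i, Suc j)" "c = (i, Suc j)" "b = (Suc i, j)"
    | "a = (i, Suc j)" "b = (i, j)" "c = (Suc i, Suc j)" | "a = (Suc i, j)" "b = (i, j)" "c = (Suc i, Suc j)"
    | "a = (i, Suc j)" "c = (i, j)" "b = (Suc i, Suc j)" | "a = (Suc i, j)" "c = (i, j)" "b = (Suc i, Suc j)"
    using d bc by (elim insertE; simp add: grid_adj_def)
  then show ?thesis
  proof cases
    case 1 show ?thesis by (rule *[OF V(2-4) s, of "(Suc i, Suc j)"]) (simp add: 1)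
  next
    case 2 show ?thesis by (rule *[OF V(2-4) s, of "(i, j)"]) (simp add: 2)
  next
    case 3 have "bridged V a c b" by (rule *[OF V(3,2,4) s(1,3,2), of "(Suc i, Suc j)"]) (simp add: 3)
    then show ?thesis by (simp add: bridged_commute)
  next
    case 4 have "bridged V a c b" by (rule *[OF V(3,2,4) s(1,3,2), of "(i, j)"]) (simp add: 4)
    then show ?thesis by (simp add: bridged_commute)
  next
    case 5 show ?thesis by (rule *[OF V(2-4) s, of "(Suc i, j)"]) (simp add: 5)
  next
    case 6 show ?thesis by (rule *[OF V(2-4) s, of "(i, Suc j)"]) (simp add: 6)
  next
    case 7 have "bridged V a c b" by (rule *[OF V(3,2,4) s(1,3,2), of "(Suc i, j)"]) (simp add: 7)
    then show ?thesis by (simp add: bridged_commute)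
  next
    case 8 have "bridged V a c b" by (rule *[OF V(3,2,4) s(1,3,2), of "(i, Suc j)"]) (simp add: 8)
    then show ?thesis by (simp add: bridged_commute)
  qed
qed

end

context classes
begin
text \<open>Cells of one class lie on the same side of the boundary and compare alike with every
  special cell. Therefore boundary segments between special cells are saturated.\<close>

lemma ring_pos_class:
  assumes b: "special b" "b \<in> ring m n" and v: "v \<in> ring m n" "w \<in> grid m n" "h w = h v"
  shows "w \<in> ring m n" "ring_pos m n v \<le> ring_pos m n b \<longleftrightarrow> ring_pos m n w \<le> ring_pos m n b"
    "ring_pos m n b \<le> ring_pos m n v \<longleftrightarrow> ring_pos m n b \<le> ring_pos m n w"
proof -
  obtain i j i' j' p q where e: "v = (i, j)" "w = (i', j')" "b = (p, q)" by (cases v; cases w; cases b)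
  have g1: "1 \<le> i" "i \<le> m" "1 \<le> j" "j \<le> n" "1 \<le> i'" "i' \<le> m" "1 \<le> j'" "j' \<le> n"
    "i = 1 \<or> i = m \<or> j = 1 \<or> j = n"
    using v by (auto simp: e ring_def)
  have g2: "p \<in> R" "1 \<le> p" "p \<le> m" "q \<in> C" "1 \<le> q" "q \<le> n" "p = 1 \<or> p = m \<or> q = 1 \<or> q = n"
    using b by (auto simp: e special_def ring_def)
  have hv: "f i' = f i" "g j' = g j" using v(3) by (simp_all add: e)
  have r: "i' = 1 \<longleftrightarrow> i = 1" "i' = m \<longleftrightarrow> i = m" "i' = p \<longleftrightarrow> i = p" "i' < p \<longleftrightarrow> i < p"
    using row_special[OF _ _ _ g1(5,6,1,2) hv(1)] border_special g2 m3 by auto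
  have c: "j' = 1 \<longleftrightarrow> j = 1" "j' = n \<longleftrightarrow> j = n" "j' = q \<longleftrightarrow> j = q" "j' < q \<longleftrightarrow> j < q"
    using column_special[OF _ _ _ g1(7,8,3,4) hv(2)] border_special g2 n3 by auto
  show "w \<in> ring m n" using g1 r c by (auto simp: e ring_def)
  define x y z where "x = ring_pos m n v" and "y = ring_pos m n w" and "z = ring_pos m n b"
  have z: "p = 1 \<and> z = q \<or> p \<noteq> 1 \<and> q = n \<and> z = n + p \<or> p = m \<and> p \<noteq> 1 \<and> q < n \<and> z = n + m + (n - q) \<or>
      q = 1 \<and> p \<noteq> 1 \<and> p < m \<and> q < n \<and> z = n + m + n + (m - p)"
    using g2 by (auto simp: e ring_pos_def z_def)
  have xy: "i = 1 \<and> i' = 1 \<and> x = j \<and> y = j' \<or> i \<noteq> 1 \<and> j = n \<and> j' = n \<and> x = n + i \<and> y = n + i' \<or>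
      i = m \<and> i' = m \<and> i \<noteq> 1 \<and> j < n \<and> j' < n \<and> x = n + m + (n - j) \<and> y = n + m + (n - j') \<or>
      i \<noteq> 1 \<and> i < m \<and> i' < m \<and> j < n \<and> x = n + m + n + (m - i) \<and> y = n + m + n + (m - i')"
    using g1 r c by (auto simp: e ring_pos_def x_def y_def)
  have ri: "i < p \<and> i' < p \<or> i = p \<and> i' = p \<or> p < i \<and> p < i'" using r by linarith
  have cj: "j < q \<and> j' < q \<or> j = q \<and> j' = q \<or> q < j \<and> q < j'" using c by linarith
  have zA: "z = q \<or> n < z" and zB: "z \<le> n \<or> z = n + p \<or> n + m < z"
    and zC: "z \<le> n + m \<or> z = n + m + (n - q) \<and> q < n \<or> n + m + n \<le> z"
    and zD: "z < n + m + n \<or> z = n + m + n + (m - p) \<and> p < m"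
    using z g2(2,3,5,6) by auto
  have "(x \<le> z \<longleftrightarrow> y \<le> z) \<and> (z \<le> x \<longleftrightarrow> z \<le> y)"
    using xy
  proof (elim disjE conjE)
    assume "x = j" "y = j'"
    then show ?thesis using zA cj g1(4,8) by auto
  next
    assume "x = n + i" "y = n + i'"
    then show ?thesis using zB ri g1(1,2,5,6) by auto
  next
    assume "x = n + m + (n - j)" "y = n + m + (n - j')" "j < n" "j' < n"
    then show ?thesis using zC cj g1(3,7) by auto
  next
    assume "x = n + m + n + (m - i)" "y = n + m + n + (m - i')" "i < m" "i' < m"
    then show ?thesis using zD ri by auto
  qed
  then have le: "x \<le> z \<longleftrightarrow> y \<le> z" "z \<le> x \<longleftrightarrow> z \<le> y" by blast+
  show "ring_pos m n v \<le> ring_pos m n b \<longleftrightarrow> ring_pos m n w \<le> ring_pos m n b"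
    "ring_pos m n b \<le> ring_pos m n v \<longleftrightarrow> ring_pos m n b \<le> ring_pos m n w" using le by (simp_all add: x_def y_def z_def)
qed

text \<open>By \<open>ring_crossing\<close> no boundary cell outside \<open>V\<close> is separated
  from \<open>a\<close> by \<open>b\<close> and \<open>c\<close>. So the boundary segment from
  \<open>b\<close> to \<open>c\<close> that misses \<open>a\<close> lies entirely in
  \<open>V\<close> and joins them.\<close>

lemma bridged_ring:
  assumes V: "bipart m n V" "b \<in> V" "c \<in> V" "a \<notin> V" and s: "special a" "special b" "special c"
    and r: "a \<in> ring m n" "b \<in> ring m n" "c \<in> ring m n" and d: "b \<noteq> c"
  shows "bridged V a b c"
proof -
  let ?k = "ring_pos m n"
  have m2: "2 \<le> m" "2 \<le> n" using m3 n3 by auto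
  have V2: "conn V" "conn (grid m n - V)" "V \<subseteq> grid m n" using V by (auto simp: bipart_def)
  have ag: "a \<in> grid m n" using s by (simp add: special_def)
  have *: "bridged V a b c"
    if V': "b \<in> V" "c \<in> V" and s: "special b" "special c"
      and r: "b \<in> ring m n" "c \<in> ring m n" and lt: "?k b < ?k c" for b c
  proof -
    have ne: "?k a \<noteq> ?k b" "?k a \<noteq> ?k c" using ring_pos_inj[OF assms(8)] r V' V(4) by metis+
    have cross: "((?k a < ?k b) \<noteq> (?k v < ?k b)) = ((?k a < ?k c) \<noteq> (?k v < ?k c))"
      if "v \<in> ring m n" "v \<notin> V" for v
    proof (rule ring_crossing[OF m2 V2(1) V' V2(2)])
      show "v \<in> grid m n - V" using that by (simp add: ring_def)
      show "a \<in> grid m n - V" using ag V(4) by simp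
    qed (use that V2 r assms(8) in auto)
    \<comment> \<open>If \<open>a\<close> lies between \<open>b\<close> and \<open>c\<close>, the
      other segment wraps around through \<open>(1, 1)\<close> and consists of two pieces, joined by
      the step between \<open>(1, 1)\<close> and \<open>(2, 1)\<close>.\<close>
    define B where "B = (if ?k b < ?k a \<and> ?k a < ?k c
      then {v \<in> ring m n. ?k v \<le> ?k b} \<union> {v \<in> ring m n. ?k c \<le> ?k v}
      else {v \<in> ring m n. ?k b \<le> ?k v \<and> ?k v \<le> ?k c})"
    show ?thesis
    proof (rule bridged_forced[OF V(1), of b B c a])
      show "b \<in> B" "c \<in> B" using r lt by (auto simp: B_def)
      show "B \<subseteq> V"
      proof
        fix v assume v: "v \<in> B"
        show "v \<in> V"
        proof (rule ccontr)
          assume nv: "v \<notin> V"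
          have vr: "v \<in> ring m n" using v by (auto simp: B_def split: if_splits)
          have "?k v \<noteq> ?k b" "?k v \<noteq> ?k c" using ring_pos_inj[OF vr] r V' nv by metis+
          then show False using cross[OF vr nv] v ne lt by (auto simp: B_def split: if_splits)
        qed
      qed
      have seg: "conn {v \<in> ring m n. ?k b \<le> ?k v \<and> ?k v \<le> ?k c}"
        by (rule conn_ring_segment[OF m2 r(1)]) (use lt in simp)
      have o: "(1, 1) \<in> ring m n" "(2, 1) \<in> ring m n" "?k (1, 1) = 1" "?k (2, 1) = n + m + n + (m - 2)"
        using m3 n3 by (auto simp: ring_def ring_pos_def)
      have rg: "1 \<le> ?k v \<and> ?k v \<le> n + m + n + (m - 2)" if v: "v \<in> ring m n" for v
        using v m3 n3 by (cases v) (auto simp: ring_def ring_pos_def)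
      have "{v \<in> ring m n. ?k v \<le> ?k b} = {v \<in> ring m n. ?k (1, 1) \<le> ?k v \<and> ?k v \<le> ?k b}"
        using rg o by auto
      then have c1: "conn {v \<in> ring m n. ?k v \<le> ?k b}"
        using conn_ring_segment[OF m2 o(1), of "?k b"] rg[OF r(1)] o by simp
      have "{v \<in> ring m n. ?k c \<le> ?k v} = {v \<in> ring m n. ?k c \<le> ?k v \<and> ?k v \<le> n + m + n + (m - 2)}"
        using rg by auto
      then have c2: "conn {v \<in> ring m n. ?k c \<le> ?k v}"
        using conn_ring_segment[OF m2 r(2), of "n + m + n + (m - 2)"] rg[OF r(2)] by simp
      have "conn ({v \<in> ring m n. ?k v \<le> ?k b} \<union> {v \<in> ring m n. ?k c \<le> ?k v})"
        by (rule conn_Un[OF c1 c2, of "(1, 1)" "(2, 1)"]) (use o rg r in \<open>auto simp: grid_adj_def\<close>)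
      then show "conn B" using seg by (simp add: B_def)
      show "sat B"
        unfolding sat_def
      proof (intro conjI ballI impI)
        show "B \<subseteq> grid m n" by (auto simp: B_def ring_def split: if_splits)
        fix u v assume u: "u \<in> B" and v: "v \<in> grid m n" "h v = h u"
        have ur: "u \<in> ring m n" using u by (auto simp: B_def split: if_splits)
        show "v \<in> B"
          using u ring_pos_class[OF s(1) r(1) ur v] ring_pos_class[OF s(2) r(2) ur v]
          by (auto simp: B_def split: if_splits)
      qed
    qed (use ag V in simp_all)
  qed
  have "?k b \<noteq> ?k c" using ring_pos_inj[OF r(2,3)] d by blast
  then consider "?k b < ?k c" | "?k c < ?k b" by linarith
  then show ?thesis
  proof cases
    case 1
    then show ?thesis using * V s r by blast
  next
    case 2
    then show ?thesis using *[of c b] V s r bridged_commute by blast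
  qed
qed

text \<open>The cases follow the obstructions to the minor: a common outer face, a common square, a
  corner adjacent to another of the cells. Adjacent \<open>b\<close> and \<open>c\<close> need no
  bridge at all.\<close>

theorem bridged_special:
  assumes V: "bipart m n V" "b \<in> V" "c \<in> V" "a \<notin> V" and s: "special a" "special b" "special c" and bc: "b \<noteq> c"
  shows "bridged V a b c"
proof -
  have gr: "a \<in> grid m n" "b \<in> grid m n" "c \<in> grid m n" using s by (simp_all add: special_def)
  have d: "a \<noteq> b" "a \<noteq> c" using V by blast+
  have ri: "v \<in> ring m n \<longleftrightarrow> \<not> interior m n v" if "v \<in> grid m n" for v using that by (simp add: ring_def)
  have no: "\<not> grid_adj u v" if "corner m n u" "interior m n v" for u v
    using that m3 n3 by (cases u; cases v) (auto simp: grid_adj_def)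
  consider (adj) "grid_adj b c" | (ring) "a \<in> ring m n" "b \<in> ring m n" "c \<in> ring m n"
    | (sq) i j where "{a, b, c} \<subseteq> square i j" "\<not> grid_adj b c"
    | (K) "K23_triple m n a b c" "interior m n a \<or> interior m n b \<or> interior m n c"
    | (cn) "\<not> grid_adj b c" "\<And>i j. \<not> {a, b, c} \<subseteq> square i j" "\<exists>r\<in>{a, b, c}. \<exists>s\<in>{a, b, c}. corner m n r \<and> grid_adj r s"
      "interior m n a \<or> interior m n b \<or> interior m n c"
    using ri gr d bc unfolding K23_triple_def by meson
  then show ?thesis
  proof cases
    case adj
    show ?thesis
    proof (rule bridged_forced[OF V(1), of b "{b, c}" c a])
      show "conn {b, c}" using conn_insert[OF conn_singleton[of b] _ adj] by (simp add: insert_commute)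
      show "sat {b, c}" using sat_Un[OF sat_special[OF s(2)] sat_special[OF s(3)]] by (simp add: insert_commute)
    qed (use V gr in simp_all)
  next
    case ring
    then show ?thesis using bridged_ring[OF V s _ _ _ bc] by blast
  next
    case sq
    then show ?thesis using bridged_square[OF V s d bc] by blast
  next
    case K
    then show ?thesis using bridged_K23[OF V s] by blast
  next
    case cn
    obtain r q where rq: "r \<in> {a, b, c}" "q \<in> {a, b, c}" "corner m n r" "grid_adj r q" using cn(3) by blast
    have "r \<noteq> q" using rq(4) by (cases r) (auto simp: grid_adj_def)
    have rq2: "\<not> interior m n r" "\<not> interior m n q"
      using rq(3) no[OF rq(3)] rq(4) by (cases r, auto)[1] (use no[OF rq(3)] rq(4) in blast)
    \<comment> \<open>A corner and its neighbour both lie on the boundary, so the third cell is the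
      interior one; and the adjacent pair is not \<open>b\<close>, \<open>c\<close>.\<close>
    have "(r = a \<or> q = a)" using rq cn(1) \<open>r \<noteq> q\<close> grid_adj_sym by blast
    then have *: "grid_adj a b \<and> (corner m n a \<or> corner m n b) \<and> interior m n c \<or>
       grid_adj a c \<and> (corner m n a \<or> corner m n c) \<and> interior m n b"
      using rq rq2 \<open>r \<noteq> q\<close> cn(4) grid_adj_sym by blast
    then show ?thesis
    proof
      assume "grid_adj a b \<and> (corner m n a \<or> corner m n b) \<and> interior m n c"
      then show ?thesis using bridged_corner[OF V s cn(2)] by blast
    next
      assume ac: "grid_adj a c \<and> (corner m n a \<or> corner m n c) \<and> interior m n b"
      have "\<not> {a, c, b} \<subseteq> square i j" for i j using cn(2) by (simp add: insert_commute)
      then have "bridged V a c b" using bridged_corner[OF V(1,3,2,4) s(1,3,2)] ac by blast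
      then show ?thesis by (simp add: bridged_commute)
    qed
  qed
qed

end

section \<open>Arcs of a cyclic order\<close>

text \<open>A discrete intermediate value theorem: the target interval has length
  \<open>W / 5\<close>, and each increase is smaller than that.\<close>

lemma no_jump:
  fixes f :: "nat \<Rightarrow> nat"
  assumes "5 * f 1 < 2 * W" "3 * W < 5 * f K" "1 \<le> K"
    and "\<And>k. 1 \<le> k \<Longrightarrow> k < K \<Longrightarrow> 5 * f (Suc k) < 5 * f k + W"
  obtains k where "1 \<le> k" "k \<le> K" "2 * W \<le> 5 * f k" "5 * f k \<le> 3 * W"
proof -
  have "2 * W \<le> 5 * f k \<Longrightarrow> k \<le> K \<Longrightarrow> \<exists>j\<ge>1. j \<le> K \<and> 2 * W \<le> 5 * f j \<and> 5 * f j \<le> 3 * W" if "1 \<le> k" for k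
    using that
  proof (induction k rule: dec_induct)
    case base
    then show ?case using assms(1) by simp
  next
    case (step k)
    show ?case
    proof (cases "2 * W \<le> 5 * f k")
      case True
      then show ?thesis using step by simp
    next
      case False
      then have "5 * f (Suc k) \<le> 3 * W" using assms(4)[of k] step by simp
      then show ?thesis using step by (intro exI[of _ "Suc k"]) auto
    qed
  qed
  from this[OF assms(3)] assms(2) that show ?thesis by force
qed

text \<open>The order is a periodic sequence over all natural numbers, so an arc that passes the end
  is still an image of an interval.\<close>

locale cyclic =
  fixes v :: "nat \<Rightarrow> 'a" and N :: nat and G :: "'a set" and w :: "'a \<Rightarrow> nat"
  assumes per: "v (k + N) = v k" and bij: "bij_betw v {..<N} G" and N6: "6 \<le> N"
begin

definition psum :: "nat \<Rightarrow> nat" where "psum k = (\<Sum>i<k. w (v i))"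
definition arc :: "nat \<Rightarrow> nat \<Rightarrow> 'a set" where "arc s l = v ` {s..<s + l}"

lemma window_image: "v ` {s..<s + N} = G"
proof (induction s)
  case 0
  then show ?case using bij by (simp add: bij_betw_def lessThan_atLeast0)
next
  case (Suc s)
  have "{Suc s..<Suc s + N} = insert (s + N) ({s..<s + N} - {s})" using N6 by auto
  moreover have "v ` (insert (s + N) ({s..<s + N} - {s})) = v ` {s..<s + N}"
  proof -
    have "{s..<s + N} = insert s ({s..<s + N} - {s})" using N6 by auto
    then show ?thesis by (metis image_insert per)
  qed
  ultimately show ?case using Suc by simp
qed

lemma finite_G: "finite G" and card_G: "card G = N"
  using bij by (simp_all add: bij_betw_finite bij_betw_same_card[symmetric])
    (metis bij_betw_finite finite_lessThan)

lemma inj_window: "inj_on v {s..<s + N}"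
  by (rule eq_card_imp_inj_on) (simp_all add: window_image card_G)

lemma v_eq: "s \<le> i \<Longrightarrow> i < s + N \<Longrightarrow> s \<le> j \<Longrightarrow> j < s + N \<Longrightarrow> v i = v j \<longleftrightarrow> i = j"
  using inj_window[of s] by (auto simp: inj_on_def)

lemma v_in: "v i \<in> G"
  using window_image[of i] N6 by force

lemma per_mult: "v (k + q * N) = v k"
proof (induction q)
  case (Suc q)
  have "k + Suc q * N = (k + q * N) + N" by simp
  then show ?case using Suc per by metis
qed simp

lemma shift: "v i = v j \<Longrightarrow> v (i + k) = v (j + k)"
proof -
  have Suc: "v (Suc i) = v (Suc j)" if ij: "v i = v j" "i \<le> j" for i j
  proof (cases "i = j")
    case False
      have "i + (j - i) mod N + (j - i) div N * N = j" using ij(2) by simp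
    then have "v (i + (j - i) mod N) = v j" using per_mult by metis
    then have "(j - i) mod N = 0"
      using v_eq[of i i "i + (j - i) mod N"] that N6 by simp
    then obtain q where "j - i = N * q" by (auto simp: mod_eq_0_iff_dvd)
    then have q: "j = i + q * N" using ij(2) by (simp add: mult.commute)
    have "v (Suc i + q * N) = v (Suc i)" by (rule per_mult)
    then show ?thesis using q by (metis add_Suc)
  qed simp
  have Suc': "v (Suc i) = v (Suc j)" if "v i = v j" for i j
  proof (cases "i \<le> j")
    case True
    then show ?thesis by (rule Suc[OF that])
  next
    case False
    then have "j \<le> i" by simp
    then show ?thesis by (rule Suc[OF that[symmetric], symmetric])
  qed
  assume a: "v i = v j"
  show "v (i + k) = v (j + k)"
  proof (induction k)
    case (Suc k)
    then show ?case using Suc'[of "i + k" "j + k"] by simp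
  qed (simp add: a)
qed

lemma index: assumes "x \<in> G" obtains i where "i < N" "v i = x"
  using assms bij by (auto simp: bij_betw_def)

lemma psum_Suc: "psum (Suc k) = psum k + w (v k)"
  by (simp add: psum_def)

lemma sum_arc: "l \<le> N \<Longrightarrow> sum w (arc s l) + psum s = psum (s + l)"
proof -
  assume l: "l \<le> N"
  have "inj_on v {s..<s + l}" by (rule inj_on_subset[OF inj_window[of s]]) (use l in auto)
  then have "sum w (arc s l) = (\<Sum>i\<in>{s..<s + l}. w (v i))" by (simp add: arc_def sum.reindex)
  moreover have "psum (s + l) = psum s + (\<Sum>i\<in>{s..<s + l}. w (v i))"
    unfolding psum_def by (simp add: lessThan_atLeast0 sum.atLeastLessThan_concat)
  ultimately show ?thesis by simp
qed

lemma arc_N: "arc s N = G" by (simp add: arc_def window_image)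

lemma psum_N: "psum (s + N) = psum s + sum w G"
  using sum_arc[of N s] by (simp add: arc_N)

lemma arc_subset: "arc s l \<subseteq> G" using v_in by (auto simp: arc_def)

lemma arc_compl: "l \<le> N \<Longrightarrow> G - arc s l = arc (s + l) (N - l)"
proof -
  assume l: "l \<le> N"
  have e: "{s..<s + N} = {s..<s + l} \<union> {s + l..<s + N}" using l by auto
  then have "G = arc s l \<union> arc (s + l) (N - l)"
    using window_image[of s] l by (simp add: arc_def image_Un)
  moreover have "arc s l \<inter> arc (s + l) (N - l) = {}"
    using inj_window[of s] l unfolding arc_def by (subst inj_on_image_Int[symmetric]) auto
  ultimately show ?thesis by blast
qed

lemma sum_compl: "A \<subseteq> G \<Longrightarrow> sum w (G - A) = sum w G - sum w A" "A \<subseteq> G \<Longrightarrow> sum w A \<le> sum w G"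
  using finite_G by (auto simp: sum_diff_nat finite_subset sum_mono2)

text \<open>The one pair of consecutive cells that may fail to be adjacent. This pair and its
  complement are the only arcs exempt in \<open>dominates\<close>; for a true Hamiltonian cycle
  \<open>\<tau>\<close> may be chosen freely.\<close>

definition exc :: "nat \<Rightarrow> 'a set" where "exc \<tau> = {v \<tau>, v (Suc \<tau>)}"

definition dominates :: "nat \<Rightarrow> nat \<Rightarrow> bool" where
  "dominates \<tau> M \<longleftrightarrow> (\<forall>s l. 0 < l \<and> l < N \<and> arc s l \<noteq> exc \<tau> \<and> arc s l \<noteq> G - exc \<tau> \<longrightarrow>
     min (sum w (arc s l)) (sum w (G - arc s l)) \<le> M)"

lemma dominatesD:
  assumes "dominates \<tau> M" "5 * M < 2 * sum w G" "0 < l" "l < N" "arc s l \<noteq> exc \<tau>" "arc s l \<noteq> G - exc \<tau>"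
  shows "\<not> (2 * sum w G \<le> 5 * sum w (arc s l) \<and> 5 * sum w (arc s l) \<le> 3 * sum w G)"
    "2 * sum w G \<le> 5 * sum w (arc s l) \<Longrightarrow> sum w G - sum w (arc s l) \<le> M"
proof -
  have m: "min (sum w (arc s l)) (sum w G - sum w (arc s l)) \<le> M"
    using assms unfolding dominates_def sum_compl(1)[OF arc_subset] by blast
  have le: "sum w (arc s l) \<le> sum w G" using sum_compl(2)[OF arc_subset] .
  show "\<not> (2 * sum w G \<le> 5 * sum w (arc s l) \<and> 5 * sum w (arc s l) \<le> 3 * sum w G)"
    "2 * sum w G \<le> 5 * sum w (arc s l) \<Longrightarrow> sum w G - sum w (arc s l) \<le> M"
    using m le assms(2) by linarith+
qed

text \<open>Arcs of length \<open>1, ..., N - 1\<close>, each extending the previous one by a cell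
  at either end, always contain \<open>v s\<close> and avoid \<open>v (s + d)\<close>. Their weights
  start below \<open>2 W / 5\<close>, end above \<open>3 W / 5\<close> and grow by light cells only,
  so one of them is balanced. The index \<open>s + N\<close> is used for \<open>v s\<close> to leave
  room on the left.\<close>

lemma two_ended:
  assumes dom: "dominates \<tau> M" and M: "5 * M < 2 * sum w G" and big: "\<And>z. z \<in> G \<Longrightarrow> 5 * w z < 2 * sum w G"
    and light: "\<And>z. z \<in> G \<Longrightarrow> z \<noteq> v s \<Longrightarrow> z \<noteq> v (s + d) \<Longrightarrow> 5 * w z < sum w G"
    and d: "0 < d" "d < N"
    and S: "S 1 = s + N" "\<And>k. 1 \<le> k \<Longrightarrow> k < N - 1 \<Longrightarrow> S (Suc k) = S k \<or> S k = Suc (S (Suc k))"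
      "\<And>k. 1 \<le> k \<Longrightarrow> k \<le> N - 1 \<Longrightarrow> s + d < S k \<and> S k \<le> s + N \<and> s + N < S k + k \<and> S k + k \<le> s + N + d"
    and good: "\<And>k. 1 \<le> k \<Longrightarrow> k \<le> N - 1 \<Longrightarrow> v s \<in> arc (S k) k \<Longrightarrow> v (s + d) \<notin> arc (S k) k \<Longrightarrow>
      arc (S k) k \<noteq> exc \<tau> \<and> arc (S k) k \<noteq> G - exc \<tau>"
  shows False
proof -
  define F where "F = (\<lambda>k. sum w (arc (S k) k))"
  have F: "F k + psum (S k) = psum (S k + k)" if "k \<le> N - 1" for k
    unfolding F_def using that by (intro sum_arc) simp
  have x: "v s \<in> arc (S k) k" if k: "1 \<le> k" "k \<le> N - 1" for k
    using S(3)[OF k] per[of s] unfolding arc_def by (intro image_eqI[of _ _ "s + N"]) auto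
  have y: "v (s + d) \<notin> arc (S k) k" if k: "1 \<le> k" "k \<le> N - 1" for k
  proof
    assume "v (s + d) \<in> arc (S k) k"
    then obtain i where i: "S k \<le> i" "i < S k + k" "v i = v (s + d)" by (auto simp: arc_def)
    then have "s + d \<le> i" "i < s + d + N" using S(3)[OF k] by auto
    then have "i = s + d" using v_eq[of "s + d" i "s + d"] i(3) N6 by simp
    then show False using i(1) S(3)[OF k] by simp
  qed
  have F1: "5 * F 1 < 2 * sum w G"
  proof -
    have "F 1 = w (v s)" using F[of 1] S(1) N6 per[of s] by (simp add: psum_Suc)
    then show ?thesis using big v_in by simp
  qed
  have FN: "3 * sum w G < 5 * F (N - 1)"
  proof -
    have "G - arc (S (N - 1)) (N - 1) = arc (S (N - 1) + (N - 1)) 1" using arc_compl[of "N - 1"] N6 by simp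
    then have "G - arc (S (N - 1)) (N - 1) = {v (S (N - 1) + (N - 1))}" by (simp add: arc_def)
    moreover have "v (s + d) \<in> G - arc (S (N - 1)) (N - 1)" using y[of "N - 1"] v_in N6 by simp
    ultimately have "G - arc (S (N - 1)) (N - 1) = {v (s + d)}" by simp
    then have "sum w (G - arc (S (N - 1)) (N - 1)) = w (v (s + d))" by simp
    then have "w (v (s + d)) = sum w G - F (N - 1)" using sum_compl(1)[OF arc_subset] unfolding F_def by simp
    moreover have "5 * w (v (s + d)) < 2 * sum w G" using big v_in by simp
    ultimately show ?thesis by linarith
  qed
  have Fs: "5 * F (Suc k) < 5 * F k + sum w G" if k: "1 \<le> k" "k < N - 1" for k
  proof -
    have k1: "1 \<le> k" "k \<le> N - 1" "1 \<le> Suc k" "Suc k \<le> N - 1" using k by auto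
    from S(2)[OF k] show ?thesis
    proof
      assume a: "S (Suc k) = S k"
      have "F (Suc k) = F k + w (v (S k + k))" using F[OF k1(2)] F[OF k1(4)] a by (simp add: psum_Suc)
      moreover have "v (S k + k) \<noteq> v s" 
      proof -
        have "s + N < S k + k" "S k + k < s + N + N" using S(3)[OF k1(1,2)] d by auto
        then show ?thesis using v_eq[of "s + N" "S k + k" "s + N"] per[of s] by simp
      qed
      moreover have "v (S k + k) \<noteq> v (s + d)"
      proof -
        have "s + N < S k + k" "S k + k < s + d + N" using S(3)[OF k1(1,2)] S(3)[OF k1(3,4)] a by auto
        then show ?thesis using v_eq[of "s + d" "S k + k" "s + d"] d by simp
      qed
      ultimately show ?thesis using light[of "v (S k + k)"] v_in by simp
    next
      assume a: "S k = Suc (S (Suc k))"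
      have "F (Suc k) = F k + w (v (S (Suc k)))"
        using F[OF k1(2)] F[OF k1(4)] a psum_Suc[of "S (Suc k)"] by simp
      moreover have "v (S (Suc k)) \<noteq> v s" "v (S (Suc k)) \<noteq> v (s + d)"
        using S(3)[OF k1(3,4)] S(3)[OF k1(1,2)] a v_eq[of s "S (Suc k)" s] v_eq[of s "S (Suc k)" "s + d"] d by auto
      ultimately show ?thesis using light[of "v (S (Suc k))"] v_in by simp
    qed
  qed
  have "1 \<le> N - 1" using N6 by simp
  then obtain k where k: "1 \<le> k" "k \<le> N - 1" "2 * sum w G \<le> 5 * F k" "5 * F k \<le> 3 * sum w G"
    by (rule no_jump[OF F1 FN _ Fs])
  have kN: "0 < k" "k < N" using k N6 by auto
  have g: "arc (S k) k \<noteq> exc \<tau>" "arc (S k) k \<noteq> G - exc \<tau>"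
    using good[OF k(1,2) x[OF k(1,2)] y[OF k(1,2)]] by metis+
  show False
    using dominatesD(1)[OF dom M kN g] k(3,4) unfolding F_def by blast
qed

text \<open>If \<open>exc \<tau>\<close> contains both or neither of \<open>x\<close>,
  \<open>y\<close>, an arc separating them is neither \<open>exc \<tau>\<close> nor its complement.
  Otherwise the arc starts at the one inside and first grows away from its partner, forwards from
  \<open>v (Suc \<tau>)\<close> and backwards from \<open>v \<tau>\<close>. This fails only if the
  other heavy cell blocks the first step, which \<open>ex\<close> rules out.\<close>

lemma two_heavy:
  assumes dom: "dominates \<tau> M" and M: "5 * M < 2 * sum w G" and big: "\<And>z. z \<in> G \<Longrightarrow> 5 * w z < 2 * sum w G"
    and xy: "x \<in> G" "y \<in> G" "x \<noteq> y"
    and light: "\<And>z. z \<in> G \<Longrightarrow> z \<noteq> x \<Longrightarrow> z \<noteq> y \<Longrightarrow> 5 * w z < sum w G"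
    and ex: "{x, y} \<noteq> {v (Suc \<tau>), v (\<tau> + 2)}" "{x, y} \<noteq> {v \<tau>, v (\<tau> + N - 1)}"
  shows False
proof -
  have fwd: False if s: "x = v s" and y: "y \<in> G" "x \<noteq> y" and light: "\<And>z. z \<in> G \<Longrightarrow> z \<noteq> x \<Longrightarrow> z \<noteq> y \<Longrightarrow> 5 * w z < sum w G"
     and good: "\<And>A. x \<in> A \<Longrightarrow> y \<notin> A \<Longrightarrow> A = {x} \<or> v (Suc s) \<in> A \<or> v (Suc s) = y \<Longrightarrow> A \<noteq> exc \<tau> \<and> A \<noteq> G - exc \<tau>" for x y s
  proof -
    obtain j where j: "s \<le> j" "j < s + N" "y = v j" using window_image[of s] y(1) by force
    define d where "d = j - s"
    have d: "0 < d" "d < N" "y = v (s + d)" using j y s by (auto simp: d_def intro: ccontr)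
    show False
    \<comment> \<open>Truncated subtraction keeps the left end fixed for \<open>k \<le> d\<close>:
      the arc grows to the right until it is stopped by \<open>v (s + d)\<close>, and then to the
      left.\<close>
    proof (rule two_ended[OF dom M big, of s d "\<lambda>k. s + N - (k - d)"])
      fix k assume k: "1 \<le> k" "k \<le> N - 1" "v s \<in> arc (s + N - (k - d)) k" "v (s + d) \<notin> arc (s + N - (k - d)) k"
      have disj: "arc (s + N - (k - d)) k = {x} \<or> v (Suc s) \<in> arc (s + N - (k - d)) k \<or> v (Suc s) = y"
      proof (cases "k = 1 \<or> d = 1")
        case True
        then show ?thesis using per[of s] d s by (auto simp: arc_def)
      next
        case False
        then have "Suc s + N \<in> {s + N - (k - d)..<s + N - (k - d) + k}" using k d by auto
        then show ?thesis unfolding arc_def using per[of "Suc s"] by (metis image_eqI)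
      qed
      then show "arc (s + N - (k - d)) k \<noteq> exc \<tau> \<and> arc (s + N - (k - d)) k \<noteq> G - exc \<tau>"
        by (intro good[OF _ _ disj]) (use k(3,4) d(3) s in simp_all)
    qed (use d light s in \<open>auto simp: Suc_diff_le\<close>)
  qed
  have bwd: False if s: "x = v s" and y: "y \<in> G" "x \<noteq> y" and light: "\<And>z. z \<in> G \<Longrightarrow> z \<noteq> x \<Longrightarrow> z \<noteq> y \<Longrightarrow> 5 * w z < sum w G"
     and good: "\<And>A. x \<in> A \<Longrightarrow> y \<notin> A \<Longrightarrow> A = {x} \<or> v (s + N - 1) \<in> A \<or> v (s + N - 1) = y \<Longrightarrow> A \<noteq> exc \<tau> \<and> A \<noteq> G - exc \<tau>" for x y s
  proof -
    obtain j where j: "s \<le> j" "j < s + N" "y = v j" using window_image[of s] y(1) by force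
    define d where "d = j - s"
    have d: "0 < d" "d < N" "y = v (s + d)" using j y s by (auto simp: d_def intro: ccontr)
    \<comment> \<open>Here the arc grows to the left until only \<open>v (s + d)\<close> blocks it,
      and then to the right.\<close>
    let ?S = "\<lambda>k. s + N - min (k - 1) (N - d - 1)"
    show False
    proof (rule two_ended[OF dom M big, of s d ?S])
      fix k assume k: "1 \<le> k" "k \<le> N - 1" "v s \<in> arc (?S k) k" "v (s + d) \<notin> arc (?S k) k"
      have disj: "arc (?S k) k = {x} \<or> v (s + N - 1) \<in> arc (?S k) k \<or> v (s + N - 1) = y"
      proof (cases "k = 1 \<or> d = N - 1")
        case True
        then show ?thesis using per[of s] d s N6 by (auto simp: arc_def)
      next
        case False
        then have "s + N - 1 \<in> {?S k..<?S k + k}" using k d by auto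
        then show ?thesis unfolding arc_def by blast
      qed
      then show "arc (?S k) k \<noteq> exc \<tau> \<and> arc (?S k) k \<noteq> G - exc \<tau>"
        by (intro good[OF _ _ disj]) (use k(3,4) d(3) s in simp_all)
    qed (use d light s in \<open>auto simp: min_def\<close>)
  qed
  have n1: "\<tau> \<le> \<tau> + N - 1" "\<tau> + N - 1 < \<tau> + N" "\<tau> \<noteq> \<tau> + N - 1" "Suc \<tau> \<noteq> \<tau> + N - 1"
    using N6 by linarith+
  have n2: "\<tau> < \<tau> + N" "Suc \<tau> < \<tau> + N" "\<tau> + 2 < \<tau> + N" using N6 by linarith+
  have "v \<tau> \<noteq> v (\<tau> + N - 1)" "v (Suc \<tau>) \<noteq> v (\<tau> + N - 1)"
    using v_eq[OF _ n2(1) n1(1,2)] v_eq[OF _ n2(2) n1(1,2)] n1(3,4) by simp_all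
  moreover have "v \<tau> \<noteq> v (Suc \<tau>)" "v \<tau> \<noteq> v (\<tau> + 2)" "v (Suc \<tau>) \<noteq> v (\<tau> + 2)"
    using v_eq[OF _ n2(1) _ n2(2)] v_eq[OF _ n2(1) _ n2(3)] v_eq[OF _ n2(2) _ n2(3)] by simp_all
  ultimately have one: "v \<tau> \<noteq> v (Suc \<tau>)" "v (\<tau> + 2) \<notin> exc \<tau>" "v (\<tau> + N - 1) \<notin> exc \<tau>"
    unfolding exc_def by auto
  have main: False if xt: "x \<in> exc \<tau>" and y: "y \<in> G" "y \<notin> exc \<tau>"
    and light: "\<And>z. z \<in> G \<Longrightarrow> z \<noteq> x \<Longrightarrow> z \<noteq> y \<Longrightarrow> 5 * w z < sum w G"
    and ex: "{x, y} \<noteq> {v (Suc \<tau>), v (\<tau> + 2)}" "{x, y} \<noteq> {v \<tau>, v (\<tau> + N - 1)}" for x y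
  proof -
    have ne: "x \<noteq> y" using xt y by blast
    have s1: "A \<noteq> {x}" if "A = exc \<tau>" for A using that one(1) by (auto simp: exc_def)
    from xt consider "x = v (Suc \<tau>)" | "x = v \<tau>" by (auto simp: exc_def)
    then show False
    proof cases
      case 1
      then have "y \<noteq> v (\<tau> + 2)" using ex(1) by auto
      then show False
        using one(2) s1 xt by (intro fwd[OF 1 y(1) ne light]) auto
    next
      case 2
      then have "y \<noteq> v (\<tau> + N - 1)" using ex(2) by auto
      then show False
        using one(3) s1 xt by (intro bwd[OF 2 y(1) ne light]) auto
    qed
  qed
  show False
  proof (cases "(x \<in> exc \<tau>) = (y \<in> exc \<tau>)")
    case True
    obtain s where "x = v s" using index[OF xy(1)] by metis
    then show False
      by (rule fwd[OF _ xy(2,3) light]) (use True xy(1,2) in blast)+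
  next
    case False
    show False
    proof (cases "x \<in> exc \<tau>")
      case True
      have f: "y \<notin> exc \<tau>" using False True by simp
      show False by (rule main[OF True xy(2) f light ex])
    next
      case f: False
      have y: "y \<in> exc \<tau>" using False f by simp
      have e: "{y, x} = {x, y}" by (rule insert_commute)
      have l: "5 * w z < sum w G" if z: "z \<in> G" "z \<noteq> y" "z \<noteq> x" for z
        using light[OF z(1) z(3) z(2)] .
      show False by (rule main[OF y xy(1) f l ex[folded e]])
    qed
  qed
qed

lemma sum_ge_two: "finite A \<Longrightarrow> x \<in> A \<Longrightarrow> y \<in> A \<Longrightarrow> x \<noteq> y \<Longrightarrow> w x + w y \<le> sum w A"
  using sum_mono2[of A "{x, y}" w] by simp

lemma arc_mem: "s \<le> i \<Longrightarrow> i < s + l \<Longrightarrow> v i \<in> arc s l"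
  by (auto simp: arc_def)

lemma arc_not_mem: "l \<le> N \<Longrightarrow> s + l \<le> i \<Longrightarrow> i < s + N \<Longrightarrow> v i \<notin> arc s l"
proof
  assume a: "l \<le> N" "s + l \<le> i" "i < s + N" "v i \<in> arc s l"
  then obtain j where "s \<le> j" "j < s + l" "v j = v i" by (auto simp: arc_def)
  then show False using v_eq[of s j i] a by simp
qed

text \<open>An arc spanning two consecutive heavy cells has at least \<open>2 W / 5\<close> inside
  and outside, so it must be exceptional. The arcs from \<open>i1\<close> to \<open>i2\<close> and
  from \<open>i2\<close> to \<open>i3\<close> share a cell and would both be exceptional, hence
  equal, although only one contains the third cell.\<close>

lemma four_heavy:
  assumes dom: "dominates \<tau> M" and M: "5 * M < 2 * sum w G"
    and i: "i1 < i2" "i2 < i3" "i3 < i4" "i4 < N"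
    and h: "\<And>i. i \<in> {i1, i2, i3, i4} \<Longrightarrow> sum w G \<le> 5 * w (v i)"
  shows False
proof -
  have f: "finite (arc s l)" "finite (G - arc s l)" for s l using finite_G arc_subset by (auto intro: finite_subset)
  have *: "arc a (Suc (b - a)) = exc \<tau> \<or> arc a (Suc (b - a)) = G - exc \<tau>"
    if ab: "a < b" "b < a + N" "{a, b} \<subseteq> {i1, i2, i3, i4}" and cd: "v c \<notin> arc a (Suc (b - a))" "v d \<notin> arc a (Suc (b - a))" "v c \<noteq> v d"
      "{c, d} \<subseteq> {i1, i2, i3, i4}" for a b c d
  proof (rule ccontr)
    assume n: "\<not> ?thesis"
    have l: "0 < Suc (b - a)" "Suc (b - a) \<le> N" using ab by auto
    have ne: "v a \<noteq> v b" using v_eq[of a a b] ab by simp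
    have "v a \<in> arc a (Suc (b - a))" "v b \<in> arc a (Suc (b - a))" using arc_mem ab by auto
    then have "w (v a) + w (v b) \<le> sum w (arc a (Suc (b - a)))" by (rule sum_ge_two[OF f(1) _ _ ne])
    moreover have "sum w G \<le> 5 * w (v a)" "sum w G \<le> 5 * w (v b)" using h ab(3) by auto
    ultimately have 1: "2 * sum w G \<le> 5 * sum w (arc a (Suc (b - a)))" by linarith
    have "w (v c) + w (v d) \<le> sum w (G - arc a (Suc (b - a)))" by (intro sum_ge_two f(2) cd(3) DiffI v_in cd(1,2))
    moreover have "sum w G \<le> 5 * w (v c)" "sum w G \<le> 5 * w (v d)" using h cd(4) by auto
    ultimately have 2: "2 * sum w G \<le> 5 * (sum w G - sum w (arc a (Suc (b - a))))"
      unfolding sum_compl(1)[OF arc_subset] by linarith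
    have "Suc (b - a) \<noteq> N"
    proof
      assume "Suc (b - a) = N"
      then show False using cd(1) v_in arc_N by metis
    qed
    then have lN: "Suc (b - a) < N" using l by simp
    have g: "arc a (Suc (b - a)) \<noteq> exc \<tau>" "arc a (Suc (b - a)) \<noteq> G - exc \<tau>" using n by metis+
    have "5 * sum w (arc a (Suc (b - a))) \<le> 3 * sum w G"
      using 2 sum_compl(2)[OF arc_subset, of a "Suc (b - a)"] by linarith
    then show False using dominatesD(1)[OF dom M l(1) lN g] 1 by linarith
  qed
  have n34: "v i3 \<noteq> v i4" "v i1 \<noteq> v i4"
    using v_eq[of 0 i3 i4] v_eq[of 0 i1 i4] i by auto
  have A: "v i3 \<notin> arc i1 (Suc (i2 - i1))" "v i4 \<notin> arc i1 (Suc (i2 - i1))"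
    by (rule arc_not_mem; use i in simp)+
  have B: "v i4 \<notin> arc i2 (Suc (i3 - i2))" "v i1 \<notin> arc i2 (Suc (i3 - i2))"
  proof -
    show "v i4 \<notin> arc i2 (Suc (i3 - i2))" by (rule arc_not_mem) (use i in simp_all)
    have "v (i1 + N) \<notin> arc i2 (Suc (i3 - i2))" by (rule arc_not_mem) (use i in simp_all)
    then show "v i1 \<notin> arc i2 (Suc (i3 - i2))" by (simp add: per)
  qed
  have "arc i1 (Suc (i2 - i1)) = exc \<tau> \<or> arc i1 (Suc (i2 - i1)) = G - exc \<tau>"
    by (rule *[of i1 i2 i3 i4]) (use i A n34 in auto)
  moreover have "arc i2 (Suc (i3 - i2)) = exc \<tau> \<or> arc i2 (Suc (i3 - i2)) = G - exc \<tau>"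
    by (rule *[of i2 i3 i4 i1]) (use i B n34 in auto)
  moreover have "v i2 \<in> arc i1 (Suc (i2 - i1))" "v i2 \<in> arc i2 (Suc (i3 - i2))" "v i3 \<in> arc i2 (Suc (i3 - i2))"
    using arc_mem i by auto
  ultimately show False using A(1) v_in by (metis DiffD2 DiffI)
qed

text \<open>The three arcs between cyclically consecutive heavy cells cover every cell once and the
  heavy ones twice. Each has weight at least \<open>2 W / 5\<close>, so its complement weighs at
  most \<open>M\<close>; adding up gives \<open>3 (W - M) \<le> W + H\<close> with \<open>H\<close>
  the weight of the three cells.\<close>

lemma three_heavy:
  assumes dom: "dominates \<tau> M" and M: "5 * M < 2 * sum w G"
    and i: "i1 < i2" "i2 < i3" "i3 < N"
    and h: "\<And>i. i \<in> {i1, i2, i3} \<Longrightarrow> sum w G \<le> 5 * w (v i)"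
    and t: "v \<tau> \<notin> {v i1, v i2, v i3}" and ex: "{v i1, v i2, v i3} \<noteq> {v (\<tau> + N - 1), v (Suc \<tau>), v (\<tau> + 2)}"
  shows "2 * sum w G \<le> 3 * M + (w (v i1) + w (v i2) + w (v i3))"
proof -
  have f: "finite (arc s l)" for s l using finite_G arc_subset by (auto intro: finite_subset)
  have h': "sum w G \<le> 5 * w x" if x: "x \<in> {v i1, v i2, v i3}" for x
    using x h[of i1] h[of i2] h[of i3] by (elim insertE) simp_all
  have *: "sum w G - sum w (arc a (Suc (b - a))) \<le> M"
    if ab: "a < b" "b < a + N" "v a \<in> {v i1, v i2, v i3}" "v b \<in> {v i1, v i2, v i3}" "{v a, v b, v c} = {v i1, v i2, v i3}"
      and c: "v c \<notin> arc a (Suc (b - a))" for a b c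
  proof -
    have l: "0 < Suc (b - a)" "Suc (b - a) \<le> N" using ab by auto
    have ne: "v a \<noteq> v b" using v_eq[of a a b] ab by simp
    have m: "v a \<in> arc a (Suc (b - a))" "v b \<in> arc a (Suc (b - a))" using arc_mem ab by auto
    then have "w (v a) + w (v b) \<le> sum w (arc a (Suc (b - a)))" by (rule sum_ge_two[OF f _ _ ne])
    moreover have "sum w G \<le> 5 * w (v a)" "sum w G \<le> 5 * w (v b)" using h'[OF ab(3)] h'[OF ab(4)] .
    ultimately have 1: "2 * sum w G \<le> 5 * sum w (arc a (Suc (b - a)))" by linarith
    have "Suc (b - a) \<noteq> N"
    proof
      assume "Suc (b - a) = N"
      then show False using c v_in arc_N by metis
    qed
    then have lN: "Suc (b - a) < N" using l by simp
    have e1: "arc a (Suc (b - a)) \<noteq> exc \<tau>"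
    proof
      assume "arc a (Suc (b - a)) = exc \<tau>"
      then have "v a = v (Suc \<tau>)" "v b = v (Suc \<tau>)" using m t ab by (auto simp: exc_def)
      then show False using ne by simp
    qed
    \<comment> \<open>If the complement of the arc were the exceptional pair, the third cell would
      be \<open>v (Suc \<tau>)\<close>, the arc would end just before \<open>v \<tau>\<close> and
      begin at \<open>v (\<tau> + 2)\<close>: the configuration excluded by
      \<open>ex\<close>.\<close>
    have e2: "arc a (Suc (b - a)) \<noteq> G - exc \<tau>"
    proof
      assume e: "arc a (Suc (b - a)) = G - exc \<tau>"
      have "v c \<in> exc \<tau>" using c[unfolded e] v_in[of c] by simp
      moreover have "v c \<noteq> v \<tau>"
      proof
        assume ct: "v c = v \<tau>"
        have "v c \<in> {v i1, v i2, v i3}" unfolding ab(5)[symmetric] by simp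
        then show False using t unfolding ct by (rule notE[rotated])
      qed
      ultimately have vc: "v c = v (Suc \<tau>)" by (simp add: exc_def)
      have "G - arc a (Suc (b - a)) = exc \<tau>" unfolding e using v_in[of \<tau>] v_in[of "Suc \<tau>"] by (auto simp: exc_def)
      then have e': "arc (Suc b) (N - Suc (b - a)) = exc \<tau>" using arc_compl[OF l(2), of a] ab by (simp add: Suc_diff_le)
      have cd: "card (exc \<tau>) = 2" using v_eq[of \<tau> \<tau> "Suc \<tau>"] N6 by (auto simp: exc_def)
      have "inj_on v {Suc b..<Suc b + (N - Suc (b - a))}" by (rule inj_on_subset[OF inj_window[of "Suc b"]]) auto
      then have "card (arc (Suc b) (N - Suc (b - a))) = N - Suc (b - a)" unfolding arc_def by (simp add: card_image)
      then have N2: "N - Suc (b - a) = 2" using e' cd by simp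
      have "arc (Suc b) 2 = {v (Suc b), v (Suc (Suc b))}"
      proof -
        have "{Suc b..<Suc b + 2} = {Suc b, Suc (Suc b)}" by auto
        then show ?thesis by (simp add: arc_def)
      qed
      then have e3: "{v (Suc b), v (Suc (Suc b))} = {v \<tau>, v (Suc \<tau>)}" using e' N2 by (simp add: exc_def)
      obtain \<beta> where \<beta>: "\<tau> \<le> \<beta>" "\<beta> < \<tau> + N" "v \<beta> = v (Suc b)" using window_image[of \<tau>] v_in[of "Suc b"] by force
      have sh: "v (\<beta> + k) = v (Suc b + k)" for k
        using shift[OF \<beta>(3)] .
      have "\<beta> = \<tau> \<or> \<beta> = Suc \<tau>"
        using e3 \<beta> v_eq[of \<tau> \<beta> \<tau>] v_eq[of \<tau> \<beta> "Suc \<tau>"] N6 by (auto simp: doubleton_eq_iff)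
      moreover have "\<beta> \<noteq> Suc \<tau>"
      proof
        assume "\<beta> = Suc \<tau>"
        then have "v (Suc (Suc b)) = v (\<tau> + 2)" using sh[of 1] by (simp add: numeral_2_eq_2)
        then have "v (\<tau> + 2) \<in> {v \<tau>, v (Suc \<tau>)}" unfolding e3[symmetric] by simp
        then show False using v_eq[of \<tau> "\<tau> + 2" \<tau>] v_eq[of \<tau> "\<tau> + 2" "Suc \<tau>"] N6 by simp
      qed
      ultimately have b: "\<beta> = \<tau>" by simp
      have "v b = v (\<tau> + N - 1)"
      proof -
        have "v (\<tau> + (N - 1)) = v (Suc b + (N - 1))" using sh[of "N - 1"] b by simp
        also have "Suc b + (N - 1) = b + N" using N6 by simp
        finally show ?thesis using per[of b] N6 by simp
      qed
      moreover have "v a = v (\<tau> + 2)"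
      proof -
        have "v (\<tau> + 2) = v (Suc b + 2)" using sh[of 2] b by simp
        also have "Suc b + 2 = a + N" using N2 ab by simp
        finally show ?thesis using per[of a] by simp
      qed
      ultimately have "{v a, v b, v c} = {v (\<tau> + N - 1), v (Suc \<tau>), v (\<tau> + 2)}"
        unfolding vc by (simp add: insert_commute)
      then show False using ex unfolding ab(5) by (rule notE[rotated])
    qed
    show ?thesis using dominatesD(2)[OF dom M l(1) lN e1 e2 1] .
  qed
  have "v i3 \<notin> arc i1 (Suc (i2 - i1))" by (rule arc_not_mem) (use i in simp_all)
  then have A1: "sum w G - sum w (arc i1 (Suc (i2 - i1))) \<le> M"
    by (intro *[of i1 i2 i3]) (use i in simp_all)
  have "v (i1 + N) \<notin> arc i2 (Suc (i3 - i2))" by (rule arc_not_mem) (use i in simp_all)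
  then have A2: "sum w G - sum w (arc i2 (Suc (i3 - i2))) \<le> M"
    by (intro *[of i2 i3 i1]) (use i per in \<open>simp_all add: insert_commute\<close>)
  have "v (i2 + N) \<notin> arc i3 (Suc (i1 + N - i3))" by (rule arc_not_mem) (use i in simp_all)
  then have A3: "sum w G - sum w (arc i3 (Suc (i1 + N - i3))) \<le> M"
    by (intro *[of i3 "i1 + N" i2]) (use i per in \<open>simp_all add: insert_commute\<close>)
  have "sum w (arc i1 (Suc (i2 - i1))) + psum i1 = psum (Suc i2)" using sum_arc[of "Suc (i2 - i1)" i1] i by simp
  moreover have "sum w (arc i2 (Suc (i3 - i2))) + psum i2 = psum (Suc i3)" using sum_arc[of "Suc (i3 - i2)" i2] i by simp
  moreover have "sum w (arc i3 (Suc (i1 + N - i3))) + psum i3 = psum (Suc (i1 + N))" using sum_arc[of "Suc (i1 + N - i3)" i3] i by simp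
  ultimately show ?thesis using A1 A2 A3 psum_N[of i1] per[of i1] by (simp add: psum_Suc)
qed

end

section \<open>A cyclic order of the cells\<close>

text \<open>The top row is run to the right, rows from 2 on snake through columns
  \<open>2..n\<close>, and the first column leads back up. If \<open>m\<close> is odd, the last two
  rows are covered jointly by a column-wise zigzag from right to left. If \<open>n\<close> is odd
  too, the zigzag ends on the wrong row: the walk visits \<open>(m, 2)\<close>,
  \<open>(m, 1)\<close> and then jumps diagonally to \<open>(m - 1, 2)\<close>.\<close>

definition nxt :: "nat \<Rightarrow> nat \<Rightarrow> nat \<times> nat \<Rightarrow> nat \<times> nat" where
  "nxt m n = (\<lambda>(i, j).
     if i = 1 then (if j < n then (1, j + 1) else (2, n))
     else if j = 1 then (if odd m \<and> odd n \<and> i = m then (m - 1, 2) else (i - 1, 1))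
     else if odd m \<and> i = m - 1 then (if even (n - j) then (m, j) else (i, j - 1))
     else if odd m \<and> i = m then (if even (n - j) \<or> j = 2 then (m, j - 1) else (m - 1, j))
     else if even i then (if 2 < j \<or> i = m then (i, j - 1) else (i + 1, 2))
     else (if j < n then (i, j + 1) else (i + 1, n)))"

definition pos :: "nat \<Rightarrow> nat \<Rightarrow> nat \<times> nat \<Rightarrow> int" where
  "pos m n = (\<lambda>(i, j).
     if i = 1 then int j - 1
     else if j = 1 then int m * int n - int i + (if odd m \<and> odd n \<and> i = m then 0 else 1)
     else if odd m \<and> m - 1 \<le> i then int n + (int m - 3) * (int n - 1) + 2 * (int n - int j) +
       (if even (n - j) = (i = m) then 1 else 0) + (if odd n \<and> j = 2 \<and> i = m - 1 then 1 else 0)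
     else int n + (int i - 2) * (int n - 1) + (if even i then int n - int j else int j - 2))"

lemma pos_left: "i \<noteq> 1 \<Longrightarrow> pos m n (i, 1) = int m * int n - int i + (if odd m \<and> odd n \<and> i = m then 0 else 1)"
  by (simp add: pos_def)

lemma pos_zigzag:
  "odd m \<Longrightarrow> m - 1 \<le> i \<Longrightarrow> i \<noteq> 1 \<Longrightarrow> j \<noteq> 1 \<Longrightarrow>
   pos m n (i, j) = int n + (int m - 3) * (int n - 1) + 2 * (int n - int j) +
     (if even (n - j) = (i = m) then 1 else 0) + (if odd n \<and> j = 2 \<and> i = m - 1 then 1 else 0)"
  by (simp only: pos_def prod.case if_False if_True simp_thms)

lemma pos_row:
  "\<not> (odd m \<and> m - 1 \<le> i) \<Longrightarrow> i \<noteq> 1 \<Longrightarrow> j \<noteq> 1 \<Longrightarrow>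
   pos m n (i, j) = int n + (int i - 2) * (int n - 1) + (if even i then int n - int j else int j - 2)"
  by (simp only: pos_def prod.case if_False if_True)

text \<open>\<open>pos\<close> is the explicit inverse of the walk, counted from 0 at
  \<open>(1, 1)\<close>. Since it rises by 1 with every step, no cell repeats, and counting gives
  bijectivity; \<open>(2, 1)\<close> is the last cell.\<close>

lemma nxt_pos:
  assumes m: "3 \<le> m" "3 \<le> n" and c: "c \<in> grid m n" "c \<noteq> (2, 1)"
  shows "nxt m n c \<in> grid m n \<and> pos m n (nxt m n c) = pos m n c + 1"
proof -
  obtain i j where ij: "c = (i, j)" by (cases c)
  have b: "1 \<le> i" "i \<le> m" "1 \<le> j" "j \<le> n" using c by (auto simp: ij)
  consider (top) "i = 1" | (left) "i \<noteq> 1" "j = 1" | (z1) "odd m" "i = m - 1" "1 < j" | (z2) "odd m" "i = m" "1 < j"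
    | (ev) "1 < i" "1 < j" "even i" "odd m \<Longrightarrow> i < m - 1" | (od) "1 < i" "1 < j" "odd i" "odd m \<Longrightarrow> i < m - 1"
  proof -
    have "odd m \<Longrightarrow> i = m \<or> i = m - 1 \<or> i < m - 1" using b by linarith
    then show ?thesis using that b by (metis One_nat_def Suc_leI le_neq_implies_less)
  qed
  note cs = this
  have g0: "j - Suc 0 \<le> n" "Suc 0 \<le> m - Suc 0" "m - Suc 0 \<le> m" using b m by linarith+
  have mm: "int (m - 1) = int m - 1" "m - Suc 0 \<noteq> m" "m - Suc 0 \<noteq> Suc 0" "m \<noteq> Suc 0" "Suc 0 \<le> m - Suc 0" using m by auto
  from cs show ?thesis
  proof cases
    case top
    show ?thesis
    proof (cases "j < n")
      case True
      then show ?thesis using top m b by (simp add: ij nxt_def pos_def)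
    next
      case False
      then have "j = n" using b by simp
      then have jn: "c = (1, n)" "nxt m n (1, n) = (2, n)" using top by (simp_all add: ij nxt_def)
      have p1: "pos m n (1, n) = int n - 1" by (simp add: pos_def)
      have "pos m n (2, n) = int n"
      proof (cases "m = 3")
        case True
        then show ?thesis using m(2) unfolding pos_def by simp
      next
        case False
        then have "\<not> m - 1 \<le> 2" using m by linarith
        then show ?thesis using m(2) unfolding pos_def by simp
      qed
      then show ?thesis unfolding jn p1 using m by simp
    qed
  next
    case left
    show ?thesis
    proof (cases "odd m \<and> odd n \<and> i = m")
      case True
      then have "odd (n - 2)" using m by simp
      then show ?thesis using True left m mm by (simp add: ij nxt_def pos_def algebra_simps)
    next
      case False
      have "3 \<le> i" using left b c by (cases "i = 2") (auto simp: ij)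
      then show ?thesis using False left m b by (auto simp: ij nxt_def pos_def)
    qed
  next
    case z1
    have m1: "int (m - 1) = int m - 1" "m - 1 \<noteq> m" "m - 1 \<noteq> 1" "m \<noteq> 1" using m by auto
    show ?thesis
    proof (cases "even (n - j)")
      case True
      then have "\<not> (odd n \<and> j = 2)" using m by auto
      then show ?thesis using True z1 m1 m b by (auto simp: ij nxt_def pos_def algebra_simps)
    next
      case False
      then have jn: "j < n" using b by (cases "j = n") auto
      show ?thesis
      proof (cases "j = 2")
        case True
        then have "odd n" using False m by simp
        then show ?thesis using True False z1 m1 m b by (auto simp: ij nxt_def pos_def algebra_simps)
      next
        case j2: False
        have r: "even (n - (j - 1))" "int (j - 1) = int j - 1" "j - 1 \<noteq> 1" "\<not> (odd n \<and> j - 1 = 2)" "1 \<le> j - 1"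
          using j2 z1 jn False by (auto simp: Suc_diff_le)
        have "nxt m n c = (m - 1, j - 1)" using False z1 m1 j2 by (simp add: ij nxt_def)
        moreover have "pos m n (m - 1, j - 1) = int n + (int m - 3) * (int n - 1) + 2 * (int n - (int j - 1))"
          using z1 m1 r by (subst pos_zigzag) simp_all
        moreover have "pos m n c = int n + (int m - 3) * (int n - 1) + 2 * (int n - int j) + 1"
          unfolding ij z1(2) using z1 m1 False j2 by (subst pos_zigzag) simp_all
        ultimately show ?thesis using r b m g0 by simp
      qed
    qed
  next
    case z2
    have m1: "int (m - 1) = int m - 1" "m - 1 \<noteq> m" "m - 1 \<noteq> 1" "m \<noteq> 1" using m by auto
    show ?thesis
    proof (cases "even (n - j)")
      case True
      show ?thesis
      proof (cases "j = 2")
        case j2: True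
        then have "even n" using True m by simp
        then show ?thesis using True j2 z2 m1 m b by (auto simp: ij nxt_def pos_def algebra_simps)
      next
        case j2: False
        have r: "odd (n - (j - 1))" "int (j - 1) = int j - 1" "j - 1 \<noteq> 1" "1 \<le> j - 1"
          using j2 z2 b True by (auto simp: Suc_diff_le)
        have "nxt m n c = (m, j - 1)" using True z2 m1 j2 by (simp add: ij nxt_def)
        moreover have "pos m n (m, j - 1) = int n + (int m - 3) * (int n - 1) + 2 * (int n - (int j - 1))"
          using z2 m1 r by (subst pos_zigzag) simp_all
        moreover have "pos m n c = int n + (int m - 3) * (int n - 1) + 2 * (int n - int j) + 1"
          unfolding ij z2(2) using z2 m1 True j2 by (subst pos_zigzag) simp_all
        ultimately show ?thesis using r b m g0 by simp
      qed
    next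
      case False
      show ?thesis
      proof (cases "j = 2")
        case j2: True
        then have "odd n" using False m by simp
        then show ?thesis using False j2 z2 m1 m b by (auto simp: ij nxt_def pos_def algebra_simps)
      next
        case j2: False
        then show ?thesis using False z2 m1 m b by (auto simp: ij nxt_def pos_def algebra_simps)
      qed
    qed
  next
    case ev
    have im: "\<not> (odd m \<and> m - 1 \<le> i)" "\<not> (odd m \<and> i = m - 1)" "\<not> (odd m \<and> i = m)" using ev(4) by auto
    have p: "pos m n c = int n + (int i - 2) * (int n - 1) + (int n - int j)"
      unfolding ij using im ev by (subst pos_row) simp_all
    have x: "nxt m n c = (if 2 < j \<or> i = m then (i, j - 1) else (i + 1, 2))"
    proof -
      have "i \<noteq> 1" "j \<noteq> 1" using ev(1,2) by auto
      then show ?thesis using ev(3) im(2,3) unfolding ij by (simp only: nxt_def prod.case if_False if_True simp_thms)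
    qed
    consider "2 < j" | "j = 2" "i = m" | "j = 2" "i < m" using ev b by linarith
    then show ?thesis
    proof cases
      case 1
      have "pos m n (i, j - 1) = int n + (int i - 2) * (int n - 1) + (int n - (int j - 1))"
        using im ev 1 by (subst pos_row) simp_all
      moreover have "Suc 0 \<le> j - Suc 0" using 1 by linarith
      ultimately show ?thesis using x p b 1 g0 by simp
    next
      case 2
      have em: "even m" using ev(3) 2 by simp
      have "pos m n (m, 1) = int m * int n - int m + 1" using em m by (subst pos_left) simp_all
      then show ?thesis using x p b 2 m by (simp add: algebra_simps)
    next
      case 3
      have im': "\<not> (odd m \<and> m - 1 \<le> i + 1)"
      proof
        assume a: "odd m \<and> m - 1 \<le> i + 1"
        then have "i + 2 = m" using ev(4) m by linarith
        then show False using a ev(3) by auto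
      qed
      have "pos m n (i + 1, 2) = int n + (int i - 1) * (int n - 1)"
        using im' ev by (subst pos_row) simp_all
      then show ?thesis using x p b 3 m by (simp add: algebra_simps)
    qed
  next
    case od
    have im: "\<not> (odd m \<and> m - 1 \<le> i)" "\<not> (odd m \<and> i = m - 1)" "\<not> (odd m \<and> i = m)" using od(4) by auto
    have p: "pos m n c = int n + (int i - 2) * (int n - 1) + (int j - 2)"
      unfolding ij using im od by (subst pos_row) simp_all
    have x: "nxt m n c = (if j < n then (i, j + 1) else (i + 1, n))"
    proof -
      have "i \<noteq> 1" "j \<noteq> 1" using od(1,2) by auto
      then show ?thesis using od(3) im(2,3) unfolding ij by (simp only: nxt_def prod.case if_False if_True simp_thms)
    qed
    show ?thesis
    proof (cases "j < n")
      case True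
      have "pos m n (i, j + 1) = int n + (int i - 2) * (int n - 1) + (int j - 1)"
        using im od by (subst pos_row) simp_all
      then show ?thesis using x p b True by simp
    next
      case False
      then have jn: "j = n" using b by simp
      have i1: "i + 1 \<le> m" using od im b by (cases "i = m") auto
      have "pos m n (i + 1, n) = int n + (int i - 1) * (int n - 1)"
      proof (cases "odd m \<and> m - 1 \<le> i + 1")
        case True
        then have "i + 2 = m" using od(4) m by linarith
        then have "int i = int m - 2" "i + 1 \<noteq> m" by auto
        then show ?thesis using True m od i1 by (subst pos_zigzag) simp_all
      next
        case F: False
        then show ?thesis using od m by (subst pos_row) simp_all
      qed
      then show ?thesis using x p b m jn i1 by (simp add: algebra_simps)
    qed
  qed
qed

lemma nxt_adj:
  assumes m: "3 \<le> m" "3 \<le> n" and c: "c \<in> grid m n" and ne: "\<not> (odd m \<and> odd n \<and> c = (m, 1))"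
  shows "grid_adj c (nxt m n c)"
proof -
  obtain i j where ij: "c = (i, j)" by (cases c)
  have mm: "m \<noteq> m - Suc 0" "m - Suc 0 \<noteq> m" using m by auto
  have b: "1 \<le> i" "i \<le> m" "1 \<le> j" "j \<le> n" using c by (auto simp: ij)
  show ?thesis
  proof (cases "i = 1 \<or> j = 1")
    case True
    moreover have "m \<noteq> m - Suc 0" using m by simp
    ultimately show ?thesis using b m ne by (cases "i = 1"; cases "i = m") (simp_all add: ij nxt_def grid_adj_def)
  next
    case False
    then have n: "i \<noteq> 1" "j \<noteq> 1" by auto
    show ?thesis
    proof (cases "odd m \<and> m - 1 \<le> i")
      case True
      then have "i = m \<or> i = m - 1" using b by linarith
      then show ?thesis using True n b m mm by (elim disjE) (simp_all add: ij nxt_def grid_adj_def)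
    next
      case F: False
      then have f: "\<not> (odd m \<and> i = m - 1)" "\<not> (odd m \<and> i = m)" by auto
      have x: "nxt m n (i, j) = (if even i then (if 2 < j \<or> i = m then (i, j - 1) else (i + 1, 2)) else (if j < n then (i, j + 1) else (i + 1, n)))"
        using n f by (simp only: nxt_def prod.case if_False if_True simp_thms)
      show ?thesis unfolding ij x grid_adj_def using n b by auto
    qed
  qed
qed

locale ham =
  fixes m n :: nat
  assumes m3: "3 \<le> m" and n3: "3 \<le> n"
begin

definition ord :: "nat \<Rightarrow> nat \<times> nat" where "ord k = (nxt m n ^^ k) (1, 1)"

lemma ord_0: "ord 0 = (1, 1)" and ord_Suc: "ord (Suc k) = nxt m n (ord k)"
  by (simp_all add: ord_def)

lemma ord_pos: "k < m * n \<Longrightarrow> ord k \<in> grid m n \<and> pos m n (ord k) = int k"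
proof (induction k)
  case 0
  then show ?case using m3 n3 by (auto simp: ord_0 pos_def)
next
  case (Suc k)
  have "pos m n (2, 1) = int (m * n) - 1" using m3 n3 by (auto simp: pos_def)
  then have "pos m n (2, 1) \<noteq> int k" using Suc.prems by linarith
  then have "ord k \<noteq> (2, 1)" using Suc by auto
  then show ?case using nxt_pos[OF m3 n3, of "ord k"] Suc by (simp add: ord_Suc)
qed

lemma ord_bij: "bij_betw ord {..<m * n} (grid m n)"
proof -
  have inj: "inj_on ord {..<m * n}"
    by (rule inj_onI) (metis ord_pos lessThan_iff of_nat_eq_iff)
  moreover have "ord ` {..<m * n} = grid m n"
  proof (rule card_subset_eq)
    show "ord ` {..<m * n} \<subseteq> grid m n" using ord_pos by blast
    show "card (ord ` {..<m * n}) = card (grid m n)" using inj by (simp add: card_image)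
  qed simp
  ultimately show ?thesis by (simp add: bij_betw_def)
qed

lemma ord_at: "c \<in> grid m n \<Longrightarrow> pos m n c = int k \<Longrightarrow> ord k = c"
proof -
  assume c: "c \<in> grid m n" "pos m n c = int k"
  have "c \<in> ord ` {..<m * n}" unfolding bij_betw_imp_surj_on[OF ord_bij] by (rule c(1))
  then obtain j where j: "c = ord j" "j \<in> {..<m * n}" by (rule imageE)
  then have "j = k" using ord_pos[of j] c(2) by simp
  then show "ord k = c" using j by simp
qed

lemma mn: "9 \<le> m * n" "m < m * n"
proof -
  have "3 * 3 \<le> m * n" using m3 n3 by (rule mult_le_mono)
  then show "9 \<le> m * n" by simp
  show "m < m * n" using m3 n3 by simp
qed

lemma ord_per: "ord (k + m * n) = ord k"
proof -
  have "pos m n (2, 1) = int (m * n - 1)" using m3 n3 mn by (auto simp: pos_def of_nat_diff)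
  then have "ord (m * n - 1) = (2, 1)" using m3 n3 by (intro ord_at) auto
  then have "ord (m * n) = nxt m n (2, 1)" using ord_Suc[of "m * n - 1"] mn by simp
  also have "\<dots> = (1, 1)" using m3 by (simp add: nxt_def)
  finally have "ord (m * n) = (1, 1)" .
  then show ?thesis
    by (induction k) (simp_all add: ord_0 ord_Suc)
qed

definition exceptional :: bool where "exceptional \<longleftrightarrow> odd m \<and> odd n"
text \<open>In the exceptional case this is the position of \<open>(m, 1)\<close>, from which the
  diagonal jump is made.\<close>

definition \<tau> :: nat where "\<tau> = m * n - m"

lemma ord_exceptional:
  assumes "exceptional"
  shows "ord \<tau> = (m, 1)" "ord (Suc \<tau>) = (m - 1, 2)" "ord (\<tau> + 2) = (m - 1, 1)" "ord (\<tau> - 1) = (m, 2)"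
    "ord (\<tau> + m * n - 1) = (m, 2)"
proof -
  have o: "odd m" "odd n" using assms by (auto simp: exceptional_def)
  have t: "pos m n (m, 1) = int \<tau>" using o m3 mn by (auto simp: pos_def \<tau>_def of_nat_diff)
  show 1: "ord \<tau> = (m, 1)" by (rule ord_at[OF _ t]) (use m3 n3 in auto)
  show 2: "ord (Suc \<tau>) = (m - 1, 2)" using 1 o m3 by (simp add: ord_Suc nxt_def)
  have "odd (n - 2)" using o n3 by simp
  then show "ord (\<tau> + 2) = (m - 1, 1)" using 2 o m3 by (simp add: ord_Suc nxt_def numeral_2_eq_2)
  have "3 * m \<le> m * n" using n3 by simp
  then have tm: "1 \<le> \<tau>" using m3 unfolding \<tau>_def by linarith
  have "pos m n (m, 2) = pos m n (m, 1) - 1"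
  proof -
    have "nxt m n (m, 2) = (m, 1)" using o m3 n3 by (auto simp: nxt_def)
    then show ?thesis using nxt_pos[OF m3 n3, of "(m, 2)"] m3 n3 by simp
  qed
  then have "pos m n (m, 2) = int (\<tau> - 1)" using t tm by simp
  then show 4: "ord (\<tau> - 1) = (m, 2)" by (intro ord_at) (use m3 n3 in auto)
  have "\<tau> + m * n - 1 = (\<tau> - 1) + m * n" using tm by simp
  then show "ord (\<tau> + m * n - 1) = (m, 2)" using 4 by (simp only: ord_per)
qed

lemma cyclic_ord: "cyclic ord (m * n) (grid m n)"
  by unfold_locales (use ord_per ord_bij mn in auto)

lemma conn_ord_path:
  assumes "0 < l" "\<And>i. s \<le> i \<Longrightarrow> Suc i < s + l \<Longrightarrow> grid_adj (ord i) (ord (Suc i))"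
  shows "conn (ord ` {s..<s + l})"
  using assms
proof (induction l)
  case (Suc l)
  show ?case
  proof (cases "l = 0")
    case True
    then show ?thesis by (simp add: conn_singleton)
  next
    case False
    have "conn (ord ` {s..<s + l})" using Suc False by simp
    moreover have "ord (s + l - 1) \<in> ord ` {s..<s + l}" using False by auto
    moreover have "grid_adj (ord (s + l - 1)) (ord (s + l))" using Suc.prems(2)[of "s + l - 1"] False by simp
    ultimately have "conn (insert (ord (s + l)) (ord ` {s..<s + l}))" by (rule conn_insert)
    moreover have "{s..<s + Suc l} = insert (s + l) {s..<s + l}" by auto
    ultimately show ?thesis by simp
  qed
qed simp

lemma ord_grid: "ord k \<in> grid m n"
  using cyclic.v_in[OF cyclic_ord] .

text \<open>The jump from \<open>(m, 1)\<close> to \<open>(m - 1, 2)\<close> is harmless in a longer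
  arc: a preceding \<open>(m, 2)\<close> is adjacent to the target, and if the arc starts at
  \<open>(m, 1)\<close>, a following \<open>(m - 1, 1)\<close> is adjacent to the source. Only the
  bare pair is disconnected.\<close>

lemma conn_arc:
  assumes l: "0 < l" "l \<le> m * n" and ne: "exceptional \<Longrightarrow> ord ` {s..<s + l} \<noteq> {ord \<tau>, ord (Suc \<tau>)}"
  shows "conn (ord ` {s..<s + l})"
proof (cases "exceptional \<and> (\<exists>i. s \<le> i \<and> Suc i < s + l \<and> ord i = (m, 1))")
  case False
  show ?thesis
  proof (rule conn_ord_path[OF l(1)])
    fix i assume "s \<le> i" "Suc i < s + l"
    then have "\<not> (odd m \<and> odd n \<and> ord i = (m, 1))" using False by (auto simp: exceptional_def)
    then show "grid_adj (ord i) (ord (Suc i))" using nxt_adj[OF m3 n3 ord_grid] by (simp add: ord_Suc)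
  qed
next
  case True
  then obtain i0 where e: "exceptional" and i0: "s \<le> i0" "Suc i0 < s + l" "ord i0 = (m, 1)" by blast
  note oe = ord_exceptional[OF e]
  have sh: "ord (i0 + k) = ord (\<tau> + k)" for k
    using cyclic.shift[OF cyclic_ord, of i0 \<tau>] i0(3) oe(1) by simp
  have u: "ord (Suc i0) = (m - 1, 2)" "ord (i0 + 2) = (m - 1, 1)" using sh[of 1] sh[of 2] oe by simp_all
  have adj: "grid_adj (ord i) (ord (Suc i))" if "s \<le> i" "Suc i < s + l" "i \<noteq> i0" for i
  proof -
    have "ord i \<noteq> (m, 1)" using cyclic.v_eq[OF cyclic_ord, of s i i0] that i0 l by auto
    then show ?thesis using nxt_adj[OF m3 n3 ord_grid[of i]] by (simp add: ord_Suc)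
  qed
  have L: "conn (ord ` {s..<s + (Suc i0 - s)})"
    by (rule conn_ord_path) (use i0 adj in auto)
  have R: "conn (ord ` {Suc i0..<Suc i0 + (s + l - Suc i0)})"
    by (rule conn_ord_path) (use i0 adj in auto)
  have "conn (ord ` {s..<s + (Suc i0 - s)} \<union> ord ` {Suc i0..<Suc i0 + (s + l - Suc i0)})"
  proof (cases "s < i0")
    case True
    have "(i0 - 1) + 1 = i0" using True by simp
    have "ord (i0 - 1) = (m, 2)"
    proof -
      have "ord ((i0 - 1) + m * n) = ord (i0 + (m * n - 1))" using True mn by (simp add: algebra_simps)
      also have "\<dots> = ord (\<tau> + (m * n - 1))" by (rule sh)
      also have "\<dots> = ord (\<tau> + m * n - 1)" using mn by simp
      finally show ?thesis using oe(5) ord_per by simp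
    qed
    then show ?thesis
      using True i0 u m3 by (intro conn_Un[OF L R, of "ord (i0 - 1)" "ord (Suc i0)"] imageI) (auto simp: grid_adj_def)
  next
    case False
    then have s: "s = i0" using i0 by simp
    have "2 < l"
    proof (rule ccontr)
      assume "\<not> 2 < l"
      then have l2: "l = 2" using i0 s by simp
      have "{s..<s + 2} = {i0, Suc i0}" using s by auto
      then have "ord ` {s..<s + l} = {ord \<tau>, ord (Suc \<tau>)}" using l2 i0 u oe by simp
      then show False using ne e by simp
    qed
    then show ?thesis
      using i0 u m3 s by (intro conn_Un[OF L R, of "ord i0" "ord (i0 + 2)"] imageI) (auto simp: grid_adj_def)
  qed
  moreover have "{s..<s + (Suc i0 - s)} \<union> {Suc i0..<Suc i0 + (s + l - Suc i0)} = {s..<s + l}" using i0 by auto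
  ultimately show ?thesis by (metis image_Un)
qed

lemma bipart_arc:
  assumes l: "0 < l" "l < m * n" and ne: "exceptional \<Longrightarrow> ord ` {s..<s + l} \<noteq> {ord \<tau>, ord (Suc \<tau>)}"
    "exceptional \<Longrightarrow> ord ` {s..<s + l} \<noteq> grid m n - {ord \<tau>, ord (Suc \<tau>)}"
  shows "bipart m n (ord ` {s..<s + l})"
proof -
  have c: "grid m n - ord ` {s..<s + l} = ord ` {s + l..<s + l + (m * n - l)}"
    using cyclic.arc_compl[OF cyclic_ord, of l s] l by (simp add: cyclic.arc_def[OF cyclic_ord])
  have sub: "ord ` {s..<s + l} \<subseteq> grid m n" using ord_grid by blast
  have "conn (ord ` {s + l..<s + l + (m * n - l)})"
  proof (rule conn_arc)
    assume e: exceptional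
    show "ord ` {s + l..<s + l + (m * n - l)} \<noteq> {ord \<tau>, ord (Suc \<tau>)}"
      using ne(2)[OF e] c sub by (metis double_diff order_refl)
  qed (use l in auto)
  then show ?thesis using conn_arc[OF l(1) _ ne(1)] sub l c by (simp add: bipart_def)
qed

end

section \<open>The approximation ratio\<close>

definition minw :: "nat \<Rightarrow> nat \<Rightarrow> (nat \<times> nat \<Rightarrow> nat) \<Rightarrow> (nat \<times> nat) set \<Rightarrow> nat" where
  "minw m n w V = min (sum w V) (sum w (grid m n - V))"

definition mirror :: "nat \<Rightarrow> nat \<Rightarrow> bool \<Rightarrow> bool \<Rightarrow> nat \<times> nat \<Rightarrow> nat \<times> nat" where
  "mirror m n a b = (\<lambda>(i, j). (if a then m + 1 - i else i, if b then n + 1 - j else j))"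

lemma mirror_grid: "v \<in> grid m n \<Longrightarrow> mirror m n a b v \<in> grid m n"
  by (cases v) (auto simp: mirror_def)

lemma mirror_mirror: "v \<in> grid m n \<Longrightarrow> mirror m n a b (mirror m n a b v) = v"
  by (cases v; cases a; cases b) (auto simp: mirror_def)

lemma mirror_adj: "u \<in> grid m n \<Longrightarrow> v \<in> grid m n \<Longrightarrow> grid_adj u v \<Longrightarrow> grid_adj (mirror m n a b u) (mirror m n a b v)"
  by (cases u; cases v; cases a; cases b) (auto simp: mirror_def grid_adj_def)

lemma mirror_image: "mirror m n a b ` grid m n = grid m n"
proof
  show "mirror m n a b ` grid m n \<subseteq> grid m n" using mirror_grid by blast
  show "grid m n \<subseteq> mirror m n a b ` grid m n"
  proof
    fix v assume v: "v \<in> grid m n"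
    show "v \<in> mirror m n a b ` grid m n"
      by (rule rev_image_eqI[OF mirror_grid[OF v, of a b]]) (rule mirror_mirror[OF v, symmetric])
  qed
qed

lemma inj_mirror: "inj_on (mirror m n a b) (grid m n)"
  by (rule inj_on_inverseI[where g = "mirror m n a b"]) (rule mirror_mirror)

lemma bipart_mirror:
  assumes "bipart m n U" shows "bipart m n (mirror m n a b ` U)"
proof -
  have U: "U \<subseteq> grid m n" "conn U" "conn (grid m n - U)" using assms by (simp_all add: bipart_def)
  have c: "conn (mirror m n a b ` S)" if "conn S" "S \<subseteq> grid m n" for S
  proof (rule conn_image[OF that(1)])
    fix u v assume "u \<in> S" "v \<in> S" "grid_adj u v"
    then show "mirror m n a b u = mirror m n a b v \<or> grid_adj (mirror m n a b u) (mirror m n a b v)"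
      using mirror_adj[of u m n v] that(2) by blast
  qed
  have "grid m n - mirror m n a b ` U = mirror m n a b ` (grid m n - U)"
    using inj_on_image_set_diff[OF inj_mirror, of "grid m n" U] U(1) mirror_image by simp
  moreover have "mirror m n a b ` U \<subseteq> grid m n" using U(1) mirror_image by blast
  ultimately show ?thesis using c[OF U(2,1)] c[OF U(3)] by (simp add: bipart_def)
qed

context ham
begin

definition walk :: "bool \<Rightarrow> bool \<Rightarrow> nat \<Rightarrow> nat \<times> nat" where
  "walk a b k = mirror m n a b (ord k)"

lemma cyclic_walk: "cyclic (walk a b) (m * n) (grid m n)"
proof
  show "walk a b (k + m * n) = walk a b k" for k by (simp add: walk_def ord_per)
  have "bij_betw (mirror m n a b) (grid m n) (grid m n)" using inj_mirror mirror_image by (simp add: bij_betw_def)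
  then have "bij_betw (mirror m n a b \<circ> ord) {..<m * n} (grid m n)" by (rule bij_betw_trans[OF ord_bij])
  then show "bij_betw (walk a b) {..<m * n} (grid m n)" by (simp only: walk_def[abs_def] o_def)
  show "6 \<le> m * n" using mn by simp
qed

end

lemma pick_min:
  fixes I :: "nat set"
  assumes "k < card I"
  obtains i where "i \<in> I" "k \<le> card {j \<in> I. i < j}"
proof -
  have f: "finite I" "I \<noteq> {}" using assms card.infinite by fastforce+
  have "{j \<in> I. Min I < j} = I - {Min I}" using Min_le[OF f(1)] by (auto simp: order_less_le)
  then have "k \<le> card {j \<in> I. Min I < j}" using assms f Min_in[OF f] by simp
  then show ?thesis using that Min_in[OF f] by blast
qed

lemma card_le_two_cover:
  assumes "finite G" "2 \<le> card G" "H \<subseteq> G" "card H \<le> 2"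
  obtains x y where "x \<in> G" "y \<in> G" "x \<noteq> y" "H \<subseteq> {x, y}"
proof -
  obtain K where K: "H \<subseteq> K" "K \<subseteq> G" "card K = 2"
    using exists_subset_between[of H 2 G] assms by auto
  then show ?thesis using that by (auto simp: card_2_iff)
qed

text \<open>The interface between program and analysis, with \<open>M\<close> the best value found.
  In the exceptional case the program skips the start positions \<open>\<tau>\<close> and
  \<open>\<tau> + 2\<close> altogether, so that its test does not depend on the length of the arc;
  complements recover what is lost.\<close>

locale swept = classes m n R C f g for m n R C f g +
  fixes w :: "nat \<times> nat \<Rightarrow> nat" and M :: nat
  assumes heavy: "\<And>v. v \<in> grid m n \<Longrightarrow> sum w (grid m n) \<le> 5 * w v \<Longrightarrow> special v"
    and arcs: "\<And>a b s l. s < m * n \<Longrightarrow> 0 < l \<Longrightarrow> l < m * n \<Longrightarrow>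
      \<not> (ham.exceptional m n \<and> (s = ham.\<tau> m n \<or> s = ham.\<tau> m n + 2)) \<Longrightarrow>
      minw m n w (mirror m n a b ` ham.ord m n ` {s..<s + l}) \<le> M"
    and sats: "\<And>V. bipart m n V \<Longrightarrow> sat V \<Longrightarrow> minw m n w V \<le> M"
begin

interpretation ham m n by unfold_locales (rule m3 n3)+

sublocale W: cyclic "walk a b" "m * n" "grid m n" w for a b by (rule cyclic_walk)

lemma minw_arc:
  assumes "s < m * n" "0 < l" "l < m * n" "\<not> (exceptional \<and> (s = \<tau> \<or> s = \<tau> + 2))"
  shows "min (sum w (W.arc a b s l)) (sum w (grid m n - W.arc a b s l)) \<le> M"
proof -
  have "W.arc a b s l = mirror m n a b ` ord ` {s..<s + l}"
    unfolding W.arc_def image_image by (rule image_cong) (simp_all add: walk_def)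
  then show ?thesis using arcs[OF assms, of a b] by (simp only: minw_def)
qed

lemma arc_mod: "W.arc a b (s mod (m * n)) l = W.arc a b s l"
proof -
  have "walk a b (s mod (m * n) + k) = walk a b (s + k)" for k
  proof (rule W.shift)
    have "walk a b (s mod (m * n) + s div (m * n) * (m * n)) = walk a b (s mod (m * n))" by (rule W.per_mult)
    then show "walk a b (s mod (m * n)) = walk a b s" unfolding mod_div_mult_eq by (rule sym)
  qed
  moreover have "W.arc a b t l = (\<lambda>k. walk a b (t + k)) ` {..<l}" for t
  proof -
    have "{t..<t + l} = (\<lambda>k. t + k) ` {..<l}" by (simp add: lessThan_atLeast0 add.commute)
    then show ?thesis unfolding W.arc_def by (simp add: image_image)
  qed
  ultimately show ?thesis by simp
qed

text \<open>An arc with a skipped start is judged by its complement, which begins where the arc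
  ends. That start is skipped as well only for the exceptional pair and for its complement.\<close>

lemma dominates_walk:
  assumes t: "exceptional \<Longrightarrow> t = \<tau>"
  shows "W.dominates a b t M"
  unfolding W.dominates_def
proof (intro allI impI, elim conjE)
  fix s l assume l: "0 < l" "l < m * n" and ne: "W.arc a b s l \<noteq> W.exc a b t" "W.arc a b s l \<noteq> grid m n - W.exc a b t"
  define s' where "s' = s mod (m * n)"
  have s': "s' < m * n" "W.arc a b s' l = W.arc a b s l" using mn by (simp_all add: s'_def arc_mod)
  show "min (sum w (W.arc a b s l)) (sum w (grid m n - W.arc a b s l)) \<le> M"
  proof (cases "exceptional \<and> (s' = \<tau> \<or> s' = \<tau> + 2)")
    case False
    show ?thesis using minw_arc[OF s'(1) l False, of a b] unfolding s'(2) .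
  next
    case True
    then have e: exceptional "t = \<tau>" using t by auto
    have "\<tau> + 2 < m * n" using m3 mn by (simp add: \<tau>_def)
    define q where "q = (s' + l) mod (m * n)"
    have exc2: "W.exc a b t = W.arc a b \<tau> 2"
    proof -
      have "{\<tau>..<\<tau> + 2} = {\<tau>, Suc \<tau>}" by auto
      then show ?thesis by (simp add: W.arc_def W.exc_def e)
    qed
    have "q \<noteq> \<tau> \<and> q \<noteq> \<tau> + 2"
    proof (cases "s' + l < m * n")
      case T: True
      then have q: "q = s' + l" by (simp add: q_def)
      show ?thesis
      proof (rule disjE[OF conjunct2[OF True]])
        assume s: "s' = \<tau>"
        have "l \<noteq> 2"
        proof
          assume "l = 2"
          then have "W.arc a b s l = W.exc a b t" using s'(2) s exc2 by simp
          then show False using ne(1) by simp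
        qed
        then show ?thesis using q s l by simp
      qed (use q l in simp)
    next
      case F: False
      then have q: "q = s' + l - m * n" using s' l by (simp add: q_def mod_if)
      show ?thesis
      proof (rule disjE[OF conjunct2[OF True]])
        assume s: "s' = \<tau> + 2"
        have "q \<noteq> \<tau>"
        proof
          assume qt: "q = \<tau>"
          then have l2: "m * n - l = 2" using q s l F by linarith
          have "grid m n - W.arc a b s' l = W.arc a b q 2"
            using W.arc_compl[of l a b s'] l l2 by (simp add: q_def arc_mod)
          then have "grid m n - W.arc a b s l = W.exc a b t" using s'(2) exc2 qt by simp
          then show False using ne(2) W.arc_subset by (metis double_diff order_refl)
        qed
        then show ?thesis using q s l F by linarith
      qed (use q l F in linarith)
    qed
    then have nq: "\<not> (exceptional \<and> (q = \<tau> \<or> q = \<tau> + 2))" by simp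
    have "q < m * n" using mn by (simp add: q_def)
    note A = minw_arc[OF this _ _ nq, of "m * n - l" a b]
    have c: "W.arc a b q (m * n - l) = grid m n - W.arc a b s l"
      using W.arc_compl[of l a b s'] l s'(2) by (simp add: q_def arc_mod)
    have cc: "grid m n - (grid m n - W.arc a b s l) = W.arc a b s l" using W.arc_subset by (rule double_diff) simp
    show ?thesis using A l unfolding c cc by (simp add: min.commute)
  qed
qed

abbreviation "TW \<equiv> sum w (grid m n)"

definition heavies :: "(nat \<times> nat) set" where "heavies = {v \<in> grid m n. TW \<le> 5 * w v}"

lemma heavies: "heavies \<subseteq> grid m n" "finite heavies" "v \<in> heavies \<Longrightarrow> TW \<le> 5 * w v"
  "v \<in> grid m n \<Longrightarrow> v \<notin> heavies \<Longrightarrow> 5 * w v < TW"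
  by (auto simp: heavies_def simp del: mem_Sigma_iff)

lemma walk_exceptional:
  assumes exceptional
  shows "walk a b \<tau> = mirror m n a b (m, 1)" "walk a b (Suc \<tau>) = mirror m n a b (m - 1, 2)"
    "walk a b (\<tau> + 2) = mirror m n a b (m - 1, 1)" "walk a b (\<tau> + m * n - 1) = mirror m n a b (m, 2)"
  using ord_exceptional[OF assms] by (simp_all only: walk_def)

text \<open>The order must be chosen so that neither forbidden pair of \<open>two_heavy\<close>
  occurs. In the exceptional case a left-right reflection replaces pairs in columns 1, 2 by pairs in
  columns \<open>n - 1\<close>, \<open>n\<close>. Otherwise \<open>\<tau>\<close> is free: if 0
  fails, 3 works, since the heavy cells then avoid positions 3 and 4.\<close>

lemma not_two:
  assumes M: "5 * M < 2 * TW" and big: "\<And>z. z \<in> grid m n \<Longrightarrow> 5 * w z < 2 * TW"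
  shows "3 \<le> card heavies"
proof (rule ccontr)
  assume "\<not> 3 \<le> card heavies"
  then have c: "card heavies \<le> 2" by simp
  have "2 \<le> card (grid m n)" using mn by simp
  have fin: "finite (grid m n)" by simp
  obtain x y where xy: "x \<in> grid m n" "y \<in> grid m n" "x \<noteq> y" and H: "heavies \<subseteq> {x, y}"
    by (rule card_le_two_cover[OF fin \<open>2 \<le> card (grid m n)\<close> heavies(1) c])
  have light: "5 * w z < TW" if "z \<in> grid m n" "z \<noteq> x" "z \<noteq> y" for z
    using heavies(4)[OF that(1)] H that(2,3) by blast
  have "\<exists>a b t. (exceptional \<longrightarrow> t = \<tau>) \<and> {x, y} \<noteq> {walk a b (Suc t), walk a b (t + 2)} \<and> {x, y} \<noteq> {walk a b t, walk a b (t + m * n - 1)}"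
  proof (cases exceptional)
    case True
    note we = walk_exceptional[OF True]
    show ?thesis
    proof (cases "{x, y} = {(m - 1, 2), (m - 1, 1)} \<or> {x, y} = {(m, 1), (m, 2)}")
      case False
      have e: "walk False False \<tau> = (m, 1)" "walk False False (Suc \<tau>) = (m - 1, 2)"
        "walk False False (\<tau> + 2) = (m - 1, 1)" "walk False False (\<tau> + m * n - 1) = (m, 2)"
        unfolding we by (simp_all add: mirror_def)
      show ?thesis by (rule exI[of _ False], rule exI[of _ False], rule exI[of _ \<tau>]) (use False in \<open>simp only: e\<close>, blast)
    next
      case T: True
      have e: "walk False True \<tau> = (m, n)" "walk False True (Suc \<tau>) = (m - 1, n - 1)"
        "walk False True (\<tau> + 2) = (m - 1, n)" "walk False True (\<tau> + m * n - 1) = (m, n - 1)"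
        unfolding we by (simp_all add: mirror_def)
      have n: "(m - 1, n) \<notin> {x, y}" "(m, n) \<notin> {x, y}" using T n3 by (elim disjE; simp)+
      have "{x, y} \<noteq> {walk False True (Suc \<tau>), walk False True (\<tau> + 2)}"
        "{x, y} \<noteq> {walk False True \<tau>, walk False True (\<tau> + m * n - 1)}"
        unfolding e using n by (metis insertI1 insertI2)+
      then show ?thesis by blast
    qed
  next
    case False
    have ne: "walk False False i = walk False False j \<longleftrightarrow> i = j" if "i < m * n" "j < m * n" for i j
      using W.v_eq[of 0 i j False False] that by simp
    have N: "0 < m" "0 < n" "Suc 0 < m * n" "Suc (Suc 0) < m * n" "2 < m * n" "3 < m * n" "4 < m * n" "m * n - Suc 0 < m * n" "m * n - Suc 0 \<noteq> 3" "m * n - Suc 0 \<noteq> 4"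
      "3 \<noteq> m * n - Suc 0" "4 \<noteq> m * n - Suc 0"
      using mn(1) m3 n3 by linarith+
    have d: "walk False False 3 \<notin> {walk False False (Suc 0), walk False False (0 + 2)}" "walk False False 3 \<notin> {walk False False 0, walk False False (0 + m * n - 1)}"
      "walk False False 4 \<notin> {walk False False (Suc 0), walk False False (0 + 2)}" "walk False False 4 \<notin> {walk False False 0, walk False False (0 + m * n - 1)}"
      by (simp_all add: ne N)
    have q: "walk False False (3 + m * n - 1) = walk False False 2"
      using W.per[of False False 2] by (simp add: add.commute)
    have e: "walk False False (Suc 3) = walk False False 4" by simp
    show ?thesis
    proof (cases "{x, y} \<noteq> {walk False False (Suc 0), walk False False (0 + 2)} \<and> {x, y} \<noteq> {walk False False 0, walk False False (0 + m * n - 1)}")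
      case True
      then show ?thesis using False by blast
    next
      case F: False
      then have AB: "{x, y} = {walk False False (Suc 0), walk False False (0 + 2)} \<or> {x, y} = {walk False False 0, walk False False (0 + m * n - 1)}"
        by (simp only: de_Morgan_conj not_not)
      have "walk False False 3 \<notin> {x, y}" using AB d(1,2) by (elim disjE) (simp_all only: not_False_eq_True)
      moreover have "walk False False 4 \<notin> {x, y}" using AB d(3,4) by (elim disjE) (simp_all only: not_False_eq_True)
      ultimately have "walk False False 3 \<notin> {x, y}" "walk False False 4 \<notin> {x, y}" .
      then have "{x, y} \<noteq> {walk False False (Suc 3), walk False False (3 + 2)}" "{x, y} \<noteq> {walk False False 3, walk False False (3 + m * n - 1)}"
        unfolding e by (metis insertI1)+
      then show ?thesis using False by blast
    qed
  qed
  then obtain a b t where t: "exceptional \<longrightarrow> t = \<tau>" and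
    ex: "{x, y} \<noteq> {walk a b (Suc t), walk a b (t + 2)}" "{x, y} \<noteq> {walk a b t, walk a b (t + m * n - 1)}" by metis
  have d: "W.dominates a b t M" using t by (intro dominates_walk) simp
  show False by (rule W.two_heavy[OF d M big xy light ex])
qed

lemma heavy_indices:
  obtains I where "finite I" "card I = card heavies" "I \<subseteq> {..<m * n}" "heavies = walk a b ` I"
proof
  let ?I = "{i \<in> {..<m * n}. walk a b i \<in> heavies}"
  have bij: "bij_betw (walk a b) {..<m * n} (grid m n)" by (rule W.bij)
  show im: "heavies = walk a b ` ?I"
  proof (intro equalityI subsetI)
    fix v assume v: "v \<in> heavies"
    have "v \<in> grid m n" using heavies(1) v by (rule subsetD)
    then obtain i where "i < m * n" "walk a b i = v" by (rule W.index)
    then show "v \<in> walk a b ` ?I" using v by (intro image_eqI[of _ _ i]) simp_all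
  next
    fix v assume "v \<in> walk a b ` ?I"
    then show "v \<in> heavies" by (elim imageE CollectE conjE) simp
  qed
  have "inj_on (walk a b) {..<m * n}" using bij by (rule bij_betw_imp_inj_on)
  then have "inj_on (walk a b) ?I" by (rule inj_on_subset) blast
  then show "card ?I = card heavies" by (subst im) (rule card_image[symmetric])
qed auto

lemma not_four:
  assumes M: "5 * M < 2 * TW"
  shows "card heavies \<le> 3"
proof (rule ccontr)
  assume c: "\<not> card heavies \<le> 3"
  obtain I where I: "card I = card heavies" "I \<subseteq> {..<m * n}" "heavies = walk False False ` I"
    by (rule heavy_indices)
  have "3 < card I" using c I by simp
  then obtain i1 where i1: "i1 \<in> I" "3 \<le> card {j \<in> I. i1 < j}" by (rule pick_min)
  then have "2 < card {j \<in> I. i1 < j}" by simp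
  then obtain i2 where i2: "i2 \<in> {j \<in> I. i1 < j}" "2 \<le> card {j \<in> {j \<in> I. i1 < j}. i2 < j}" by (rule pick_min)
  then have "1 < card {j \<in> {j \<in> I. i1 < j}. i2 < j}" by simp
  then obtain i3 where i3: "i3 \<in> {j \<in> {j \<in> I. i1 < j}. i2 < j}" "1 \<le> card {j \<in> {j \<in> {j \<in> I. i1 < j}. i2 < j}. i3 < j}" by (rule pick_min)
  then have "{j \<in> {j \<in> {j \<in> I. i1 < j}. i2 < j}. i3 < j} \<noteq> {}" by (metis card.empty not_one_le_zero)
  then obtain i4 where i4: "i4 \<in> I" "i3 < i4" by blast
  have in_I: "i1 \<in> I" "i2 \<in> I" "i3 \<in> I" "i4 \<in> I" using i1 i2 i3 i4 by simp_all
  have lt: "i1 < i2" "i2 < i3" "i3 < i4" "i4 < m * n" using i2(1) i3(1) i4 I(2) by auto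
  show False
  proof (cases exceptional)
    case True
    show False
    proof (rule W.four_heavy[OF dominates_walk[of \<tau> False False] M lt])
      fix i assume "i \<in> {i1, i2, i3, i4}"
      then have "i \<in> I" using in_I by auto
      then show "TW \<le> 5 * w (walk False False i)" using heavies(3) I(3) by simp
    qed simp
  next
    case False
    show False
    proof (rule W.four_heavy[OF dominates_walk[of \<tau> False False] M lt])
      fix i assume "i \<in> {i1, i2, i3, i4}"
      then have "i \<in> I" using in_I by auto
      then show "TW \<le> 5 * w (walk False False i)" using heavies(3) I(3) by simp
    qed simp
  qed
qed

text \<open>Three heavy cells leave one of the four corners free, and a reflection brings the
  exceptional position there; a further left-right reflection avoids the remaining bad
  configuration. Without an exceptional arc, \<open>t\<close> is a nonheavy position among
  \<open>2..5\<close>, or \<open>t + 4\<close> if \<open>t\<close> is bad.\<close>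

lemma three:
  assumes M: "5 * M < 2 * TW" and c: "card heavies = 3"
  shows "2 * TW \<le> 3 * M + sum w heavies"
proof -
  have "\<exists>a b t. (exceptional \<longrightarrow> t = \<tau>) \<and> walk a b t \<notin> heavies \<and> heavies \<noteq> {walk a b (t + m * n - 1), walk a b (Suc t), walk a b (t + 2)}"
  proof (cases exceptional)
    case True
    note we = walk_exceptional[OF True]
    have "\<exists>a b. walk a b \<tau> \<notin> heavies"
    proof (rule ccontr)
      assume "\<not> ?thesis"
      then have "mirror m n a b (m, 1) \<in> heavies" for a b using we(1) by metis
      from this[of False False] this[of False True] this[of True False] this[of True True]
      have "{(m, 1), (m, n), (1, 1), (1, n)} \<subseteq> heavies" by (simp add: mirror_def)
      moreover have "card {(m, 1), (m, n), (1, 1), (1, n)} = 4" using m3 n3 by simp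
      ultimately have "4 \<le> card heavies" using card_mono[OF heavies(2)] by metis
      then show False using c by simp
    qed
    then obtain a b where t: "walk a b \<tau> \<notin> heavies" by blast
    show ?thesis
    proof (cases "heavies = {walk a b (\<tau> + m * n - 1), walk a b (Suc \<tau>), walk a b (\<tau> + 2)}")
      case False
      then show ?thesis using t by blast
    next
      case H: True
      have "walk a (\<not> b) \<tau> \<notin> heavies" "walk a (\<not> b) (\<tau> + 2) \<notin> heavies"
        unfolding H we using n3 by (auto simp: mirror_def)
      then have "walk a (\<not> b) \<tau> \<notin> heavies \<and> heavies \<noteq> {walk a (\<not> b) (\<tau> + m * n - 1), walk a (\<not> b) (Suc \<tau>), walk a (\<not> b) (\<tau> + 2)}"
        by (metis insertI1 insertI2)
      then show ?thesis by blast
    qed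
  next
    case False
    let ?v = "walk False False"
    have ne: "?v i = ?v j \<longleftrightarrow> i = j" if "1 \<le> i" "i < 1 + m * n" "1 \<le> j" "j < 1 + m * n" for i j
      using W.v_eq[of 1 i j False False] that by simp
    have "\<exists>t. 2 \<le> t \<and> t \<le> 5 \<and> ?v t \<notin> heavies"
    proof (rule ccontr)
      assume "\<not> ?thesis"
      then have "{?v 2, ?v 3, ?v 4, ?v 5} \<subseteq> heavies" by simp
      moreover have "card {?v 2, ?v 3, ?v 4, ?v 5} = 4" using ne mn(1) by simp
      ultimately have "4 \<le> card heavies" using card_mono[OF heavies(2)] by metis
      then show False using c by simp
    qed
    then obtain t where t: "2 \<le> t" "t \<le> 5" "?v t \<notin> heavies" by blast
    have q: "?v (s + m * n - 1) = ?v (s - 1)" if "1 \<le> s" for s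
      using W.per[of False False "s - 1"] that by simp
    show ?thesis
    proof (cases "heavies = {?v (t + m * n - 1), ?v (Suc t), ?v (t + 2)}")
      case F: False
      then show ?thesis using t False by blast
    next
      case H: True
      have "?v (t + 4) \<notin> heavies" "?v (t + 3) \<notin> heavies"
        unfolding H using q[of t] ne t mn(1) by simp_all
      moreover have "?v (t + 4 + m * n - 1) = ?v (t + 3)"
      proof -
        have "1 \<le> t + 4" "t + 4 - 1 = t + 3" by simp_all
        then show ?thesis using q by metis
      qed
      ultimately have "?v (t + 4) \<notin> heavies \<and> heavies \<noteq> {?v (t + 4 + m * n - 1), ?v (Suc (t + 4)), ?v (t + 4 + 2)}"
        by (metis insertI1)
      then show ?thesis using False by blast
    qed
  qed
  then obtain a b t where t: "exceptional \<longrightarrow> t = \<tau>" "walk a b t \<notin> heavies"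
    and ex: "heavies \<noteq> {walk a b (t + m * n - 1), walk a b (Suc t), walk a b (t + 2)}" by metis
  obtain I where I: "card I = card heavies" "I \<subseteq> {..<m * n}" "heavies = walk a b ` I"
    by (rule heavy_indices)
  have "2 < card I" using c I by simp
  then obtain i1 where i1: "i1 \<in> I" "2 \<le> card {j \<in> I. i1 < j}" by (rule pick_min)
  then have "1 < card {j \<in> I. i1 < j}" by simp
  then obtain i2 where i2: "i2 \<in> {j \<in> I. i1 < j}" "1 \<le> card {j \<in> {j \<in> I. i1 < j}. i2 < j}" by (rule pick_min)
  then have "{j \<in> {j \<in> I. i1 < j}. i2 < j} \<noteq> {}" by (metis card.empty not_one_le_zero)
  then obtain i3 where i3: "i3 \<in> I" "i2 < i3" by blast
  have in_I: "{i1, i2, i3} \<subseteq> I" using i1 i2 i3 by simp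
  have lt: "i1 < i2" "i2 < i3" "i3 < m * n" using i2(1) i3 I(2) by auto
  have fI: "finite I" using I(2) finite_subset by blast
  have "{i1, i2, i3} = I" using fI in_I by (rule card_subset_eq) (use lt I(1) c in simp)
  then have H: "heavies = {walk a b i1, walk a b i2, walk a b i3}" using I(3) by (metis image_empty image_insert)
  have "2 * TW \<le> 3 * M + (w (walk a b i1) + w (walk a b i2) + w (walk a b i3))"
  proof (rule W.three_heavy[OF dominates_walk[of t] M lt _ _ ex[unfolded H]])
    show "walk a b t \<notin> {walk a b i1, walk a b i2, walk a b i3}" using t(2) unfolding H .
    fix i assume "i \<in> {i1, i2, i3}"
    then have "i \<in> I" using in_I by blast
    then show "TW \<le> 5 * w (walk a b i)" using heavies(3) I(3) by simp
  qed (use t(1) in simp)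
  moreover have "sum w heavies = w (walk a b i1) + w (walk a b i2) + w (walk a b i3)"
    unfolding H using W.v_eq[of 0 i1 i2 a b] W.v_eq[of 0 i1 i3 a b] W.v_eq[of 0 i2 i3 a b] lt by simp
  ultimately show ?thesis by simp
qed

lemma sum_V: "V \<subseteq> grid m n \<Longrightarrow> sum w (grid m n - V) + sum w V = TW"
  by (subst add.commute, rule sum.subset_diff[symmetric, THEN trans[rotated]], simp_all add: add.commute)

text \<open>Both saturated parts contain \<open>b\<close> and \<open>c\<close>, hence weigh at least
  \<open>2 TW / 5\<close>, and their complements weigh at most \<open>M\<close>. Their union avoids
  \<open>a\<close> and their intersection lies in \<open>V\<close>, so the sum of their weights
  gives \<open>w a + u \<le> 2 * M\<close>.\<close>

lemma one_outside:
  assumes M: "5 * M < 2 * TW" and c: "card heavies = 3" and V: "bipart m n V"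
    and H: "heavies = {a, b, c}" "a \<notin> V" "b \<in> V" "c \<in> V" "b \<noteq> c"
  shows "4 * sum w (grid m n - V) \<le> 5 * M"
proof -
  have sub: "V \<subseteq> grid m n" using V by (simp add: bipart_def)
  have fin: "finite (grid m n)" by simp
  have hv: "a \<in> heavies" "b \<in> heavies" "c \<in> heavies" unfolding H by simp_all
  have gr: "a \<in> grid m n" "b \<in> grid m n" "c \<in> grid m n" using hv heavies(1) by blast+
  have hw: "TW \<le> 5 * w a" "TW \<le> 5 * w b" "TW \<le> 5 * w c" using heavies(3) hv by simp_all
  have sp: "special a" "special b" "special c" using heavy gr hw by simp_all
  have ab: "a \<noteq> b" "a \<noteq> c" using H by blast+
  have sH: "sum w heavies = w a + w b + w c" unfolding H(1) using ab H(5) by simp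
  define L where "L = TW - (w a + w b + w c)"
  define u where "u = sum w (grid m n - V)"
  have HT: "w a + w b + w c \<le> TW" unfolding sH[symmetric] using heavies(1) by (rule sum_mono2[OF fin]) simp
  have three: "TW + L \<le> 3 * M" using three[OF M c] HT unfolding sH L_def by linarith
  have "grid m n - V \<subseteq> grid m n - {b, c}" using H(3,4) by blast
  then have "u \<le> sum w (grid m n - {b, c})" unfolding u_def by (intro sum_mono2) simp_all
  moreover have "sum w (grid m n - {b, c}) + sum w {b, c} = TW" using gr by (intro sum_V) simp
  ultimately have u: "u \<le> w a + L" using H(5) HT unfolding L_def by simp
  have uV: "u + sum w V = TW" unfolding u_def by (rule sum_V[OF sub])
  show ?thesis
  \<comment> \<open>The threshold at which both estimates yield \<open>5 * M / 4\<close>: below it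
    \<open>u \<le> w a + L \<le> 5 * w a / 3\<close> is combined with
    \<open>w a + u \<le> 2 * M\<close>, above it \<open>u < 5 * L / 2\<close> with
    \<open>2 * L < M\<close>.\<close>
  proof (cases "3 * L \<le> 2 * w a")
    case True
    have "bridged V a b c" by (rule bridged_special[OF V H(3,4,2) sp H(5)])
    then obtain V1 V2 where V12: "bipart m n V1" "sat V1" "bipart m n V2" "sat V2" "{b, c} \<subseteq> V1" "{b, c} \<subseteq> V2"
      "a \<notin> V1" "a \<notin> V2" "V1 \<inter> V2 \<subseteq> V" unfolding bridged_def by metis
    have large: "TW \<le> M + sum w X" if X: "bipart m n X" "sat X" "{b, c} \<subseteq> X" for X
    proof -
      have s: "X \<subseteq> grid m n" using X by (simp add: bipart_def)
      have "sum w {b, c} \<le> sum w X" using X(3) by (rule sum_mono2[OF finite_subset[OF s fin]]) simp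
      then have "w b + w c \<le> sum w X" using H(5) by simp
      then show ?thesis using sats[OF X(1,2)] sum_V[OF s] hw M unfolding minw_def by linarith
    qed
    have s12: "V1 \<subseteq> grid m n" "V2 \<subseteq> grid m n" using V12 by (simp_all add: bipart_def)
    have f12: "finite V1" "finite V2" "finite V" using s12 sub fin finite_subset by blast+
    have "sum w V1 + sum w V2 = sum w (V1 \<union> V2) + sum w (V1 \<inter> V2)" using sum.union_inter[OF f12(1,2), of w] by simp
    moreover have "sum w (V1 \<inter> V2) \<le> sum w V" using V12(9) by (rule sum_mono2[OF f12(3)]) simp
    moreover have "V1 \<union> V2 \<subseteq> grid m n - {a}" using s12 V12(7,8) by blast
    then have "sum w (V1 \<union> V2) \<le> sum w (grid m n - {a})" by (intro sum_mono2) simp_all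
    moreover have "sum w (grid m n - {a}) + w a = TW" using sum_V[of "{a}"] gr(1) by simp
    ultimately have "w a + u \<le> 2 * M" using large[OF V12(1,2,5)] large[OF V12(3,4,6)] uV by linarith
    then show ?thesis using u True unfolding u_def[symmetric] by linarith
  next
    case False
    then show ?thesis using u three M unfolding u_def[symmetric] by linarith
  qed
qed

theorem approximation:
  assumes V: "bipart m n V"
  shows "4 * minw m n w V \<le> 5 * M"
proof -
  have sub: "V \<subseteq> grid m n" using V by (simp add: bipart_def)
  have fin: "finite (grid m n)" by simp
  note VT = sum_V[OF sub]
  have half: "2 * minw m n w V \<le> TW" using VT unfolding minw_def by linarith
  show ?thesis
  proof (cases "5 * M < 2 * TW")
    case False
    then show ?thesis using half by linarith
  next
    case M: True
    show ?thesis
    \<comment> \<open>One very heavy cell: the arc \<open>{z}\<close> shows that the other cells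
      weigh at most \<open>M\<close>, and every bipartition has a part without
      \<open>z\<close>.\<close>
    proof (cases "\<exists>z\<in>grid m n. 2 * TW \<le> 5 * w z")
      case True
      then obtain z where z: "z \<in> grid m n" "2 * TW \<le> 5 * w z" by blast
      obtain k where k: "k < m * n" "walk False False k = z" by (rule W.index[OF z(1), of False False])
      have a1: "W.arc False False k 1 = {z}" using k by (simp add: W.arc_def)
      have tc: "\<tau> < \<tau> + m * n" "Suc \<tau> < \<tau> + m * n" using mn by linarith+
      have ce: "card (W.exc False False \<tau>) = 2" "W.exc False False \<tau> \<subseteq> grid m n"
        using W.v_eq[of \<tau> \<tau> "Suc \<tau>" False False] tc W.v_in unfolding W.exc_def by (simp_all del: mem_Sigma_iff)
      have "card {z} \<noteq> card (W.exc False False \<tau>)" using ce by simp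
      then have n1: "W.arc False False k 1 \<noteq> W.exc False False \<tau>" unfolding a1 by metis
      have "card (grid m n - W.exc False False \<tau>) = m * n - 2" using card_Diff_subset[OF finite_subset[OF ce(2) fin] ce(2)] ce(1) by simp
      then have "card {z} \<noteq> card (grid m n - W.exc False False \<tau>)" using mn by simp
      then have n2: "W.arc False False k 1 \<noteq> grid m n - W.exc False False \<tau>" unfolding a1 by metis
      have "sum w (W.arc False False k 1) = w z" unfolding a1 by simp
      then have zM: "TW - w z \<le> M"
        using W.dominatesD(2)[OF dominates_walk[of \<tau> False False] M _ _ n1 n2] mn z(2) by simp
      have "minw m n w V \<le> TW - w z"
      proof (cases "z \<in> V")
        case True
        then have "w z \<le> sum w V" using member_le_sum[of z V w] finite_subset[OF sub fin] by simp
        then show ?thesis using VT unfolding minw_def by linarith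
      next
        case False
        then have "w z \<le> sum w (grid m n - V)" using member_le_sum[of z "grid m n - V" w] z(1) by simp
        then show ?thesis using VT unfolding minw_def by linarith
      qed
      then show ?thesis using zM by linarith
    next
      case False
      then have big: "5 * w z < 2 * TW" if "z \<in> grid m n" for z using that False by (meson not_le)
      have c3: "card heavies = 3" using not_two[OF M big] not_four[OF M] by simp
      have th: "2 * TW \<le> 3 * M + sum w heavies" by (rule three[OF M c3])
      have Hc: "sum w (grid m n - heavies) + sum w heavies = TW" by (rule sum_V[OF heavies(1)])
      \<comment> \<open>A part without heavy cells weighs at most \<open>L\<close>, which is below
        \<open>M / 2\<close> here.\<close>
      have ind: "4 * minw m n w V \<le> 5 * M" if X: "X \<in> {V, grid m n - V}" "X \<inter> heavies = {}" for X
      proof -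
        have "X \<subseteq> grid m n - heavies" using X sub by blast
        then have "sum w X \<le> sum w (grid m n - heavies)" by (intro sum_mono2) simp_all
        moreover have "minw m n w V \<le> sum w X" using X(1) unfolding minw_def by auto
        ultimately show ?thesis using th Hc M by linarith
      qed
      have two: "4 * minw m n w V \<le> 5 * M" if X: "X \<in> {V, grid m n - V}" and a: "heavies = {a, b, c}" "a \<notin> X" "b \<in> X" "c \<in> X" for X a b c
      proof -
        have bX: "bipart m n X"
        proof (cases "X = V")
          case F: False
          then have "X = grid m n - V" using X by simp
          moreover have "grid m n - (grid m n - V) = V" using sub by (rule double_diff) simp
          ultimately show ?thesis using V by (simp add: bipart_def)
        qed (use V in simp)
        have "b \<noteq> c"
        proof
          assume "b = c"
          then have "card heavies \<le> 2" unfolding a(1) by (simp add: card_insert_if)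
          then show False using c3 by simp
        qed
        from one_outside[OF M c3 bX a this] have "4 * sum w (grid m n - X) \<le> 5 * M" .
        moreover have "minw m n w V \<le> sum w (grid m n - X)"
          using X double_diff[OF sub order_refl] unfolding minw_def by auto
        ultimately show ?thesis by linarith
      qed
      obtain x y z where H: "heavies = {x, y, z}" using c3 by (auto simp: card_3_iff)
      have gr: "x \<in> grid m n" "y \<in> grid m n" "z \<in> grid m n" using heavies(1) unfolding H by blast+
      let ?V = "grid m n - V"
      have H2: "heavies = {y, x, z}" "heavies = {z, x, y}" unfolding H by blast+
      have no: "t \<notin> ?V" if "t \<in> V" for t using that by simp
      have yes: "t \<in> ?V" if "t \<in> grid m n" "t \<notin> V" for t using that by (rule DiffI)
      have VV: "V \<in> {V, ?V}" "?V \<in> {V, ?V}" by simp_all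
      show ?thesis
      proof (cases "x \<in> V")
        case x: True
        show ?thesis
        proof (cases "y \<in> V")
          case y: True
          show ?thesis
          proof (cases "z \<in> V")
            case z: True
            show ?thesis by (rule ind[OF VV(2)], unfold H, use x y z in blast)
          next
            case z: False
            show ?thesis by (rule two[OF VV(1) H2(2) z x y])
          qed
        next
          case y: False
          show ?thesis
          proof (cases "z \<in> V")
            case z: True
            show ?thesis by (rule two[OF VV(1) H2(1) y x z])
          next
            case z: False
            show ?thesis by (rule two[OF VV(2) H no[OF x] yes[OF gr(2) y] yes[OF gr(3) z]])
          qed
        qed
      next
        case x: False
        show ?thesis
        proof (cases "y \<in> V")
          case y: True
          show ?thesis
          proof (cases "z \<in> V")
            case z: True
            show ?thesis by (rule two[OF VV(1) H x y z])
          next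
            case z: False
            show ?thesis by (rule two[OF VV(2) H2(1) no[OF y] yes[OF gr(1) x] yes[OF gr(3) z]])
          qed
        next
          case y: False
          show ?thesis
          proof (cases "z \<in> V")
            case z: True
            show ?thesis by (rule two[OF VV(2) H2(2) no[OF z] yes[OF gr(1) x] yes[OF gr(2) y]])
          next
            case z: False
            show ?thesis by (rule ind[OF VV(1)], unfold H, use x y z in blast)
          qed
        qed
      qed
    qed
  qed
qed

end

section \<open>Reasoning about programs\<close>

text \<open>On loop-free programs execution is the function \<open>eff\<close>, and
  \<open>cst\<close> bounds its cost uniformly by adding both branches. The clauses of
  \<open>eff\<close> and \<open>cst\<close> for loops are dummy values.\<close>

fun flat :: "com \<Rightarrow> bool" where
  "flat Skip = True"
| "flat (Assign x e) = True"
| "flat (Write a e1 e2) = True"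
| "flat (Seq c d) = (flat c \<and> flat d)"
| "flat (com.If b c d) = (flat c \<and> flat d)"
| "flat (While b c) = False"

fun eff :: "com \<Rightarrow> store \<Rightarrow> store" where
  "eff Skip s = s"
| "eff (Assign x e) s = s\<lparr>regs := (regs s)(x := aval e s)\<rparr>"
| "eff (Write a e1 e2) s = s\<lparr>arrays := (arrays s)(a := (arrays s a)(aval e1 s := aval e2 s))\<rparr>"
| "eff (Seq c d) s = eff d (eff c s)"
| "eff (com.If b c d) s = (if bval b s then eff c s else eff d s)"
| "eff (While b c) s = s"

fun cst :: "com \<Rightarrow> nat" where
  "cst Skip = 1"
| "cst (Assign x e) = 1 + acost e"
| "cst (Write a e1 e2) = 1 + acost e1 + acost e2"
| "cst (Seq c d) = cst c + cst d"
| "cst (com.If b c d) = 1 + bcost b + cst c + cst d"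
| "cst (While b c) = 0"

fun wr :: "com \<Rightarrow> string set" where
  "wr Skip = {}"
| "wr (Assign x e) = {x}"
| "wr (Write a e1 e2) = {}"
| "wr (Seq c d) = wr c \<union> wr d"
| "wr (com.If b c d) = wr c \<union> wr d"
| "wr (While b c) = wr c"

fun wa :: "com \<Rightarrow> string set" where
  "wa Skip = {}"
| "wa (Assign x e) = {}"
| "wa (Write a e1 e2) = {a}"
| "wa (Seq c d) = wa c \<union> wa d"
| "wa (com.If b c d) = wa c \<union> wa d"
| "wa (While b c) = wa c"

lemma exec_flat: "flat c \<Longrightarrow> \<exists>t\<le>cst c. exec c s t (eff c s)"
proof (induction c arbitrary: s)
  case (Seq c d)
  obtain t1 where t1: "t1 \<le> cst c" "exec c s t1 (eff c s)" using Seq by auto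
  obtain t2 where t2: "t2 \<le> cst d" "exec d (eff c s) t2 (eff d (eff c s))" using Seq by fastforce
  show ?case using exec.Seq[OF t1(2) t2(2)] t1(1) t2(1) by (intro exI[of _ "t1 + t2"]) simp
next
  case (If b c d)
  show ?case
  proof (cases "bval b s")
    case True
    obtain t where "t \<le> cst c" "exec c s t (eff c s)" using If by auto
    then show ?thesis using exec.IfTrue[OF True, of c t _ d] True by (intro exI[of _ "1 + bcost b + t"]) simp
  next
    case False
    obtain t where "t \<le> cst d" "exec d s t (eff d s)" using If by fastforce
    then show ?thesis using exec.IfFalse[OF False, of d t _ c] False by (intro exI[of _ "1 + bcost b + t"]) simp
  qed
qed (auto intro: exec.intros simp del: One_nat_def plus_1_eq_Suc)

text \<open>The frame condition, read off syntactically: everything outside \<open>wr c\<close> and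
  \<open>wa c\<close> keeps its value.\<close>

definition same :: "com \<Rightarrow> store \<Rightarrow> store \<Rightarrow> bool" where
  "same c s s' \<longleftrightarrow> (\<forall>x. x \<notin> wr c \<longrightarrow> regs s' x = regs s x) \<and> (\<forall>a. a \<notin> wa c \<longrightarrow> arrays s' a = arrays s a)"

lemma exec_same: "exec c s t s' \<Longrightarrow> same c s s'"
  by (induction rule: exec.induct) (auto simp: same_def)

lemma same_eff: "flat c \<Longrightarrow> same c s (eff c s)"
  using exec_flat exec_same by blast

text \<open>The only loop form in the program. Bodies are loop-free, so loops never nest, which is
  what keeps the running time linear. The bound \<open>e\<close> is evaluated anew in every round
  and has to be stable.\<close>

definition For :: "aexp \<Rightarrow> com \<Rightarrow> com" where
  "For e c = Seq (Assign ''k'' (Const 0))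
     (While (Less (Reg ''k'') e) (Seq c (Assign ''k'' (Add (Reg ''k'') (Const 1)))))"

lemma wr_For [simp]: "wr (For e c) = insert ''k'' (wr c)" and wa_For [simp]: "wa (For e c) = wa c"
  by (auto simp: For_def)

lemma exec_For:
  assumes c: "flat c" "''k'' \<notin> wr c"
    and e: "\<And>s. same (For e c) s0 s \<Longrightarrow> aval e s = int L"
    and I0: "I 0 (s0\<lparr>regs := (regs s0)(''k'' := 0)\<rparr>)"
    and step: "\<And>i s. i < L \<Longrightarrow> same (For e c) s0 s \<Longrightarrow> regs s ''k'' = int i \<Longrightarrow> I i s \<Longrightarrow>
      I (Suc i) ((eff c s)\<lparr>regs := (regs (eff c s))(''k'' := int (Suc i))\<rparr>)"
  shows "\<exists>t s'. exec (For e c) s0 t s' \<and> t \<le> (acost e + cst c + 10) * Suc L \<and> I L s' \<and> same (For e c) s0 s'"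
proof -
  let ?b = "Less (Reg ''k'') e" and ?d = "Seq c (Assign ''k'' (Add (Reg ''k'') (Const 1)))"
  let ?K = "acost e + cst c + 8"
  have main: "\<exists>t s'. exec (While ?b ?d) s t s' \<and> t \<le> ?K * Suc (L - i) \<and> I L s'"
    if a: "i \<le> L" "same (For e c) s0 s" "regs s ''k'' = int i" "I i s" for i s
    using a
  proof (induction "L - i" arbitrary: i s)
    case 0
    then have "\<not> bval ?b s" using e by simp
    from exec.WhileFalse[OF this] show ?case using 0 by (intro exI[of _ "1 + bcost ?b"] exI[of _ s]) simp
  next
    case (Suc l)
    have lt: "i < L" using Suc by simp
    then have b: "bval ?b s" using e Suc.prems by simp
    obtain t1 where t1: "t1 \<le> cst c" "exec c s t1 (eff c s)" using exec_flat[OF c(1)] by blast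
    have kk: "regs (eff c s) ''k'' = int i" using same_eff[OF c(1), of s] c(2) Suc.prems by (simp add: same_def)
    let ?s1 = "(eff c s)\<lparr>regs := (regs (eff c s))(''k'' := int (Suc i))\<rparr>"
    have x: "exec (Assign ''k'' (Add (Reg ''k'') (Const 1))) (eff c s) 4 ?s1"
      using exec.Assign[of "''k''" "Add (Reg ''k'') (Const 1)" "eff c s"] kk by (simp add: add.commute eval_nat_numeral)
    have d: "exec ?d s (t1 + 4) ?s1" by (rule exec.Seq[OF t1(2) x])
    have sm: "same (For e c) s0 ?s1"
      using exec_same[OF t1(2)] Suc.prems(2) by (auto simp: same_def)
    have "\<exists>t s'. exec (While ?b ?d) ?s1 t s' \<and> t \<le> ?K * Suc (L - Suc i) \<and> I L s'"
      by (rule Suc.hyps(1)) (use Suc.hyps(2) lt sm step[OF lt Suc.prems(2-4)] in simp_all)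
    then obtain t2 s' where t2: "exec (While ?b ?d) ?s1 t2 s'" "t2 \<le> ?K * Suc (L - Suc i)" "I L s'" by blast
    have "1 + bcost ?b + (t1 + 4) + t2 \<le> ?K + ?K * Suc (L - Suc i)" using t1(1) t2(2) by simp
    also have "\<dots> = ?K * Suc (L - i)" using lt by (simp add: Suc_diff_Suc[symmetric])
    finally show ?case using exec.WhileTrue[OF b d t2(1)] t2(3) by blast
  qed
  let ?s0 = "s0\<lparr>regs := (regs s0)(''k'' := 0)\<rparr>"
  have "same (For e c) s0 ?s0" by (simp add: same_def)
  from main[of 0, OF _ this] I0 obtain t s' where t: "exec (While ?b ?d) ?s0 t s'" "t \<le> ?K * Suc L" "I L s'" by auto
  have "exec (Assign ''k'' (Const 0)) s0 2 ?s0" using exec.Assign[of "''k''" "Const 0" s0] by (simp add: eval_nat_numeral)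
  from exec.Seq[OF this t(1)] have x: "exec (For e c) s0 (2 + t) s'" by (simp add: For_def)
  have "2 + t \<le> (acost e + cst c + 10) * Suc L" using t(2) by (simp add: algebra_simps)
  then show ?thesis using x t(3) exec_same[OF x] by blast
qed

type_synonym pre = "nat \<Rightarrow> nat \<Rightarrow> (nat \<times> nat \<Rightarrow> nat) \<Rightarrow> store \<Rightarrow> bool"

text \<open>A Hoare triple with running time: the constant \<open>K\<close> is chosen before the
  instance, so the cost is linear in the number of cells. Postconditions also see the initial
  store.\<close>

definition triple :: "pre \<Rightarrow> com \<Rightarrow> (nat \<Rightarrow> nat \<Rightarrow> (nat \<times> nat \<Rightarrow> nat) \<Rightarrow> store \<Rightarrow> store \<Rightarrow> bool) \<Rightarrow> bool" where
  "triple P c Q \<longleftrightarrow> (\<exists>K. \<forall>m n w s. P m n w s \<longrightarrow>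
     (\<exists>t s'. exec c s t s' \<and> t \<le> K * (m * n) \<and> Q m n w s s' \<and> same c s s'))"

lemma triple_flat:
  assumes "flat c" "\<And>m n w s. P m n w s \<Longrightarrow> 1 \<le> m * n" "\<And>m n w s. P m n w s \<Longrightarrow> same c s (eff c s) \<Longrightarrow> Q m n w s (eff c s)"
  shows "triple P c Q"
  unfolding triple_def
proof (rule exI[of _ "cst c"], intro allI impI)
  fix m n w s assume P: "P m n w s"
  obtain t where t: "t \<le> cst c" "exec c s t (eff c s)" using exec_flat[OF assms(1)] by blast
  have "cst c * 1 \<le> cst c * (m * n)" using assms(2)[OF P] by (rule mult_le_mono2)
  then have "t \<le> cst c * (m * n)" using t(1) by linarith
  then show "\<exists>t s'. exec c s t s' \<and> t \<le> cst c * (m * n) \<and> Q m n w s s' \<and> same c s s'"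
    using t(2) assms(3)[OF P exec_same[OF t(2)]] exec_same[OF t(2)] by blast
qed

lemma triple_Seq:
  assumes "triple P c Q" "triple P' d Q'"
    and "\<And>m n w s s'. P m n w s \<Longrightarrow> Q m n w s s' \<Longrightarrow> same c s s' \<Longrightarrow> P' m n w s'"
    and "\<And>m n w s s' s''. P m n w s \<Longrightarrow> Q m n w s s' \<Longrightarrow> same c s s' \<Longrightarrow> Q' m n w s' s'' \<Longrightarrow> same d s' s'' \<Longrightarrow> R m n w s s''"
  shows "triple P (Seq c d) R"
proof -
  obtain K where K: "\<And>m n w s. P m n w s \<Longrightarrow> \<exists>t s'. exec c s t s' \<and> t \<le> K * (m * n) \<and> Q m n w s s' \<and> same c s s'"
    using assms(1) unfolding triple_def by metis
  obtain K' where K': "\<And>m n w s. P' m n w s \<Longrightarrow> \<exists>t s'. exec d s t s' \<and> t \<le> K' * (m * n) \<and> Q' m n w s s' \<and> same d s s'"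
    using assms(2) unfolding triple_def by metis
  show ?thesis
    unfolding triple_def
  proof (rule exI[of _ "K + K'"], intro allI impI)
    fix m n w s assume P: "P m n w s"
    obtain t s' where 1: "exec c s t s'" "t \<le> K * (m * n)" "Q m n w s s'" "same c s s'" using K[OF P] by blast
    obtain t' s'' where 2: "exec d s' t' s''" "t' \<le> K' * (m * n)" "Q' m n w s' s''" "same d s' s''" using K'[OF assms(3)[OF P 1(3,4)]] by blast
    show "\<exists>t s''. exec (Seq c d) s t s'' \<and> t \<le> (K + K') * (m * n) \<and> R m n w s s'' \<and> same (Seq c d) s s''"
      using exec.Seq[OF 1(1) 2(1)] exec_same[OF exec.Seq[OF 1(1) 2(1)]] assms(4)[OF P 1(3,4) 2(3,4)] 1(2) 2(2)
      by (intro exI[of _ "t + t'"] exI[of _ s'']) (simp add: add_mult_distrib)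
  qed
qed

lemma triple_If:
  assumes "triple (\<lambda>m n w s. P m n w s \<and> bval b s) c Q" "triple (\<lambda>m n w s. P m n w s \<and> \<not> bval b s) d Q"
    and "\<And>m n w s. P m n w s \<Longrightarrow> 1 \<le> m * n"
  shows "triple P (com.If b c d) Q"
proof -
  obtain K where K: "\<And>m n w s. P m n w s \<Longrightarrow> bval b s \<Longrightarrow> \<exists>t s'. exec c s t s' \<and> t \<le> K * (m * n) \<and> Q m n w s s' \<and> same c s s'"
    using assms(1) unfolding triple_def by metis
  obtain K' where K': "\<And>m n w s. P m n w s \<Longrightarrow> \<not> bval b s \<Longrightarrow> \<exists>t s'. exec d s t s' \<and> t \<le> K' * (m * n) \<and> Q m n w s s' \<and> same d s s'"
    using assms(2) unfolding triple_def by metis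
  show ?thesis
    unfolding triple_def
  proof (rule exI[of _ "1 + bcost b + K + K'"], intro allI impI)
    fix m n w s assume P: "P m n w s"
    have "(1 + bcost b) * 1 \<le> (1 + bcost b) * (m * n)" using assms(3)[OF P] by (rule mult_le_mono2)
    then have le: "1 + bcost b + t \<le> (1 + bcost b + K + K') * (m * n)" if "t \<le> K * (m * n) \<or> t \<le> K' * (m * n)" for t
      using that unfolding add_mult_distrib by linarith
    show "\<exists>t s'. exec (com.If b c d) s t s' \<and> t \<le> (1 + bcost b + K + K') * (m * n) \<and> Q m n w s s' \<and> same (com.If b c d) s s'"
    proof (cases "bval b s")
      case True
      obtain t s' where 1: "exec c s t s'" "t \<le> K * (m * n)" "Q m n w s s'" using K[OF P True] by blast
      have x: "exec (com.If b c d) s (1 + bcost b + t) s'" by (rule exec.IfTrue[OF True 1(1)])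
      then show ?thesis using le 1 exec_same by blast
    next
      case False
      obtain t s' where 1: "exec d s t s'" "t \<le> K' * (m * n)" "Q m n w s s'" using K'[OF P False] by blast
      have x: "exec (com.If b c d) s (1 + bcost b + t) s'" by (rule exec.IfFalse[OF False 1(1)])
      then show ?thesis using le 1 exec_same by blast
    qed
  qed
qed

lemma triple_For:
  assumes c: "flat c" "''k'' \<notin> wr c"
    and N: "\<And>m n w s. P m n w s \<Longrightarrow> 1 \<le> m * n" "\<And>m n w s. P m n w s \<Longrightarrow> L m n \<le> 3 * (m * n)"
    and e: "\<And>m n w s0 s. P m n w s0 \<Longrightarrow> same (For e c) s0 s \<Longrightarrow> aval e s = int (L m n)"
    and I0: "\<And>m n w s0. P m n w s0 \<Longrightarrow> I m n w s0 0 (s0\<lparr>regs := (regs s0)(''k'' := 0)\<rparr>)"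
    and step: "\<And>m n w s0 i s. P m n w s0 \<Longrightarrow> i < L m n \<Longrightarrow> same (For e c) s0 s \<Longrightarrow> regs s ''k'' = int i \<Longrightarrow> I m n w s0 i s \<Longrightarrow>
      I m n w s0 (Suc i) ((eff c s)\<lparr>regs := (regs (eff c s))(''k'' := int (Suc i))\<rparr>)"
    and Q: "\<And>m n w s0 s. P m n w s0 \<Longrightarrow> same (For e c) s0 s \<Longrightarrow> I m n w s0 (L m n) s \<Longrightarrow> Q m n w s0 s"
  shows "triple P (For e c) Q"
  unfolding triple_def
proof (rule exI[of _ "(acost e + cst c + 10) * 4"], intro allI impI)
  fix m n w s0 assume P: "P m n w s0"
  have "\<exists>t s'. exec (For e c) s0 t s' \<and> t \<le> (acost e + cst c + 10) * Suc (L m n) \<and> I m n w s0 (L m n) s' \<and> same (For e c) s0 s'"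
    by (rule exec_For[OF c e[OF P] I0[OF P] step[OF P]])
  then obtain t s' where t: "exec (For e c) s0 t s'" "t \<le> (acost e + cst c + 10) * Suc (L m n)" "I m n w s0 (L m n) s'" "same (For e c) s0 s'" by blast
  have "Suc (L m n) \<le> 4 * (m * n)" using N[OF P] by linarith
  then have "(acost e + cst c + 10) * Suc (L m n) \<le> (acost e + cst c + 10) * (4 * (m * n))" by (rule mult_le_mono2)
  then have "t \<le> (acost e + cst c + 10) * 4 * (m * n)" using t(2) by (simp only: mult.assoc)
  then show "\<exists>t s'. exec (For e c) s0 t s' \<and> t \<le> (acost e + cst c + 10) * 4 * (m * n) \<and> Q m n w s0 s' \<and> same (For e c) s0 s'"
    using t Q[OF P t(4,3)] by blast
qed

lemma triple_conseq:
  assumes "triple P c Q" "\<And>m n w s. P' m n w s \<Longrightarrow> P m n w s"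
    "\<And>m n w s s'. P' m n w s \<Longrightarrow> same c s s' \<Longrightarrow> Q m n w s s' \<Longrightarrow> Q' m n w s s'"
  shows "triple P' c Q'"
proof -
  obtain K where K: "\<And>m n w s. P m n w s \<Longrightarrow> \<exists>t s'. exec c s t s' \<and> t \<le> K * (m * n) \<and> Q m n w s s' \<and> same c s s'"
    using assms(1) unfolding triple_def by metis
  show ?thesis unfolding triple_def
  proof (rule exI[of _ K], intro allI impI)
    fix m n w s assume P: "P' m n w s"
    obtain t s' where 1: "exec c s t s'" "t \<le> K * (m * n)" "Q m n w s s'" "same c s s'" using K[OF assms(2)[OF P]] by blast
    then show "\<exists>t s'. exec c s t s' \<and> t \<le> K * (m * n) \<and> Q' m n w s s' \<and> same c s s'" using assms(3)[OF P 1(4,3)] by blast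
  qed
qed

definition Eq :: "aexp \<Rightarrow> aexp \<Rightarrow> bexp" where "Eq a b = bexp.And (bexp.Not (Less a b)) (bexp.Not (Less b a))"

lemma bval_Eq [simp]: "bval (Eq a b) s \<longleftrightarrow> aval a s = aval b s"
  by (auto simp: Eq_def)

section \<open>The program\<close>

text \<open>Inverse of \<open>cell n\<close> on positions below \<open>m * n\<close>.\<close>

definition cel :: "nat \<Rightarrow> nat \<Rightarrow> nat \<times> nat" where "cel n k = (Suc (k div n), Suc (k mod n))"

lemma cell_cel: "cell n (cel n k) = int k"
proof -
  have "int (k div n) * int n + int (k mod n) = int k" by (metis div_mult_mod_eq of_nat_add of_nat_mult)
  then show ?thesis by (simp add: cell_def cel_def)
qed

lemma cel_grid: "k < m * n \<Longrightarrow> cel n k \<in> grid m n"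
proof -
  assume k: "k < m * n"
  then have "0 < n" by (cases n) auto
  moreover have "k div n < m" using k by (simp add: less_mult_imp_div_less)
  ultimately show ?thesis by (simp add: cel_def Suc_le_eq)
qed

lemma cel_surj: assumes "v \<in> grid m n" obtains k where "k < m * n" "v = cel n k"
proof -
  obtain i j where v: "v = (Suc i, Suc j)" "i < m" "j < n"
    using assms by (cases v; case_tac a; case_tac b) auto
  have "Suc i * n \<le> m * n" using v by (intro mult_le_mono1) simp
  then have "i * n + j < m * n" using v by simp
  moreover have "(i * n + j) div n = i" "(i * n + j) mod n = j" using v by simp_all
  ultimately show ?thesis using that[of "i * n + j"] v by (simp add: cel_def)
qed

lemma bij_cel: "bij_betw (cel n) {..<m * n} (grid m n)"
proof (rule bij_betw_imageI)
  show "inj_on (cel n) {..<m * n}" by (rule inj_onI) (metis cell_cel of_nat_eq_iff)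
  show "cel n ` {..<m * n} = grid m n"
  proof (intro equalityI subsetI)
    fix v assume "v \<in> grid m n"
    then show "v \<in> cel n ` {..<m * n}" by (rule cel_surj) simp
  next
    fix v assume "v \<in> cel n ` {..<m * n}"
    then show "v \<in> grid m n" using cel_grid by blast
  qed
qed

lemma cell_inj: "u \<in> grid m n \<Longrightarrow> v \<in> grid m n \<Longrightarrow> cell n u = cell n v \<Longrightarrow> u = v"
  by (metis cel_surj cell_cel of_nat_eq_iff)

lemma sum_cel: "sum h (grid m n) = (\<Sum>k<m * n. h (cel n k))"
  by (rule sum.reindex_bij_betw[OF bij_cel, symmetric])

lemma sum_restrict:
  fixes w :: "nat \<times> nat \<Rightarrow> nat"
  assumes "X \<subseteq> grid m n"
  shows "sum w X = (\<Sum>k<m * n. if cel n k \<in> X then w (cel n k) else 0)"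
proof -
  have "sum w X = sum w (grid m n \<inter> X)" using assms by (simp add: Int_absorb1)
  also have "\<dots> = (\<Sum>v\<in>grid m n. if v \<in> X then w v else 0)" by (rule sum.inter_restrict) simp
  also have "\<dots> = (\<Sum>k<m * n. if cel n k \<in> X then w (cel n k) else 0)" by (rule sum_cel)
  finally show ?thesis .
qed

definition heavy_rows :: "nat \<Rightarrow> nat \<Rightarrow> (nat \<times> nat \<Rightarrow> nat) \<Rightarrow> nat set" where
  "heavy_rows m n w = {1, 2, m - 1, m} \<union> fst ` {v \<in> grid m n. sum w (grid m n) \<le> 5 * w v}"

definition heavy_cols :: "nat \<Rightarrow> nat \<Rightarrow> (nat \<times> nat \<Rightarrow> nat) \<Rightarrow> nat set" where
  "heavy_cols m n w = {1, 2, n - 1, n} \<union> snd ` {v \<in> grid m n. sum w (grid m n) \<le> 5 * w v}"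

text \<open>The class map in the form in which one loop fills its table. Index 0 relies on memory
  being zero initially; since row 1 is always marked, row 1 gets number 1.\<close>

fun cm :: "nat set \<Rightarrow> nat \<Rightarrow> nat" where
  "cm R 0 = 0"
| "cm R (Suc i) = (if i \<in> R \<or> Suc i \<in> R then Suc (cm R i) else cm R i)"

definition Base :: pre where
  "Base m n w s \<longleftrightarrow> 3 \<le> m \<and> 3 \<le> n \<and> (\<forall>v\<in>grid m n. 0 < w v) \<and> regs s ''m'' = int m \<and> regs s ''n'' = int n \<and>
     (\<forall>k<m * n. arrays s ''w'' (int k) = int (w (cel n k)))"

definition PA :: pre where
  "PA m n w s \<longleftrightarrow> Base m n w s \<and> regs s ''W'' = 0 \<and> regs s ''b'' = 0 \<and>
    (\<forall>i. arrays s ''S'' i = 0 \<and> arrays s ''T'' i = 0 \<and> arrays s ''p'' i = 0 \<and> arrays s ''f'' i = 0 \<and> arrays s ''g'' i = 0)"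

definition PB :: pre where
  "PB m n w s \<longleftrightarrow> PA m n w s \<and> regs s ''N'' = int (m * n) \<and> (\<forall>i\<le>m. arrays s ''r'' (int i) = int (i * n))"

definition PC :: pre where
  "PC m n w s \<longleftrightarrow> Base m n w s \<and> regs s ''W'' = int (sum w (grid m n)) \<and> regs s ''b'' = 0 \<and>
    (\<forall>i. arrays s ''S'' i = 0 \<and> arrays s ''T'' i = 0 \<and> arrays s ''p'' i = 0 \<and> arrays s ''f'' i = 0 \<and> arrays s ''g'' i = 0) \<and>
    regs s ''N'' = int (m * n) \<and> (\<forall>i\<le>m. arrays s ''r'' (int i) = int (i * n))"

definition Core :: pre where
  "Core m n w s \<longleftrightarrow> Base m n w s \<and> regs s ''W'' = int (sum w (grid m n)) \<and>
     regs s ''N'' = int (m * n) \<and> (\<forall>i\<le>m. arrays s ''r'' (int i) = int (i * n)) \<and>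
     (\<forall>k<m * n. arrays s ''I'' (int k) = int (Suc (k div n)) \<and> arrays s ''J'' (int k) = int (Suc (k mod n)))"

definition PD :: pre where
  "PD m n w s \<longleftrightarrow> Core m n w s \<and> regs s ''b'' = 0 \<and>
    (\<forall>i. arrays s ''p'' i = 0 \<and> arrays s ''f'' i = 0 \<and> arrays s ''g'' i = 0) \<and>
    (\<forall>i::nat. arrays s ''S'' (int i) = (if i \<in> heavy_rows m n w then 1 else 0)) \<and>
    (\<forall>i::nat. arrays s ''T'' (int i) = (if i \<in> heavy_cols m n w then 1 else 0))"

text \<open>The tables replace missing arithmetic: \<open>r\<close> multiplies by \<open>n\<close>,
  \<open>I\<close> and \<open>J\<close> give quotient and remainder, \<open>p\<close> gives parity,
  \<open>f\<close> and \<open>g\<close> the classes. Tables \<open>p\<close>, \<open>f\<close>,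
  \<open>g\<close> extend to index \<open>m * n\<close> because one loop over the cells fills them
  all.\<close>

definition Env :: pre where
  "Env m n w s \<longleftrightarrow> Core m n w s \<and> (\<forall>i\<le>m * n. arrays s ''p'' (int i) = int (i mod 2)) \<and>
     (\<forall>i\<le>m * n. arrays s ''f'' (int i) = int (cm (heavy_rows m n w) i)) \<and>
     (\<forall>i\<le>m * n. arrays s ''g'' (int i) = int (cm (heavy_cols m n w) i))"

lemma same_refl_upd: "same c s0 s \<Longrightarrow> x \<notin> wr c \<Longrightarrow> regs s x = regs s0 x"
  "same c s0 s \<Longrightarrow> a \<notin> wa c \<Longrightarrow> arrays s a = arrays s0 a"
  by (auto simp: same_def)

section \<open>Computing the tables\<close>

definition phaseA :: com where
  "phaseA = Seq (For (Reg ''m'') (Write ''r'' (Add (Reg ''k'') (Const 1)) (Add (Read ''r'' (Reg ''k'')) (Reg ''n''))))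
     (Assign ''N'' (Read ''r'' (Reg ''m'')))"

lemma phaseA: "triple (\<lambda>m n w s. PA m n w s \<and> arrays s ''r'' 0 = 0) phaseA (\<lambda>m n w s. PB m n w)"
  unfolding phaseA_def
proof (rule triple_Seq[where Q = "\<lambda>m n w s0 s. \<forall>j\<le>m. arrays s ''r'' (int j) = int (j * n)"
      and P' = "\<lambda>m n w s. PA m n w s \<and> (\<forall>j\<le>m. arrays s ''r'' (int j) = int (j * n))" and Q' = "\<lambda>m n w s. PB m n w"])
  show "triple (\<lambda>m n w s. PA m n w s \<and> arrays s ''r'' 0 = 0)
     (For (Reg ''m'') (Write ''r'' (Add (Reg ''k'') (Const 1)) (Add (Read ''r'' (Reg ''k'')) (Reg ''n''))))
     (\<lambda>m n w s0 s. \<forall>j\<le>m. arrays s ''r'' (int j) = int (j * n))"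
  proof (rule triple_For[where L = "\<lambda>m n. m" and I = "\<lambda>m n w s0 i s. \<forall>j\<le>i. arrays s ''r'' (int j) = int (j * n)"])
    fix m n w s0 i s
    assume P: "PA m n w s0 \<and> arrays s0 ''r'' 0 = 0"
      and sm: "same (For (Reg ''m'') (Write ''r'' (Add (Reg ''k'') (Const 1)) (Add (Read ''r'' (Reg ''k'')) (Reg ''n'')))) s0 s"
      and k: "regs s ''k'' = int i" and I: "\<forall>j\<le>i. arrays s ''r'' (int j) = int (j * n)"
    have n: "regs s ''n'' = int n" using same_refl_upd(1)[OF sm, of "''n''"] P by (simp add: PA_def Base_def)
    have "int j = int i + 1 \<longleftrightarrow> j = Suc i" for j by auto
    then show "\<forall>j\<le>Suc i. arrays ((eff (Write ''r'' (Add (Reg ''k'') (Const 1)) (Add (Read ''r'' (Reg ''k'')) (Reg ''n''))) s)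
        \<lparr>regs := (regs (eff (Write ''r'' (Add (Reg ''k'') (Const 1)) (Add (Read ''r'' (Reg ''k'')) (Reg ''n''))) s))(''k'' := int (Suc i))\<rparr>) ''r'' (int j) = int (j * n)"
      using I k n by (auto simp: le_Suc_eq algebra_simps)
  qed (auto simp: same_def PA_def Base_def)
  show "triple (\<lambda>m n w s. PA m n w s \<and> (\<forall>j\<le>m. arrays s ''r'' (int j) = int (j * n))) (Assign ''N'' (Read ''r'' (Reg ''m''))) (\<lambda>m n w s. PB m n w)"
    by (rule triple_flat) (auto simp: PB_def PA_def Base_def)
qed (auto simp: PA_def Base_def same_def)

definition phaseB :: com where
  "phaseB = For (Reg ''N'') (Assign ''W'' (Add (Reg ''W'') (Read ''w'' (Reg ''k''))))"

lemma phaseB: "triple PB phaseB (\<lambda>m n w s. PC m n w)"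
  unfolding phaseB_def
proof (rule triple_For[where L = "\<lambda>m n. m * n" and I = "\<lambda>m n w s0 i s. regs s ''W'' = int (\<Sum>k<i. w (cel n k))"])
  fix m n w s0 i s
  assume P: "PB m n w s0" and i: "i < m * n" and sm: "same (For (Reg ''N'') (Assign ''W'' (Add (Reg ''W'') (Read ''w'' (Reg ''k''))))) s0 s"
    and k: "regs s ''k'' = int i" and I: "regs s ''W'' = int (\<Sum>k<i. w (cel n k))"
  have "arrays s ''w'' = arrays s0 ''w''" using same_refl_upd(2)[OF sm, of "''w''"] by simp
  then have "arrays s ''w'' (int i) = int (w (cel n i))" using P i by (simp add: PB_def PA_def Base_def)
  then show "regs ((eff (Assign ''W'' (Add (Reg ''W'') (Read ''w'' (Reg ''k'')))) s)
       \<lparr>regs := (regs (eff (Assign ''W'' (Add (Reg ''W'') (Read ''w'' (Reg ''k'')))) s))(''k'' := int (Suc i))\<rparr>) ''W'' =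
      int (\<Sum>k<Suc i. w (cel n k))" using k I by simp
next
  fix m n w s0 s
  assume P: "PB m n w s0" and sm: "same (For (Reg ''N'') (Assign ''W'' (Add (Reg ''W'') (Read ''w'' (Reg ''k''))))) s0 s"
    and I: "regs s ''W'' = int (\<Sum>k<m * n. w (cel n k))"
  show "PC m n w s" using P sm I[folded sum_cel[of w]] by (auto simp: PC_def PB_def PA_def Base_def same_def)
qed (auto simp: same_def PB_def PA_def Base_def)

text \<open>The registers \<open>i\<close>, \<open>j\<close> follow the row-major position
  \<open>k\<close> without division, and the comparison with one fifth of the total adds the weight
  five times instead of multiplying.\<close>

definition bodyC :: com where
  "bodyC = Seq (Write ''I'' (Reg ''k'') (Reg ''i'')) (Seq (Write ''J'' (Reg ''k'') (Reg ''j''))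
     (Seq (com.If (bexp.Not (Less (Add (Read ''w'' (Reg ''k'')) (Add (Add (Read ''w'' (Reg ''k'')) (Read ''w'' (Reg ''k''))) (Add (Read ''w'' (Reg ''k'')) (Read ''w'' (Reg ''k''))))) (Reg ''W'')))
        (Seq (Write ''S'' (Reg ''i'') (Const 1)) (Write ''T'' (Reg ''j'') (Const 1))) Skip)
      (com.If (Eq (Reg ''j'') (Reg ''n'')) (Seq (Assign ''j'' (Const 1)) (Assign ''i'' (Add (Reg ''i'') (Const 1)))) (Assign ''j'' (Add (Reg ''j'') (Const 1))))))"

definition scanned :: "nat \<Rightarrow> nat \<Rightarrow> (nat \<times> nat \<Rightarrow> nat) \<Rightarrow> nat \<Rightarrow> (nat \<times> nat) set" where
  "scanned m n w i = {cel n k |k. k < i \<and> sum w (grid m n) \<le> 5 * w (cel n k)}"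

lemma scanned_Suc: "scanned m n w (Suc i) = (if sum w (grid m n) \<le> 5 * w (cel n i) then insert (cel n i) (scanned m n w i) else scanned m n w i)"
  unfolding scanned_def by (auto simp: less_Suc_eq)

lemma scanned_all: "scanned m n w (m * n) = {v \<in> grid m n. sum w (grid m n) \<le> 5 * w v}"
proof (intro equalityI subsetI)
  fix v assume "v \<in> scanned m n w (m * n)"
  then obtain k where "v = cel n k" "k < m * n" "sum w (grid m n) \<le> 5 * w (cel n k)" unfolding scanned_def by blast
  then show "v \<in> {v \<in> grid m n. sum w (grid m n) \<le> 5 * w v}" using cel_grid[of k m n] by simp
next
  fix v assume v: "v \<in> {v \<in> grid m n. sum w (grid m n) \<le> 5 * w v}"
  then have "v \<in> grid m n" by blast
  then obtain k where "k < m * n" "v = cel n k" by (rule cel_surj)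
  then show "v \<in> scanned m n w (m * n)" using v unfolding scanned_def by blast
qed

definition invC :: "nat \<Rightarrow> nat \<Rightarrow> (nat \<times> nat \<Rightarrow> nat) \<Rightarrow> store \<Rightarrow> nat \<Rightarrow> store \<Rightarrow> bool" where
  "invC m n w s0 i s \<longleftrightarrow> regs s ''i'' = int (Suc (i div n)) \<and> regs s ''j'' = int (Suc (i mod n)) \<and>
     (\<forall>k<i. arrays s ''I'' (int k) = int (Suc (k div n)) \<and> arrays s ''J'' (int k) = int (Suc (k mod n))) \<and>
     (\<forall>r::nat. arrays s ''S'' (int r) = (if r \<in> fst ` scanned m n w i then 1 else 0)) \<and>
     (\<forall>r::nat. arrays s ''T'' (int r) = (if r \<in> snd ` scanned m n w i then 1 else 0))"

lemma loopC: "triple (\<lambda>m n w s. PC m n w s \<and> regs s ''i'' = 1 \<and> regs s ''j'' = 1) (For (Reg ''N'') bodyC) (\<lambda>m n w s0. invC m n w s0 (m * n))"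
proof (rule triple_For[where L = "\<lambda>m n. m * n" and I = invC])
  fix m n w s0 i s
  assume P: "PC m n w s0 \<and> regs s0 ''i'' = 1 \<and> regs s0 ''j'' = 1" and i: "i < m * n" and sm: "same (For (Reg ''N'') bodyC) s0 s"
    and k: "regs s ''k'' = int i" and I: "invC m n w s0 i s"
  have "arrays s ''w'' = arrays s0 ''w''" using same_refl_upd(2)[OF sm, of "''w''"] by (simp add: bodyC_def)
  then have w: "arrays s ''w'' (int i) = int (w (cel n i))" using P i by (simp add: PC_def Base_def)
  have W: "regs s ''W'' = int (sum w (grid m n))" "regs s ''n'' = int n"
    using same_refl_upd(1)[OF sm, of "''W''"] same_refl_upd(1)[OF sm, of "''n''"] P by (simp_all add: bodyC_def PC_def Base_def)
  have n: "0 < n" using P by (simp add: PC_def Base_def)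
  have h: "\<not> (int (w (cel n i)) + (int (w (cel n i)) + int (w (cel n i)) + (int (w (cel n i)) + int (w (cel n i)))) < int (sum w (grid m n))) \<longleftrightarrow> sum w (grid m n) \<le> 5 * w (cel n i)"
    by linarith
  have c: "fst (cel n i) = Suc (i div n)" "snd (cel n i) = Suc (i mod n)" by (simp_all add: cel_def)
  have dm: "Suc i div n = (if Suc (i mod n) = n then Suc (i div n) else i div n)" "Suc i mod n = (if Suc (i mod n) = n then 0 else Suc (i mod n))"
    by (auto simp: div_Suc mod_Suc)
  have jn: "int (Suc (i mod n)) = int n \<longleftrightarrow> Suc (i mod n) = n" by (rule of_nat_eq_iff)
  define hv where "hv \<longleftrightarrow> sum w (grid m n) \<le> 5 * w (cel n i)"
  define en where "en \<longleftrightarrow> Suc (i mod n) = n"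
  define s1 where "s1 = eff (Seq (Write ''I'' (Reg ''k'') (Reg ''i'')) (Write ''J'' (Reg ''k'') (Reg ''j''))) s"
  have Is: "regs s ''i'' = int (Suc (i div n))" "regs s ''j'' = int (Suc (i mod n))"
    "\<And>k. k < i \<Longrightarrow> arrays s ''I'' (int k) = int (Suc (k div n)) \<and> arrays s ''J'' (int k) = int (Suc (k mod n))"
    "\<And>r::nat. arrays s ''S'' (int r) = (if r \<in> fst ` scanned m n w i then 1 else 0)"
    "\<And>r::nat. arrays s ''T'' (int r) = (if r \<in> snd ` scanned m n w i then 1 else 0)"
    using I by (auto simp: invC_def)
  have e: "eff bodyC s = (let s2 = s\<lparr>arrays := (arrays s)(''I'' := (arrays s ''I'')(int i := int (Suc (i div n))), ''J'' := (arrays s ''J'')(int i := int (Suc (i mod n))))\<rparr>;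
      s3 = (if hv then s2\<lparr>arrays := (arrays s2)(''S'' := (arrays s ''S'')(int (Suc (i div n)) := 1), ''T'' := (arrays s ''T'')(int (Suc (i mod n)) := 1))\<rparr> else s2)
      in if en then s3\<lparr>regs := (regs s)(''j'' := 1, ''i'' := int (Suc (i div n)) + 1)\<rparr> else s3\<lparr>regs := (regs s)(''j'' := int (Suc (i mod n)) + 1)\<rparr>)"
    unfolding bodyC_def hv_def en_def h[symmetric] jn[symmetric] by (simp add: k w W Is(1,2) Let_def del: of_nat_Suc)
  show "invC m n w s0 (Suc i) ((eff bodyC s)\<lparr>regs := (regs (eff bodyC s))(''k'' := int (Suc i))\<rparr>)"
    unfolding invC_def scanned_Suc hv_def[symmetric] dm en_def[symmetric] e Let_def
    by (cases hv; cases en) (use Is c in \<open>simp_all add: less_Suc_eq all_conj_distrib\<close>)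
next
  fix m n w s0
  assume P: "PC m n w s0 \<and> regs s0 ''i'' = 1 \<and> regs s0 ''j'' = 1"
  then show "invC m n w s0 0 (s0\<lparr>regs := (regs s0)(''k'' := 0)\<rparr>)" by (simp add: invC_def PC_def scanned_def)
qed (auto simp: same_def PC_def Base_def bodyC_def)

definition marks :: com where
  "marks = Seq (Seq (Seq (Write ''S'' (Const 1) (Const 1)) (Write ''S'' (Const 2) (Const 1)))
      (Seq (Write ''S'' (Sub (Reg ''m'') (Const 1)) (Const 1)) (Write ''S'' (Reg ''m'') (Const 1))))
    (Seq (Seq (Write ''T'' (Const 1) (Const 1)) (Write ''T'' (Const 2) (Const 1)))
      (Seq (Write ''T'' (Sub (Reg ''n'') (Const 1)) (Const 1)) (Write ''T'' (Reg ''n'') (Const 1))))"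

definition phaseC :: com where
  "phaseC = Seq (Seq (Assign ''i'' (Const 1)) (Assign ''j'' (Const 1))) (Seq (For (Reg ''N'') bodyC) marks)"

lemma phaseC: "triple PC phaseC (\<lambda>m n w s. PD m n w)"
  unfolding phaseC_def
proof (rule triple_Seq[where Q = "\<lambda>m n w s0 s. PC m n w s \<and> regs s ''i'' = 1 \<and> regs s ''j'' = 1"
      and P' = "\<lambda>m n w s. PC m n w s \<and> regs s ''i'' = 1 \<and> regs s ''j'' = 1" and Q' = "\<lambda>m n w s. PD m n w"])
  show "triple (\<lambda>m n w s. PC m n w s \<and> regs s ''i'' = 1 \<and> regs s ''j'' = 1) (Seq (For (Reg ''N'') bodyC) marks) (\<lambda>m n w s. PD m n w)"
  proof (rule triple_Seq[OF loopC, where P' = "\<lambda>m n w s. Core m n w s \<and> regs s ''b'' = 0 \<and>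
    (\<forall>i. arrays s ''p'' i = 0 \<and> arrays s ''f'' i = 0 \<and> arrays s ''g'' i = 0) \<and>
    (\<forall>r::nat. arrays s ''S'' (int r) = (if r \<in> fst ` scanned m n w (m * n) then 1 else 0)) \<and>
    (\<forall>r::nat. arrays s ''T'' (int r) = (if r \<in> snd ` scanned m n w (m * n) then 1 else 0))" and Q' = "\<lambda>m n w s. PD m n w"])
    fix m n w s s'
    assume "PC m n w s \<and> regs s ''i'' = 1 \<and> regs s ''j'' = 1" "invC m n w s (m * n) s'" "same (For (Reg ''N'') bodyC) s s'"
    then show "Core m n w s' \<and> regs s' ''b'' = 0 \<and>
    (\<forall>i. arrays s' ''p'' i = 0 \<and> arrays s' ''f'' i = 0 \<and> arrays s' ''g'' i = 0) \<and>
    (\<forall>r::nat. arrays s' ''S'' (int r) = (if r \<in> fst ` scanned m n w (m * n) then 1 else 0)) \<and>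
    (\<forall>r::nat. arrays s' ''T'' (int r) = (if r \<in> snd ` scanned m n w (m * n) then 1 else 0))"
      by (simp add: same_def bodyC_def Core_def PC_def Base_def invC_def)
  next
    show "triple (\<lambda>m n w s. Core m n w s \<and> regs s ''b'' = 0 \<and>
    (\<forall>i. arrays s ''p'' i = 0 \<and> arrays s ''f'' i = 0 \<and> arrays s ''g'' i = 0) \<and>
    (\<forall>r::nat. arrays s ''S'' (int r) = (if r \<in> fst ` scanned m n w (m * n) then 1 else 0)) \<and>
    (\<forall>r::nat. arrays s ''T'' (int r) = (if r \<in> snd ` scanned m n w (m * n) then 1 else 0))) marks (\<lambda>m n w s. PD m n w)"
    proof (rule triple_flat)
      fix m n w s assume P: "Core m n w s \<and> regs s ''b'' = 0 \<and>
    (\<forall>i. arrays s ''p'' i = 0 \<and> arrays s ''f'' i = 0 \<and> arrays s ''g'' i = 0) \<and>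
    (\<forall>r::nat. arrays s ''S'' (int r) = (if r \<in> fst ` scanned m n w (m * n) then 1 else 0)) \<and>
    (\<forall>r::nat. arrays s ''T'' (int r) = (if r \<in> snd ` scanned m n w (m * n) then 1 else 0))"
      have mn: "3 \<le> m" "3 \<le> n" and r: "regs s ''m'' = int m" "regs s ''n'' = int n" using P by (simp_all add: Core_def Base_def)
      have i: "int x = 1 \<longleftrightarrow> x = 1" "int x = 2 \<longleftrightarrow> x = 2" "int x = int m - 1 \<longleftrightarrow> x = m - 1" "int x = int n - 1 \<longleftrightarrow> x = n - 1" for x
        using mn by auto
      have A: "arrays (eff marks s) ''S'' (int x) = (if x = m \<or> x = m - 1 \<or> x = 2 \<or> x = 1 then 1 else arrays s ''S'' (int x))"
        "arrays (eff marks s) ''T'' (int x) = (if x = n \<or> x = n - 1 \<or> x = 2 \<or> x = 1 then 1 else arrays s ''T'' (int x))" for x :: nat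
        by (simp_all add: marks_def r i fun_upd_apply del: One_nat_def)
      have B: "x \<in> heavy_rows m n w \<longleftrightarrow> (x = m \<or> x = m - 1 \<or> x = 2 \<or> x = 1) \<or> x \<in> fst ` scanned m n w (m * n)"
        "x \<in> heavy_cols m n w \<longleftrightarrow> (x = n \<or> x = n - 1 \<or> x = 2 \<or> x = 1) \<or> x \<in> snd ` scanned m n w (m * n)" for x
        unfolding heavy_rows_def heavy_cols_def scanned_all[symmetric] by blast+
      have S: "\<forall>x::nat. arrays (eff marks s) ''S'' (int x) = (if x \<in> heavy_rows m n w then 1 else 0)"
        "\<forall>x::nat. arrays (eff marks s) ''T'' (int x) = (if x \<in> heavy_cols m n w then 1 else 0)"
        unfolding A B using P by (simp_all del: One_nat_def)
      show "PD m n w (eff marks s)" using P S by (simp add: PD_def Core_def Base_def marks_def)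
    qed (auto simp: marks_def Core_def Base_def)
  qed simp
  show "triple PC (Seq (Assign ''i'' (Const 1)) (Assign ''j'' (Const 1))) (\<lambda>m n w s0 s. PC m n w s \<and> regs s ''i'' = 1 \<and> regs s ''j'' = 1)"
    by (rule triple_flat) (auto simp: PC_def Base_def)
qed simp_all

definition bodyD :: com where
  "bodyD = (Seq (Write ''p'' (Add (Reg ''k'') (Const 1)) (Sub (Const 1) (Read ''p'' (Reg ''k''))))
    (Seq (com.If (Less (Const 0) (Add (Read ''S'' (Reg ''k'')) (Read ''S'' (Add (Reg ''k'') (Const 1)))))
       (Write ''f'' (Add (Reg ''k'') (Const 1)) (Add (Read ''f'' (Reg ''k'')) (Const 1))) (Write ''f'' (Add (Reg ''k'') (Const 1)) (Read ''f'' (Reg ''k''))))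
     (com.If (Less (Const 0) (Add (Read ''T'' (Reg ''k'')) (Read ''T'' (Add (Reg ''k'') (Const 1)))))
       (Write ''g'' (Add (Reg ''k'') (Const 1)) (Add (Read ''g'' (Reg ''k'')) (Const 1))) (Write ''g'' (Add (Reg ''k'') (Const 1)) (Read ''g'' (Reg ''k''))))))"

definition phaseD :: com where "phaseD = For (Reg ''N'') bodyD"

definition invD :: "nat \<Rightarrow> nat \<Rightarrow> (nat \<times> nat \<Rightarrow> nat) \<Rightarrow> store \<Rightarrow> nat \<Rightarrow> store \<Rightarrow> bool" where
  "invD m n w s0 i s \<longleftrightarrow> (\<forall>j\<le>i. arrays s ''p'' (int j) = int (j mod 2) \<and>
    arrays s ''f'' (int j) = int (cm (heavy_rows m n w) j) \<and> arrays s ''g'' (int j) = int (cm (heavy_cols m n w) j))"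

lemma phaseD: "triple PD phaseD (\<lambda>m n w s s'. Env m n w s' \<and> regs s' ''b'' = 0)"
  unfolding phaseD_def
proof (rule triple_For[where L = "\<lambda>m n. m * n" and I = invD])
  fix m n w s0 i s
  assume P: "PD m n w s0" and i: "i < m * n" and sm: "same (For (Reg ''N'') bodyD) s0 s" and k: "regs s ''k'' = int i" and I': "invD m n w s0 i s"
  let ?R = "heavy_rows m n w" and ?C = "heavy_cols m n w"
  have ST: "arrays s ''S'' (int x) = (if x \<in> ?R then 1 else 0)" "arrays s ''T'' (int x) = (if x \<in> ?C then 1 else 0)" for x :: nat
    using same_refl_upd(2)[OF sm, of "''S''"] same_refl_upd(2)[OF sm, of "''T''"] P by (simp_all add: PD_def bodyD_def)
  have S1: "arrays s ''S'' (int i + 1) = (if Suc i \<in> ?R then 1 else 0)" "arrays s ''T'' (int i + 1) = (if Suc i \<in> ?C then 1 else 0)"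
    using ST[of "Suc i"] by (simp_all add: add.commute)
  have I: "arrays s ''p'' (int j) = int (j mod 2)" "arrays s ''f'' (int j) = int (cm ?R j)" "arrays s ''g'' (int j) = int (cm ?C j)" if "j \<le> i" for j
    using I' that unfolding invD_def by simp_all
  have ne: "int j = int i + 1 \<longleftrightarrow> j = Suc i" for j by auto
  have md: "int (Suc i mod 2) = 1 - int (i mod 2)" by (auto simp: mod_Suc)
  define F where "F = int (cm ?R (Suc i))"
  define G where "G = int (cm ?C (Suc i))"
  have e: "arrays (eff bodyD s) = (arrays s)(''p'' := (arrays s ''p'')(int i + 1 := int (Suc i mod 2)), ''f'' := (arrays s ''f'')(int i + 1 := F), ''g'' := (arrays s ''g'')(int i + 1 := G))"
    unfolding bodyD_def F_def G_def md by (cases "i \<in> ?R \<or> Suc i \<in> ?R"; cases "i \<in> ?C \<or> Suc i \<in> ?C") (auto simp: k ST S1[unfolded add.commute[of _ 1]] I add.commute)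
  show "invD m n w s0 (Suc i) ((eff bodyD s)\<lparr>regs := (regs (eff bodyD s))(''k'' := int (Suc i))\<rparr>)"
    unfolding invD_def
  proof (intro allI impI)
    fix j assume "j \<le> Suc i"
    then have "j = Suc i \<or> j \<noteq> Suc i \<and> j \<le> i" by linarith
    then show "arrays ((eff bodyD s)\<lparr>regs := (regs (eff bodyD s))(''k'' := int (Suc i))\<rparr>) ''p'' (int j) = int (j mod 2) \<and>
      arrays ((eff bodyD s)\<lparr>regs := (regs (eff bodyD s))(''k'' := int (Suc i))\<rparr>) ''f'' (int j) = int (cm ?R j) \<and>
      arrays ((eff bodyD s)\<lparr>regs := (regs (eff bodyD s))(''k'' := int (Suc i))\<rparr>) ''g'' (int j) = int (cm ?C j)"
    proof (elim disjE conjE)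
      assume "j = Suc i"
      then show ?thesis using F_def G_def by (simp add: e ne del: cm.simps)
    next
      assume "j \<noteq> Suc i" "j \<le> i"
      then show ?thesis using I[of j] by (simp add: e ne)
    qed
  qed
next
  fix m n w s0 s
  assume "PD m n w s0" "same (For (Reg ''N'') bodyD) s0 s" "invD m n w s0 (m * n) s"
  then show "Env m n w s \<and> regs s ''b'' = 0" by (simp add: same_def PD_def Core_def Base_def Env_def bodyD_def invD_def)
qed (auto simp: same_def PD_def Core_def Base_def bodyD_def invD_def)

lemma Env_same:
  assumes "Env m n w s0" "same c s0 s" "wr c \<inter> {''m'', ''n'', ''N'', ''W''} = {}" "wa c \<inter> {''w'', ''r'', ''I'', ''J'', ''p'', ''f'', ''g''} = {}"
  shows "Env m n w s"
proof -
  have "''m'' \<notin> wr c" "''n'' \<notin> wr c" "''N'' \<notin> wr c" "''W'' \<notin> wr c" "''w'' \<notin> wa c" "''r'' \<notin> wa c" "''I'' \<notin> wa c" "''J'' \<notin> wa c"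
    "''p'' \<notin> wa c" "''f'' \<notin> wa c" "''g'' \<notin> wa c" using assms(3,4) by blast+
  then show ?thesis using assms(1,2) by (simp add: Env_def Core_def Base_def same_def)
qed

section \<open>Evaluating and recording a candidate\<close>

definition dec :: "nat \<Rightarrow> nat \<Rightarrow> (int \<Rightarrow> int) \<Rightarrow> (nat \<times> nat) set" where
  "dec m n a = {v \<in> grid m n. a (cell n v) = 1}"

lemma dec_cel: "k < m * n \<Longrightarrow> cel n k \<in> dec m n a \<longleftrightarrow> a (int k) = 1"
  unfolding dec_def using cel_grid[of k m n] cell_cel[of n k] by simp

lemma dec_cong:
  assumes "\<And>k. k < m * n \<Longrightarrow> a (int k) = b (int k)" shows "dec m n a = dec m n b"
proof -
  have "a (cell n v) = b (cell n v)" if "v \<in> grid m n" for v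
    using that by (rule cel_surj) (simp add: cell_cel assms)
  then show ?thesis unfolding dec_def by (intro Collect_cong conj_cong refl) (simp only:)
qed

text \<open>The value 0 in \<open>b\<close> means that nothing has been recorded; it is unambiguous
  because positive weights give every bipartition a positive value.\<close>

definition J :: pre where
  "J m n w s \<longleftrightarrow> Env m n w s \<and> 0 \<le> regs s ''b'' \<and> (regs s ''b'' = 0 \<or>
     bipart m n (dec m n (arrays s ''u'')) \<and> int (minw m n w (dec m n (arrays s ''u''))) = regs s ''b'')"

lemma J_N: "J m n w s \<Longrightarrow> 1 \<le> m * n"
  by (auto simp: J_def Env_def Core_def Base_def)

definition bodyS :: com where
  "bodyS = com.If (Eq (Read ''q'' (Reg ''k'')) (Const 1)) (Assign ''c'' (Add (Reg ''c'') (Read ''w'' (Reg ''k'')))) Skip"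

definition evalS :: com where
  "evalS = Seq (Assign ''c'' (Const 0)) (Seq (For (Reg ''N'') bodyS)
     (com.If (Less (Sub (Reg ''W'') (Reg ''c'')) (Reg ''c'')) (Assign ''c'' (Sub (Reg ''W'') (Reg ''c''))) Skip))"

lemma Env_simps:
  assumes "Env m n w s"
  shows "3 \<le> m" "3 \<le> n" "regs s ''m'' = int m" "regs s ''n'' = int n" "regs s ''N'' = int (m * n)" "regs s ''W'' = int (sum w (grid m n))"
    "\<And>k. k < m * n \<Longrightarrow> arrays s ''w'' (int k) = int (w (cel n k))" "\<And>i. i \<le> m \<Longrightarrow> arrays s ''r'' (int i) = int (i * n)"
    "\<And>k. k < m * n \<Longrightarrow> arrays s ''I'' (int k) = int (Suc (k div n))" "\<And>k. k < m * n \<Longrightarrow> arrays s ''J'' (int k) = int (Suc (k mod n))"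
    "\<And>i. i \<le> m * n \<Longrightarrow> arrays s ''p'' (int i) = int (i mod 2)"
    "\<And>i. i \<le> m * n \<Longrightarrow> arrays s ''f'' (int i) = int (cm (heavy_rows m n w) i)"
    "\<And>i. i \<le> m * n \<Longrightarrow> arrays s ''g'' (int i) = int (cm (heavy_cols m n w) i)"
    "1 \<le> m * n" "\<And>v. v \<in> grid m n \<Longrightarrow> 0 < w v"
  using assms by (auto simp: Env_def Core_def Base_def)

lemma Env_pos: "Env m n w s \<Longrightarrow> Suc 0 \<le> m" "Env m n w s \<Longrightarrow> Suc 0 \<le> n"
  by (simp_all add: Env_def Core_def Base_def)

lemma J_pos: "J m n w s \<Longrightarrow> Suc 0 \<le> m" "J m n w s \<Longrightarrow> Suc 0 \<le> n"
  unfolding J_def using Env_pos by blast+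

text \<open>Specialised to bodies that leave the tables alone, so that the number of rounds depends
  only on the register \<open>N\<close>.\<close>

lemma triple_ForE:
  assumes c: "flat c" "''k'' \<notin> wr c" "wr c \<inter> {''m'', ''n'', ''N'', ''W''} = {}" "wa c \<inter> {''w'', ''r'', ''I'', ''J'', ''p'', ''f'', ''g''} = {}"
    and L: "\<And>m n. L m n \<le> 3 * (m * n)"
    and e: "\<And>m n s. regs s ''N'' = int m * int n \<Longrightarrow> aval e s = int (L m n)"
    and P: "\<And>m n w s. P m n w s \<Longrightarrow> Env m n w s"
    and I0: "\<And>m n w s0. P m n w s0 \<Longrightarrow> I m n w s0 0 (s0\<lparr>regs := (regs s0)(''k'' := 0)\<rparr>)"
    and step: "\<And>m n w s0 i s. P m n w s0 \<Longrightarrow> i < L m n \<Longrightarrow> same (For e c) s0 s \<Longrightarrow> regs s ''k'' = int i \<Longrightarrow> I m n w s0 i s \<Longrightarrow>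
      I m n w s0 (Suc i) ((eff c s)\<lparr>regs := (regs (eff c s))(''k'' := int (Suc i))\<rparr>)"
    and Q: "\<And>m n w s0 s. P m n w s0 \<Longrightarrow> same (For e c) s0 s \<Longrightarrow> I m n w s0 (L m n) s \<Longrightarrow> Q m n w s0 s"
  shows "triple P (For e c) Q"
proof (rule triple_For[where L = L and I = I, OF c(1,2) _ L _ I0 step Q])
  show "1 \<le> m * n" if "P m n w s" for m n w s using Env_simps(14)[OF P[OF that]] .
  show "aval e s = int (L m n)" if p: "P m n w s0" and sm: "same (For e c) s0 s" for m n w s0 s
  proof (rule e)
    have "''N'' \<notin> wr (For e c)" using c(3) by simp
    then have "regs s ''N'' = regs s0 ''N''" by (rule same_refl_upd(1)[OF sm])
    then show "regs s ''N'' = int m * int n" using Env_simps(5)[OF P[OF p]] by simp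
  qed
qed

lemma sumS: "triple (\<lambda>m n w s. Env m n w s \<and> regs s ''c'' = 0) (For (Reg ''N'') bodyS)
   (\<lambda>m n w s0 s. Env m n w s \<and> regs s ''c'' = int (sum w (dec m n (arrays s0 ''q''))))"
proof (rule triple_ForE[where L = "\<lambda>m n. m * n" and I = "\<lambda>m n w s0 i s. regs s ''c'' = int (\<Sum>k<i. if cel n k \<in> dec m n (arrays s0 ''q'') then w (cel n k) else 0)"])
  fix m n w s0 i s
  assume P: "Env m n w s0 \<and> regs s0 ''c'' = 0" and i: "i < m * n" and sm: "same (For (Reg ''N'') bodyS) s0 s" and k: "regs s ''k'' = int i"
    and I: "regs s ''c'' = int (\<Sum>k<i. if cel n k \<in> dec m n (arrays s0 ''q'') then w (cel n k) else 0)"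
  have E: "Env m n w s" using P by (intro Env_same[OF _ sm]) (simp_all add: bodyS_def)
  have q: "arrays s ''q'' = arrays s0 ''q''" using same_refl_upd(2)[OF sm, of "''q''"] by (simp add: bodyS_def)
  show "regs ((eff bodyS s)\<lparr>regs := (regs (eff bodyS s))(''k'' := int (Suc i))\<rparr>) ''c'' =
     int (\<Sum>k<Suc i. if cel n k \<in> dec m n (arrays s0 ''q'') then w (cel n k) else 0)"
    using I by (simp add: bodyS_def k q Env_simps(7)[OF E i] dec_cel[OF i])
next
  fix m n w s0 s
  assume P: "Env m n w s0 \<and> regs s0 ''c'' = 0" and sm: "same (For (Reg ''N'') bodyS) s0 s"
    and I: "regs s ''c'' = int (\<Sum>k<m * n. if cel n k \<in> dec m n (arrays s0 ''q'') then w (cel n k) else 0)"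
  have "dec m n (arrays s0 ''q'') \<subseteq> grid m n" unfolding dec_def by blast
  note I' = I[folded sum_restrict[OF this]]
  have "Env m n w s" using P by (intro Env_same[OF _ sm]) (simp_all add: bodyS_def)
  then show "Env m n w s \<and> regs s ''c'' = int (sum w (dec m n (arrays s0 ''q'')))" using I' by blast
qed (simp_all add: bodyS_def)

lemma sum_minw: "X \<subseteq> grid m n \<Longrightarrow> int (minw m n w X) = min (int (sum w X)) (int (sum w (grid m n)) - int (sum w X))"
proof -
  assume X: "X \<subseteq> grid m n"
  have "sum w (grid m n - X) + sum w X = sum w (grid m n)" by (rule sum.subset_diff[OF X, symmetric]) simp
  then have "int (sum w (grid m n - X)) = int (sum w (grid m n)) - int (sum w X)" by linarith
  then show ?thesis unfolding minw_def by (simp only: of_nat_min)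
qed

lemma evalS: "triple Env evalS (\<lambda>m n w s0 s. Env m n w s \<and> regs s ''c'' = int (minw m n w (dec m n (arrays s0 ''q''))))"
  unfolding evalS_def
proof (rule triple_Seq[where Q = "\<lambda>m n w s0 s. Env m n w s \<and> regs s ''c'' = 0" and P' = "\<lambda>m n w s. Env m n w s \<and> regs s ''c'' = 0"
    and Q' = "\<lambda>m n w s0 s. Env m n w s \<and> regs s ''c'' = int (minw m n w (dec m n (arrays s0 ''q'')))"])
  show "triple Env (Assign ''c'' (Const 0)) (\<lambda>m n w s0 s. Env m n w s \<and> regs s ''c'' = 0)"
  proof (rule triple_flat)
    fix m n w s assume E: "Env m n w s" and sm: "same (Assign ''c'' (Const 0)) s (eff (Assign ''c'' (Const 0)) s)"
    show "Env m n w (eff (Assign ''c'' (Const 0)) s) \<and> regs (eff (Assign ''c'' (Const 0)) s) ''c'' = 0"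
      using Env_same[OF E sm] by simp
  qed (simp, rule Env_simps(14))
  have e: "dec m n a \<subseteq> grid m n" for m n a by (auto simp: dec_def)
  show "triple (\<lambda>m n w s. Env m n w s \<and> regs s ''c'' = 0) (Seq (For (Reg ''N'') bodyS)
     (com.If (Less (Sub (Reg ''W'') (Reg ''c'')) (Reg ''c'')) (Assign ''c'' (Sub (Reg ''W'') (Reg ''c''))) Skip))
     (\<lambda>m n w s0 s. Env m n w s \<and> regs s ''c'' = int (minw m n w (dec m n (arrays s0 ''q''))))"
  proof (rule triple_Seq[OF sumS, where P' = Env and Q' = "\<lambda>m n w s0 s. Env m n w s \<and> regs s ''c'' = min (regs s0 ''c'') (int (sum w (grid m n)) - regs s0 ''c'')"])
    show "triple Env (com.If (Less (Sub (Reg ''W'') (Reg ''c'')) (Reg ''c'')) (Assign ''c'' (Sub (Reg ''W'') (Reg ''c''))) Skip)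
      (\<lambda>m n w s0 s. Env m n w s \<and> regs s ''c'' = min (regs s0 ''c'') (int (sum w (grid m n)) - regs s0 ''c''))"
    proof (rule triple_flat)
      fix m n w s assume E: "Env m n w s" and sm: "same (com.If (Less (Sub (Reg ''W'') (Reg ''c'')) (Reg ''c'')) (Assign ''c'' (Sub (Reg ''W'') (Reg ''c''))) Skip) s
        (eff (com.If (Less (Sub (Reg ''W'') (Reg ''c'')) (Reg ''c'')) (Assign ''c'' (Sub (Reg ''W'') (Reg ''c''))) Skip) s)"
      show "Env m n w (eff (com.If (Less (Sub (Reg ''W'') (Reg ''c'')) (Reg ''c'')) (Assign ''c'' (Sub (Reg ''W'') (Reg ''c''))) Skip) s) \<and>
        regs (eff (com.If (Less (Sub (Reg ''W'') (Reg ''c'')) (Reg ''c'')) (Assign ''c'' (Sub (Reg ''W'') (Reg ''c''))) Skip) s) ''c'' = min (regs s ''c'') (int (sum w (grid m n)) - regs s ''c'')"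
        using Env_same[OF E sm] Env_simps(6)[OF E] by simp
    qed (simp, rule Env_simps(14))
  qed (simp_all add: sum_minw[OF e])
qed (simp_all add: same_def)

definition copyS :: com where
  "copyS = Seq (Assign ''b'' (Reg ''c'')) (For (Reg ''N'') (Write ''u'' (Reg ''k'') (Read ''q'' (Reg ''k''))))"

lemma copyS: "triple Env copyS (\<lambda>m n w s0 s. Env m n w s \<and> regs s ''b'' = regs s0 ''c'' \<and> dec m n (arrays s ''u'') = dec m n (arrays s0 ''q''))"
  unfolding copyS_def
proof (rule triple_Seq[where Q = "\<lambda>m n w s0 s. Env m n w s \<and> regs s ''b'' = regs s0 ''c''" and P' = Env
    and Q' = "\<lambda>m n w s0 s. Env m n w s \<and> dec m n (arrays s ''u'') = dec m n (arrays s0 ''q'')"])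
  show "triple Env (Assign ''b'' (Reg ''c'')) (\<lambda>m n w s0 s. Env m n w s \<and> regs s ''b'' = regs s0 ''c'')"
  proof (rule triple_flat)
    fix m n w s assume E: "Env m n w s" and sm: "same (Assign ''b'' (Reg ''c'')) s (eff (Assign ''b'' (Reg ''c'')) s)"
    show "Env m n w (eff (Assign ''b'' (Reg ''c'')) s) \<and> regs (eff (Assign ''b'' (Reg ''c'')) s) ''b'' = regs s ''c''"
      using Env_same[OF E sm] by simp
  qed (simp, rule Env_simps(14))
  show "triple Env (For (Reg ''N'') (Write ''u'' (Reg ''k'') (Read ''q'' (Reg ''k'')))) (\<lambda>m n w s0 s. Env m n w s \<and> dec m n (arrays s ''u'') = dec m n (arrays s0 ''q''))"
  proof (rule triple_ForE[where L = "\<lambda>m n. m * n" and I = "\<lambda>m n w s0 i s. \<forall>k<i. arrays s ''u'' (int k) = arrays s0 ''q'' (int k)"])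
    fix m n w s0 i s
    assume sm: "same (For (Reg ''N'') (Write ''u'' (Reg ''k'') (Read ''q'' (Reg ''k'')))) s0 s" and k: "regs s ''k'' = int i"
      and I: "\<forall>k<i. arrays s ''u'' (int k) = arrays s0 ''q'' (int k)"
    have q: "arrays s ''q'' = arrays s0 ''q''" using same_refl_upd(2)[OF sm, of "''q''"] by simp
    show "\<forall>ka<Suc i. arrays ((eff (Write ''u'' (Reg ''k'') (Read ''q'' (Reg ''k''))) s)
        \<lparr>regs := (regs (eff (Write ''u'' (Reg ''k'') (Read ''q'' (Reg ''k''))) s))(''k'' := int (Suc i))\<rparr>) ''u'' (int ka) = arrays s0 ''q'' (int ka)"
      using I by (simp add: k q less_Suc_eq)
  next
    fix m n w s0 s
    assume E: "Env m n w s0" and sm: "same (For (Reg ''N'') (Write ''u'' (Reg ''k'') (Read ''q'' (Reg ''k'')))) s0 s"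
      and I: "\<forall>k<m * n. arrays s ''u'' (int k) = arrays s0 ''q'' (int k)"
    have "Env m n w s" by (rule Env_same[OF E sm]) auto
    then show "Env m n w s \<and> dec m n (arrays s ''u'') = dec m n (arrays s0 ''q'')" using dec_cong[of m n] I by blast
  qed simp_all
qed (simp_all add: same_def)

text \<open>The candidate is the characteristic vector in \<open>q\<close>; the best one so far is
  kept in \<open>u\<close>.\<close>

definition EV :: com where
  "EV = Seq evalS (com.If (Less (Reg ''b'') (Reg ''c'')) copyS Skip)"

lemma wr_evalS: "wr evalS = {''c'', ''k''}" "wa evalS = {}" "wr copyS = {''b'', ''k''}" "wa copyS = {''u''}"
  by (auto simp: evalS_def bodyS_def copyS_def)

lemma EV: "triple (\<lambda>m n w s. J m n w s \<and> bipart m n (dec m n (arrays s ''q''))) EV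
  (\<lambda>m n w s0 s. J m n w s \<and> regs s0 ''b'' \<le> regs s ''b'' \<and> int (minw m n w (dec m n (arrays s0 ''q''))) \<le> regs s ''b'')"
  unfolding EV_def
proof (rule triple_Seq[where Q = "\<lambda>m n w s0 s. Env m n w s \<and> regs s ''c'' = int (minw m n w (dec m n (arrays s0 ''q'')))"
      and P' = "\<lambda>m n w s. J m n w s \<and> bipart m n (dec m n (arrays s ''q'')) \<and> regs s ''c'' = int (minw m n w (dec m n (arrays s ''q'')))"
      and Q' = "\<lambda>m n w s0 s. J m n w s \<and> regs s0 ''b'' \<le> regs s ''b'' \<and> int (minw m n w (dec m n (arrays s0 ''q''))) \<le> regs s ''b''"])
  show "triple (\<lambda>m n w s. J m n w s \<and> bipart m n (dec m n (arrays s ''q''))) evalS (\<lambda>m n w s0 s. Env m n w s \<and> regs s ''c'' = int (minw m n w (dec m n (arrays s0 ''q''))))"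
    by (rule triple_conseq[OF evalS]) (auto simp: J_def)
  show "triple (\<lambda>m n w s. J m n w s \<and> bipart m n (dec m n (arrays s ''q'')) \<and> regs s ''c'' = int (minw m n w (dec m n (arrays s ''q''))))
     (com.If (Less (Reg ''b'') (Reg ''c'')) copyS Skip)
     (\<lambda>m n w s0 s. J m n w s \<and> regs s0 ''b'' \<le> regs s ''b'' \<and> int (minw m n w (dec m n (arrays s0 ''q''))) \<le> regs s ''b'')"
  proof (rule triple_If)
    show "triple (\<lambda>m n w s. (J m n w s \<and> bipart m n (dec m n (arrays s ''q'')) \<and> regs s ''c'' = int (minw m n w (dec m n (arrays s ''q'')))) \<and> bval (Less (Reg ''b'') (Reg ''c'')) s)
      copyS (\<lambda>m n w s0 s. J m n w s \<and> regs s0 ''b'' \<le> regs s ''b'' \<and> int (minw m n w (dec m n (arrays s0 ''q''))) \<le> regs s ''b'')"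
      by (rule triple_conseq[OF copyS]) (simp_all add: J_def)
    show "triple (\<lambda>m n w s. (J m n w s \<and> bipart m n (dec m n (arrays s ''q'')) \<and> regs s ''c'' = int (minw m n w (dec m n (arrays s ''q'')))) \<and> \<not> bval (Less (Reg ''b'') (Reg ''c'')) s)
      Skip (\<lambda>m n w s0 s. J m n w s \<and> regs s0 ''b'' \<le> regs s ''b'' \<and> int (minw m n w (dec m n (arrays s0 ''q''))) \<le> regs s ''b'')"
      by (rule triple_flat) (simp, use J_N in blast, simp)
  qed (use J_N in blast)
  fix m n w s s'
  assume A: "J m n w s \<and> bipart m n (dec m n (arrays s ''q''))" and sm: "same evalS s s'"
    and B: "Env m n w s' \<and> regs s' ''c'' = int (minw m n w (dec m n (arrays s ''q'')))"
  have e: "regs s' ''b'' = regs s ''b''" "arrays s' ''q'' = arrays s ''q''" "arrays s' ''u'' = arrays s ''u''"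
    using same_refl_upd[OF sm] by (simp_all add: wr_evalS)
  show "J m n w s' \<and> bipart m n (dec m n (arrays s' ''q'')) \<and> regs s' ''c'' = int (minw m n w (dec m n (arrays s' ''q'')))"
    using A B unfolding J_def e by blast
  fix s''
  assume "J m n w s'' \<and> regs s' ''b'' \<le> regs s'' ''b'' \<and> int (minw m n w (dec m n (arrays s' ''q''))) \<le> regs s'' ''b''"
  then show "J m n w s'' \<and> regs s ''b'' \<le> regs s'' ''b'' \<and> int (minw m n w (dec m n (arrays s ''q''))) \<le> regs s'' ''b''"
    unfolding e .
qed

section \<open>Generating the cyclic order\<close>

definition evenE :: "aexp \<Rightarrow> bexp" where "evenE e = Less (Read ''p'' e) (Const 1)"
definition oddE :: "aexp \<Rightarrow> bexp" where "oddE e = bexp.Not (evenE e)"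

lemma bval_evenE: "aval e s = int x \<Longrightarrow> arrays s ''p'' (int x) = int (x mod 2) \<Longrightarrow> bval (evenE e) s \<longleftrightarrow> even x"
  by (cases "even x") (simp_all add: evenE_def odd_iff_mod_2_eq_one)

lemma bval_oddE: "bval (oddE e) s \<longleftrightarrow> \<not> bval (evenE e) s"
  by (simp add: oddE_def)

text \<open>A transcription of \<open>nxt\<close> clause by clause; disjunctions are expressed
  through \<open>Not\<close> and \<open>And\<close>, parity through the table
  \<open>p\<close>.\<close>

definition NX :: com where
  "NX = com.If (Eq (Reg ''i'') (Const 1))
     (com.If (Less (Reg ''j'') (Reg ''n'')) (Assign ''j'' (Add (Reg ''j'') (Const 1))) (Seq (Assign ''i'' (Const 2)) (Assign ''j'' (Reg ''n''))))
   (com.If (Eq (Reg ''j'') (Const 1))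
     (com.If (bexp.And (oddE (Reg ''m'')) (bexp.And (oddE (Reg ''n'')) (Eq (Reg ''i'') (Reg ''m''))))
       (Seq (Assign ''i'' (Sub (Reg ''m'') (Const 1))) (Assign ''j'' (Const 2))) (Assign ''i'' (Sub (Reg ''i'') (Const 1))))
   (com.If (bexp.And (oddE (Reg ''m'')) (Eq (Reg ''i'') (Sub (Reg ''m'') (Const 1))))
     (com.If (evenE (Sub (Reg ''n'') (Reg ''j''))) (Assign ''i'' (Reg ''m'')) (Assign ''j'' (Sub (Reg ''j'') (Const 1))))
   (com.If (bexp.And (oddE (Reg ''m'')) (Eq (Reg ''i'') (Reg ''m'')))
     (com.If (bexp.Not (bexp.And (oddE (Sub (Reg ''n'') (Reg ''j''))) (bexp.Not (Eq (Reg ''j'') (Const 2)))))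
       (Assign ''j'' (Sub (Reg ''j'') (Const 1))) (Assign ''i'' (Sub (Reg ''m'') (Const 1))))
   (com.If (evenE (Reg ''i''))
     (com.If (bexp.Not (bexp.And (bexp.Not (Less (Const 2) (Reg ''j''))) (bexp.Not (Eq (Reg ''i'') (Reg ''m'')))))
       (Assign ''j'' (Sub (Reg ''j'') (Const 1))) (Seq (Assign ''i'' (Add (Reg ''i'') (Const 1))) (Assign ''j'' (Const 2))))
   (com.If (Less (Reg ''j'') (Reg ''n'')) (Assign ''j'' (Add (Reg ''j'') (Const 1)))
     (Seq (Assign ''i'' (Add (Reg ''i'') (Const 1))) (Assign ''j'' (Reg ''n''))))))))"

lemma NX_frame: "flat NX" "wr NX = {''i'', ''j''}" "wa NX = {}"
  by (auto simp: NX_def)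

lemma NX:
  assumes E: "Env m n w s" and ij: "regs s ''i'' = int i" "regs s ''j'' = int j" "(i, j) \<in> grid m n"
  shows "regs (eff NX s) ''i'' = int (fst (nxt m n (i, j))) \<and> regs (eff NX s) ''j'' = int (snd (nxt m n (i, j)))"
proof -
  note En = Env_simps[OF E]
  have b: "1 \<le> i" "i \<le> m" "1 \<le> j" "j \<le> n" using ij by auto
  have mn: "m \<le> m * n" "n \<le> m * n" using En(1,2) by simp_all
  have le: "i \<le> m * n" "n - j \<le> m * n" using b mn by linarith+
  have ev: "bval (evenE (Reg ''i'')) s \<longleftrightarrow> even i" "bval (evenE (Reg ''m'')) s \<longleftrightarrow> even m" "bval (evenE (Reg ''n'')) s \<longleftrightarrow> even n"
    "bval (evenE (Sub (Reg ''n'') (Reg ''j''))) s \<longleftrightarrow> even (n - j)"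
    by (rule bval_evenE[OF _ En(11)[OF le(1)]] bval_evenE[OF _ En(11)[OF mn(1)]] bval_evenE[OF _ En(11)[OF mn(2)]] bval_evenE[OF _ En(11)[OF le(2)]];
      use b in \<open>simp add: ij En(3,4) of_nat_diff\<close>)+
  have q: "int i = 1 \<longleftrightarrow> i = 1" "int j = 1 \<longleftrightarrow> j = 1" "int j = 2 \<longleftrightarrow> j = 2" "int i = int m - 1 \<longleftrightarrow> i = m - 1" "2 < int j \<longleftrightarrow> 2 < j"
    "int (m - 1) = int m - 1" "int (i - 1) = int i - 1" "int (j - 1) = int j - 1" "int (i + 1) = int i + 1" "int (j + 1) = int j + 1"
    "\<not> (even (n - j) \<or> j = 2) \<longleftrightarrow> odd (n - j) \<and> j \<noteq> 2" using b En(1) by auto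
  have en: "i = 1 \<Longrightarrow> \<not> j < n \<Longrightarrow> j = n" using b by simp
  have v: "bval (Eq (Reg ''i'') (Const 1)) s \<longleftrightarrow> i = 1" "bval (Eq (Reg ''j'') (Const 1)) s \<longleftrightarrow> j = 1" "bval (Eq (Reg ''j'') (Const 2)) s \<longleftrightarrow> j = 2"
    "bval (Eq (Reg ''i'') (Reg ''m'')) s \<longleftrightarrow> i = m" "bval (Eq (Reg ''i'') (Sub (Reg ''m'') (Const 1))) s \<longleftrightarrow> i = m - 1"
    "bval (Less (Reg ''j'') (Reg ''n'')) s \<longleftrightarrow> j < n" "bval (Less (Const 2) (Reg ''j'')) s \<longleftrightarrow> 2 < j"
    using q by (simp_all add: ij En(3,4) del: One_nat_def)
  let ?P = "\<lambda>s' c. regs s' ''i'' = int (fst c) \<and> regs s' ''j'' = int (snd c)"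
  have if2: "?P (if A then s1 else s2) (if A then c1 else c2)" if "A \<Longrightarrow> ?P s1 c1" "\<not> A \<Longrightarrow> ?P s2 c2" for A s1 s2 c1 c2
    using that by simp
  have d: "(\<not> (\<not> even (n - j) \<and> j \<noteq> 2)) = (even (n - j) \<or> j = 2)" "(\<not> (\<not> 2 < j \<and> i \<noteq> m)) = (2 < j \<or> i = m)" by auto
  show ?thesis
    unfolding NX_def nxt_def prod.case eff.simps bval.simps(2,3) bval_oddE ev v d
    by (intro if2) (use q in \<open>simp_all add: ij En(3,4) del: One_nat_def\<close>)
qed

definition genB :: "bool \<Rightarrow> bool \<Rightarrow> com" where
  "genB a b = Seq (Write ''o'' (Reg ''k'') (Add (Read ''r'' (Sub (if a then Sub (Add (Reg ''m'') (Const 1)) (Reg ''i'') else Reg ''i'') (Const 1)))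
      (Sub (if b then Sub (Add (Reg ''n'') (Const 1)) (Reg ''j'') else Reg ''j'') (Const 1)))) NX"

text \<open>Two full turns are written, so that windows passing the end of the order are read
  without a remainder operation.\<close>

definition gen :: "bool \<Rightarrow> bool \<Rightarrow> com" where
  "gen a b = Seq (Seq (Assign ''i'' (Const 1)) (Assign ''j'' (Const 1))) (For (Add (Reg ''N'') (Reg ''N'')) (genB a b))"

lemma gen_frame: "flat (genB a b)" "wr (genB a b) = {''i'', ''j''}" "wa (genB a b) = {''o''}" "wr (gen a b) = {''i'', ''j'', ''k''}" "wa (gen a b) = {''o''}"
  by (auto simp: genB_def NX_frame gen_def)

definition Ord :: "bool \<Rightarrow> bool \<Rightarrow> nat \<Rightarrow> nat \<Rightarrow> store \<Rightarrow> nat \<Rightarrow> bool" where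
  "Ord a b m n s t \<longleftrightarrow> (\<forall>k<t. arrays s ''o'' (int k) = cell n (ham.walk m n a b k))"

lemma ham_Env: "Env m n w s \<Longrightarrow> ham m n"
  by unfold_locales (simp_all add: Env_simps)

lemma gen: "triple Env (gen a b) (\<lambda>m n w s0 s. Env m n w s \<and> Ord a b m n s (2 * (m * n)))"
  unfolding gen_def
proof (rule triple_Seq[where Q = "\<lambda>m n w s0 s. Env m n w s \<and> regs s ''i'' = 1 \<and> regs s ''j'' = 1" and P' = "\<lambda>m n w s. Env m n w s \<and> regs s ''i'' = 1 \<and> regs s ''j'' = 1"
    and Q' = "\<lambda>m n w s0 s. Env m n w s \<and> Ord a b m n s (2 * (m * n))"])
  show "triple Env (Seq (Assign ''i'' (Const 1)) (Assign ''j'' (Const 1))) (\<lambda>m n w s0 s. Env m n w s \<and> regs s ''i'' = 1 \<and> regs s ''j'' = 1)"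
  proof (rule triple_flat)
    fix m n w s assume E: "Env m n w s" and sm: "same (Seq (Assign ''i'' (Const 1)) (Assign ''j'' (Const 1))) s (eff (Seq (Assign ''i'' (Const 1)) (Assign ''j'' (Const 1))) s)"
    show "Env m n w (eff (Seq (Assign ''i'' (Const 1)) (Assign ''j'' (Const 1))) s) \<and> regs (eff (Seq (Assign ''i'' (Const 1)) (Assign ''j'' (Const 1))) s) ''i'' = 1 \<and> regs (eff (Seq (Assign ''i'' (Const 1)) (Assign ''j'' (Const 1))) s) ''j'' = 1"
      using Env_same[OF E sm] by simp
  qed (simp, rule Env_simps(14))
  show "triple (\<lambda>m n w s. Env m n w s \<and> regs s ''i'' = 1 \<and> regs s ''j'' = 1) (For (Add (Reg ''N'') (Reg ''N'')) (genB a b))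
     (\<lambda>m n w s0 s. Env m n w s \<and> Ord a b m n s (2 * (m * n)))"
  proof (rule triple_ForE[where L = "\<lambda>m n. 2 * (m * n)" and I = "\<lambda>m n w s0 i s. regs s ''i'' = int (fst (ham.ord m n i)) \<and> regs s ''j'' = int (snd (ham.ord m n i)) \<and> Ord a b m n s i"])
    fix m n w s0 i s
    assume P: "Env m n w s0 \<and> regs s0 ''i'' = 1 \<and> regs s0 ''j'' = 1" and i: "i < 2 * (m * n)" and sm: "same (For (Add (Reg ''N'') (Reg ''N'')) (genB a b)) s0 s"
      and k: "regs s ''k'' = int i" and I: "regs s ''i'' = int (fst (ham.ord m n i)) \<and> regs s ''j'' = int (snd (ham.ord m n i)) \<and> Ord a b m n s i"
    have E: "Env m n w s" using P by (intro Env_same[OF _ sm]) (auto simp: gen_frame)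
    interpret ham m n by (rule ham_Env[OF E])
    obtain p q where pq: "ord i = (p, q)" by (cases "ord i")
    have g: "(p, q) \<in> grid m n" using ord_grid[of i] pq by simp
    then have b: "1 \<le> p" "p \<le> m" "1 \<le> q" "q \<le> n" by auto
    define wrt where "wrt = Write ''o'' (Reg ''k'') (Add (Read ''r'' (Sub (if a then Sub (Add (Reg ''m'') (Const 1)) (Reg ''i'') else Reg ''i'') (Const 1)))
      (Sub (if b then Sub (Add (Reg ''n'') (Const 1)) (Reg ''j'') else Reg ''j'') (Const 1)))"
    define s1 where "s1 = eff wrt s"
    have E1: "Env m n w s1" unfolding s1_def by (rule Env_same[OF E same_eff]) (auto simp: wrt_def)
    have r1: "regs s1 ''i'' = int p" "regs s1 ''j'' = int q" using I pq by (simp_all add: s1_def wrt_def)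
    define p' where "p' = (if a then m + 1 - p else p)"
    define q' where "q' = (if b then n + 1 - q else q)"
    have mir: "walk a b i = (p', q')" by (simp add: walk_def pq mirror_def p'_def q'_def)
    have pb: "1 \<le> p'" "p' \<le> m" "1 \<le> q'" using b by (auto simp: p'_def q'_def)
    have ap: "aval (if a then Sub (Add (Reg ''m'') (Const 1)) (Reg ''i'') else Reg ''i'') s = int p'"
      "aval (if b then Sub (Add (Reg ''n'') (Const 1)) (Reg ''j'') else Reg ''j'') s = int q'"
      using I pq b by (auto simp: p'_def q'_def Env_simps(3,4)[OF E] of_nat_diff)
    have "arrays s ''r'' (int (p' - 1)) = int ((p' - 1) * n)" using Env_simps(8)[OF E, of "p' - 1"] pb by simp
    then have ro: "arrays s ''r'' (int p' - 1) = (int p' - 1) * int n" using pb by (simp add: of_nat_diff)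
    have o1: "arrays s1 ''o'' = (arrays s ''o'')(int i := cell n (walk a b i))"
      unfolding s1_def wrt_def mir by (simp add: ap k ro cell_def)
    have "same NX s1 (eff NX s1)" by (rule same_eff) (rule NX_frame)
    then have o2: "arrays (eff NX s1) = arrays s1" by (auto simp: same_def NX_frame)
    have nx: "regs (eff NX s1) ''i'' = int (fst (ord (Suc i)))" "regs (eff NX s1) ''j'' = int (snd (ord (Suc i)))"
      using NX[OF E1 r1 g] by (simp_all add: ord_Suc pq)
    have e: "eff (genB a b) s = eff NX s1" by (simp add: genB_def s1_def wrt_def)
    have "Ord a b m n s i" using I by simp
    then have "Ord a b m n (eff NX s1) (Suc i)" unfolding Ord_def o2 o1 by (simp add: less_Suc_eq)
    then show "regs ((eff (genB a b) s)\<lparr>regs := (regs (eff (genB a b) s))(''k'' := int (Suc i))\<rparr>) ''i'' = int (fst (ord (Suc i))) \<and>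
       regs ((eff (genB a b) s)\<lparr>regs := (regs (eff (genB a b) s))(''k'' := int (Suc i))\<rparr>) ''j'' = int (snd (ord (Suc i))) \<and>
       Ord a b m n ((eff (genB a b) s)\<lparr>regs := (regs (eff (genB a b) s))(''k'' := int (Suc i))\<rparr>) (Suc i)"
      using nx unfolding e by (simp add: Ord_def)
  next
    fix m n w s0
    assume P: "Env m n w s0 \<and> regs s0 ''i'' = 1 \<and> regs s0 ''j'' = 1"
    then interpret ham m n using ham_Env by blast
    show "regs (s0\<lparr>regs := (regs s0)(''k'' := 0)\<rparr>) ''i'' = int (fst (ord 0)) \<and> regs (s0\<lparr>regs := (regs s0)(''k'' := 0)\<rparr>) ''j'' = int (snd (ord 0)) \<and> Ord a b m n (s0\<lparr>regs := (regs s0)(''k'' := 0)\<rparr>) 0"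
      using P by (simp add: ord_0 Ord_def)
  next
    fix m n w s0 s
    assume P: "Env m n w s0 \<and> regs s0 ''i'' = 1 \<and> regs s0 ''j'' = 1" and sm: "same (For (Add (Reg ''N'') (Reg ''N'')) (genB a b)) s0 s"
      and I: "regs s ''i'' = int (fst (ham.ord m n (2 * (m * n)))) \<and> regs s ''j'' = int (snd (ham.ord m n (2 * (m * n)))) \<and> Ord a b m n s (2 * (m * n))"
    have "Env m n w s" using P by (intro Env_same[OF _ sm]) (auto simp: gen_frame)
    then show "Env m n w s \<and> Ord a b m n s (2 * (m * n))" using I by simp
  qed (simp_all add: gen_frame)
qed simp_all

section \<open>The best arc by a sliding window\<close>

context ham
begin

definition skip :: "nat \<Rightarrow> bool" where "skip s \<longleftrightarrow> exceptional \<and> (s = \<tau> \<or> s = \<tau> + 2)"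

text \<open>Among starts below \<open>m * n\<close>, the exceptional pair starts only at
  \<open>\<tau>\<close> and its complement only at \<open>\<tau> + 2\<close>; these are the skipped
  positions.\<close>

lemma bipart_window:
  assumes s: "s < m * n" "\<not> skip s" and l: "0 < l" "l < m * n"
  shows "bipart m n (walk a b ` {s..<s + l})"
proof -
  interpret C: cyclic ord "m * n" "grid m n" by (rule cyclic_ord)
  have two: "l' = 2 \<and> ord s' = ord \<tau>" if e: exceptional and l': "0 < l'" "l' < m * n" and eq: "ord ` {s'..<s' + l'} = {ord \<tau>, ord (Suc \<tau>)}" for s' l'
  proof -
    have bd: "\<tau> < \<tau> + m * n" "Suc \<tau> < \<tau> + m * n" "\<tau> + 2 < \<tau> + m * n" using mn(1) by linarith+
    have d: "ord \<tau> \<noteq> ord (Suc \<tau>)" "ord (\<tau> + 2) \<noteq> ord \<tau>" "ord (\<tau> + 2) \<noteq> ord (Suc \<tau>)"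
      using C.v_eq[of \<tau> \<tau> "Suc \<tau>"] C.v_eq[of \<tau> "\<tau> + 2" \<tau>] C.v_eq[of \<tau> "\<tau> + 2" "Suc \<tau>"] bd by simp_all
    have "inj_on ord {s'..<s' + l'}" by (rule inj_on_subset[OF C.inj_window[of s']]) (use l' in auto)
    then have "card (ord ` {s'..<s' + l'}) = l'" by (simp add: card_image)
    then have l2: "l' = 2" using eq d by simp
    have "ord s' \<in> ord ` {s'..<s' + l'}" "ord (s' + 1) \<in> ord ` {s'..<s' + l'}" using l2 by auto
    then have m2: "ord s' \<in> {ord \<tau>, ord (Suc \<tau>)}" "ord (s' + 1) \<in> {ord \<tau>, ord (Suc \<tau>)}" unfolding eq by simp_all
    have "ord s' \<noteq> ord (Suc \<tau>)"
    proof
      assume "ord s' = ord (Suc \<tau>)"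
      then have "ord (s' + 1) = ord (Suc \<tau> + 1)" by (rule C.shift)
      then show False using m2(2) d by simp
    qed
    then show ?thesis using l2 m2 by simp
  qed
  have tb: "\<tau> < m * n" "\<tau> + 2 < m * n" using m3 mn by (simp_all add: \<tau>_def)
  have "bipart m n (ord ` {s..<s + l})"
  proof (rule bipart_arc[OF l])
    assume e: exceptional
    show "ord ` {s..<s + l} \<noteq> {ord \<tau>, ord (Suc \<tau>)}"
    proof
      assume "ord ` {s..<s + l} = {ord \<tau>, ord (Suc \<tau>)}"
      then have "ord s = ord \<tau>" using two[OF e l] by blast
      then have "s = \<tau>" using C.v_eq[of 0 s \<tau>] s(1) tb by simp
      then show False using s(2) e by (simp add: skip_def)
    qed
    show "ord ` {s..<s + l} \<noteq> grid m n - {ord \<tau>, ord (Suc \<tau>)}"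
    proof
      assume eq: "ord ` {s..<s + l} = grid m n - {ord \<tau>, ord (Suc \<tau>)}"
      have "grid m n - ord ` {s..<s + l} = ord ` {s + l..<s + l + (m * n - l)}"
        using C.arc_compl[of l s] l by (simp add: C.arc_def)
      moreover have "grid m n - ord ` {s..<s + l} = {ord \<tau>, ord (Suc \<tau>)}"
        unfolding eq using ord_grid by (intro double_diff) auto
      ultimately have 2: "m * n - l = 2 \<and> ord (s + l) = ord \<tau>" using two[OF e, of "m * n - l" "s + l"] l by simp
      then have "ord (s + l + 2) = ord (\<tau> + 2)" using C.shift[of "s + l" \<tau> 2] by blast
      moreover have "s + l + 2 = s + m * n" using 2 l by linarith
      ultimately have "ord (s + m * n) = ord (\<tau> + 2)" by (simp only:)
      then have "ord s = ord (\<tau> + 2)" by (simp only: ord_per)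
      then have "s = \<tau> + 2" using C.v_eq[of 0 s "\<tau> + 2"] s(1) tb by simp
      then show False using s(2) e by (simp add: skip_def)
    qed
  qed
  from bipart_mirror[OF this, of a b] show ?thesis by (simp add: image_image walk_def[abs_def])
qed

definition F :: "bool \<Rightarrow> bool \<Rightarrow> (nat \<times> nat \<Rightarrow> nat) \<Rightarrow> nat \<Rightarrow> int" where
  "F a b w k = (\<Sum>i<k. int (w (walk a b i)))"

definition val :: "bool \<Rightarrow> bool \<Rightarrow> (nat \<times> nat \<Rightarrow> nat) \<Rightarrow> nat \<Rightarrow> nat \<Rightarrow> int" where
  "val a b w s l = int (minw m n w (walk a b ` {s..<s + l}))"

definition TWi :: "(nat \<times> nat \<Rightarrow> nat) \<Rightarrow> int" where "TWi w = int (sum w (grid m n))"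

lemma F_Suc: "F a b w (Suc k) = F a b w k + int (w (walk a b k))"
  by (simp add: F_def)

lemma F_mono: "i \<le> j \<Longrightarrow> F a b w i \<le> F a b w j"
  by (induction j rule: dec_induct) (simp_all add: F_Suc)

lemma F_psum: "F a b w k = int (cyclic.psum (walk a b) w k)"
  by (simp add: F_def cyclic.psum_def[OF cyclic_walk])

lemma F_arc: "l \<le> m * n \<Longrightarrow> int (sum w (walk a b ` {s..<s + l})) = F a b w (s + l) - F a b w s"
  using cyclic.sum_arc[OF cyclic_walk, of l w a b s] unfolding F_psum cyclic.arc_def[OF cyclic_walk] by linarith

lemma F_N: "F a b w (s + m * n) = F a b w s + TWi w"
  using cyclic.psum_N[OF cyclic_walk, of a b w s] unfolding F_psum TWi_def by linarith

lemma val_F: "l \<le> m * n \<Longrightarrow> val a b w s l = min (F a b w (s + l) - F a b w s) (TWi w - (F a b w (s + l) - F a b w s))"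
proof -
  assume l: "l \<le> m * n"
  have "walk a b ` {s..<s + l} \<subseteq> grid m n" using cyclic.v_in[OF cyclic_walk] by blast
  then show ?thesis unfolding val_def by (subst sum_minw) (simp_all only: F_arc[OF l] TWi_def)
qed

text \<open>As for the recorded best value, \<open>v = 0\<close> encodes that no arc has been found,
  and then \<open>X\<close> and \<open>Y\<close> are arbitrary.\<close>

definition found :: "bool \<Rightarrow> bool \<Rightarrow> (nat \<times> nat \<Rightarrow> nat) \<Rightarrow> int \<Rightarrow> nat \<Rightarrow> nat \<Rightarrow> bool" where
  "found a b w v X Y \<longleftrightarrow> 0 \<le> v \<and> (0 < v \<longrightarrow> X < m * n \<and> X < Y \<and> Y < X + m * n \<and> \<not> skip X \<and> v = val a b w X (Y - X))"

definition covered :: "bool \<Rightarrow> bool \<Rightarrow> (nat \<times> nat \<Rightarrow> nat) \<Rightarrow> nat \<Rightarrow> int \<Rightarrow> bool" where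
  "covered a b w S v \<longleftrightarrow> (\<forall>s<S. \<not> skip s \<longrightarrow> (\<forall>l. 0 < l \<longrightarrow> l < m * n \<longrightarrow> val a b w s l \<le> v))"

text \<open>The end \<open>E\<close> has not overshot: without its last cell the window is still
  lighter than half of the total.\<close>

definition window :: "bool \<Rightarrow> bool \<Rightarrow> (nat \<times> nat \<Rightarrow> nat) \<Rightarrow> nat \<Rightarrow> nat \<Rightarrow> bool" where
  "window a b w S E \<longleftrightarrow> S \<le> E \<and> E \<le> S + m * n \<and> S \<le> m * n \<and> (S < E \<longrightarrow> 2 * (F a b w (E - 1) - F a b w S) < TWi w)"

lemma window_shift:
  assumes "window a b w S E" "S < m * n" "TWi w \<le> 2 * (F a b w E - F a b w S)" "0 < TWi w"
  shows "S < E" "window a b w (Suc S) E"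
proof -
  show SE: "S < E"
  proof (rule ccontr)
    assume "\<not> S < E"
    then have "S = E" using assms(1) by (simp add: window_def)
    then show False using assms(3,4) by simp
  qed
  have "F a b w S \<le> F a b w (Suc S)" by (rule F_mono) simp
  then show "window a b w (Suc S) E" using assms(1,2) SE by (auto simp: window_def)
qed

lemma window_grow:
  assumes "window a b w S E" "S < m * n" "2 * (F a b w E - F a b w S) < TWi w" "0 < TWi w"
  shows "E < 2 * (m * n)" "window a b w S (Suc E)"
proof -
  have "E \<noteq> S + m * n" using assms(3,4) F_N[of a b w S] by auto
  then show "E < 2 * (m * n)" "window a b w S (Suc E)" using assms by (auto simp: window_def)
qed

text \<open>Two candidates settle all lengths from start \<open>S\<close>. An arc ending before
  \<open>E\<close> weighs no more than the window without its last cell; a longer one leaves no more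
  than the complement of the full window.\<close>

lemma covered_step:
  assumes w: "window a b w S E" "S < E" and c: "covered a b w S v" "v \<le> v'"
    and v: "TWi w - (F a b w E - F a b w S) \<le> v'" "F a b w (E - 1) - F a b w S \<le> v'"
  shows "covered a b w (Suc S) v'"
  unfolding covered_def
proof (intro allI impI)
  fix s l assume s: "s < Suc S" "\<not> skip s" and l: "0 < l" "l < m * n"
  show "val a b w s l \<le> v'"
  proof (cases "s = S")
    case False
    then show ?thesis using c s l unfolding covered_def by (meson less_SucE order_trans)
  next
    case True
    show ?thesis
    proof (cases "S + l \<le> E - 1")
      case T: True
      have "F a b w (S + l) \<le> F a b w (E - 1)" using T by (rule F_mono)
      then show ?thesis using v(2) l unfolding True by (subst val_F) auto
    next
      case F': False
      then have "F a b w E \<le> F a b w (S + l)" by (intro F_mono) simp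
      then show ?thesis using v(1) l unfolding True by (subst val_F) auto
    qed
  qed
qed

lemma covered_skip: "skip S \<Longrightarrow> covered a b w S v \<Longrightarrow> covered a b w (Suc S) v"
  unfolding covered_def using less_SucE by blast

lemma found1:
  assumes "window a b w S E" "S < E" "S < m * n" "\<not> skip S" "TWi w \<le> 2 * (F a b w E - F a b w S)" "0 \<le> v" "v < TWi w - (F a b w E - F a b w S)"
  shows "found a b w (TWi w - (F a b w E - F a b w S)) S E"
proof -
  \<comment> \<open>The window comprising all cells has the empty complement, of weight 0, which
    cannot exceed \<open>v\<close>.\<close>
  have "E \<noteq> S + m * n" using assms(6,7) F_N[of a b w S] by auto
  then have E: "E < S + m * n" using assms(1) by (simp add: window_def)
  have "S + (E - S) = E" using assms(2) by simp
  then have "val a b w S (E - S) = TWi w - (F a b w E - F a b w S)"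
    using assms(5) E assms(2) by (subst val_F) auto
  then show ?thesis using assms E by (simp add: found_def)
qed

lemma found2:
  assumes "window a b w S E" "S < E" "S < m * n" "\<not> skip S" "0 \<le> v" "v < F a b w (E - 1) - F a b w S"
  shows "found a b w (F a b w (E - 1) - F a b w S) S (E - 1)"
proof -
  have "S \<noteq> E - 1" using assms(5,6) by auto
  then have S: "S < E - 1" using assms(2) by simp
  have E: "E - 1 < S + m * n" using assms(1,2) unfolding window_def by linarith
  have "S + (E - 1 - S) = E - 1" using S by simp
  moreover have "2 * (F a b w (E - 1) - F a b w S) < TWi w" using assms(1,2) by (simp add: window_def)
  ultimately have "val a b w S (E - 1 - S) = F a b w (E - 1) - F a b w S"
    using E S by (subst val_F) auto
  then show ?thesis using assms E S by (simp add: found_def)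
qed

end

definition skipE :: bexp where
  "skipE = bexp.And (bexp.And (oddE (Reg ''m'')) (oddE (Reg ''n'')))
     (bexp.Not (bexp.And (bexp.Not (Eq (Reg ''s'') (Sub (Reg ''N'') (Reg ''m'')))) (bexp.Not (Eq (Reg ''s'') (Add (Sub (Reg ''N'') (Reg ''m'')) (Const 2))))))"

definition upd1 :: com where
  "upd1 = com.If (Less (Reg ''v'') (Sub (Reg ''W'') (Reg ''c''))) (Seq (Assign ''v'' (Sub (Reg ''W'') (Reg ''c''))) (Seq (Assign ''x'' (Reg ''s'')) (Assign ''y'' (Reg ''e'')))) Skip"
definition upd2 :: com where
  "upd2 = Seq (Assign ''d'' (Sub (Reg ''c'') (Read ''w'' (Read ''o'' (Sub (Reg ''e'') (Const 1))))))
     (com.If (Less (Reg ''v'') (Reg ''d'')) (Seq (Assign ''v'' (Reg ''d'')) (Seq (Assign ''x'' (Reg ''s'')) (Assign ''y'' (Sub (Reg ''e'') (Const 1))))) Skip)"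
definition growT :: com where
  "growT = Seq (Assign ''c'' (Add (Reg ''c'') (Read ''w'' (Read ''o'' (Reg ''e''))))) (Assign ''e'' (Add (Reg ''e'') (Const 1)))"
definition dropT :: com where
  "dropT = Seq (Assign ''c'' (Sub (Reg ''c'') (Read ''w'' (Read ''o'' (Reg ''s''))))) (Assign ''s'' (Add (Reg ''s'') (Const 1)))"
text \<open>Each round advances either the end or the start by one instead of running an inner loop.
  As the start stays at most \<open>N\<close> and the end at most \<open>2 N\<close>,
  \<open>3 N\<close> rounds finish; later rounds do nothing.\<close>

definition stepT :: com where
  "stepT = com.If (Less (Reg ''s'') (Reg ''N'')) (com.If (Less (Add (Reg ''c'') (Reg ''c'')) (Reg ''W'')) growT
      (Seq (com.If skipE Skip (Seq upd1 upd2)) dropT)) Skip"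

lemma stepT_frame: "flat stepT" "wr stepT = {''c'', ''e'', ''v'', ''x'', ''y'', ''d'', ''s''}" "wa stepT = {}"
  by (auto simp: stepT_def growT_def upd1_def upd2_def dropT_def)

lemma Env_w: "Env m n w s \<Longrightarrow> v \<in> grid m n \<Longrightarrow> arrays s ''w'' (cell n v) = int (w v)"
  by (erule cel_surj) (simp add: cell_cel Env_simps(7))

definition holds :: "bool \<Rightarrow> bool \<Rightarrow> nat \<Rightarrow> nat \<Rightarrow> (nat \<times> nat \<Rightarrow> nat) \<Rightarrow> store \<Rightarrow> nat \<Rightarrow> nat \<Rightarrow> int \<Rightarrow> nat \<Rightarrow> nat \<Rightarrow> bool" where
  "holds a b m n w s S E v X Y \<longleftrightarrow> regs s ''s'' = int S \<and> regs s ''e'' = int E \<and> regs s ''v'' = v \<and> regs s ''x'' = int X \<and> regs s ''y'' = int Y \<and>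
     regs s ''c'' = ham.F m n a b w E - ham.F m n a b w S \<and> ham.found m n a b w v X Y"

definition invT :: "bool \<Rightarrow> bool \<Rightarrow> nat \<Rightarrow> nat \<Rightarrow> (nat \<times> nat \<Rightarrow> nat) \<Rightarrow> nat \<Rightarrow> store \<Rightarrow> bool" where
  "invT a b m n w t s \<longleftrightarrow> (\<exists>S E v X Y. holds a b m n w s S E v X Y \<and> ham.window m n a b w S E \<and> ham.covered m n a b w S v \<and> (S = m * n \<or> t \<le> S + E))"

text \<open>Progress is measured by \<open>t \<le> S + E\<close>. The end moves while the window is
  below half; otherwise both candidates are compared, unless the start is skipped, and the start
  moves.\<close>

lemma invT_step:
  assumes E: "Env m n w s" and O: "Ord a b m n s (2 * (m * n))" and I: "invT a b m n w t s"
  shows "invT a b m n w (Suc t) (eff stepT s)"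
proof -
  interpret ham m n by (rule ham_Env[OF E])
  note En = Env_simps[OF E]
  obtain S e v X Y where H: "holds a b m n w s S e v X Y" and win: "window a b w S e" and cov: "covered a b w S v" and pr: "S = m * n \<or> t \<le> S + e"
    using I unfolding invT_def by blast
  have r: "regs s ''s'' = int S" "regs s ''e'' = int e" "regs s ''v'' = v" "regs s ''x'' = int X" "regs s ''y'' = int Y"
    "regs s ''c'' = F a b w e - F a b w S" and fnd: "found a b w v X Y" using H by (simp_all add: holds_def)
  have o: "arrays s ''w'' (arrays s ''o'' (int k)) = int (w (walk a b k))" if "k < 2 * (m * n)" for k
    using O that Env_w[OF E, of "walk a b k"] cyclic.v_in[OF cyclic_walk] by (simp add: Ord_def del: mem_Sigma_iff)
  have W: "regs s ''W'' = TWi w" using En(6) by (simp add: TWi_def)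
  have W0: "0 < TWi w"
  proof -
    have "(1, 1) \<in> grid m n" using En(1,2) by simp
    then have "w (1, 1) \<le> sum w (grid m n)" by (intro member_le_sum) simp_all
    then have "0 < sum w (grid m n)" using En(15)[OF \<open>(1, 1) \<in> grid m n\<close>] by linarith
    then show ?thesis by (simp only: TWi_def of_nat_0_less_iff)
  qed
  have v0: "0 \<le> v" using fnd by (simp add: found_def)
  have sk: "bval skipE s \<longleftrightarrow> skip S"
  proof -
    have ev: "bval (evenE (Reg ''m'')) s \<longleftrightarrow> even m" "bval (evenE (Reg ''n'')) s \<longleftrightarrow> even n"
      by (rule bval_evenE; use En(1,2,11) in \<open>simp add: En(3,4)\<close>)+
    have "int (m * n) - int m = int \<tau>" using mn(2) by (simp add: \<tau>_def of_nat_diff)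
    then have t: "regs s ''N'' - regs s ''m'' = int \<tau>" by (simp only: En(3,5))
    have "int S = int \<tau> + 2 \<longleftrightarrow> S = \<tau> + 2" by auto
    then show ?thesis unfolding skipE_def skip_def exceptional_def bval.simps bval_oddE ev by (simp add: r t)
  qed
  show ?thesis
  proof (cases "S < m * n")
    case False
    then have "S = m * n" using win by (simp add: window_def)
    moreover have "eff stepT s = s" using False by (simp add: stepT_def r En(5) flip: of_nat_mult)
    ultimately show ?thesis using H win cov unfolding invT_def by (intro exI conjI) auto
  next
    case S: True
    then have pr': "t \<le> S + e" using pr by simp
    have bS: "bval (Less (Reg ''s'') (Reg ''N'')) s" using S by (simp add: r En(5) flip: of_nat_mult)
    show ?thesis
    proof (cases "2 * (F a b w e - F a b w S) < TWi w")
      case True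
      have st: "eff stepT s = eff growT s" using bS True by (simp add: stepT_def r W)
      note g = window_grow[OF win S True W0]
      have "holds a b m n w (eff growT s) S (Suc e) v X Y" using fnd by (simp add: holds_def growT_def r o[OF g(1)] F_Suc)
      then show ?thesis unfolding st invT_def using g(2) cov pr' by (intro exI conjI) auto
    next
      case False
      then have big: "TWi w \<le> 2 * (F a b w e - F a b w S)" by simp
      note sh = window_shift[OF win S big W0]
      have e2: "e \<le> 2 * (m * n)" "0 < e" using win S sh(1) by (simp_all add: window_def)
      have st: "eff stepT s = eff dropT (if skip S then s else eff upd2 (eff upd1 s))" using bS False by (simp add: stepT_def r W sk)
      have drop: "holds a b m n w (eff dropT s1) (Suc S) e v1 X1 Y1"
        if h: "holds a b m n w s1 S e v1 X1 Y1" "arrays s1 = arrays s" for s1 v1 X1 Y1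
        using h S o[of S] by (simp add: holds_def dropT_def F_Suc)
      show ?thesis
      proof (cases "skip S")
        case True
        then show ?thesis unfolding st invT_def using drop[OF H refl] sh(2) covered_skip[OF True cov] pr' by (intro exI conjI) auto
      next
        case ns: False
        define v1 where "v1 = (if v < TWi w - (F a b w e - F a b w S) then TWi w - (F a b w e - F a b w S) else v)"
        define X1 where "X1 = (if v < TWi w - (F a b w e - F a b w S) then S else X)"
        define Y1 where "Y1 = (if v < TWi w - (F a b w e - F a b w S) then e else Y)"
        have f1: "found a b w v1 X1 Y1" using found1[OF win sh(1) S ns big v0] fnd by (simp add: v1_def X1_def Y1_def)
        have h1: "holds a b m n w (eff upd1 s) S e v1 X1 Y1" "arrays (eff upd1 s) = arrays s"
          using f1 by (auto simp: holds_def upd1_def r W v1_def X1_def Y1_def)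
        have v1: "v \<le> v1" "TWi w - (F a b w e - F a b w S) \<le> v1" "0 \<le> v1" using v0 by (auto simp: v1_def)
        define d where "d = F a b w (e - 1) - F a b w S"
        have "F a b w e = F a b w (e - 1) + int (w (walk a b (e - 1)))" using F_Suc[of a b w "e - 1"] e2 by simp
        moreover have "arrays s ''w'' (arrays s ''o'' (int e - 1)) = int (w (walk a b (e - 1)))"
          using o[of "e - 1"] e2 by (simp add: of_nat_diff)
        ultimately have dd: "F a b w e - F a b w S - arrays s ''w'' (arrays s ''o'' (int e - 1)) = d" by (simp add: d_def)
        define v2 where "v2 = (if v1 < d then d else v1)"
        define X2 where "X2 = (if v1 < d then S else X1)"
        define Y2 where "Y2 = (if v1 < d then e - 1 else Y1)"
        have f2: "found a b w v2 X2 Y2" using found2[OF win sh(1) S ns v1(3)] f1 by (simp add: v2_def X2_def Y2_def d_def)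
        have h2: "holds a b m n w (eff upd2 (eff upd1 s)) S e v2 X2 Y2" "arrays (eff upd2 (eff upd1 s)) = arrays s"
        proof -
          have q: "regs (eff upd1 s) ''s'' = int S" "regs (eff upd1 s) ''e'' = int e" "regs (eff upd1 s) ''v'' = v1" "regs (eff upd1 s) ''x'' = int X1"
            "regs (eff upd1 s) ''y'' = int Y1" "regs (eff upd1 s) ''c'' = F a b w e - F a b w S" using h1 by (simp_all add: holds_def)
          have "int (e - 1) = int e - 1" using e2 by (simp add: of_nat_diff)
          then show "holds a b m n w (eff upd2 (eff upd1 s)) S e v2 X2 Y2" "arrays (eff upd2 (eff upd1 s)) = arrays s"
            using f2 by (auto simp: holds_def upd2_def q h1(2) dd v2_def X2_def Y2_def)
        qed
        have "v1 \<le> v2" "d \<le> v2" by (auto simp: v2_def)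
        then have "covered a b w (Suc S) v2" using v1 covered_step[OF win sh(1) cov, of v2] by (simp add: d_def)
        then show ?thesis unfolding st invT_def using ns drop[OF h2] sh(2) pr' by (intro exI conjI) auto
      qed
    qed
  qed
qed

definition two :: com where
  "two = Seq (Seq (Assign ''s'' (Const 0)) (Seq (Assign ''e'' (Const 0)) (Seq (Assign ''c'' (Const 0)) (Seq (Assign ''v'' (Const 0)) (Seq (Assign ''x'' (Const 0)) (Assign ''y'' (Const 0)))))))
     (For (Add (Reg ''N'') (Add (Reg ''N'') (Reg ''N''))) stepT)"

definition Found :: "bool \<Rightarrow> bool \<Rightarrow> pre" where
  "Found a b m n w s \<longleftrightarrow> (\<exists>X Y. regs s ''x'' = int X \<and> regs s ''y'' = int Y \<and> ham.found m n a b w (regs s ''v'') X Y \<and> ham.covered m n a b w (m * n) (regs s ''v''))"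

lemma invT_regs: "invT a b m n w t (s\<lparr>regs := (regs s)(''k'' := x)\<rparr>) = invT a b m n w t s"
  by (simp add: invT_def holds_def)

lemma two: "triple (\<lambda>m n w s. Env m n w s \<and> Ord a b m n s (2 * (m * n))) two
   (\<lambda>m n w s0 s. Env m n w s \<and> Ord a b m n s (2 * (m * n)) \<and> Found a b m n w s)"
  unfolding two_def
proof (rule triple_Seq[where Q = "\<lambda>m n w s0 s. Env m n w s \<and> Ord a b m n s (2 * (m * n)) \<and> invT a b m n w 0 s"
      and P' = "\<lambda>m n w s. Env m n w s \<and> Ord a b m n s (2 * (m * n)) \<and> invT a b m n w 0 s"
      and Q' = "\<lambda>m n w s0 s. Env m n w s \<and> Ord a b m n s (2 * (m * n)) \<and> Found a b m n w s"])
  let ?c = "Seq (Assign ''s'' (Const 0)) (Seq (Assign ''e'' (Const 0)) (Seq (Assign ''c'' (Const 0)) (Seq (Assign ''v'' (Const 0)) (Seq (Assign ''x'' (Const 0)) (Assign ''y'' (Const 0))))))"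
  show "triple (\<lambda>m n w s. Env m n w s \<and> Ord a b m n s (2 * (m * n))) ?c (\<lambda>m n w s0 s. Env m n w s \<and> Ord a b m n s (2 * (m * n)) \<and> invT a b m n w 0 s)"
  proof (rule triple_flat)
    fix m n w s assume P: "Env m n w s \<and> Ord a b m n s (2 * (m * n))" and sm: "same ?c s (eff ?c s)"
    interpret ham m n using P ham_Env by blast
    have "Env m n w (eff ?c s)" using P by (intro Env_same[OF _ sm]) auto
    moreover have "Ord a b m n (eff ?c s) (2 * (m * n))" using P by (simp add: Ord_def)
    moreover have "holds a b m n w (eff ?c s) 0 0 0 0 0" by (simp add: holds_def found_def)
    then have "invT a b m n w 0 (eff ?c s)" unfolding invT_def
      by (intro exI conjI) (auto simp: window_def covered_def)
    ultimately show "Env m n w (eff ?c s) \<and> Ord a b m n (eff ?c s) (2 * (m * n)) \<and> invT a b m n w 0 (eff ?c s)" by blast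
  qed (auto intro: Env_pos)
  let ?f = "For (Add (Reg ''N'') (Add (Reg ''N'') (Reg ''N''))) stepT"
  have sE: "Env m n w s \<and> Ord a b m n s (2 * (m * n))" if "Env m n w s0 \<and> Ord a b m n s0 (2 * (m * n)) \<and> invT a b m n w 0 s0" "same ?f s0 s" for m n w s0 s
  proof
    show "Env m n w s" using that(1) by (intro Env_same[OF _ that(2)]) (auto simp: stepT_frame)
    show "Ord a b m n s (2 * (m * n))" using that same_refl_upd(2)[OF that(2), of "''o''"] by (simp add: Ord_def stepT_frame)
  qed
  show "triple (\<lambda>m n w s. Env m n w s \<and> Ord a b m n s (2 * (m * n)) \<and> invT a b m n w 0 s) ?f
     (\<lambda>m n w s0 s. Env m n w s \<and> Ord a b m n s (2 * (m * n)) \<and> Found a b m n w s)"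
  proof (rule triple_ForE[where L = "\<lambda>m n. 3 * (m * n)" and I = "\<lambda>m n w s0. invT a b m n w"])
    fix m n w s0 i s
    assume P: "Env m n w s0 \<and> Ord a b m n s0 (2 * (m * n)) \<and> invT a b m n w 0 s0" and sm: "same ?f s0 s" and I: "invT a b m n w i s"
    show "invT a b m n w (Suc i) ((eff stepT s)\<lparr>regs := (regs (eff stepT s))(''k'' := int (Suc i))\<rparr>)"
      unfolding invT_regs using sE[OF P sm] invT_step I by blast
  next
    fix m n w s0 s
    assume P: "Env m n w s0 \<and> Ord a b m n s0 (2 * (m * n)) \<and> invT a b m n w 0 s0" and sm: "same ?f s0 s" and I: "invT a b m n w (3 * (m * n)) s"
    have E: "Env m n w s" using sE[OF P sm] by blast
    interpret ham m n by (rule ham_Env[OF E])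
    obtain S e v X Y where H: "holds a b m n w s S e v X Y" and win: "window a b w S e" and cov: "covered a b w S v" and pr: "S = m * n \<or> 3 * (m * n) \<le> S + e"
      using I unfolding invT_def by blast
    have "S = m * n" using pr win unfolding window_def by linarith
    then have "Found a b m n w s" using H cov unfolding Found_def holds_def by blast
    then show "Env m n w s \<and> Ord a b m n s (2 * (m * n)) \<and> Found a b m n w s" using sE[OF P sm] by blast
  qed (simp_all add: stepT_frame invT_regs)
qed simp_all

text \<open>The loop runs one full turn from the start of the arc, so every cell of \<open>q\<close>
  is overwritten and no old candidate remains.\<close>

definition putB :: com where
  "putB = com.If (Less (Reg ''k'') (Sub (Reg ''y'') (Reg ''x''))) (Write ''q'' (Read ''o'' (Add (Reg ''x'') (Reg ''k''))) (Const 1)) (Write ''q'' (Read ''o'' (Add (Reg ''x'') (Reg ''k''))) (Const 0))"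

definition Arc :: "bool \<Rightarrow> bool \<Rightarrow> pre" where
  "Arc a b m n w s \<longleftrightarrow> Env m n w s \<and> Ord a b m n s (2 * (m * n)) \<and> Found a b m n w s \<and> 0 < regs s ''v''"

lemma put: "triple (Arc a b) (For (Reg ''N'') putB)
   (\<lambda>m n w s0 s. bipart m n (dec m n (arrays s ''q'')) \<and> int (minw m n w (dec m n (arrays s ''q''))) = regs s ''v'')"
proof (rule triple_ForE[where L = "\<lambda>m n. m * n" and I = "\<lambda>m n w s0 i s. \<forall>k<i. arrays s ''q'' (arrays s0 ''o'' (regs s0 ''x'' + int k)) = (if int k < regs s0 ''y'' - regs s0 ''x'' then 1 else 0)"])
  fix m n w s0 i s
  assume P: "Arc a b m n w s0" and i: "i < m * n" and sm: "same (For (Reg ''N'') putB) s0 s" and k: "regs s ''k'' = int i"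
    and I: "\<forall>k<i. arrays s ''q'' (arrays s0 ''o'' (regs s0 ''x'' + int k)) = (if int k < regs s0 ''y'' - regs s0 ''x'' then 1 else 0)"
  have E: "Env m n w s0" and O: "Ord a b m n s0 (2 * (m * n))" and Fd: "Found a b m n w s0" "0 < regs s0 ''v''" using P by (simp_all add: Arc_def)
  interpret ham m n by (rule ham_Env[OF E])
  obtain X Y where XY: "regs s0 ''x'' = int X" "X < m * n" using Fd unfolding Found_def found_def by blast
  have o: "arrays s0 ''o'' (regs s0 ''x'' + int k) = cell n (walk a b (X + k))" if "k \<le> i" for k
    using O that i XY by (simp add: Ord_def flip: of_nat_add)
  have ne: "arrays s0 ''o'' (regs s0 ''x'' + int k) \<noteq> arrays s0 ''o'' (regs s0 ''x'' + int i)" if "k < i" for k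
  proof
    assume "arrays s0 ''o'' (regs s0 ''x'' + int k) = arrays s0 ''o'' (regs s0 ''x'' + int i)"
    then have "walk a b (X + k) = walk a b (X + i)" using o[of k] o[of i] that
      by (intro cell_inj[of _ m n] cyclic.v_in[OF cyclic_walk]) simp
    then show False using cyclic.v_eq[OF cyclic_walk, of X "X + k" "X + i" a b] that i by simp
  qed
  have sr: "regs s ''x'' = regs s0 ''x''" "regs s ''y'' = regs s0 ''y''" "arrays s ''o'' = arrays s0 ''o''"
    using same_refl_upd[OF sm] by (simp_all add: putB_def)
  show "\<forall>k<Suc i. arrays ((eff putB s)\<lparr>regs := (regs (eff putB s))(''k'' := int (Suc i))\<rparr>) ''q'' (arrays s0 ''o'' (regs s0 ''x'' + int k)) = (if int k < regs s0 ''y'' - regs s0 ''x'' then 1 else 0)"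
  proof (intro allI impI)
    fix j assume "j < Suc i"
    then consider "j = i" | "j < i" by linarith
    then show "arrays ((eff putB s)\<lparr>regs := (regs (eff putB s))(''k'' := int (Suc i))\<rparr>) ''q'' (arrays s0 ''o'' (regs s0 ''x'' + int j)) = (if int j < regs s0 ''y'' - regs s0 ''x'' then 1 else 0)"
    proof cases
      case 1
      then show ?thesis by (simp add: putB_def k sr)
    next
      case 2
      then show ?thesis using I ne[OF 2] by (simp add: putB_def k sr)
    qed
  qed
next
  fix m n w s0 s
  assume P: "Arc a b m n w s0" and sm: "same (For (Reg ''N'') putB) s0 s"
    and I: "\<forall>k<m * n. arrays s ''q'' (arrays s0 ''o'' (regs s0 ''x'' + int k)) = (if int k < regs s0 ''y'' - regs s0 ''x'' then 1 else 0)"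
  have E: "Env m n w s0" and O: "Ord a b m n s0 (2 * (m * n))" and Fd: "Found a b m n w s0" "0 < regs s0 ''v''" using P by (simp_all add: Arc_def)
  interpret ham m n by (rule ham_Env[OF E])
  obtain X Y where XY: "regs s0 ''x'' = int X" "regs s0 ''y'' = int Y" "X < m * n" "X < Y" "Y < X + m * n" "\<not> skip X" "regs s0 ''v'' = val a b w X (Y - X)"
    using Fd unfolding Found_def found_def by blast
  have q: "arrays s ''q'' (cell n (walk a b (X + k))) = (if k < Y - X then 1 else 0)" if k: "k < m * n" for k
  proof -
    have "arrays s0 ''o'' (regs s0 ''x'' + int k) = cell n (walk a b (X + k))"
      using O k XY by (simp add: Ord_def flip: of_nat_add)
    moreover have "int k < regs s0 ''y'' - regs s0 ''x'' \<longleftrightarrow> k < Y - X" using XY by auto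
    ultimately show ?thesis using I k by metis
  qed
  have "dec m n (arrays s ''q'') = walk a b ` {X..<X + (Y - X)}"
  proof (intro equalityI subsetI)
    fix v assume "v \<in> dec m n (arrays s ''q'')"
    then have v: "v \<in> grid m n" "arrays s ''q'' (cell n v) = 1" unfolding dec_def by blast+
    have "v \<in> walk a b ` {X..<X + m * n}" unfolding cyclic.window_image[OF cyclic_walk] by (rule v(1))
    then obtain j where j: "v = walk a b j" "j \<in> {X..<X + m * n}" by (rule imageE)
    then have e: "X + (j - X) = j" "j - X < m * n" by auto
    have "j - X < Y - X" using q[OF e(2)] v(2) j(1) unfolding e(1) by (simp split: if_splits)
    then show "v \<in> walk a b ` {X..<X + (Y - X)}" using j by auto
  next
    fix v assume "v \<in> walk a b ` {X..<X + (Y - X)}"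
    then obtain j where j: "v = walk a b j" "j \<in> {X..<X + (Y - X)}" by (rule imageE)
    then have "arrays s ''q'' (cell n v) = 1" using q[of "j - X"] XY by auto
    moreover have "v \<in> grid m n" unfolding j(1) by (rule cyclic.v_in[OF cyclic_walk])
    ultimately show "v \<in> dec m n (arrays s ''q'')" unfolding dec_def by (intro CollectI conjI)
  qed
  then show "bipart m n (dec m n (arrays s ''q'')) \<and> int (minw m n w (dec m n (arrays s ''q''))) = regs s ''v''"
    using bipart_window[OF XY(3,6), of "Y - X" a b] XY(4,5,7) same_refl_upd(1)[OF sm, of "''v''"] unfolding val_def by (auto simp: putB_def)
qed (simp_all add: putB_def Arc_def)

definition sweep :: "bool \<times> bool \<Rightarrow> com" where
  "sweep z = Seq (gen (fst z) (snd z)) (Seq two (com.If (Less (Const 0) (Reg ''v'')) (Seq (For (Reg ''N'') putB) EV) Skip))"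

definition swept_by :: "bool \<times> bool \<Rightarrow> nat \<Rightarrow> nat \<Rightarrow> (nat \<times> nat \<Rightarrow> nat) \<Rightarrow> int \<Rightarrow> bool" where
  "swept_by z m n w \<beta> \<longleftrightarrow> ham.covered m n (fst z) (snd z) w (m * n) \<beta>"

lemma J_same:
  assumes "J m n w s0" "Env m n w s" "same c s0 s" "''b'' \<notin> wr c" "''u'' \<notin> wa c"
  shows "J m n w s"
  using assms by (simp add: J_def same_def)

lemma two_frame: "wr two = {''s'', ''e'', ''c'', ''v'', ''x'', ''y'', ''d'', ''k''}" "wa two = {}"
  by (auto simp: two_def stepT_frame)

lemma ham_covered_mono: "ham m n \<Longrightarrow> ham.covered m n a b w S v \<Longrightarrow> v \<le> v' \<Longrightarrow> ham.covered m n a b w S v'"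
  unfolding ham.covered_def by (meson order_trans)

lemma sweep: "triple J (sweep z) (\<lambda>m n w s0 s. J m n w s \<and> regs s0 ''b'' \<le> regs s ''b'' \<and> swept_by z m n w (regs s ''b''))"
proof -
  obtain a b where z: "z = (a, b)" by (cases z)
  let ?O = "\<lambda>m n s. Ord a b m n s (2 * (m * n))"
  let ?Q = "\<lambda>m n w s0 s. J m n w s \<and> regs s0 ''b'' \<le> regs s ''b'' \<and> swept_by z m n w (regs s ''b'')"
  have JE: "Env m n w s" if "J m n w s" for m n w s using that by (simp add: J_def)
  have p: "triple (\<lambda>m n w s. J m n w s \<and> Arc a b m n w s) (Seq (For (Reg ''N'') putB) EV) ?Q"
  proof (rule triple_Seq[where Q = "\<lambda>m n w s0 s. bipart m n (dec m n (arrays s ''q'')) \<and> int (minw m n w (dec m n (arrays s ''q''))) = regs s ''v''"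
      and P' = "\<lambda>m n w s. J m n w s \<and> bipart m n (dec m n (arrays s ''q''))" and Q' = "\<lambda>m n w s0 s. J m n w s \<and> regs s0 ''b'' \<le> regs s ''b'' \<and> int (minw m n w (dec m n (arrays s0 ''q''))) \<le> regs s ''b''"])
    show "triple (\<lambda>m n w s. J m n w s \<and> Arc a b m n w s) (For (Reg ''N'') putB) (\<lambda>m n w s0 s. bipart m n (dec m n (arrays s ''q'')) \<and> int (minw m n w (dec m n (arrays s ''q''))) = regs s ''v'')"
      by (rule triple_conseq[OF put]) blast+
    fix m n w s s'
    assume A: "J m n w s \<and> Arc a b m n w s" and B: "bipart m n (dec m n (arrays s' ''q'')) \<and> int (minw m n w (dec m n (arrays s' ''q''))) = regs s' ''v''"
      and sm: "same (For (Reg ''N'') putB) s s'"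
    have "Env m n w s'" using A by (intro Env_same[OF _ sm]) (auto simp: putB_def Arc_def)
    then have "J m n w s'" using A by (intro J_same[OF _ _ sm]) (auto simp: putB_def)
    then show "J m n w s' \<and> bipart m n (dec m n (arrays s' ''q''))" using B by blast
    fix s'' assume C: "J m n w s'' \<and> regs s' ''b'' \<le> regs s'' ''b'' \<and> int (minw m n w (dec m n (arrays s' ''q''))) \<le> regs s'' ''b''"
    have "ham m n" using A JE ham_Env by blast
    moreover have "ham.covered m n a b w (m * n) (regs s ''v'')" using A unfolding Arc_def Found_def by blast
    moreover have "regs s' ''v'' = regs s ''v''" "regs s' ''b'' = regs s ''b''" using same_refl_upd(1)[OF sm] by (simp_all add: putB_def)
    ultimately show "?Q m n w s s''" using B C ham_covered_mono[of m n a b w "m * n" "regs s ''v''" "regs s'' ''b''"] unfolding swept_by_def z by simp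
  qed (rule EV)
  have i: "triple (\<lambda>m n w s. J m n w s \<and> ?O m n s \<and> Found a b m n w s) (com.If (Less (Const 0) (Reg ''v'')) (Seq (For (Reg ''N'') putB) EV) Skip) ?Q"
  proof (rule triple_If)
    show "triple (\<lambda>m n w s. (J m n w s \<and> ?O m n s \<and> Found a b m n w s) \<and> bval (Less (Const 0) (Reg ''v'')) s) (Seq (For (Reg ''N'') putB) EV) ?Q"
      by (rule triple_conseq[OF p]) (auto simp: Arc_def JE)
    show "triple (\<lambda>m n w s. (J m n w s \<and> ?O m n s \<and> Found a b m n w s) \<and> \<not> bval (Less (Const 0) (Reg ''v'')) s) Skip ?Q"
    proof (rule triple_flat)
      fix m n w s assume A: "(J m n w s \<and> ?O m n s \<and> Found a b m n w s) \<and> \<not> bval (Less (Const 0) (Reg ''v'')) s"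
      have h: "ham m n" using A JE ham_Env by blast
      have "ham.covered m n a b w (m * n) (regs s ''v'')" "regs s ''v'' \<le> regs s ''b''" using A unfolding Found_def J_def by auto
      then show "?Q m n w s (eff Skip s)" using A ham_covered_mono[OF h] unfolding swept_by_def z by auto
    qed (auto intro: J_pos)
  qed (use J_N in blast)
  have t: "triple (\<lambda>m n w s. J m n w s \<and> ?O m n s) (Seq two (com.If (Less (Const 0) (Reg ''v'')) (Seq (For (Reg ''N'') putB) EV) Skip)) ?Q"
  proof (rule triple_Seq[OF triple_conseq[OF two[of a b], where P' = "\<lambda>m n w s. J m n w s \<and> ?O m n s" and Q' = "\<lambda>m n w s0 s. J m n w s \<and> ?O m n s \<and> Found a b m n w s"] i])
    fix m n w s s'
    assume A: "J m n w s \<and> ?O m n s" and sm: "same two s s'" and B: "Env m n w s' \<and> ?O m n s' \<and> Found a b m n w s'"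
    have "J m n w s'" using A B by (intro J_same[OF _ _ sm]) (auto simp: two_frame)
    then show "J m n w s' \<and> ?O m n s' \<and> Found a b m n w s'" using B by blast
  next
    fix m n w s s' s''
    assume "same two s s'" "?Q m n w s' s''"
    then show "?Q m n w s s''" using same_refl_upd(1)[of two s s' "''b''"] by (simp add: two_frame)
  qed (auto simp: JE)
  show ?thesis
    unfolding sweep_def z fst_conv snd_conv
  proof (rule triple_Seq[OF triple_conseq[OF gen[of a b], where P' = J and Q' = "\<lambda>m n w s0 s. J m n w s \<and> ?O m n s"] t[unfolded z]])
    fix m n w s s'
    assume A: "J m n w s" and sm: "same (gen a b) s s'" and B: "Env m n w s' \<and> ?O m n s'"
    have "J m n w s'" using A B by (intro J_same[OF _ _ sm]) (auto simp: gen_frame)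
    then show "J m n w s' \<and> ?O m n s'" using B by blast
  next
    fix m n w s s' s''
    assume "same (gen a b) s s'" "J m n w s'' \<and> regs s' ''b'' \<le> regs s'' ''b'' \<and> swept_by (a, b) m n w (regs s'' ''b'')"
    then show "J m n w s'' \<and> regs s ''b'' \<le> regs s'' ''b'' \<and> swept_by (a, b) m n w (regs s'' ''b'')" using same_refl_upd(1)[of "gen a b" s s' "''b''"] by (simp add: gen_frame)
  qed (auto simp: JE)
qed

section \<open>Trying all bipartitions of the merged grid\<close>

text \<open>The set of merged cells is compiled into the program text as constants, so the cost of
  this test depends only on the list.\<close>

fun inb :: "(nat \<times> nat) list \<Rightarrow> bexp" where
  "inb [] = Less (Const 0) (Const 0)"
| "inb (p # xs) = bexp.Not (bexp.And
     (bexp.Not (bexp.And (Eq (Read ''f'' (Read ''I'' (Reg ''k''))) (Const (int (fst p)))) (Eq (Read ''g'' (Read ''J'' (Reg ''k''))) (Const (int (snd p))))))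
     (bexp.Not (inb xs)))"

lemma bval_inb:
  assumes "arrays s ''f'' (arrays s ''I'' (regs s ''k'')) = int a" "arrays s ''g'' (arrays s ''J'' (regs s ''k'')) = int b"
  shows "bval (inb xs) s \<longleftrightarrow> (a, b) \<in> set xs"
  using assms by (induction xs) auto

definition tryB :: "(nat \<times> nat) list \<Rightarrow> com" where
  "tryB xs = com.If (inb xs) (Write ''q'' (Reg ''k'') (Const 1)) (Write ''q'' (Reg ''k'') (Const 0))"

text \<open>A pattern carries the dimensions of its merged grid and is tried only if the instance
  has exactly these; otherwise its lift need not be a bipartition.\<close>

definition tryX :: "(nat \<times> nat) \<times> (nat \<times> nat) list \<Rightarrow> com" where
  "tryX z = com.If (bexp.And (Eq (Read ''f'' (Reg ''m'')) (Const (int (fst (fst z))))) (Eq (Read ''g'' (Reg ''n'')) (Const (int (snd (fst z))))))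
     (Seq (For (Reg ''N'') (tryB (snd z))) EV) Skip"

definition lifted :: "nat \<Rightarrow> nat \<Rightarrow> (nat \<times> nat \<Rightarrow> nat) \<Rightarrow> (nat \<times> nat) set \<Rightarrow> (nat \<times> nat) set" where
  "lifted m n w X = {v \<in> grid m n. (cm (heavy_rows m n w) (fst v), cm (heavy_cols m n w) (snd v)) \<in> X}"

definition tried :: "(nat \<times> nat) \<times> (nat \<times> nat) list \<Rightarrow> nat \<Rightarrow> nat \<Rightarrow> (nat \<times> nat \<Rightarrow> nat) \<Rightarrow> int \<Rightarrow> bool" where
  "tried z m n w \<beta> \<longleftrightarrow> (cm (heavy_rows m n w) m = fst (fst z) \<and> cm (heavy_cols m n w) n = snd (fst z) \<longrightarrow>
     int (minw m n w (lifted m n w (set (snd z)))) \<le> \<beta>)"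

lemma classmap_cm: "1 \<in> R \<Longrightarrow> classmap m R (cm R)"
  by (simp add: classmap_def)

lemma classes_cm: "3 \<le> m \<Longrightarrow> 3 \<le> n \<Longrightarrow> classes m n (heavy_rows m n w) (heavy_cols m n w) (cm (heavy_rows m n w)) (cm (heavy_cols m n w))"
  by unfold_locales (auto simp: heavy_rows_def heavy_cols_def intro!: classmap_cm)

lemma bipart_lifted:
  assumes "3 \<le> m" "3 \<le> n" "bipart (cm (heavy_rows m n w) m) (cm (heavy_cols m n w) n) X"
  shows "bipart m n (lifted m n w X)"
proof -
  interpret classes m n "heavy_rows m n w" "heavy_cols m n w" "cm (heavy_rows m n w)" "cm (heavy_cols m n w)" by (rule classes_cm[OF assms(1,2)])
  have "lifted m n w X = lift X" by (simp add: lifted_def lift_def h_def case_prod_unfold)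
  then show ?thesis using bipart_lift[OF assms(3)] by simp
qed

lemma loopX: "triple J (For (Reg ''N'') (tryB xs)) (\<lambda>m n w s0 s. J m n w s \<and> dec m n (arrays s ''q'') = lifted m n w (set xs) \<and> regs s ''b'' = regs s0 ''b'')"
proof (rule triple_ForE[where L = "\<lambda>m n. m * n" and I = "\<lambda>m n w s0 i s. \<forall>k<i. arrays s ''q'' (int k) = (if cel n k \<in> lifted m n w (set xs) then 1 else 0)"])
  fix m n w s0 i s
  assume P: "J m n w s0" and i: "i < m * n" and sm: "same (For (Reg ''N'') (tryB xs)) s0 s" and k: "regs s ''k'' = int i"
    and I: "\<forall>k<i. arrays s ''q'' (int k) = (if cel n k \<in> lifted m n w (set xs) then 1 else 0)"
  have E: "Env m n w s" using P by (intro Env_same[OF _ sm]) (auto simp: tryB_def J_def)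
  have g: "Suc (i div n) \<le> m" "Suc (i mod n) \<le> n" "cel n i \<in> grid m n" using cel_grid[OF i] by (simp_all add: cel_def)
  have mn: "m \<le> m * n" "n \<le> m * n" using Env_pos[OF E] by simp_all
  have "arrays s ''f'' (arrays s ''I'' (regs s ''k'')) = int (cm (heavy_rows m n w) (Suc (i div n)))"
    "arrays s ''g'' (arrays s ''J'' (regs s ''k'')) = int (cm (heavy_cols m n w) (Suc (i mod n)))"
    unfolding k Env_simps(9,10)[OF E i] by (rule Env_simps(12)[OF E order_trans[OF g(1) mn(1)]] Env_simps(13)[OF E order_trans[OF g(2) mn(2)]])+
  from bval_inb[OF this, of xs] have bv: "bval (inb xs) s \<longleftrightarrow> cel n i \<in> lifted m n w (set xs)"
    using g(3) unfolding lifted_def by (simp add: cel_def)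
  show "\<forall>k<Suc i. arrays ((eff (tryB xs) s)\<lparr>regs := (regs (eff (tryB xs) s))(''k'' := int (Suc i))\<rparr>) ''q'' (int k) = (if cel n k \<in> lifted m n w (set xs) then 1 else 0)"
    using I by (simp add: tryB_def bv k less_Suc_eq)
next
  fix m n w s0 s
  assume P: "J m n w s0" and sm: "same (For (Reg ''N'') (tryB xs)) s0 s"
    and I: "\<forall>k<m * n. arrays s ''q'' (int k) = (if cel n k \<in> lifted m n w (set xs) then 1 else 0)"
  have E: "Env m n w s" using P by (intro Env_same[OF _ sm]) (auto simp: tryB_def J_def)
  have "J m n w s" using P E by (intro J_same[OF _ _ sm]) (auto simp: tryB_def)
  moreover have "dec m n (arrays s ''q'') = lifted m n w (set xs)"
  proof (intro equalityI subsetI)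
    fix v assume v: "v \<in> dec m n (arrays s ''q'')"
    then have "v \<in> grid m n" unfolding dec_def by blast
    then obtain k where k: "k < m * n" "v = cel n k" by (rule cel_surj)
    then show "v \<in> lifted m n w (set xs)" using v I dec_cel[OF k(1)] by (auto split: if_splits)
  next
    fix v assume v: "v \<in> lifted m n w (set xs)"
    then have "v \<in> grid m n" unfolding lifted_def by blast
    then obtain k where k: "k < m * n" "v = cel n k" by (rule cel_surj)
    then show "v \<in> dec m n (arrays s ''q'')" using v I dec_cel[OF k(1)] by auto
  qed
  ultimately show "J m n w s \<and> dec m n (arrays s ''q'') = lifted m n w (set xs) \<and> regs s ''b'' = regs s0 ''b''"
    using same_refl_upd(1)[OF sm, of "''b''"] by (simp add: tryB_def)
qed (simp_all add: tryB_def J_def)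

lemma tryX:
  assumes z: "bipart (fst (fst z)) (snd (fst z)) (set (snd z))"
  shows "triple J (tryX z) (\<lambda>m n w s0 s. J m n w s \<and> regs s0 ''b'' \<le> regs s ''b'' \<and> tried z m n w (regs s ''b''))"
proof -
  let ?b = "bexp.And (Eq (Read ''f'' (Reg ''m'')) (Const (int (fst (fst z))))) (Eq (Read ''g'' (Reg ''n'')) (Const (int (snd (fst z)))))"
  let ?C = "\<lambda>m n w. cm (heavy_rows m n w) m = fst (fst z) \<and> cm (heavy_cols m n w) n = snd (fst z)"
  have b: "bval ?b s \<longleftrightarrow> ?C m n w" if j: "J m n w s" for m n w s
  proof -
    have E: "Env m n w s" using j by (simp add: J_def)
    have mn: "m \<le> m * n" "n \<le> m * n" using Env_pos[OF E] by simp_all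
    show ?thesis using Env_simps(12)[OF E mn(1)] Env_simps(13)[OF E mn(2)] by (simp add: Env_simps(3,4)[OF E])
  qed
  let ?Q = "\<lambda>m n w s0 s. J m n w s \<and> regs s0 ''b'' \<le> regs s ''b'' \<and> tried z m n w (regs s ''b'')"
  show ?thesis
    unfolding tryX_def
  proof (rule triple_If)
    show "triple (\<lambda>m n w s. J m n w s \<and> bval ?b s) (Seq (For (Reg ''N'') (tryB (snd z))) EV) ?Q"
    proof (rule triple_Seq[where Q = "\<lambda>m n w s0 s. ?C m n w \<and> J m n w s \<and> dec m n (arrays s ''q'') = lifted m n w (set (snd z)) \<and> regs s ''b'' = regs s0 ''b''"
      and P' = "\<lambda>m n w s. J m n w s \<and> bipart m n (dec m n (arrays s ''q''))" and Q' = "\<lambda>m n w s0 s. J m n w s \<and> regs s0 ''b'' \<le> regs s ''b'' \<and> int (minw m n w (dec m n (arrays s0 ''q''))) \<le> regs s ''b''"])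
      show "triple (\<lambda>m n w s. J m n w s \<and> bval ?b s) (For (Reg ''N'') (tryB (snd z)))
        (\<lambda>m n w s0 s. ?C m n w \<and> J m n w s \<and> dec m n (arrays s ''q'') = lifted m n w (set (snd z)) \<and> regs s ''b'' = regs s0 ''b'')"
      proof (rule triple_conseq[OF loopX])
        fix m n w s s'
        assume A: "J m n w s \<and> bval ?b s" and B: "J m n w s' \<and> dec m n (arrays s' ''q'') = lifted m n w (set (snd z)) \<and> regs s' ''b'' = regs s ''b''"
        have "?C m n w" using b[OF conjunct1[OF A]] conjunct2[OF A] by (rule iffD1)
        then show "?C m n w \<and> J m n w s' \<and> dec m n (arrays s' ''q'') = lifted m n w (set (snd z)) \<and> regs s' ''b'' = regs s ''b''" using B by (rule conjI)
      qed (rule conjunct1)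
      fix m n w s s'
      assume B: "?C m n w \<and> J m n w s' \<and> dec m n (arrays s' ''q'') = lifted m n w (set (snd z)) \<and> regs s' ''b'' = regs s ''b''"
      have E: "Env m n w s'" using B by (simp add: J_def)
      have "bipart m n (lifted m n w (set (snd z)))"
        by (rule bipart_lifted[OF Env_simps(1,2)[OF E]]) (use z B in simp)
      then show "J m n w s' \<and> bipart m n (dec m n (arrays s' ''q''))" using B by simp
      fix s'' assume "J m n w s'' \<and> regs s' ''b'' \<le> regs s'' ''b'' \<and> int (minw m n w (dec m n (arrays s' ''q''))) \<le> regs s'' ''b''"
      then show "?Q m n w s s''" using B by (simp add: tried_def)
    qed (rule EV)
    show "triple (\<lambda>m n w s. J m n w s \<and> \<not> bval ?b s) Skip ?Q"
    proof (rule triple_flat)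
      fix m n w s assume A: "J m n w s \<and> \<not> bval ?b s"
      then have "\<not> ?C m n w" using b by blast
      then have "tried z m n w (regs s ''b'')" unfolding tried_def by blast
      then show "?Q m n w s (eff Skip s)" using A by simp
    qed (auto intro: J_pos)
  qed (use J_N in blast)
qed

text \<open>The list is part of the program text, so the constants of its finitely many members
  simply add up. Monotonicity keeps earlier achievements valid while the best value grows.\<close>

lemma triple_list:
  assumes "\<And>z. z \<in> set L \<Longrightarrow> triple J (C z) (\<lambda>m n w s0 s. J m n w s \<and> regs s0 ''b'' \<le> regs s ''b'' \<and> D z m n w (regs s ''b''))"
    and mono: "\<And>z m n w \<beta> \<beta>'. 3 \<le> m \<Longrightarrow> 3 \<le> n \<Longrightarrow> D z m n w \<beta> \<Longrightarrow> \<beta> \<le> \<beta>' \<Longrightarrow> D z m n w \<beta>'"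
  shows "triple J (foldr (\<lambda>z. Seq (C z)) L Skip) (\<lambda>m n w s0 s. J m n w s \<and> regs s0 ''b'' \<le> regs s ''b'' \<and> (\<forall>z\<in>set L. D z m n w (regs s ''b'')))"
  using assms(1)
proof (induction L)
  case Nil
  have "triple J Skip (\<lambda>m n w s0 s. J m n w s \<and> regs s0 ''b'' \<le> regs s ''b'')"
    by (rule triple_flat) (auto intro: J_pos)
  then show ?case by simp
next
  case (Cons z L)
  have "triple J (Seq (C z) (foldr (\<lambda>z. Seq (C z)) L Skip)) (\<lambda>m n w s0 s. J m n w s \<and> regs s0 ''b'' \<le> regs s ''b'' \<and> (\<forall>z\<in>set (z # L). D z m n w (regs s ''b'')))"
  proof (rule triple_Seq[OF Cons.prems[of z] Cons.IH])
    fix m n w s s' s''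
    assume A: "J m n w s' \<and> regs s ''b'' \<le> regs s' ''b'' \<and> D z m n w (regs s' ''b'')"
      and B: "J m n w s'' \<and> regs s' ''b'' \<le> regs s'' ''b'' \<and> (\<forall>z\<in>set L. D z m n w (regs s'' ''b''))"
    have "3 \<le> m" "3 \<le> n" using A by (simp_all add: J_def Env_def Core_def Base_def)
    then have "D z m n w (regs s'' ''b'')" using A B mono by blast
    then show "J m n w s'' \<and> regs s ''b'' \<le> regs s'' ''b'' \<and> (\<forall>z\<in>set (z # L). D z m n w (regs s'' ''b''))" using A B by auto
  qed (use Cons.prems in auto)
  then show ?case by simp
qed

text \<open>At most nine rows are special, the four at the border and five heavy ones, and each
  raises the class number at most twice. So there are at most 18 classes, and 19 is a safe bound;
  the same holds for columns.\<close>

definition patterns :: "(nat \<times> nat) \<times> (nat \<times> nat) set \<Rightarrow> bool" where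
  "patterns p \<longleftrightarrow> fst (fst p) \<le> 19 \<and> snd (fst p) \<le> 19 \<and> bipart (fst (fst p)) (snd (fst p)) (snd p)"

text \<open>An arbitrary enumeration suffices: the set of patterns does not depend on the instance,
  so \<open>tries\<close> is one fixed list and the program one fixed text.\<close>

definition listing :: "'a set \<Rightarrow> 'a list" where "listing X = (SOME xs. set xs = X)"

lemma set_listing: "finite X \<Longrightarrow> set (listing X) = X"
  unfolding listing_def by (rule someI_ex) (rule finite_list)

definition tries :: "((nat \<times> nat) \<times> (nat \<times> nat) list) list" where
  "tries = map (\<lambda>p. (fst p, listing (snd p))) (listing {p. patterns p})"

lemma finite_bipart: "bipart m n X \<Longrightarrow> finite X"
  by (rule finite_subset[of _ "grid m n"]) (simp_all add: bipart_def)

lemma finite_patterns: "finite {p. patterns p}"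
proof (rule finite_subset)
  show "{p. patterns p} \<subseteq> ({..19} \<times> {..19}) \<times> Pow (grid 19 19)"
  proof
    fix p assume "p \<in> {p. patterns p}"
    then have p: "fst (fst p) \<le> 19" "snd (fst p) \<le> 19" "snd p \<subseteq> grid (fst (fst p)) (snd (fst p))" by (simp_all add: patterns_def bipart_def)
    have "grid (fst (fst p)) (snd (fst p)) \<subseteq> grid 19 19" using p(1,2) by (intro Sigma_mono) auto
    then have "snd p \<subseteq> grid 19 19" using p(3) by (rule subset_trans[rotated])
    then show "p \<in> ({..19} \<times> {..19}) \<times> Pow (grid 19 19)" using p(1,2) unfolding mem_Times_iff by simp
  qed
qed simp

lemma tries:
  shows "z \<in> set tries \<Longrightarrow> bipart (fst (fst z)) (snd (fst z)) (set (snd z))"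
    and "patterns p \<Longrightarrow> \<exists>z\<in>set tries. fst z = fst p \<and> set (snd z) = snd p"
proof -
  have st: "set tries = (\<lambda>p. (fst p, listing (snd p))) ` {p. patterns p}"
    by (simp only: tries_def set_map set_listing[OF finite_patterns])
  have l: "set (listing (snd p)) = snd p" if "patterns p" for p
    using that finite_bipart set_listing unfolding patterns_def by metis
  show "bipart (fst (fst z)) (snd (fst z)) (set (snd z))" if "z \<in> set tries"
  proof -
    obtain p where p: "z = (fst p, listing (snd p))" "p \<in> {p. patterns p}" using \<open>z \<in> set tries\<close> unfolding st by (rule imageE)
    then have "patterns p" by simp
    then show ?thesis using l[of p] p(1) by (simp add: patterns_def)
  qed
  show "\<exists>z\<in>set tries. fst z = fst p \<and> set (snd z) = snd p" if "patterns p"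
    unfolding st using that l[OF that] by (intro bexI[of _ "(fst p, listing (snd p))"]) simp_all
qed

text \<open>All four reflections are swept because three of the four corners may be heavy, and the
  exceptional position has to be moved to the free one.\<close>

definition sweeps :: "(bool \<times> bool) list" where "sweeps = [(False, False), (False, True), (True, False), (True, True)]"

definition program :: com where
  "program = Seq phaseA (Seq phaseB (Seq phaseC (Seq phaseD
     (Seq (foldr (\<lambda>z. Seq (sweep z)) sweeps Skip) (foldr (\<lambda>z. Seq (tryX z)) tries Skip)))))"

definition Inp :: pre where
  "Inp m n w s \<longleftrightarrow> 3 \<le> m \<and> 3 \<le> n \<and> (\<forall>v\<in>grid m n. 0 < w v) \<and> s = grid_input m n w"

lemma Inp_PA: "Inp m n w s \<Longrightarrow> PA m n w s \<and> arrays s ''r'' 0 = 0"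
proof -
  assume I: "Inp m n w s"
  have "arrays s ''w'' (int k) = int (w (cel n k))" if "k < m * n" for k
    using grid_input_cell[of "cel n k" m n w] cel_grid[OF that] I by (simp add: cell_cel Inp_def)
  then show ?thesis using I by (simp add: PA_def Base_def Inp_def grid_input_def)
qed

definition Done :: pre where
  "Done m n w s \<longleftrightarrow> J m n w s \<and> (\<forall>z\<in>set sweeps. swept_by z m n w (regs s ''b'')) \<and> (\<forall>z\<in>set tries. tried z m n w (regs s ''b''))"

lemma swept_by_mono: "3 \<le> m \<Longrightarrow> 3 \<le> n \<Longrightarrow> swept_by z m n w \<beta> \<Longrightarrow> \<beta> \<le> \<beta>' \<Longrightarrow> swept_by z m n w \<beta>'"
  unfolding swept_by_def by (rule ham_covered_mono[OF ham.intro])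

lemma program: "triple Inp program (\<lambda>m n w s0. Done m n w)"
proof -
  have seq: "triple P (Seq c d) (\<lambda>m n w s0. R m n w)" if "triple P c (\<lambda>m n w s0. Q m n w)" "triple Q d (\<lambda>m n w s0. R m n w)" for P Q R :: pre and c d
    by (rule triple_Seq[OF that])
  have A: "triple Inp phaseA (\<lambda>m n w s0. PB m n w)"
    by (rule triple_conseq[OF phaseA]) (auto dest: Inp_PA)
  have D: "triple PD phaseD (\<lambda>m n w s0. J m n w)"
    by (rule triple_conseq[OF phaseD]) (auto simp: J_def)
  have S: "triple J (foldr (\<lambda>z. Seq (sweep z)) sweeps Skip) (\<lambda>m n w s0 s. J m n w s \<and> regs s0 ''b'' \<le> regs s ''b'' \<and> (\<forall>z\<in>set sweeps. swept_by z m n w (regs s ''b'')))"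
    by (rule triple_list) (rule sweep, rule swept_by_mono)
  have X: "triple J (foldr (\<lambda>z. Seq (tryX z)) tries Skip) (\<lambda>m n w s0 s. J m n w s \<and> regs s0 ''b'' \<le> regs s ''b'' \<and> (\<forall>z\<in>set tries. tried z m n w (regs s ''b'')))"
    by (rule triple_list) (rule tryX, erule tries(1), auto simp: tried_def)
  have "triple J (Seq (foldr (\<lambda>z. Seq (sweep z)) sweeps Skip) (foldr (\<lambda>z. Seq (tryX z)) tries Skip)) (\<lambda>m n w s0. Done m n w)"
  proof (rule triple_Seq[OF S X])
    fix m n w s s' s''
    assume A: "J m n w s' \<and> regs s ''b'' \<le> regs s' ''b'' \<and> (\<forall>z\<in>set sweeps. swept_by z m n w (regs s' ''b''))"
      and B: "J m n w s'' \<and> regs s' ''b'' \<le> regs s'' ''b'' \<and> (\<forall>z\<in>set tries. tried z m n w (regs s'' ''b''))"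
    have "3 \<le> m" "3 \<le> n" using A by (simp_all add: J_def Env_def Core_def Base_def)
    then show "Done m n w s''" using A B swept_by_mono unfolding Done_def by blast
  qed simp
  from seq[OF A seq[OF phaseB seq[OF phaseC seq[OF D this]]]] show ?thesis unfolding program_def .
qed

section \<open>Size of the merged grid and correctness of the output\<close>

text \<open>The increase at index \<open>k + 1\<close> is charged to \<open>k\<close> or to
  \<open>k + 1\<close>, whichever is in \<open>R\<close>; so each element pays at most
  twice.\<close>

lemma cm_le: "finite R \<Longrightarrow> cm R k \<le> card (R \<inter> {..<k}) + card (R \<inter> {..k})"
proof (induction k)
  case (Suc k)
  have 1: "card (R \<inter> {..<Suc k}) = card (R \<inter> {..<k}) + (if k \<in> R then 1 else 0)"
    using Suc.prems by (auto simp: lessThan_Suc Int_insert_right)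
  have 2: "card (R \<inter> {..Suc k}) = card (R \<inter> {..k}) + (if Suc k \<in> R then 1 else 0)"
    using Suc.prems by (auto simp: atMost_Suc Int_insert_right)
  show ?case using Suc 1 2 by auto
qed simp

lemma cm_le_card: "finite R \<Longrightarrow> cm R k \<le> 2 * card R"
  using cm_le[of R k] card_mono[of R "R \<inter> {..<k}"] card_mono[of R "R \<inter> {..k}"] by simp

text \<open>Six heavy cells would together exceed the total weight, which is positive.\<close>

lemma card_heavy:
  fixes w :: "nat \<times> nat \<Rightarrow> nat"
  assumes "(1::nat) \<le> m" "(1::nat) \<le> n" "\<And>v. v \<in> grid m n \<Longrightarrow> 0 < w v"
  shows "card {v \<in> grid m n. sum w (grid m n) \<le> 5 * w v} \<le> (5::nat)"
proof -
  let ?H = "{v \<in> grid m n. sum w (grid m n) \<le> 5 * w v}" and ?W = "sum w (grid m n)"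
  have one: "(1, 1) \<in> grid m n" using assms by simp
  then have "w (1, 1) \<le> ?W" by (intro member_le_sum) simp_all
  then have W: "0 < ?W" using assms(3)[OF one] by simp
  have "of_nat (card ?H) * ?W \<le> (\<Sum>v\<in>?H. 5 * w v)" by (rule sum_bounded_below) blast
  also have "\<dots> = 5 * sum w ?H" by (simp add: sum_distrib_left)
  also have "sum w ?H \<le> ?W" by (rule sum_mono2) auto
  finally have "card ?H * ?W \<le> 5 * ?W" by simp
  then show ?thesis using W by simp
qed

lemma classes_le:
  assumes "(1::nat) \<le> m" "(1::nat) \<le> n" "\<And>v. v \<in> grid m n \<Longrightarrow> 0 < w v"
  shows "cm (heavy_rows m n w) m \<le> 19" "cm (heavy_cols m n w) n \<le> 19"
proof -
  let ?H = "{v \<in> grid m n. sum w (grid m n) \<le> 5 * w v}"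
  have f: "finite ?H" by (rule finite_subset[of _ "grid m n"]) auto
  have four: "card {a, b, c, d} \<le> 4" for a b c d :: nat by (simp add: card_insert_if)
  have H: "card ?H \<le> 5" by (rule card_heavy) (use assms in auto)
  have "card (heavy_rows m n w) \<le> 4 + 5"
    unfolding heavy_rows_def by (rule order_trans[OF card_Un_le add_mono[OF four order_trans[OF card_image_le[OF f] H]]])
  moreover have "finite (heavy_rows m n w)" unfolding heavy_rows_def using f by simp
  ultimately show "cm (heavy_rows m n w) m \<le> 19" using cm_le_card[of "heavy_rows m n w" m] by linarith
  have "card (heavy_cols m n w) \<le> 4 + 5"
    unfolding heavy_cols_def by (rule order_trans[OF card_Un_le add_mono[OF four order_trans[OF card_image_le[OF f] H]]])
  moreover have "finite (heavy_cols m n w)" unfolding heavy_cols_def using f by simp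
  ultimately show "cm (heavy_cols m n w) n \<le> 19" using cm_le_card[of "heavy_cols m n w" n] by linarith
qed

text \<open>The final register \<open>b\<close> meets all requirements on \<open>M\<close>: the
  sweeps account for the arcs, and the patterns for every saturated bipartition through its image in
  the merged grid.\<close>

lemma Done_swept:
  assumes D: "Done m n w s"
  shows "swept m n (heavy_rows m n w) (heavy_cols m n w) (cm (heavy_rows m n w)) (cm (heavy_cols m n w)) w (nat (regs s ''b''))"
proof -
  let ?R = "heavy_rows m n w" and ?C = "heavy_cols m n w"
  have J: "J m n w s" using D by (simp add: Done_def)
  then have E: "Env m n w s" and b0: "0 \<le> regs s ''b''" by (simp_all add: J_def)
  have sw: "\<forall>z\<in>set sweeps. swept_by z m n w (regs s ''b'')" and tr: "\<forall>z\<in>set tries. tried z m n w (regs s ''b'')"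
    using D unfolding Done_def by blast+
  note mn3 = Env_simps(1,2)[OF E]
  interpret ham m n by (rule ham_Env[OF E])
  interpret classes m n ?R ?C "cm ?R" "cm ?C" by (rule classes_cm[OF mn3])
  show ?thesis
  proof
    fix v assume v: "v \<in> grid m n" "sum w (grid m n) \<le> 5 * w v"
    then have "v \<in> {v \<in> grid m n. sum w (grid m n) \<le> 5 * w v}" by blast
    then have "fst v \<in> ?R" "snd v \<in> ?C" unfolding heavy_rows_def heavy_cols_def by blast+
    then show "special v" using v(1) unfolding special_def by (intro conjI)
  next
    fix a b s' l assume a: "s' < m * n" "0 < l" "l < m * n" "\<not> (exceptional \<and> (s' = \<tau> \<or> s' = \<tau> + 2))"
    have im: "mirror m n a b ` ord ` S = walk a b ` S" for S by (simp add: image_image walk_def[abs_def])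
    have "(a, b) \<in> set sweeps" unfolding sweeps_def by (cases a; cases b) simp_all
    from bspec[OF sw this] have "covered a b w (m * n) (regs s ''b'')" unfolding swept_by_def fst_conv snd_conv .
    then have "val a b w s' l \<le> regs s ''b''" using a unfolding covered_def skip_def by blast
    then show "minw m n w (mirror m n a b ` ord ` {s'..<s' + l}) \<le> nat (regs s ''b'')"
      unfolding val_def im le_nat_iff[OF b0] .
  next
    fix V assume V: "bipart m n V" "sat V"
    have bp: "bipart (cm ?R m) (cm ?C n) (h ` V)" by (rule bipart_image[OF V(2,1)])
    have "1 \<le> m" "1 \<le> n" using mn3 by simp_all
    then have "patterns ((cm ?R m, cm ?C n), h ` V)"
      using bp classes_le[of m n w] Env_simps(15)[OF E] unfolding patterns_def by simp
    from tries(2)[OF this] obtain z where z: "z \<in> set tries" "fst z = (cm ?R m, cm ?C n)" "set (snd z) = h ` V" by auto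
    then have "int (minw m n w (lifted m n w (h ` V))) \<le> regs s ''b''" using bspec[OF tr z(1)] unfolding tried_def z(2,3) by simp
    moreover have "lifted m n w (h ` V) = V"
    proof -
      have "lifted m n w (h ` V) = lift (h ` V)" by (simp add: lifted_def lift_def h_def case_prod_unfold)
      then show ?thesis using sat_lift_image[OF V(2)] by simp
    qed
    ultimately show "minw m n w V \<le> nat (regs s ''b'')" by (simp add: le_nat_iff[OF b0])
  qed
qed

lemma minw_pos:
  assumes "bipart m n V" "\<And>v. v \<in> grid m n \<Longrightarrow> 0 < w v" shows "0 < minw m n w V"
proof -
  have V: "V \<subseteq> grid m n" "V \<noteq> {}" "grid m n - V \<noteq> {}" using assms(1) conn_nonempty[of V] conn_nonempty[of "grid m n - V"] unfolding bipart_def by simp_all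
  have "0 < sum w X" if X: "X \<subseteq> grid m n" "X \<noteq> {}" for X
  proof -
    obtain x where x: "x \<in> X" using X(2) by blast
    have "w x \<le> sum w X" by (rule member_le_sum[OF x]) (use finite_subset[OF X(1)] in auto)
    then show ?thesis using assms(2)[of x] x X(1) by force
  qed
  then show ?thesis using V by (simp add: minw_def)
qed

lemma min_weight_grid: "min_weight (grid_graph m n) w U = minw m n w U"
  by (simp add: min_weight_def minw_def)

lemma Done_output:
  assumes D: "Done m n w s"
  shows "connected_bipartition (grid_graph m n) (grid_output m n s)"
    "4 * opt_gbcp2 (grid_graph m n) w \<le> 5 * min_weight (grid_graph m n) w (grid_output m n s)"
proof -
  have J: "J m n w s" using D by (simp add: Done_def)
  then have E: "Env m n w s" and b0: "0 \<le> regs s ''b''" by (simp_all add: J_def)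
  interpret ham m n by (rule ham_Env[OF E])
  have appr: "4 * minw m n w V \<le> 5 * nat (regs s ''b'')" if "bipart m n V" for V
    by (rule swept.approximation[OF Done_swept[OF D] that])
  have "3 * m \<le> m * n" using n3 by simp
  then have "0 \<noteq> \<tau>" using m3 unfolding \<tau>_def by linarith
  then have "\<not> skip 0" by (simp add: skip_def)
  then have V0: "bipart m n (walk False False ` {0..<0 + 1})" using mn by (intro bipart_window) simp_all
  have "0 < minw m n w (walk False False ` {0..<0 + 1})" by (rule minw_pos[OF V0 Env_simps(15)[OF E]])
  \<comment> \<open>Some bipartition exists, for instance the single cell at position 0, and its
    value is positive; the approximation bound then excludes \<open>b = 0\<close>, so
    \<open>u\<close> holds a genuine candidate.\<close>
  then have "regs s ''b'' \<noteq> 0" using appr[OF V0] by auto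
  then have u: "bipart m n (dec m n (arrays s ''u''))" "int (minw m n w (dec m n (arrays s ''u''))) = regs s ''b''"
    using J unfolding J_def by blast+
  have out: "grid_output m n s = dec m n (arrays s ''u'')" by (simp add: grid_output_def dec_def)
  show cb: "connected_bipartition (grid_graph m n) (grid_output m n s)" unfolding out connected_bipartition_grid by (rule u(1))
  let ?S = "{min_weight (grid_graph m n) w U |U. connected_bipartition (grid_graph m n) U}"
  have "finite ?S"
  proof (rule finite_subset)
    show "?S \<subseteq> min_weight (grid_graph m n) w ` Pow (grid m n)"
    proof
      fix x assume "x \<in> ?S"
      then obtain U where U: "x = min_weight (grid_graph m n) w U" "bipart m n U" unfolding connected_bipartition_grid by auto
      then have "U \<in> Pow (grid m n)" by (simp add: bipart_def)
      then show "x \<in> min_weight (grid_graph m n) w ` Pow (grid m n)" unfolding U(1) by (rule imageI)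
    qed
  qed simp
  moreover have "?S \<noteq> {}" using cb by blast
  ultimately have "opt_gbcp2 (grid_graph m n) w \<in> ?S" unfolding opt_gbcp2_def by (rule Max_in)
  then obtain U where U: "opt_gbcp2 (grid_graph m n) w = minw m n w U" "bipart m n U"
    unfolding connected_bipartition_grid min_weight_grid by auto
  then show "4 * opt_gbcp2 (grid_graph m n) w \<le> 5 * min_weight (grid_graph m n) w (grid_output m n s)"
    using appr[OF U(2)] u(2) unfolding out min_weight_grid U(1) by linarith
qed

theorem theorem3:
  shows "\<exists>(prog :: com) (T :: nat \<Rightarrow> nat).
    (\<lambda>N. real (T N)) \<in> O(\<lambda>N. real N * ln (real N)) \<and>
    (\<forall>(m :: nat) (n :: nat) (w :: nat \<times> nat \<Rightarrow> nat).
       m \<ge> 3 \<longrightarrow> n \<ge> 3 \<longrightarrow> (\<forall>v \<in> pverts (grid_graph m n). w v > 0) \<longrightarrow>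
       (\<exists>t s. exec prog (grid_input m n w) t s \<and> t \<le> T (m * n) \<and>
          connected_bipartition (grid_graph m n) (grid_output m n s) \<and>
          real (opt_gbcp2 (grid_graph m n) w)
            \<le> 5 / 4 * real (min_weight (grid_graph m n) w (grid_output m n s))))"
proof -
  obtain K where K: "\<And>m n w s. Inp m n w s \<Longrightarrow> \<exists>t s'. exec program s t s' \<and> t \<le> K * (m * n) \<and> Done m n w s'"
    using program unfolding triple_def by blast
  have "(\<lambda>N. real (K * N)) \<in> O(\<lambda>N. real N * ln (real N))"
  proof (rule bigoI[of _ "real K"])
    show "\<forall>\<^sub>F N in sequentially. norm (real (K * N)) \<le> real K * norm (real N * ln (real N))"
    proof (rule eventually_sequentiallyI[of 3])
      fix N :: nat assume N: "3 \<le> N"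
      \<comment> \<open>From \<open>N = 3\<close> on the logarithm is at least 1, so the linear
        bound actually proved implies the stated one.\<close>
      have "exp 1 \<le> real N" using exp_le N by linarith
      then have l: "1 \<le> ln (real N)" using N by (simp add: ln_ge_iff)
      have "real N * 1 \<le> real N * ln (real N)" using l by (intro mult_left_mono) simp_all
      then have "real K * real N \<le> real K * (real N * ln (real N))" by (intro mult_left_mono) simp_all
      then show "norm (real (K * N)) \<le> real K * norm (real N * ln (real N))" using l by simp
    qed
  qed
  moreover have "\<exists>t s. exec program (grid_input m n w) t s \<and> t \<le> K * (m * n) \<and>
      connected_bipartition (grid_graph m n) (grid_output m n s) \<and>
      real (opt_gbcp2 (grid_graph m n) w) \<le> 5 / 4 * real (min_weight (grid_graph m n) w (grid_output m n s))"
    if a: "m \<ge> 3" "n \<ge> 3" "\<forall>v \<in> pverts (grid_graph m n). w v > 0" for m n w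
  proof -
    have "Inp m n w (grid_input m n w)" using a by (simp add: Inp_def)
    then obtain t s where ts: "exec program (grid_input m n w) t s" "t \<le> K * (m * n)" "Done m n w s" using K by blast
    have "real (opt_gbcp2 (grid_graph m n) w) \<le> 5 / 4 * real (min_weight (grid_graph m n) w (grid_output m n s))"
      using Done_output(2)[OF ts(3)] by linarith
    then show ?thesis using ts(1,2) Done_output(1)[OF ts(3)] by (intro exI conjI)
  qed
  ultimately show ?thesis
    by - (rule exI[of _ program], rule exI[of _ "\<lambda>N. K * N"], rule conjI, assumption, intro allI impI, assumption)
qed

end
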